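(* Let $d\ge 2$, $T>0$, and let $(\varrho,\mathbf u,P)$ be a weak solution of the inhomogeneous incompressible Euler system on $\mathbb T^d\times(0,T)$ (in the sense described in the context) with initial data $(\varrho_0,\varrho_0\mathbf u_0)$. Assume that $$\varrho>0,\quad \varrho,\ \varrho^{-1}\in L^\infty(\mathbb T^d\times(0,T)),\qquad \mathbf u\in L^3(\mathbb T^d\times(0,T)),\qquad P\in L^{3/2}(\mathbb T^d\times(0,T)),$$ and that for some $\delta_0>0$ $$\|\varrho\|_{L^\infty(0,T;\mathcal V^{2/3,\infty}_{\delta_0}(\mathbb T^d))}+\|\mathbf u\|_{L^3(0,T;\mathcal V^{1/3,3}_{\delta_0}(\mathbb T^d))}<\infty,\qquad \limsup_{\delta\to0}\|\mathbf u\|_{L^3(0,T;\mathcal V^{1/3,3}_{\delta}(\mathbb T^d))}=0.$$ Then the energy is conserved: $$\int_{\mathbb T^d}(\varrho|\mathbf u|^2)(x,t)\,dx=\int_{\mathbb T^d}(\varrho_0|\mathbf u_0|^2)(x)\,dx$$ for (almost) every $t\in(0,T)$.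
   Context: Weak solution of the inhomogeneous incompressible Euler system on a domain $\Omega$ ($\Omega=\mathbb T^d$ or a bounded domain of $\mathbb R^d$): measurable $\varrho:\Omega\times(0,T)\to\mathbb R_+$, $\mathbf u:\Omega\times(0,T)\to\mathbb R^d$, $P:\Omega\times(0,T)\to\mathbb R$ (with enough integrability for the integrals below to make sense) such that (i) $\int_0^T\int_\Omega(\varrho\,\partial_t\varphi+\varrho\mathbf u\cdot\nabla\varphi)\,dxdt=0$ for all $\varphi\in C_0^\infty(\Omega\times(0,T))$; (ii) $\int_0^T\int_\Omega(\varrho\mathbf u\cdot\partial_t\psi+\varrho\mathbf u\otimes\mathbf u:\nabla\psi+P\,\nabla\cdot\psi)\,dxdt=0$ for all $\psi\in C_0^\infty(\Omega\times(0,T))^d$; (iii) $\operatorname{div}\mathbf u=0$ in the sense of distributions; (iv) $\lim_{t\to0}\int_\Omega\varrho(x,t)\varphi(x)dx=\int_\Omega\varrho_0\varphi\,dx$ for all $\varphi\in C_0^\infty(\Omega)$; (v) $\lim_{t\to0}\int_\Omega(\varrho\mathbf u)(x,t)\cdot\psi(x)dx=\int_\Omega\varrho_0\mathbf u_0\cdot\psi\,dx$ for all $\psi\in C_0^\infty(\Omega)^d$. This is the weak form of $\partial_t\varrho+\operatorname{div}(\varrho\mathbf u)=0$, $\partial_t(\varrho\mathbf u)+\operatorname{div}(\varrho\mathbf u\otimes\mathbf u)+\nabla P=0$, $\operatorname{div}\mathbf u=0$. For $\beta>0$, $\delta>0$, $p\in[1,\infty]$ and a function $f$ on $\mathbb T^d$: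 $\|f\|_{\mathcal V^{\beta,p}_\delta(\mathbb T^d)}:=\sup_{|h|<\delta}|h|^{-\beta}\|f(\cdot+h)-f(\cdot)\|_{L^p(\mathbb T^d)}$ (a seminorm). For time-dependent $f$, $\|f\|_{L^q(0,T;\mathcal V^{\beta,p}_\delta)}:=\big(\int_0^T\|f(t)\|_{\mathcal V^{\beta,p}_\delta}^q dt\big)^{1/q}$ for $q<\infty$ and the essential supremum in $t$ for $q=\infty$. *)

theory Defs
  imports "HOL-Analysis.Analysis" "HOL-Probability.Essential_Supremum"
begin

text \<open>The torus T^d is modelled by Z^d-periodic functions on R^d (points of type real^'n,
  d = CARD('n)); integrals over T^d are integrals over the fundamental cell [0,1]^d.\<close>

definition torus_cell :: "(real^'n) set" where
  "torus_cell = cbox 0 (\<chi> i. 1)"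

definition periodic_x :: "(real^'n \<Rightarrow> 'b) \<Rightarrow> bool" where
  "periodic_x f \<longleftrightarrow> (\<forall>x k. (\<forall>i. k $ i \<in> \<int>) \<longrightarrow> f (x + k) = f x)"

fun C_k :: "nat \<Rightarrow> ('a::euclidean_space \<Rightarrow> real) \<Rightarrow> bool" where
  "C_k 0 f = continuous_on UNIV f"
| "C_k (Suc k) f = ((\<forall>x. f differentiable (at x)) \<and>
      (\<forall>b\<in>Basis. C_k k (\<lambda>x. frechet_derivative f (at x) b)))"

definition smooth :: "('a::euclidean_space \<Rightarrow> real) \<Rightarrow> bool" where
  "smooth f \<longleftrightarrow> (\<forall>k. C_k k f)"

definition test_fun :: "real \<Rightarrow> (real^'n \<Rightarrow> real \<Rightarrow> real) \<Rightarrow> bool" where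
  "test_fun T \<phi> \<longleftrightarrow> smooth (\<lambda>z. \<phi> (fst z) (snd z))
     \<and> (\<forall>t. periodic_x (\<lambda>x. \<phi> x t))
     \<and> (\<exists>a b. 0 < a \<and> a \<le> b \<and> b < T \<and> (\<forall>x t. t \<notin> {a..b} \<longrightarrow> \<phi> x t = 0))"

definition test_vfun :: "real \<Rightarrow> (real^'n \<Rightarrow> real \<Rightarrow> real^'n) \<Rightarrow> bool" where
  "test_vfun T \<psi> \<longleftrightarrow> (\<forall>i. test_fun T (\<lambda>x t. \<psi> x t $ i))"

definition d_t :: "(real^'n \<Rightarrow> real \<Rightarrow> real) \<Rightarrow> real^'n \<Rightarrow> real \<Rightarrow> real" where
  "d_t \<phi> x t = frechet_derivative (\<lambda>z. \<phi> (fst z) (snd z)) (at (x, t)) (0, 1)"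

definition d_x :: "(real^'n \<Rightarrow> real \<Rightarrow> real) \<Rightarrow> 'n \<Rightarrow> real^'n \<Rightarrow> real \<Rightarrow> real" where
  "d_x \<phi> i x t = frechet_derivative (\<lambda>z. \<phi> (fst z) (snd z)) (at (x, t)) (axis i 1, 0)"

definition spacetime :: "real \<Rightarrow> ((real^'n) \<times> real) set" where
  "spacetime T = torus_cell \<times> {0<..<T}"

definition weak_solution ::
  "real \<Rightarrow> (real^'n \<Rightarrow> real \<Rightarrow> real) \<Rightarrow> (real^'n \<Rightarrow> real \<Rightarrow> real^'n) \<Rightarrow>
   (real^'n \<Rightarrow> real \<Rightarrow> real) \<Rightarrow> (real^'n \<Rightarrow> real) \<Rightarrow> (real^'n \<Rightarrow> real^'n) \<Rightarrow> bool" where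
  "weak_solution T \<rho> u P \<rho>0 u0 \<longleftrightarrow>
     (\<forall>\<phi>. test_fun T \<phi> \<longrightarrow>
        (LINT z : spacetime T | lebesgue.
           (case z of (x, t) \<Rightarrow> \<rho> x t * d_t \<phi> x t + \<rho> x t * (\<Sum>i\<in>UNIV. u x t $ i * d_x \<phi> i x t))) = 0)
   \<and> (\<forall>\<psi>. test_vfun T \<psi> \<longrightarrow>
        (LINT z : spacetime T | lebesgue.
           (case z of (x, t) \<Rightarrow>
              (\<Sum>i\<in>UNIV. \<rho> x t * u x t $ i * d_t (\<lambda>y s. \<psi> y s $ i) x t)
            + (\<Sum>i\<in>UNIV. \<Sum>j\<in>UNIV. \<rho> x t * u x t $ i * u x t $ j * d_x (\<lambda>y s. \<psi> y s $ i) j x t)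
            + P x t * (\<Sum>i\<in>UNIV. d_x (\<lambda>y s. \<psi> y s $ i) i x t))) = 0)
   \<and> (\<forall>\<phi>. test_fun T \<phi> \<longrightarrow>
        (LINT z : spacetime T | lebesgue.
           (case z of (x, t) \<Rightarrow> (\<Sum>i\<in>UNIV. u x t $ i * d_x \<phi> i x t))) = 0)
   \<and> (\<forall>\<phi>::real^'n \<Rightarrow> real. smooth \<phi> \<and> periodic_x \<phi> \<longrightarrow>
        ((\<lambda>t. LINT x : torus_cell | lebesgue. \<rho> x t * \<phi> x)
           \<longlongrightarrow> (LINT x : torus_cell | lebesgue. \<rho>0 x * \<phi> x)) (at_right 0))
   \<and> (\<forall>\<psi>::real^'n \<Rightarrow> real^'n. (\<forall>i. smooth (\<lambda>x. \<psi> x $ i)) \<and> periodic_x \<psi> \<longrightarrow>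
        ((\<lambda>t. LINT x : torus_cell | lebesgue. (\<rho> x t *\<^sub>R u x t) \<bullet> \<psi> x)
           \<longlongrightarrow> (LINT x : torus_cell | lebesgue. (\<rho>0 x *\<^sub>R u0 x) \<bullet> \<psi> x)) (at_right 0))"

definition enn_powr :: "ennreal \<Rightarrow> real \<Rightarrow> ennreal" where
  "enn_powr a r = (if a = \<infinity> then \<infinity> else ennreal (enn2real a powr r))"

definition enn_root :: "real \<Rightarrow> ennreal \<Rightarrow> ennreal" where
  "enn_root p a = enn_powr a (1 / p)"

definition Lnorm_torus :: "ennreal \<Rightarrow> (real^'n \<Rightarrow> 'b::real_normed_vector) \<Rightarrow> ennreal" where
  "Lnorm_torus p g =
     (if p = \<infinity> then esssup (lebesgue_on torus_cell) (\<lambda>x. ennreal (norm (g x)))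
      else enn_root (enn2real p)
             (\<integral>\<^sup>+ x \<in> torus_cell. ennreal (norm (g x) powr enn2real p) \<partial>lebesgue))"

definition Lnorm_time :: "real \<Rightarrow> ennreal \<Rightarrow> (real \<Rightarrow> ennreal) \<Rightarrow> ennreal" where
  "Lnorm_time T q F =
     (if q = \<infinity> then esssup (lebesgue_on {0<..<T}) F
      else enn_root (enn2real q)
             (\<integral>\<^sup>+ t \<in> {0<..<T}. enn_powr (F t) (enn2real q) \<partial>lebesgue))"

definition V_norm :: "real \<Rightarrow> ennreal \<Rightarrow> real \<Rightarrow> (real^'n \<Rightarrow> 'b::real_normed_vector) \<Rightarrow> ennreal" where
  "V_norm \<beta> p \<delta> f =
     (SUP h \<in> {h. h \<noteq> 0 \<and> norm h < \<delta>}.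
        ennreal (norm h powr (- \<beta>)) * Lnorm_torus p (\<lambda>x. f (x + h) - f x))"

end

theory Submission
  imports Defs "HOL-Probability.Probability_Measure"
begin

text \<open>
  Mollify in space only, at scale \<open>\<epsilon>\<close>, and use the Favre velocity \<open>v = (\<rho> u)\<^sub>\<epsilon> / \<rho>\<^sub>\<epsilon>\<close>. Testing the
  equations with translates of the mollifier shows that \<open>\<rho>\<^sub>\<epsilon>\<close> and \<open>(\<rho> u)\<^sub>\<epsilon>\<close> are absolutely
  continuous in time, so the chain rule applies to \<open>|(\<rho> u)\<^sub>\<epsilon>|\<^sup>2 / \<rho>\<^sub>\<epsilon>\<close>. As \<open>div u\<^sub>\<epsilon> = 0\<close>, the time
  derivative of its integral is bounded by \<open>1/\<epsilon>\<close> times averages of cubes of increments of \<open>u\<close> over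
  distances at most \<open>\<epsilon>\<close>, plus a pressure term in which \<open>P\<close> meets \<open>(v - u\<^sub>\<epsilon>) / \<epsilon>\<close>. Since \<open>\<rho>\<close> is
  2/3-Hoelder, \<open>v - u\<^sub>\<epsilon>\<close> is of order \<open>\<epsilon> powr (2/3)\<close> times increments of \<open>u\<close>, that is \<open>o(\<epsilon>)\<close> in \<open>L\<^sup>3\<close>;
  so everything tends to 0 in \<open>L\<^sup>1(0, T)\<close>. The initial data enter through the limit \<open>t \<rightarrow> 0\<close> at fixed
  \<open>\<epsilon>\<close>; the mollified initial energy is at most the initial energy by Jensen's inequality, and at
  least that in the limit by Fatou's lemma.
\<close>

section \<open>Smooth functions\<close>

text \<open>No regularity in time is assumed, so smoothing in space must do everything and the time
  derivatives are taken from the equations. The flux is then a combination of moments of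
  \<open>u\<close>. Recentred at the Favre velocity it becomes a third central moment, a transport
  by \<open>v\<close> of the trace of the second central moment minus twice the mollified pressure,
  and a divergence. In the transport term \<open>v\<close> is replaced by the mollified velocity,
  which is divergence free and so transports with mean zero; the replacement costs
  \<open>v - ue\<close>, and this is the only place where the density has to be regular. The
  pressure has no smallness of its own, while the cubes of increments are o(\<kappa>). A Young
  inequality with a parameter \<Lambda>, fixed large before \<kappa> tends to 0, trades them:
  \<Lambda> powr (-1/2) stays with the pressure and \<Lambda> times o(1) with the cubes. A second
  obstacle is that a non-integrable function has integral 0. Little is assumed of the initial data,
  so integrability of the initial density is derived from the initial limit, and for the momentum
  both cases are treated.\<close>

lemma C_k_SucI:
  assumes "\<And>x. (f has_derivative f' x) (at x)"
    and "\<And>b. b \<in> Basis \<Longrightarrow> C_k k (\<lambda>x. f' x b)"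
  shows "C_k (Suc k) f"
proof -
  have "frechet_derivative f (at x) = f' x" for x
    using assms(1) by (metis frechet_derivative_at)
  then show ?thesis using assms by (auto simp: differentiable_def)
qed

lemma C_k_Suc_derivative:
  assumes "C_k (Suc k) f"
  shows "(f has_derivative frechet_derivative f (at x)) (at x)"
  using assms by (auto simp: frechet_derivative_works)

lemma C_k_Suc_lower: "C_k (Suc k) f \<Longrightarrow> C_k k f"
proof (induction k arbitrary: f)
  case 0
  then show ?case
    by (auto intro!: continuous_at_imp_continuous_on differentiable_imp_continuous_within)
next
  case (Suc k)
  then show ?case by (metis C_k.simps(2))
qed

lemma C_k_const: "C_k k (\<lambda>_. c)"
  by (induction k arbitrary: c) (auto intro!: C_k_SucI[where f'="\<lambda>_ _. 0"] simp del: C_k.simps(2))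

lemma C_k_bounded_linear: "bounded_linear f \<Longrightarrow> C_k k f"
proof (cases k)
  case 0
  then show "bounded_linear f \<Longrightarrow> C_k k f"
    by (simp add: linear_continuous_on)
next
  case (Suc m)
  assume "bounded_linear f"
  then show ?thesis unfolding Suc
    by (intro C_k_SucI[where f'="\<lambda>_. f"] C_k_const bounded_linear_imp_has_derivative)
qed

lemma C_k_add:
  assumes "C_k k f" "C_k k g" shows "C_k k (\<lambda>x. f x + g x)"
  using assms
proof (induction k arbitrary: f g)
  case 0
  then show ?case by (simp add: continuous_on_add)
next
  case (Suc k)
  show ?case
    by (rule C_k_SucI[OF has_derivative_add[OF C_k_Suc_derivative[OF Suc.prems(1)]
          C_k_Suc_derivative[OF Suc.prems(2)]]]) (use Suc in auto)
qed

lemma C_k_mult: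
  assumes "C_k k f" "C_k k g" shows "C_k k (\<lambda>x. f x * g x)"
  using assms
proof (induction k arbitrary: f g)
  case 0
  then show ?case by (simp add: continuous_on_mult)
next
  case (Suc k)
  show ?case
    by (rule C_k_SucI[OF has_derivative_mult[OF C_k_Suc_derivative[OF Suc.prems(1)]
          C_k_Suc_derivative[OF Suc.prems(2)]]])
      (use Suc C_k_Suc_lower[OF Suc.prems(1)] C_k_Suc_lower[OF Suc.prems(2)] in \<open>auto intro!: C_k_add\<close>)
qed

text \<open>The outer function has one real variable, so the derivative of the composite is the
  product \<open>?Dg x h * ?Df (g x) 1\<close> and the induction closes with
  \<open>C_k_mult\<close>; no multilinear chain rule arises.\<close>

lemma C_k_compose:
  fixes f :: "real \<Rightarrow> real"
  assumes "C_k k f" "C_k k g" shows "C_k k (\<lambda>x. f (g x))"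
  using assms
proof (induction k arbitrary: f g)
  case 0
  then show ?case by (auto intro: continuous_on_compose2)
next
  case (Suc k)
  let ?Df = "\<lambda>y. frechet_derivative f (at y)" and ?Dg = "\<lambda>x. frechet_derivative g (at x)"
  have lin: "?Df y h = h * ?Df y 1" for y h
    using has_derivative_linear[OF C_k_Suc_derivative[OF Suc.prems(1)], of y]
    by (metis linear_cmul mult.right_neutral real_scaleR_def)
  have "((\<lambda>x. f (g x)) has_derivative (\<lambda>h. ?Dg x h * ?Df (g x) 1)) (at x)" for x
    using has_derivative_compose[OF C_k_Suc_derivative[OF Suc.prems(2)] C_k_Suc_derivative[OF Suc.prems(1)]]
    by (subst (asm) lin)
  then show ?case
    by (rule C_k_SucI) (use Suc C_k_Suc_lower[OF Suc.prems(2)] in \<open>auto intro!: C_k_mult\<close>)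
qed

lemma smooth_const: "smooth (\<lambda>_. c)"
  and smooth_bounded_linear: "bounded_linear f \<Longrightarrow> smooth f"
  and smooth_add: "smooth f \<Longrightarrow> smooth g \<Longrightarrow> smooth (\<lambda>x. f x + g x)"
  and smooth_mult: "smooth f \<Longrightarrow> smooth g \<Longrightarrow> smooth (\<lambda>x. f x * g x)"
  by (auto simp: smooth_def C_k_const C_k_bounded_linear C_k_add C_k_mult)

lemma smooth_compose:
  fixes f :: "real \<Rightarrow> real"
  shows "smooth f \<Longrightarrow> smooth g \<Longrightarrow> smooth (\<lambda>x. f (g x))"
  by (auto simp: smooth_def C_k_compose)

lemma smooth_diff: "smooth f \<Longrightarrow> smooth g \<Longrightarrow> smooth (\<lambda>x. f x - g x)"
  using smooth_add[of f "\<lambda>x. (-1) * g x"] smooth_mult[OF smooth_const, of g "-1"] by simp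

lemma smooth_prod:
  assumes "finite A" "\<And>i. i \<in> A \<Longrightarrow> smooth (f i)"
  shows "smooth (\<lambda>x. \<Prod>i\<in>A. f i x)"
  using assms by (induction A rule: finite_induct) (auto intro: smooth_const smooth_mult)

lemma smooth_has_derivative:
  "smooth f \<Longrightarrow> (f has_derivative frechet_derivative f (at x)) (at x)"
  unfolding smooth_def by (rule C_k_Suc_derivative[of 0]) blast

lemma smooth_continuous_on: "smooth f \<Longrightarrow> continuous_on A f"
  unfolding smooth_def using C_k.simps(1) continuous_on_subset by blast

lemma smooth_frechet_derivative:
  "smooth f \<Longrightarrow> b \<in> Basis \<Longrightarrow> smooth (\<lambda>x. frechet_derivative f (at x) b)"
  unfolding smooth_def by (metis C_k.simps(2))

text \<open>Lets smoothness pass both ways between a function of time and its derivative, so that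
  derivatives of test functions, and suitable primitives, are again test functions.\<close>

lemma smooth_real_derivative:
  fixes f :: "real \<Rightarrow> real"
  assumes "\<And>x. (f has_real_derivative f' x) (at x)"
  shows "smooth f \<longleftrightarrow> smooth f'"
proof
  have fr: "frechet_derivative f (at x) = (*) (f' x)" for x
    using assms[of x] by (metis frechet_derivative_at has_field_derivative_def)
  show "smooth f'" if "smooth f"
    using smooth_frechet_derivative[OF that, of 1] by (simp add: fr)
  show "smooth f" if "smooth f'"
  proof -
    have "C_k (Suc k) f" for k
      by (rule C_k_SucI[where f'="\<lambda>x. (*) (f' x)"])
        (use assms that in \<open>auto simp: has_field_derivative_def smooth_def\<close>)
    then show ?thesis unfolding smooth_def using C_k_Suc_lower by blast
  qed
qed

lemma smooth_sin: "smooth (sin :: real \<Rightarrow> real)"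
proof -
  have "C_k k (sin :: real \<Rightarrow> real) \<and> C_k k (cos :: real \<Rightarrow> real)" for k
  proof (induction k)
    case 0
    show ?case by (auto intro!: continuous_intros)
  next
    case (Suc k)
    have "C_k (Suc k) (sin :: real \<Rightarrow> real)"
      by (rule C_k_SucI[where f'="\<lambda>x. (*) (cos x)"])
        (use Suc in \<open>auto intro!: derivative_eq_intros\<close>)
    moreover have "C_k (Suc k) (cos :: real \<Rightarrow> real)"
      by (rule C_k_SucI[where f'="\<lambda>x h. (-1) * sin x * h"])
        (use Suc in \<open>auto intro!: derivative_eq_intros C_k_mult C_k_const\<close>,
         use C_k_mult[OF C_k_const, of k sin "-1"] in simp)
    ultimately show ?case by blast
  qed
  then show ?thesis by (auto simp: smooth_def)
qed

text \<open>The derivatives of exp(-1/t), extended by 0, are combinations of these functions.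
  Carrying the power of t as an index makes the family closed under differentiation, so smoothness
  is one induction over the whole family.\<close>

definition flat_exp :: "nat \<Rightarrow> real \<Rightarrow> real" where
  "flat_exp n t = (if t \<le> 0 then 0 else exp (- 1 / t) / t ^ n)"

text \<open>The term of order n + 2 in the series of \<open>exp (1 / t)\<close> beats
  \<open>t ^ n\<close> and leaves \<open>t\<^sup>2\<close>; its factorial is the constant. The
  quadratic decay is what makes the difference quotient at 0 vanish.\<close>

lemma flat_exp_bound: "\<exists>c\<ge>0. \<forall>t. \<bar>flat_exp n t\<bar> \<le> c * t\<^sup>2"
proof -
  define c :: real where "c = fact (n + 2)"
  have c: "c > 0" by (simp add: c_def)
  have "\<bar>flat_exp n t\<bar> \<le> c * t\<^sup>2" for t
  proof (cases "t \<le> 0")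
    case False
    then have t: "t > 0" by simp
    have "(1 / t) ^ (n + 2) / c \<le> exp (1 / t)"
      using t sum_le_suminf[OF summable_exp_generic[of "1/t"], of "{n + 2}"]
      by (auto simp: exp_def divide_inverse mult.commute c_def simp del: fact_Suc)
    then have "1 \<le> c * t ^ (n + 2) * exp (1 / t)"
      using t c by (simp add: field_simps)
    then have "exp (- (1 / t)) \<le> c * t ^ (n + 2)"
      using t by (simp add: exp_minus field_simps)
    then show ?thesis using t by (simp add: flat_exp_def field_simps power_add power2_eq_square)
  qed (use c in \<open>simp add: flat_exp_def\<close>)
  then show ?thesis using c less_imp_le by blast
qed

lemma flat_exp_has_derivative:
  "(flat_exp n has_real_derivative (flat_exp (n + 2) t - n * flat_exp (n + 1) t)) (at t)"
proof -
  consider "t < 0" | "t = 0" | "t > 0" by linarith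
  then show ?thesis
  proof cases
    case 1
    have "(flat_exp n has_real_derivative 0) (at t)"
      by (rule has_field_derivative_transform_within_open[of "\<lambda>_. 0" _ _ "{..<0}"])
        (use 1 in \<open>auto simp: flat_exp_def\<close>)
    then show ?thesis using 1 by (simp add: flat_exp_def)
  next
    case 2
    have "((\<lambda>h. flat_exp n h / h) \<longlongrightarrow> 0) (at 0)"
    proof -
      obtain c where c: "c \<ge> 0" "\<And>t. \<bar>flat_exp n t\<bar> \<le> c * t\<^sup>2"
        using flat_exp_bound[of n] by blast
      have le: "norm (flat_exp n h / h) \<le> c * \<bar>h\<bar>" for h
      proof (cases "h = 0")
        case False
        have "\<bar>flat_exp n h\<bar> \<le> c * \<bar>h\<bar> * \<bar>h\<bar>"
          using c(2)[of h] by (simp add: power2_eq_square mult.assoc)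
        then show ?thesis using False by (simp add: pos_divide_le_eq)
      qed (use c in simp)
      have "((\<lambda>h. c * \<bar>h\<bar>) \<longlongrightarrow> 0) (at (0::real))"
        by (auto intro!: tendsto_eq_intros)
      then show ?thesis by (rule Lim_null_comparison[rotated]) (use le in auto)
    qed
    then show ?thesis using 2 by (simp add: DERIV_def flat_exp_def)
  next
    case 3
    have "((\<lambda>t. exp (- 1 / t) / t ^ n) has_real_derivative
       (exp (-1/t) / t ^ (n + 2) - n * (exp (-1/t) / t ^ (n + 1)))) (at t)"
      using 3 by (auto intro!: derivative_eq_intros simp: field_simps power2_eq_square)
        (cases n; simp add: field_simps)
    then have "(flat_exp n has_real_derivative
       (exp (-1/t) / t ^ (n + 2) - n * (exp (-1/t) / t ^ (n + 1)))) (at t)"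
      by (rule has_field_derivative_transform_within_open[of _ _ _ "{0<..}"])
        (use 3 in \<open>auto simp: flat_exp_def\<close>)
    then show ?thesis using 3 by (simp add: flat_exp_def)
  qed
qed

lemma smooth_flat_exp: "smooth (flat_exp n)"
proof -
  have "C_k k (flat_exp n)" for k
  proof (induction k arbitrary: n)
    case 0
    show ?case using DERIV_isCont[OF flat_exp_has_derivative]
      by (simp add: continuous_at_imp_continuous_on)
  next
    case (Suc k)
    have "C_k k (\<lambda>x. flat_exp (n + 2) x + (- real n) * flat_exp (n + 1) x)"
      by (intro C_k_add C_k_mult C_k_const Suc)
    then show ?case
      by (intro C_k_SucI[where f'="\<lambda>x. (*) (flat_exp (n + 2) x - n * flat_exp (n + 1) x)"])
        (use flat_exp_has_derivative[of n] in \<open>auto simp: has_field_derivative_def\<close>)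
  qed
  then show ?thesis by (simp add: smooth_def)
qed

lemma flat_exp_nonneg: "0 \<le> flat_exp n t" and flat_exp_le_1: "flat_exp 0 t \<le> 1"
  by (auto simp: flat_exp_def)

text \<open>With x = 1/t this is x^2 / 2 \<le> exp x. It caps the flat factor in
  \<open>sin_bump'\<close>, whose explicit bound enters the mollifier constant.\<close>

lemma flat_exp_2_le: "flat_exp 2 t \<le> 2"
proof (cases "t \<le> 0")
  case False
  have "1 + 1 / t + (1 / t)\<^sup>2 / 2 \<le> exp (1 / t)"
    using False by (intro exp_lower_Taylor_quadratic) auto
  then have "(1 / t)\<^sup>2 / 2 \<le> exp (1 / t)" using False by (smt (verit) divide_pos_pos)
  then show ?thesis using False by (simp add: flat_exp_def exp_minus field_simps)
qed (simp add: flat_exp_def)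

section \<open>The torus as a probability space\<close>

text \<open>A density on the whole space rather than a restricted measure space: shifted points
  \<open>x + h\<close> remain in the space, so translation arguments need no side conditions on
  membership.\<close>

definition torus :: "(real^'n) measure" where
  "torus = density lborel (indicator torus_cell)"

definition time_measure :: "real \<Rightarrow> real measure" where
  "time_measure T = density lborel (indicator {0<..<T})"

lemma torus_cell_borel [measurable]: "torus_cell \<in> sets borel"
  by (simp add: torus_cell_def)

lemma sets_torus [simp, measurable_cong]: "sets torus = sets borel"
  and space_torus [simp]: "space torus = UNIV"
  and sets_time_measure [simp, measurable_cong]: "sets (time_measure T) = sets borel"
  and space_time_measure [simp]: "space (time_measure T) = UNIV"
  by (simp_all add: torus_def time_measure_def)

lemma emeasure_torus_cell: "emeasure lborel (torus_cell :: (real^'n) set) = 1"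
proof -
  have "emeasure lborel (cbox (0::real^'n) (\<chi> i. 1)) = (\<Prod>b\<in>(Basis::(real^'n) set). ((\<chi> i. 1) - 0) \<bullet> b)"
    by (rule emeasure_lborel_cbox) (auto simp: Basis_vec_def inner_axis)
  also have "\<dots> = 1"
    by (auto intro!: prod.neutral simp: Basis_vec_def inner_axis)
  finally show ?thesis by (simp add: torus_cell_def)
qed

lemma prob_space_torus: "prob_space (torus :: (real^'n) measure)"
  by (rule prob_spaceI) (simp add: torus_def emeasure_density emeasure_torus_cell)

interpretation torus: prob_space "torus :: (real^'n) measure"
  by (rule prob_space_torus)

lemma finite_measure_time: "finite_measure (time_measure T)"
  by (rule finite_measureI) (cases "0 \<le> T"; simp add: time_measure_def emeasure_density)

interpretation time: finite_measure "time_measure T" for T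
  by (rule finite_measure_time)

section \<open>The integer lattice and translation invariance of the torus integral\<close>

definition int_lattice :: "(real^'n) set" where
  "int_lattice = {k. \<forall>i. k $ i \<in> \<int>}"

lemma countable_int_lattice: "countable (int_lattice :: (real^'n) set)"
proof -
  define g :: "('n \<Rightarrow> int) \<Rightarrow> real^'n" where "g f = (\<chi> i. real_of_int (f i))" for f
  have "k = g (\<lambda>i. \<lfloor>k $ i\<rfloor>)" if "k \<in> int_lattice" for k
    using that by (auto simp: int_lattice_def vec_eq_iff g_def elim!: Ints_cases)
  then have "int_lattice \<subseteq> range g" by blast
  moreover have "countable (range g)"
    by (intro countable_image) simp
  ultimately show ?thesis using countable_subset by blast
qed

lemma periodic_x_add: "periodic_x f \<Longrightarrow> k \<in> int_lattice \<Longrightarrow> f (x + k) = f x"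
  by (simp add: periodic_x_def int_lattice_def)

lemma periodic_x_diff: "periodic_x f \<Longrightarrow> k \<in> int_lattice \<Longrightarrow> f (x - k) = f x"
  using periodic_x_add[of f k "x - k"] by simp

text \<open>The closed cell overlaps its lattice translates along faces; the half-open one is an
  exact fundamental domain, and the two differ by a null set.\<close>

definition half_open_cell :: "(real^'n) set" where
  "half_open_cell = {x. \<forall>i. 0 \<le> x $ i \<and> x $ i < 1}"

lemma half_open_cell_borel [measurable]: "half_open_cell \<in> sets (borel :: (real^'n) measure)"
  unfolding half_open_cell_def by measurable

lemma half_open_cell_subset: "half_open_cell \<subseteq> torus_cell"
  by (auto simp: half_open_cell_def torus_cell_def mem_box_cart less_imp_le)

lemma AE_torus_cell_half_open:
  "AE x in lborel. (x :: real^'n) \<in> torus_cell \<longleftrightarrow> x \<in> half_open_cell"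
proof -
  have "AE x in lborel. (x :: real^'n) $ i \<noteq> 1" for i
  proof -
    have "negligible {x :: real^'n. axis i 1 \<bullet> x = 1}"
      by (intro negligible_hyperplane) (simp add: axis_eq_0_iff)
    then have "{x :: real^'n. x $ i = 1} \<in> null_sets lborel"
      by (subst (asm) negligible_iff_null_sets, subst (asm) null_sets_completion_iff)
        (auto simp: inner_axis')
    then show ?thesis by (rule AE_I') auto
  qed
  then have "AE x in lborel. \<forall>i. (x :: real^'n) $ i \<noteq> 1"
    by (simp add: AE_all_countable)
  then show ?thesis
    by eventually_elim (auto simp: half_open_cell_def torus_cell_def mem_box_cart less_le)
qed

lemma AE_torus_half_open: "AE x in torus. (x :: real^'n) \<in> half_open_cell"
proof -
  have "AE x in lborel. (x :: real^'n) \<in> torus_cell \<longrightarrow> x \<in> half_open_cell"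
    using AE_torus_cell_half_open by (rule eventually_mono) blast
  then show ?thesis
    unfolding torus_def by (subst AE_density) (auto simp: indicator_def)
qed

lemma nn_integral_torus:
  "f \<in> borel_measurable borel \<Longrightarrow>
    (\<integral>\<^sup>+x. f x \<partial>torus) = (\<integral>\<^sup>+x. indicator half_open_cell (x::real^'n) * f x \<partial>lborel)"
proof -
  assume f: "f \<in> borel_measurable borel"
  have "(\<integral>\<^sup>+x. f x \<partial>torus) = (\<integral>\<^sup>+x. indicator torus_cell x * f x \<partial>lborel)"
    unfolding torus_def using f by (subst nn_integral_density) auto
  also have "\<dots> = (\<integral>\<^sup>+x. indicator half_open_cell x * f x \<partial>lborel)"
    by (rule nn_integral_cong_AE, rule AE_mp[OF AE_torus_cell_half_open])
      (simp add: indicator_def)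
  finally show ?thesis .
qed

definition lattice_floor :: "real^'n \<Rightarrow> real^'n" where
  "lattice_floor x = (\<chi> i. of_int \<lfloor>x $ i\<rfloor>)"

lemma lattice_floor: "lattice_floor x \<in> int_lattice" "x - lattice_floor x \<in> half_open_cell"
  by (auto simp: lattice_floor_def int_lattice_def half_open_cell_def) linarith+

lemma lattice_floor_unique:
  assumes "k \<in> int_lattice" "x - k \<in> half_open_cell"
  shows "k = lattice_floor x"
proof -
  have "k $ i = lattice_floor x $ i" for i
  proof -
    obtain m where m: "k $ i = of_int m"
      using assms(1) by (auto simp: int_lattice_def elim: Ints_cases)
    have "0 \<le> x $ i - k $ i" "x $ i - k $ i < 1"
      using assms(2) by (auto simp: half_open_cell_def)
    then have "\<lfloor>x $ i\<rfloor> = m" unfolding m by linarith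
    then show ?thesis by (simp add: m lattice_floor_def)
  qed
  then show ?thesis by (simp add: vec_eq_iff)
qed

text \<open>The lattice translates of the half-open cell tile the space, so this is a partition of
  unity that can be inserted into any integral.\<close>

lemma nn_integral_lattice_translates:
  "(\<integral>\<^sup>+k. indicator half_open_cell (x - k) \<partial>count_space int_lattice) = 1"
proof -
  have "(\<integral>\<^sup>+k. indicator half_open_cell (x - k) \<partial>count_space int_lattice) =
        (\<integral>\<^sup>+k. indicator {lattice_floor x} k \<partial>count_space int_lattice)"
    using lattice_floor_unique lattice_floor(2)
    by (intro nn_integral_cong) (auto simp: indicator_def)
  also have "\<dots> = 1"
    using lattice_floor(1)[of x] by simp
  finally show ?thesis .
qed

lemma nn_integral_lborel_shift:
  fixes f :: "'a::euclidean_space \<Rightarrow> ennreal"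
  assumes [measurable]: "f \<in> borel_measurable borel"
  shows "(\<integral>\<^sup>+x. f (x + h) \<partial>lborel) = (\<integral>\<^sup>+x. f x \<partial>lborel)"
proof -
  have "(\<integral>\<^sup>+x. f x \<partial>lborel) = (\<integral>\<^sup>+x. f x \<partial>distr lborel borel ((+) h))"
    by (simp add: lborel_distr_plus)
  also have "\<dots> = (\<integral>\<^sup>+x. f (h + x) \<partial>lborel)"
    by (subst nn_integral_distr) auto
  finally show ?thesis by (simp add: add.commute)
qed

text \<open>Both sides are the integral of \<open>f\<close> over a fundamental domain of the lattice, cut into the
  pieces common to the cell and a lattice translate of its shift.\<close>

lemma nn_integral_torus_shift:
  fixes f :: "real^'n \<Rightarrow> ennreal"
  assumes per: "periodic_x f" and [measurable]: "f \<in> borel_measurable borel"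
  shows "(\<integral>\<^sup>+x. f (x + h) \<partial>torus) = (\<integral>\<^sup>+x. f x \<partial>torus)"
proof -
  let ?I = "indicator (half_open_cell :: (real^'n) set) :: _ \<Rightarrow> ennreal"
  have "(\<integral>\<^sup>+x. f (x + h) \<partial>torus) = (\<integral>\<^sup>+x. ?I x * f (x + h) \<partial>lborel)"
    by (rule nn_integral_torus) simp
  also have "\<dots> = (\<integral>\<^sup>+x. ?I (x - h) * f x \<partial>lborel)"
    using nn_integral_lborel_shift[of "\<lambda>x. ?I (x - h) * f x" h] by simp
  \<comment> \<open>The factor 1 is inserted as a sum over translates. After interchanging sum and
    integral each piece is moved so that \<open>f\<close> is evaluated at \<open>x + k\<close>,
    where periodicity removes \<open>k\<close>; the remaining sum over the lattice is again
    1.\<close>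
  also have "\<dots> = (\<integral>\<^sup>+x. \<integral>\<^sup>+k. ?I (x - k) * (?I (x - h) * f x) \<partial>count_space int_lattice \<partial>lborel)"
    by (simp add: nn_integral_multc nn_integral_lattice_translates)
  also have "\<dots> = (\<integral>\<^sup>+k. \<integral>\<^sup>+x. ?I (x - k) * (?I (x - h) * f x) \<partial>lborel \<partial>count_space int_lattice)"
    by (rule nn_integral_count_space_nn_integral) (auto simp: countable_int_lattice)
  also have "\<dots> = (\<integral>\<^sup>+k. \<integral>\<^sup>+x. ?I ((x + h) - k) * (?I x * f (x + h)) \<partial>lborel \<partial>count_space int_lattice)"
  proof (rule nn_integral_cong)
    fix k :: "real^'n"
    show "(\<integral>\<^sup>+x. ?I (x - k) * (?I (x - h) * f x) \<partial>lborel) =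
       (\<integral>\<^sup>+x. ?I ((x + h) - k) * (?I x * f (x + h)) \<partial>lborel)"
      using nn_integral_lborel_shift[of "\<lambda>x. ?I (x - k) * (?I (x - h) * f x)" h] by simp
  qed
  also have "\<dots> = (\<integral>\<^sup>+k. \<integral>\<^sup>+x. ?I x * (?I (x + k - h) * f x) \<partial>lborel \<partial>count_space int_lattice)"
  proof (rule nn_integral_cong)
    fix k :: "real^'n" assume "k \<in> space (count_space int_lattice)"
    then have k: "k \<in> int_lattice" by simp
    have "(\<integral>\<^sup>+x. ?I ((x + h) - k) * (?I x * f (x + h)) \<partial>lborel) =
       (\<integral>\<^sup>+x. ?I (x + (k - h) + h - k) * (?I (x + (k - h)) * f (x + (k - h) + h)) \<partial>lborel)"
      using nn_integral_lborel_shift[of "\<lambda>x. ?I ((x + h) - k) * (?I x * f (x + h))" "k - h"] by simp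
    also have "\<dots> = (\<integral>\<^sup>+x. ?I x * (?I (x + k - h) * f x) \<partial>lborel)"
      using periodic_x_add[OF per k] by (auto simp: algebra_simps intro!: nn_integral_cong)
    finally show "(\<integral>\<^sup>+x. ?I ((x + h) - k) * (?I x * f (x + h)) \<partial>lborel) =
       (\<integral>\<^sup>+x. ?I x * (?I (x + k - h) * f x) \<partial>lborel)" .
  qed
  also have "\<dots> = (\<integral>\<^sup>+x. \<integral>\<^sup>+k. ?I x * (?I (x + k - h) * f x) \<partial>count_space int_lattice \<partial>lborel)"
    by (rule nn_integral_count_space_nn_integral[symmetric]) (auto simp: countable_int_lattice)
  also have "\<dots> = (\<integral>\<^sup>+x. ?I x * f x \<partial>lborel)"
  proof (intro nn_integral_cong)
    fix x :: "real^'n"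
    have "(\<integral>\<^sup>+k. ?I (x + k - h) \<partial>count_space int_lattice) =
          (\<integral>\<^sup>+k. ?I (x - h - k) \<partial>count_space int_lattice)"
    proof -
      have "bij_betw uminus (int_lattice :: (real^'n) set) int_lattice"
        by (rule bij_betw_byWitness[where f'=uminus]) (auto simp: int_lattice_def)
      from nn_integral_bij_count_space[OF this, of "\<lambda>k. ?I (x - h - k)"]
      show ?thesis by (simp add: algebra_simps)
    qed
    then show "(\<integral>\<^sup>+k. ?I x * (?I (x + k - h) * f x) \<partial>count_space int_lattice) = ?I x * f x"
      by (simp add: nn_integral_cmult nn_integral_multc nn_integral_lattice_translates)
  qed
  also have "\<dots> = (\<integral>\<^sup>+x. f x \<partial>torus)"
    by (rule nn_integral_torus[symmetric]) simp
  finally show ?thesis .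
qed

lemma torus_integrable_shift:
  fixes f :: "real^'n \<Rightarrow> real"
  assumes per: "periodic_x f" and f: "integrable torus f"
  shows "integrable torus (\<lambda>x. f (x + h))"
proof -
  have [measurable]: "f \<in> borel_measurable borel"
    using borel_measurable_integrable[OF f] by simp
  have "(\<integral>\<^sup>+x. ennreal (norm (f (x + h))) \<partial>torus) = (\<integral>\<^sup>+x. ennreal (norm (f x)) \<partial>torus)"
    using per by (intro nn_integral_torus_shift) (auto simp: periodic_x_def)
  then show ?thesis
    using f by (auto simp: integrable_iff_bounded)
qed

lemma torus_integral_shift:
  fixes f :: "real^'n \<Rightarrow> real"
  assumes per: "periodic_x f" and f: "integrable torus f"
  shows "(\<integral>x. f (x + h) \<partial>torus) = (\<integral>x. f x \<partial>torus)"
proof -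
  have [measurable]: "f \<in> borel_measurable borel"
    using borel_measurable_integrable[OF f] by simp
  have "(\<integral>\<^sup>+x. ennreal (f (x + h)) \<partial>torus) = (\<integral>\<^sup>+x. ennreal (f x) \<partial>torus)"
    "(\<integral>\<^sup>+x. ennreal (- f (x + h)) \<partial>torus) = (\<integral>\<^sup>+x. ennreal (- f x) \<partial>torus)"
    using per by (auto intro!: nn_integral_torus_shift simp: periodic_x_def)
  then show ?thesis
    using f torus_integrable_shift[OF assms] by (simp add: real_lebesgue_integral_def)
qed

text \<open>The derivative is a bounded limit of difference quotients, each of mean zero.\<close>

lemma torus_integral_derivative:
  fixes F F' :: "real^'n \<Rightarrow> real"
  assumes per: "periodic_x F" and cont: "continuous_on UNIV F"
    and deriv: "\<And>x s. ((\<lambda>s. F (x + s *\<^sub>R e)) has_real_derivative F' (x + s *\<^sub>R e)) (at s)"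
    and bound: "\<And>x. \<bar>F x\<bar> \<le> B" "\<And>x. \<bar>F' x\<bar> \<le> B"
    and [measurable]: "F' \<in> borel_measurable borel"
  shows "(\<integral>x. F' x \<partial>torus) = 0"
proof -
  have [measurable]: "F \<in> borel_measurable borel"
    using cont by (rule borel_measurable_continuous_onI)
  have int: "integrable torus F"
    by (rule torus.integrable_const_bound[of _ B]) (use bound in auto)
  define q where "q n x = real (Suc n) * (F (x + (1 / Suc n) *\<^sub>R e) - F x)" for n x
  have "(\<lambda>n. \<integral>x. q n x \<partial>torus) \<longlonglongrightarrow> (\<integral>x. F' x \<partial>torus)"
  proof (rule integral_dominated_convergence[where w="\<lambda>_. B"])
    show "AE x in torus. (\<lambda>n. q n x) \<longlonglongrightarrow> F' x"
    proof (rule AE_I2)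
      fix x
      have "((\<lambda>s. F (x + s *\<^sub>R e)) has_real_derivative F' x) (at 0)"
        using deriv[of x 0] by simp
      then have "((\<lambda>h. (F (x + h *\<^sub>R e) - F x) / h) \<longlongrightarrow> F' x) (at 0)"
        by (simp add: DERIV_def)
      moreover have "filterlim (\<lambda>n. 1 / real (Suc n)) (at 0) sequentially"
        using LIMSEQ_inverse_real_of_nat by (auto simp: filterlim_at divide_inverse)
      ultimately have "(\<lambda>n. (F (x + (1 / Suc n) *\<^sub>R e) - F x) / (1 / Suc n)) \<longlonglongrightarrow> F' x"
        by (rule filterlim_compose)
      then show "(\<lambda>n. q n x) \<longlonglongrightarrow> F' x"
        by (simp add: q_def mult.commute)
    qed
    show "AE x in torus. norm (q n x) \<le> B" for n
    proof (rule AE_I2)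
      fix x
      let ?s = "1 / real (Suc n)"
      obtain z where "0 < z" "z < ?s"
        "F (x + ?s *\<^sub>R e) - F (x + 0 *\<^sub>R e) = (?s - 0) * F' (x + z *\<^sub>R e)"
        using MVT2[of 0 ?s "\<lambda>s. F (x + s *\<^sub>R e)" "\<lambda>s. F' (x + s *\<^sub>R e)"] deriv by auto
      then have "q n x = F' (x + z *\<^sub>R e)"
        by (simp add: q_def)
      then show "norm (q n x) \<le> B" using bound(2) by simp
    qed
  qed (auto simp: q_def)
  moreover have "(\<integral>x. q n x \<partial>torus) = 0" for n
    unfolding q_def
    by (simp add: torus_integral_shift[OF per int] torus_integrable_shift[OF per int] int)
  ultimately show ?thesis by (simp add: LIMSEQ_const_iff)
qed

lemma emeasure_cbox_cart:
  assumes "\<And>i. a $ i \<le> b $ i"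
  shows "emeasure lborel (cbox a b :: (real^'n) set) = ennreal (\<Prod>i\<in>UNIV. b $ i - a $ i)"
proof -
  have "cbox a b \<noteq> {}" using assms by (auto simp: interval_ne_empty_cart)
  then show ?thesis
    using content_cbox_cart[of a b] emeasure_eq_ennreal_measure[of lborel "cbox a b"]
      emeasure_lborel_cbox_finite[of a b] by (auto simp: top.not_eq_extremum)
qed

lemma emeasure_torus:
  assumes [measurable]: "A \<in> sets borel"
  shows "emeasure torus (A :: (real^'n) set) = emeasure lborel (A \<inter> torus_cell)"
proof -
  have "emeasure torus A = (\<integral>\<^sup>+x. indicator torus_cell x * indicator A x \<partial>lborel)"
    by (simp add: torus_def emeasure_density)
  also have "\<dots> = (\<integral>\<^sup>+x. indicator (A \<inter> torus_cell) x \<partial>lborel)"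
    by (intro nn_integral_cong) (auto simp: indicator_def)
  finally show ?thesis by simp
qed

section \<open>A smooth periodic mollifier\<close>

text \<open>Measuring the distance to the integers by the sine makes periodicity automatic, with no
  choice of a nearest lattice point.\<close>

definition near_lattice :: "real \<Rightarrow> (real^'n) set" where
  "near_lattice \<kappa> = {z. \<forall>i. \<bar>sin (pi * z $ i)\<bar> < \<kappa>}"

text \<open>Common majorant of the mollifier and, up to the factor 1/\<kappa>, of its gradient. The
  averaging estimates are made with this kernel, because its mass is bounded uniformly in
  \<kappa>.\<close>

definition box_kernel :: "real \<Rightarrow> real^'n \<Rightarrow> real" where
  "box_kernel \<kappa> z = indicator (near_lattice \<kappa>) z / \<kappa> ^ CARD('n)"

lemma near_lattice_borel [measurable]: "near_lattice \<kappa> \<in> sets borel"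
  unfolding near_lattice_def by measurable

lemma box_kernel_borel [measurable]: "box_kernel \<kappa> \<in> borel_measurable borel"
  unfolding box_kernel_def by measurable

lemma sin_pi_add_int_abs: "k \<in> \<int> \<Longrightarrow> \<bar>sin (pi * (t + k))\<bar> = \<bar>sin (pi * t)\<bar>"
  by (auto elim!: Ints_cases simp: distrib_left sin_add abs_mult)

lemma box_kernel_periodic: "periodic_x (box_kernel \<kappa>)"
  by (auto simp: periodic_x_def box_kernel_def near_lattice_def sin_pi_add_int_abs indicator_def)

lemma box_kernel_nonneg: "0 < \<kappa> \<Longrightarrow> 0 \<le> box_kernel \<kappa> z"
  by (simp add: box_kernel_def)

lemma box_kernel_minus: "box_kernel \<kappa> (- z) = box_kernel \<kappa> z"
  by (simp add: box_kernel_def near_lattice_def indicator_def)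

text \<open>Taylor's formula gives sin y \<ge> y (1 - y^2 / 6). For y = pi s \<le> 2 the right side
  is at least y / 3, which exceeds s because pi > 3.\<close>

lemma sin_pi_ge: "0 \<le> s \<Longrightarrow> s \<le> 1/2 \<Longrightarrow> s \<le> sin (pi * s)"
proof -
  assume s: "0 \<le> s" "s \<le> 1/2"
  have "pi * s \<le> 2" using s pi_less_4 mult_mono[of pi 4 s "1/2"] by simp
  have "\<bar>sin (pi * s) - pi * s\<bar> \<le> (pi * s) ^ 3 / 6"
    using Maclaurin_sin_bound[of "pi * s" 3] s
    by (simp add: eval_nat_numeral sin_coeff_def lessThan_Suc)
  then have "sin (pi * s) \<ge> pi * s - (pi * s) ^ 3 / 6" by linarith
  have "(pi * s)^2 \<le> 4" using power_mono[OF \<open>pi * s \<le> 2\<close>, of 2] s by simp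
  then have "(pi * s) ^ 3 \<le> pi * s * 4" using s by (simp add: power3_eq_cube power2_eq_square mult_left_mono mult.assoc)
  moreover have "3 * s \<le> pi * s" using s pi_gt3 by (intro mult_right_mono) auto
  ultimately show ?thesis using \<open>sin (pi * s) \<ge> _\<close> s by linarith
qed

text \<open>Rounding every coordinate gives the lattice point; the factor \<open>CARD('n)\<close> is
  the price of passing from coordinates to the norm. Later each shift in the support of the kernel
  is exchanged for this short representative.\<close>

lemma near_lattice_cell:
  fixes z :: "real^'n" and \<kappa> :: real
  assumes z: "z \<in> near_lattice \<kappa>"
  obtains k where "k \<in> int_lattice" "norm (z - k) \<le> CARD('n) * \<kappa>"
proof
  define k :: "real^'n" where "k = (\<chi> i. of_int (round (z $ i)))"
  show k: "k \<in> int_lattice" by (simp add: k_def int_lattice_def)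
  have "\<bar>(z - k) $ i\<bar> \<le> \<kappa>" for i
  proof -
    have "\<bar>z $ i - k $ i\<bar> \<le> 1/2"
      unfolding k_def using of_int_round_abs_le[of "z $ i"] by (simp add: abs_minus_commute)
    then have "\<bar>z $ i - k $ i\<bar> \<le> sin (pi * \<bar>z $ i - k $ i\<bar>)"
      by (intro sin_pi_ge) auto
    also have "\<dots> \<le> \<bar>sin (pi * (z $ i + - k $ i))\<bar>"
      using sin_minus[of "pi * (z $ i - k $ i)"] by (auto simp: abs_if algebra_simps)
    also have "\<dots> = \<bar>sin (pi * z $ i)\<bar>"
      by (rule sin_pi_add_int_abs) (simp add: k_def)
    also have "\<dots> < \<kappa>" using z by (simp add: near_lattice_def)
    finally show ?thesis by simp
  qed
  then have "(\<Sum>i\<in>UNIV. \<bar>(z - k) $ i\<bar>) \<le> (\<Sum>i\<in>(UNIV::'n set). \<kappa>)" by (intro sum_mono)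
  then show "norm (z - k) \<le> CARD('n) * \<kappa>"
    using norm_le_l1_cart[of "z - k"] by simp
qed

text \<open>Inside the cell the support lies in boxes of side \<kappa> at the corners, one for each
  set of coordinates that are close to 1 rather than to 0. There are 2^d of them, each of volume
  \<kappa>^d, so the normalisation cancels \<kappa>.\<close>

lemma nn_integral_box_kernel:
  assumes \<kappa>: "0 < \<kappa>" "\<kappa> < 1"
  shows "(\<integral>\<^sup>+z. ennreal (box_kernel \<kappa> z) \<partial>(torus :: (real^'n) measure)) \<le> ennreal (2 ^ CARD('n))"
proof -
  define Q :: "'n set \<Rightarrow> (real^'n) set" where
    "Q S = cbox (\<chi> i. if i \<in> S then 1 - \<kappa> else 0) (\<chi> i. if i \<in> S then 1 else \<kappa>)" for S
  have Q: "emeasure lborel (Q S) = ennreal (\<kappa> ^ CARD('n))" for S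
  proof -
    have "emeasure lborel (Q S) = ennreal (\<Prod>i\<in>(UNIV::'n set). (if i \<in> S then 1 else \<kappa>) - (if i \<in> S then 1 - \<kappa> else 0))"
      unfolding Q_def using \<kappa> by (subst emeasure_cbox_cart) auto
    also have "(\<Prod>i\<in>(UNIV::'n set). (if i \<in> S then 1 else \<kappa>) - (if i \<in> S then 1 - \<kappa> else 0)) = (\<Prod>i\<in>(UNIV::'n set). \<kappa>)"
      by (rule prod.cong) auto
    finally show ?thesis by simp
  qed
  have sub: "near_lattice \<kappa> \<inter> torus_cell \<subseteq> (\<Union>S\<in>UNIV. Q S)"
  proof
    fix z :: "real^'n" assume z: "z \<in> near_lattice \<kappa> \<inter> torus_cell"
    have "z \<in> Q {i. z $ i > 1/2}"
    proof -
      have "z $ i \<le> \<kappa>" if "\<not> z $ i > 1/2" for i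
      proof -
        have "z $ i \<le> sin (pi * z $ i)"
          using that z by (intro sin_pi_ge) (auto simp: torus_cell_def mem_box_cart)
        also have "\<dots> \<le> \<bar>sin (pi * z $ i)\<bar>" by simp
        also have "\<dots> < \<kappa>" using z by (simp add: near_lattice_def)
        finally show ?thesis by simp
      qed
      moreover have "z $ i \<ge> 1 - \<kappa>" if "z $ i > 1/2" for i
      proof -
        have "1 - z $ i \<le> sin (pi * (1 - z $ i))"
          using that z by (intro sin_pi_ge) (auto simp: torus_cell_def mem_box_cart)
        also have "\<dots> \<le> \<bar>sin (pi * (- z $ i + 1))\<bar>" by simp
        also have "\<dots> = \<bar>sin (pi * z $ i)\<bar>" by (subst sin_pi_add_int_abs) auto
        also have "\<dots> < \<kappa>" using z by (simp add: near_lattice_def)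
        finally show ?thesis by simp
      qed
      ultimately show ?thesis using z by (auto simp: Q_def mem_box_cart torus_cell_def)
    qed
    then show "z \<in> (\<Union>S\<in>UNIV. Q S)" by blast
  qed
  have "emeasure torus (near_lattice \<kappa> :: (real^'n) set) = emeasure lborel (near_lattice \<kappa> \<inter> (torus_cell :: (real^'n) set))"
    by (rule emeasure_torus) simp
  also have "\<dots> \<le> emeasure lborel (\<Union>S\<in>UNIV. Q S)"
    by (rule emeasure_mono[OF sub]) (simp add: Q_def)
  also have "\<dots> \<le> (\<Sum>S\<in>UNIV. emeasure lborel (Q S))"
    by (rule emeasure_subadditive_finite) (auto simp: Q_def)
  also have "\<dots> = ennreal (2 ^ CARD('n) * \<kappa> ^ CARD('n))"
    using \<kappa> by (simp add: Q card_Pow[of "UNIV :: 'n set", simplified] ennreal_mult' flip: ennreal_power)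
  finally have *: "emeasure torus (near_lattice \<kappa> :: (real^'n) set) \<le> ennreal (2 ^ CARD('n) * \<kappa> ^ CARD('n))" .
  have "(\<integral>\<^sup>+z. ennreal (box_kernel \<kappa> z) \<partial>(torus :: (real^'n) measure))
      = (\<integral>\<^sup>+z. ennreal (1 / \<kappa> ^ CARD('n)) * indicator (near_lattice \<kappa>) z \<partial>(torus :: (real^'n) measure))"
    by (intro nn_integral_cong) (auto simp: box_kernel_def indicator_def)
  also have "\<dots> = ennreal (1 / \<kappa> ^ CARD('n)) * emeasure torus (near_lattice \<kappa> :: (real^'n) set)"
    by (subst nn_integral_cmult_indicator) auto
  also have "\<dots> \<le> ennreal (1 / \<kappa> ^ CARD('n)) * ennreal (2 ^ CARD('n) * \<kappa> ^ CARD('n))"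
    by (intro mult_left_mono *) auto
  also have "\<dots> = ennreal (2 ^ CARD('n))"
    using \<kappa> by (simp flip: ennreal_mult)
  finally show ?thesis .
qed

text \<open>The standard bump exp(-1/(1 - s^2)) in the variable s = sin (pi t) / \<kappa>. The
  square of the sine has period 1, so the bump is periodic without any summation over
  translates.\<close>

definition sin_bump :: "real \<Rightarrow> real \<Rightarrow> real" where
  "sin_bump \<kappa> t = flat_exp 0 (1 - (sin (pi * t) / \<kappa>)\<^sup>2)"

definition sin_bump' :: "real \<Rightarrow> real \<Rightarrow> real" where
  "sin_bump' \<kappa> t = flat_exp 2 (1 - (sin (pi * t) / \<kappa>)\<^sup>2) * (- 2 * (sin (pi * t) / \<kappa>) * (pi * cos (pi * t) / \<kappa>))"

lemma sin_bump_has_derivative: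
  "(sin_bump \<kappa> has_real_derivative sin_bump' \<kappa> t) (at t)"
proof -
  have "((\<lambda>t. 1 - (sin (pi * t) / \<kappa>)\<^sup>2) has_real_derivative
      (- 2 * (sin (pi * t) / \<kappa>) * (pi * cos (pi * t) / \<kappa>))) (at t)"
    by (auto intro!: derivative_eq_intros simp: divide_inverse)
  from DERIV_chain2[OF flat_exp_has_derivative[of 0] this]
  show ?thesis by (simp add: sin_bump_def[abs_def] sin_bump'_def numeral_2_eq_2)
qed

lemma smooth_sin_bump: "smooth (sin_bump \<kappa>)"
proof -
  have "smooth (\<lambda>t. sin (pi * t))"
    by (intro smooth_compose[OF smooth_sin] smooth_bounded_linear bounded_linear_mult_right)
  then have "smooth (\<lambda>t. 1 - (sin (pi * t) * (1/\<kappa>)) * (sin (pi * t) * (1/\<kappa>)))"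
    by (intro smooth_diff smooth_mult smooth_const)
  from smooth_compose[OF smooth_flat_exp this, of 0]
  show ?thesis by (simp add: sin_bump_def[abs_def] power2_eq_square)
qed

text \<open>With s = sin (pi t) / \<kappa>, the slope bound is the product of
  \<open>flat_exp 2\<close> \<le> 2 with 2 |s| pi / \<kappa> for |s| \<le> 1. The floor exp (-2)
  comes from 1 - s^2 \<ge> 3/4 when |s| \<le> 1/2.\<close>

lemma sin_bump_cases:
  assumes "0 < \<kappa>"
  shows "0 \<le> sin_bump \<kappa> t" "sin_bump \<kappa> t \<le> 1" "\<bar>sin_bump' \<kappa> t\<bar> \<le> 4 * pi / \<kappa>"
    and "\<kappa> \<le> \<bar>sin (pi * t)\<bar> \<Longrightarrow> sin_bump \<kappa> t = 0"
    and "\<kappa> \<le> \<bar>sin (pi * t)\<bar> \<Longrightarrow> sin_bump' \<kappa> t = 0"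
    and "\<bar>sin (pi * t)\<bar> \<le> \<kappa> / 2 \<Longrightarrow> exp (-2) \<le> sin_bump \<kappa> t"
proof -
  let ?s = "sin (pi * t) / \<kappa>"
  show "0 \<le> sin_bump \<kappa> t" "sin_bump \<kappa> t \<le> 1"
    by (simp_all add: sin_bump_def flat_exp_nonneg flat_exp_le_1)
  have out: "1 - ?s\<^sup>2 \<le> 0" if "\<kappa> \<le> \<bar>sin (pi * t)\<bar>"
  proof -
    have "1 \<le> \<bar>?s\<bar>" using that assms by simp
    then have "1 \<le> \<bar>?s\<bar>\<^sup>2" by (rule one_le_power)
    then show ?thesis by (simp only: power2_abs)
  qed
  show "sin_bump \<kappa> t = 0" and b1: "sin_bump' \<kappa> t = 0" if "\<kappa> \<le> \<bar>sin (pi * t)\<bar>"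
    using out[OF that] by (auto simp: sin_bump_def sin_bump'_def flat_exp_def)
  show "\<bar>sin_bump' \<kappa> t\<bar> \<le> 4 * pi / \<kappa>"
  proof (cases "\<kappa> \<le> \<bar>sin (pi * t)\<bar>")
    case False
    then have "\<bar>?s\<bar> \<le> 1" using assms by simp
    have "\<bar>sin_bump' \<kappa> t\<bar> = \<bar>flat_exp 2 (1 - ?s\<^sup>2)\<bar> * (2 * \<bar>?s\<bar> * (pi * \<bar>cos (pi * t)\<bar> / \<kappa>))"
      using assms by (simp add: sin_bump'_def abs_mult)
    also have "\<dots> \<le> 2 * (2 * 1 * (pi * 1 / \<kappa>))"
      using assms \<open>\<bar>?s\<bar> \<le> 1\<close> flat_exp_nonneg[of 2] flat_exp_2_le
      by (intro mult_mono divide_right_mono) auto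
    finally show ?thesis by simp
  qed (use b1 assms in simp)
  show "exp (-2) \<le> sin_bump \<kappa> t" if "\<bar>sin (pi * t)\<bar> \<le> \<kappa> / 2"
  proof -
    have "\<bar>?s\<bar> \<le> 1 / 2" using that assms by (simp add: field_simps)
    then have "?s\<^sup>2 \<le> 1 / 4" using power_mono[of "\<bar>?s\<bar>" "1/2" 2] by (simp add: power2_eq_square)
    then have "1 / (1 - ?s\<^sup>2) \<le> 2" by (simp add: field_simps)
    then show ?thesis using \<open>?s\<^sup>2 \<le> 1 / 4\<close> by (simp add: sin_bump_def flat_exp_def)
  qed
qed

text \<open>\<open>C\<close> is a parameter of its own because the limit argument needs one constant
  for all \<kappa>. The bounds by \<open>box_kernel\<close> carry both the support and the scaling
  1/\<kappa> of the gradient, whose components are the functions \<open>K j\<close>.\<close>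

locale mollifier =
  fixes \<kappa> C :: real and \<eta> :: "real^'n \<Rightarrow> real" and K :: "'n \<Rightarrow> real^'n \<Rightarrow> real"
  assumes kappa: "0 < \<kappa>" "\<kappa> < 1" and C1: "1 \<le> C"
    and smooth_eta: "smooth \<eta>"
    and eta_deriv: "(\<eta> has_derivative (\<lambda>h. \<Sum>j\<in>UNIV. h $ j * K j x)) (at x)"
    and K_cont: "continuous_on UNIV (K j)"
    and eta_periodic: "periodic_x \<eta>" and K_periodic: "periodic_x (K j)"
    and eta_minus: "\<eta> (- x) = \<eta> x"
    and eta_nonneg: "0 \<le> \<eta> x"
    and eta_integral: "(\<integral>x. \<eta> x \<partial>torus) = 1"
    and eta_le: "\<eta> x \<le> C * box_kernel \<kappa> x"
    and K_le: "\<bar>K j x\<bar> \<le> C / \<kappa> * box_kernel \<kappa> x"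
    and box_integral: "(\<integral>\<^sup>+x. ennreal (box_kernel \<kappa> x) \<partial>(torus :: (real^'n) measure)) \<le> ennreal C"

text \<open>The kernel is a product of one-dimensional bumps divided by its integral
  \<open>Z\<close>. The point to check is that \<open>Z\<close> is bounded below by a multiple of
  \<kappa>^d, with a factor free of \<kappa>.\<close>

theorem mollifier_exists:
  obtains C :: real where
    "\<And>\<kappa>. 0 < \<kappa> \<Longrightarrow> \<kappa> < 1 \<Longrightarrow> \<exists>\<eta> K. mollifier \<kappa> C (\<eta> :: real^'n \<Rightarrow> real) K"
proof
  let ?d = "CARD('n)"
  \<comment> \<open>The factor \<open>2 * pi * exp 2\<close> is the loss per coordinate in the lower
    bound for \<open>Z\<close>, and \<open>4 * pi\<close> is the slope of the bump. The product also
    exceeds the mass 2^d of the box kernel.\<close>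
  define C where "C = (4 * pi) * (2 * pi * exp 2) ^ ?d"
  have pi1: "1 \<le> pi" "1 \<le> 4 * pi" using pi_gt3 by auto
  have e1: "1 \<le> exp (2::real)" by simp
  have pe: "1 \<le> pi * exp 2" using mult_mono[OF pi1(1) e1] by simp
  have c0: "2 ^ ?d \<le> (2 * pi * exp 2) ^ ?d" "1 \<le> (2 * pi * exp 2) ^ ?d"
    using pe by (auto intro!: power_mono one_le_power)
  have C: "(2 * pi * exp 2) ^ ?d \<le> C" "2 ^ ?d \<le> C" "1 \<le> C"
  proof -
    show "(2 * pi * exp 2) ^ ?d \<le> C"
      using mult_right_mono[OF pi1(2), of "(2 * pi * exp 2) ^ ?d"] by (simp add: C_def)
    then show "2 ^ ?d \<le> C" "1 \<le> C" using c0 by linarith+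
  qed
  fix \<kappa> :: real assume \<kappa>: "0 < \<kappa>" "\<kappa> < 1"
  define \<Phi> :: "real^'n \<Rightarrow> real" where "\<Phi> x = (\<Prod>i\<in>UNIV. sin_bump \<kappa> (x $ i))" for x
  define K0 :: "'n \<Rightarrow> real^'n \<Rightarrow> real" where
    "K0 j x = sin_bump' \<kappa> (x $ j) * (\<Prod>i\<in>UNIV - {j}. sin_bump \<kappa> (x $ i))" for j x
  have \<Phi>_smooth: "smooth \<Phi>"
    unfolding \<Phi>_def
    by (intro smooth_prod smooth_compose[OF smooth_sin_bump] smooth_bounded_linear bounded_linear_vec_nth) auto
  have [measurable]: "\<Phi> \<in> borel_measurable borel"
    using smooth_continuous_on[OF \<Phi>_smooth] by (rule borel_measurable_continuous_onI)
  have \<Phi>_01: "0 \<le> \<Phi> x" "\<Phi> x \<le> 1" for x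
    using sin_bump_cases[OF \<kappa>(1)] by (auto simp: \<Phi>_def intro!: prod_nonneg prod_le_1)
  have \<Phi>_out: "\<Phi> x = 0" "K0 j x = 0" if x: "x \<notin> near_lattice \<kappa>" for x j
  proof -
    from x obtain i where i: "\<kappa> \<le> \<bar>sin (pi * x $ i)\<bar>"
      by (auto simp: near_lattice_def not_less)
    have z: "sin_bump \<kappa> (x $ i) = 0" "sin_bump' \<kappa> (x $ i) = 0"
      using sin_bump_cases(4,5)[OF \<kappa>(1)] i by auto
    show "\<Phi> x = 0" using z unfolding \<Phi>_def by (intro prod_zero) auto
    show "K0 j x = 0"
    proof (cases "i = j")
      case False
      then have "(\<Prod>i\<in>UNIV - {j}. sin_bump \<kappa> (x $ i)) = 0" using z by (intro prod_zero) auto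
      then show ?thesis by (simp add: K0_def)
    qed (use z in \<open>simp add: K0_def\<close>)
  qed
  have K0_le: "\<bar>K0 j x\<bar> \<le> 4 * pi / \<kappa>" for j x
  proof -
    have P: "0 \<le> (\<Prod>i\<in>UNIV - {j}. sin_bump \<kappa> (x $ i))" "(\<Prod>i\<in>UNIV - {j}. sin_bump \<kappa> (x $ i)) \<le> 1"
      using sin_bump_cases(1,2)[OF \<kappa>(1)] by (auto intro: prod_nonneg prod_le_1)
    have "\<bar>K0 j x\<bar> \<le> 4 * pi / \<kappa> * 1"
      unfolding K0_def abs_mult using sin_bump_cases(3)[OF \<kappa>(1), of "x $ j"] P \<kappa>
      by (intro mult_mono) (simp_all only: abs_of_nonneg abs_ge_zero divide_nonneg_pos pi_ge_zero mult_nonneg_nonneg zero_le_numeral)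
    then show ?thesis by simp
  qed
  have \<Phi>_deriv: "(\<Phi> has_derivative (\<lambda>h. \<Sum>j\<in>UNIV. h $ j * K0 j x)) (at x)" for x
  proof -
    have "((\<lambda>x. sin_bump \<kappa> (x $ i)) has_derivative (\<lambda>h. h $ i * sin_bump' \<kappa> (x $ i))) (at x)" for i
      using has_derivative_compose[OF bounded_linear_imp_has_derivative[OF bounded_linear_vec_nth]
          sin_bump_has_derivative[unfolded has_field_derivative_def], of _ i]
      by (simp add: mult.commute)
    then show ?thesis
      unfolding \<Phi>_def[abs_def] K0_def mult.assoc[symmetric]
      by (rule has_derivative_prod)
  qed
  have per: "sin_bump \<kappa> (t + k) = sin_bump \<kappa> t" "sin_bump' \<kappa> (t + k) = sin_bump' \<kappa> t" if k: "k \<in> \<int>" for t k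
  proof -
    obtain m :: int where m: "k = of_int m" using k by (rule Ints_cases)
    have sq: "(sin (pi * (t + k)))\<^sup>2 = (sin (pi * t))\<^sup>2"
      using sin_pi_add_int_abs[OF k, of t] by (metis power2_abs)
    have sc: "sin (pi * (t + k)) * cos (pi * (t + k)) = sin (pi * t) * cos (pi * t)"
      by (cases "even m") (auto simp: m distrib_left sin_add cos_add)
    show "sin_bump \<kappa> (t + k) = sin_bump \<kappa> t" by (simp add: sin_bump_def power_divide sq)
    show "sin_bump' \<kappa> (t + k) = sin_bump' \<kappa> t"
      using sc by (simp add: sin_bump'_def power_divide sq)
  qed
  define Z where "Z = (\<integral>x. \<Phi> x \<partial>torus)"
  have \<Phi>_int: "integrable torus \<Phi>"
    by (rule torus.integrable_const_bound[of _ 1]) (use \<Phi>_01 in auto)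
  have Z: "(\<kappa> / (2 * pi * exp 2)) ^ ?d \<le> Z"
  proof -
    \<comment> \<open>One corner box is enough: for coordinates at most \<kappa> / (2 pi) the sine
      is at most \<kappa> / 2, so every factor of \<Phi> is at least exp (-2).\<close>
    define B :: "(real^'n) set" where "B = cbox 0 (\<chi> i. \<kappa> / (2 * pi))"
    have "emeasure lborel B = ennreal ((\<kappa> / (2 * pi)) ^ ?d)"
      unfolding B_def using \<kappa> by (subst emeasure_cbox_cart) auto
    moreover have "B \<subseteq> torus_cell"
    proof -
      have "\<kappa> / (2 * pi) \<le> 1" using \<kappa> pi_gt3 by simp
      then show ?thesis unfolding B_def torus_cell_def subset_iff mem_box_cart
        by (simp only: vec_lambda_beta) (meson order_trans)
    qed
    ultimately have B: "emeasure torus B = ennreal ((\<kappa> / (2 * pi)) ^ ?d)"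
      by (simp add: emeasure_torus B_def Int_absorb2)
    have *: "exp (-2) ^ ?d * indicator B x \<le> \<Phi> x" for x
    proof (cases "x \<in> B")
      case True
      have "\<bar>sin (pi * x $ i)\<bar> \<le> \<kappa> / 2" for i
      proof -
        have "\<bar>sin (pi * x $ i)\<bar> \<le> \<bar>pi * x $ i\<bar>" by (rule abs_sin_x_le_abs_x)
        also have "\<dots> = pi * x $ i"
          using True by (simp add: B_def mem_box_cart abs_mult)
        also have "\<dots> \<le> pi * (\<kappa> / (2 * pi))"
          using True by (intro mult_left_mono) (auto simp only: B_def mem_box_cart vec_lambda_beta pi_ge_zero)
        finally show ?thesis by simp
      qed
      then have "(\<Prod>i\<in>(UNIV::'n set). exp (-2)) \<le> \<Phi> x"
        unfolding \<Phi>_def by (intro prod_mono) (auto intro: sin_bump_cases(6)[OF \<kappa>(1)])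
      then show ?thesis using True by simp
    qed (use \<Phi>_01 in simp)
    have "exp (-2) ^ ?d * (\<kappa> / (2 * pi)) ^ ?d = (\<integral>x. exp (-2) ^ ?d * indicator B x \<partial>torus)"
      using B \<kappa> by (simp add: measure_def B_def)
    also have "\<dots> \<le> Z"
      unfolding Z_def by (intro integral_mono * \<Phi>_int) (auto simp: B_def torus.emeasure_finite less_top[symmetric])
    finally show ?thesis
      by (simp add: exp_minus field_simps power_mult_distrib)
  qed
  have Zpos: "0 < Z"
    by (rule less_le_trans[OF _ Z]) (use \<kappa> in simp)
  have Zinv: "1 / Z \<le> (2 * pi * exp 2) ^ ?d / \<kappa> ^ ?d"
    using le_imp_inverse_le[OF Z] \<kappa> by (simp add: field_simps power_divide)
  have "mollifier \<kappa> C (\<lambda>x. \<Phi> x / Z) (\<lambda>j x. K0 j x / Z)"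
  proof
    show "0 < \<kappa>" "\<kappa> < 1" "1 \<le> C" by fact+
    show "smooth (\<lambda>x. \<Phi> x / Z)"
      using smooth_mult[OF \<Phi>_smooth smooth_const, of "1 / Z"] by simp
    show "((\<lambda>x. \<Phi> x / Z) has_derivative (\<lambda>h. \<Sum>j\<in>UNIV. h $ j * (K0 j x / Z))) (at x)" for x
      using has_derivative_mult_right[OF \<Phi>_deriv[of x], of "1/Z"] by (simp add: sum_divide_distrib)
    show "continuous_on UNIV (\<lambda>x. K0 j x / Z)" for j
    proof -
      have 1: "continuous_on UNIV (sin_bump' \<kappa>)"
        using smooth_continuous_on smooth_real_derivative[OF sin_bump_has_derivative] smooth_sin_bump by blast
      have 2: "continuous_on UNIV (sin_bump \<kappa>)"
        using smooth_continuous_on smooth_sin_bump by blast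
      have 3: "continuous_on UNIV (\<lambda>x::real^'n. sin_bump' \<kappa> (x $ i))"
        "continuous_on UNIV (\<lambda>x::real^'n. sin_bump \<kappa> (x $ i))" for i
        by (intro continuous_on_compose2[OF 1] continuous_on_compose2[OF 2] continuous_intros; simp)+
      show ?thesis
        unfolding K0_def using Zpos by (intro continuous_intros 3) auto
    qed
    show "periodic_x (\<lambda>x. \<Phi> x / Z)" "periodic_x (\<lambda>x. K0 j x / Z)" for j
      by (auto simp: periodic_x_def \<Phi>_def K0_def per)
    show "\<Phi> (- x) / Z = \<Phi> x / Z" "0 \<le> \<Phi> x / Z" for x
      using \<Phi>_01 Zpos by (auto simp: \<Phi>_def sin_bump_def)
    show "(\<integral>x. \<Phi> x / Z \<partial>torus) = 1" using Zpos by (simp add: Z_def)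
    show "\<Phi> x / Z \<le> C * box_kernel \<kappa> x" for x
    proof (cases "x \<in> near_lattice \<kappa>")
      case True
      have "\<Phi> x / Z \<le> 1 / Z" using \<Phi>_01 Zpos by (simp add: divide_right_mono)
      also note Zinv
      also have "(2 * pi * exp 2) ^ ?d / \<kappa> ^ ?d \<le> C / \<kappa> ^ ?d"
        using C \<kappa> by (intro divide_right_mono) auto
      finally show ?thesis using True by (simp add: box_kernel_def)
    qed (use \<Phi>_out in \<open>simp add: box_kernel_def\<close>)
    show "\<bar>K0 j x / Z\<bar> \<le> C / \<kappa> * box_kernel \<kappa> x" for j x
    proof (cases "x \<in> near_lattice \<kappa>")
      case True
      have "\<bar>K0 j x / Z\<bar> = \<bar>K0 j x\<bar> * (1 / Z)" using Zpos by simp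
      also have "\<dots> \<le> (4 * pi / \<kappa>) * ((2 * pi * exp 2) ^ ?d / \<kappa> ^ ?d)"
        using Zinv Zpos K0_le \<kappa> by (intro mult_mono) auto
      also have "\<dots> = C / \<kappa> * box_kernel \<kappa> x"
        using True by (simp add: box_kernel_def C_def)
      finally show ?thesis .
    qed (use \<Phi>_out in \<open>simp add: box_kernel_def\<close>)
    show "(\<integral>\<^sup>+x. ennreal (box_kernel \<kappa> x) \<partial>(torus :: (real^'n) measure)) \<le> ennreal C"
      using nn_integral_box_kernel[OF \<kappa>, where 'n='n] C(2) by (meson ennreal_leI order_trans)
  qed
  then show "\<exists>\<eta> K. mollifier \<kappa> C (\<eta> :: real^'n \<Rightarrow> real) K" by blast
qed

lemma periodic_continuous_bounded:
  fixes f :: "real^'n \<Rightarrow> real"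
  assumes per: "periodic_x f" and cont: "continuous_on UNIV f"
  obtains B where "0 \<le> B" "\<And>x. \<bar>f x\<bar> \<le> B"
proof -
  have "compact (f ` torus_cell)"
    by (intro compact_continuous_image continuous_on_subset[OF cont]) (auto simp: torus_cell_def)
  then obtain B where B: "\<And>x. x \<in> torus_cell \<Longrightarrow> \<bar>f x\<bar> \<le> B"
    using compact_imp_bounded bounded_iff by (metis imageI real_norm_def)
  have "\<bar>f x\<bar> \<le> B" for x
    using B[of "x - lattice_floor x"] periodic_x_diff[OF per lattice_floor(1), of x x]
      lattice_floor(2)[of x] half_open_cell_subset by auto
  moreover from this have "0 \<le> B" using abs_ge_zero order_trans by blast
  ultimately show thesis using that by blast
qed

lemma torus_integrable_continuous:
  fixes f :: "real^'n \<Rightarrow> real"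
  assumes "periodic_x f" "continuous_on UNIV f"
  shows "integrable torus f"
proof -
  obtain B where B: "\<And>x. \<bar>f x\<bar> \<le> B" using periodic_continuous_bounded[OF assms] by blast
  then show ?thesis
    using borel_measurable_continuous_onI[OF assms(2)]
    by (intro torus.integrable_const_bound[of _ B]) auto
qed

lemma torus_integral_derivative_continuous:
  fixes F F' :: "real^'n \<Rightarrow> real"
  assumes per: "periodic_x F" "periodic_x F'"
    and cont: "continuous_on UNIV F" "continuous_on UNIV F'"
    and deriv: "\<And>x s. ((\<lambda>s. F (x + s *\<^sub>R e)) has_real_derivative F' (x + s *\<^sub>R e)) (at s)"
  shows "(\<integral>x. F' x \<partial>torus) = 0"
proof -
  obtain B where B: "\<And>x. \<bar>F x\<bar> \<le> B" using periodic_continuous_bounded[OF per(1) cont(1)] by blast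
  obtain B' where B': "\<And>x. \<bar>F' x\<bar> \<le> B'" using periodic_continuous_bounded[OF per(2) cont(2)] by blast
  show ?thesis
    by (rule torus_integral_derivative[OF per(1) cont(1) deriv, of "max B B'"])
      (use B B' borel_measurable_continuous_onI[OF cont(2)] in \<open>auto simp: le_max_iff_disj\<close>)
qed

section \<open>Convolution on the torus\<close>

definition conv :: "(real^'n \<Rightarrow> real) \<Rightarrow> (real^'n \<Rightarrow> real) \<Rightarrow> real^'n \<Rightarrow> real" where
  "conv k f x = (\<integral>y. k (x - y) * f y \<partial>torus)"

text \<open>Serves also as the class of continuous functions on the torus: mollified fields belong
  to it, hence are bounded and integrable.\<close>

definition kernel_fun :: "(real^'n \<Rightarrow> real) \<Rightarrow> bool" where
  "kernel_fun k \<longleftrightarrow> periodic_x k \<and> continuous_on UNIV k"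

lemma kernel_fun_bounded:
  assumes "kernel_fun k"
  obtains B where "0 \<le> B" "\<And>x. \<bar>k x\<bar> \<le> B"
  using assms periodic_continuous_bounded unfolding kernel_fun_def by blast

lemma kernel_fun_borel: "kernel_fun k \<Longrightarrow> k \<in> borel_measurable borel"
  unfolding kernel_fun_def using borel_measurable_continuous_onI by blast

lemma conv_integrable:
  assumes k: "kernel_fun k" and f: "integrable torus f"
  shows "integrable torus (\<lambda>y. k (x - y) * f y)"
proof -
  obtain B where B: "0 \<le> B" "\<And>x. \<bar>k x\<bar> \<le> B" using kernel_fun_bounded[OF k] by blast
  note [measurable] = kernel_fun_borel[OF k] borel_measurable_integrable[OF f]
  show ?thesis
    by (rule Bochner_Integration.integrable_bound[of _ "\<lambda>y. B * f y"])
      (use B f in \<open>auto simp: abs_mult intro!: mult_right_mono\<close>)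
qed

lemma conv_bound:
  assumes k: "kernel_fun k" and B: "\<And>x. \<bar>k x\<bar> \<le> B" and f: "integrable torus f"
  shows "\<bar>conv k f x\<bar> \<le> B * (\<integral>y. \<bar>f y\<bar> \<partial>torus)"
proof -
  have "\<bar>conv k f x\<bar> \<le> (\<integral>y. \<bar>k (x - y) * f y\<bar> \<partial>torus)"
    unfolding conv_def using integral_norm_bound[of torus "\<lambda>y. k (x - y) * f y"] by simp
  also have "\<dots> \<le> (\<integral>y. B * \<bar>f y\<bar> \<partial>torus)"
    by (intro integral_mono integrable_abs conv_integrable[OF k f] integrable_mult_right f)
      (auto simp: abs_mult intro!: mult_right_mono B)
  finally show ?thesis by simp
qed

lemma conv_add:
  assumes "kernel_fun k" "integrable torus f" "integrable torus g"
  shows "conv k (\<lambda>y. f y + g y) x = conv k f x + conv k g x"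
  unfolding conv_def using conv_integrable[OF assms(1,2)] conv_integrable[OF assms(1,3)]
  by (simp add: distrib_left)

lemma conv_diff:
  assumes "kernel_fun k" "integrable torus f" "integrable torus g"
  shows "conv k (\<lambda>y. f y - g y) x = conv k f x - conv k g x"
  unfolding conv_def using conv_integrable[OF assms(1,2)] conv_integrable[OF assms(1,3)]
  by (simp add: right_diff_distrib)

lemma conv_cmult: "conv k (\<lambda>y. a * f y) x = a * conv k f x"
  unfolding conv_def by (simp add: mult.left_commute)

lemma conv_sum:
  assumes "kernel_fun k" "\<And>i. i \<in> A \<Longrightarrow> integrable torus (f i)"
  shows "conv k (\<lambda>y. \<Sum>i\<in>A. f i y) x = (\<Sum>i\<in>A. conv k (f i) x)"
  unfolding conv_def sum_distrib_left
  by (rule Bochner_Integration.integral_sum) (rule conv_integrable[OF assms(1) assms(2)])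

lemma conv_mono:
  assumes "kernel_fun k" "integrable torus f" "integrable torus g"
    and "\<And>x. 0 \<le> k x" "\<And>y. f y \<le> g y"
  shows "conv k f x \<le> conv k g x"
  unfolding conv_def using assms by (intro integral_mono conv_integrable mult_left_mono) auto

lemma conv_periodic: "kernel_fun k \<Longrightarrow> periodic_x (conv k f)"
  unfolding periodic_x_def conv_def kernel_fun_def by (simp add: diff_add_eq[symmetric])

lemma conv_continuous:
  assumes k: "kernel_fun k" and f: "integrable torus f"
  shows "continuous_on UNIV (conv k f)"
proof -
  obtain B where B: "0 \<le> B" "\<And>x. \<bar>k x\<bar> \<le> B" using kernel_fun_bounded[OF k] by blast
  note [measurable] = kernel_fun_borel[OF k] borel_measurable_integrable[OF f]
  have "(\<lambda>n. conv k f (X n)) \<longlonglongrightarrow> conv k f x" if "X \<longlonglongrightarrow> x" for X x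
    unfolding conv_def
  proof (rule integral_dominated_convergence[where w="\<lambda>y. B * \<bar>f y\<bar>"])
    have "isCont k z" for z
      using k by (simp add: kernel_fun_def continuous_on_eq_continuous_at)
    then have "(\<lambda>n. k (X n - y)) \<longlonglongrightarrow> k (x - y)" for y
      by (rule isCont_tendsto_compose) (intro tendsto_diff that tendsto_const)
    then show "AE y in torus. (\<lambda>n. k (X n - y) * f y) \<longlonglongrightarrow> k (x - y) * f y"
      by (intro AE_I2 tendsto_mult tendsto_const)
    show "AE y in torus. norm (k (X n - y) * f y) \<le> B * \<bar>f y\<bar>" for n
      using B by (auto simp: abs_mult intro!: mult_right_mono)
  qed (use f in auto)
  then show ?thesis
    by (auto simp: continuous_on_sequentially o_def)
qed

lemma kernel_fun_conv: "kernel_fun k \<Longrightarrow> integrable torus f \<Longrightarrow> kernel_fun (conv k f)"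
  by (simp add: kernel_fun_def conv_periodic[unfolded kernel_fun_def] conv_continuous[unfolded kernel_fun_def])

text \<open>Dominated convergence: the bound on \<open>k'\<close> makes all difference quotients of
  the kernel bounded, so that \<open>f\<close> itself supplies the integrable majorant.\<close>

lemma conv_has_derivative:
  assumes k: "kernel_fun k" and k': "kernel_fun k'" and f: "integrable torus f"
    and deriv: "\<And>x s. ((\<lambda>s. k (x + s *\<^sub>R e)) has_real_derivative k' (x + s *\<^sub>R e)) (at s)"
  shows "((\<lambda>s. conv k f (x + s *\<^sub>R e)) has_real_derivative conv k' f (x + s *\<^sub>R e)) (at s)"
proof -
  obtain B where B: "0 \<le> B" "\<And>x. \<bar>k' x\<bar> \<le> B" using kernel_fun_bounded[OF k'] by blast
  note [measurable] = kernel_fun_borel[OF k] kernel_fun_borel[OF k'] borel_measurable_integrable[OF f]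
  have lip: "\<bar>(k (z + h *\<^sub>R e) - k z) / h\<bar> \<le> B" if "h \<noteq> 0" for z h
  proof -
    let ?g = "\<lambda>s. k (z + s *\<^sub>R e)"
    have "\<bar>?g h - ?g 0\<bar> \<le> B * \<bar>h - 0\<bar>"
      using field_differentiable_bound[of UNIV ?g "\<lambda>s. k' (z + s *\<^sub>R e)" B h 0] deriv[of z] B
      by (auto intro: has_field_derivative_at_within)
    then show ?thesis using that by (simp add: divide_le_eq)
  qed
  have "((\<lambda>h. (conv k f (z + h *\<^sub>R e) - conv k f z) / h) \<longlongrightarrow> conv k' f z) (at 0)" for z
  proof (subst tendsto_at_iff_sequentially, safe)
    fix X :: "nat \<Rightarrow> real" assume X: "\<forall>i. X i \<in> UNIV - {0}" "X \<longlonglongrightarrow> 0"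
    have eq: "(conv k f (z + X n *\<^sub>R e) - conv k f z) / X n =
        (\<integral>y. (k (z - y + X n *\<^sub>R e) - k (z - y)) / X n * f y \<partial>torus)" for n
    proof -
      have "(conv k f (z + X n *\<^sub>R e) - conv k f z) / X n =
        (\<integral>y. (k (z + X n *\<^sub>R e - y) * f y - k (z - y) * f y) \<partial>torus) / X n"
        unfolding conv_def using conv_integrable[OF k f] by simp
      also have "\<dots> = (\<integral>y. (k (z + X n *\<^sub>R e - y) * f y - k (z - y) * f y) / X n \<partial>torus)" by simp
      also have "\<dots> = (\<integral>y. (k (z - y + X n *\<^sub>R e) - k (z - y)) / X n * f y \<partial>torus)"
        by (intro Bochner_Integration.integral_cong) (auto simp: field_simps)
      finally show ?thesis .
    qed
    have "(\<lambda>n. \<integral>y. (k (z - y + X n *\<^sub>R e) - k (z - y)) / X n * f y \<partial>torus) \<longlonglongrightarrow> (\<integral>y. k' (z - y) * f y \<partial>torus)"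
    proof (rule integral_dominated_convergence[where w="\<lambda>y. B * \<bar>f y\<bar>"])
      have "(\<lambda>n. (k (z - y + X n *\<^sub>R e) - k (z - y)) / X n) \<longlonglongrightarrow> k' (z - y)" for y
      proof -
        have "((\<lambda>h. (k (z - y + h *\<^sub>R e) - k (z - y)) / h) \<longlongrightarrow> k' (z - y)) (at 0)"
          using deriv[of "z - y" 0] by (simp add: DERIV_def)
        then show ?thesis using X by (auto simp: tendsto_at_iff_sequentially o_def)
      qed
      then show "AE y in torus. (\<lambda>n. (k (z - y + X n *\<^sub>R e) - k (z - y)) / X n * f y) \<longlonglongrightarrow> k' (z - y) * f y"
        by (intro AE_I2 tendsto_mult tendsto_const)
      show "AE y in torus. norm ((k (z - y + X n *\<^sub>R e) - k (z - y)) / X n * f y) \<le> B * \<bar>f y\<bar>" for n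
        unfolding real_norm_def abs_mult using lip X by (intro AE_I2 mult_right_mono) auto
    qed (use f in auto)
    then show "((\<lambda>h. (conv k f (z + h *\<^sub>R e) - conv k f z) / h) \<circ> X) \<longlonglongrightarrow> conv k' f z"
      unfolding o_def eq by (simp only: conv_def)
  qed
  from this[of "x + s *\<^sub>R e"] show ?thesis
    by (simp add: DERIV_def algebra_simps)
qed

lemma integrable_torus_pair:
  fixes f g :: "real^'n \<Rightarrow> real"
  assumes f: "integrable torus f" and g: "integrable torus g"
  shows "integrable (torus \<Otimes>\<^sub>M torus) (\<lambda>(x, y). f x * g y)"
proof -
  note [measurable] = borel_measurable_integrable[OF f] borel_measurable_integrable[OF g]
  interpret pair_sigma_finite "torus :: (real^'n) measure" "torus :: (real^'n) measure" ..
  show ?thesis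
    by (rule Fubini_integrable) (use f g in \<open>auto simp: abs_mult\<close>)
qed

text \<open>Fubini, then translation invariance in \<open>x\<close>. For the gradient kernels, which
  have mean zero, this says that divergences integrate to zero.\<close>

lemma conv_integral:
  fixes f :: "real^'n \<Rightarrow> real"
  assumes k: "kernel_fun k" and f: "integrable torus f"
  shows "(\<integral>x. conv k f x \<partial>torus) = (\<integral>x. k x \<partial>torus) * (\<integral>y. f y \<partial>torus)"
proof -
  obtain B where B: "0 \<le> B" "\<And>x. \<bar>k x\<bar> \<le> B" using kernel_fun_bounded[OF k] by blast
  note [measurable] = kernel_fun_borel[OF k] borel_measurable_integrable[OF f]
  interpret pair_sigma_finite "torus :: (real^'n) measure" "torus :: (real^'n) measure" ..
  have "integrable (torus \<Otimes>\<^sub>M torus) (\<lambda>(x, y). k (x - y) * f y)"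
    by (rule Bochner_Integration.integrable_bound[OF integrable_torus_pair[of "\<lambda>_. B" f]])
      (use B f in \<open>auto simp: abs_mult intro!: mult_mono AE_I2\<close>)
  then have "(\<integral>x. conv k f x \<partial>torus) = (\<integral>y. \<integral>x. k (x - y) * f y \<partial>torus \<partial>torus)"
    unfolding conv_def by (rule Fubini_integral[symmetric])
  also have "\<dots> = (\<integral>y. (\<integral>x. k x \<partial>torus) * f y \<partial>torus)"
    using torus_integral_shift[of k "- y" for y] k torus_integrable_continuous[of k]
    by (intro Bochner_Integration.integral_cong) (auto simp: kernel_fun_def)
  finally show ?thesis by simp
qed

context mollifier
begin

lemma kernel_eta: "kernel_fun \<eta>" and kernel_K: "kernel_fun (K j)"
  using eta_periodic smooth_continuous_on[OF smooth_eta] K_periodic K_cont by (auto simp: kernel_fun_def)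

lemma eta_line_deriv:
  "((\<lambda>s. \<eta> (x + s *\<^sub>R axis j 1)) has_real_derivative K j (x + s *\<^sub>R axis j 1)) (at s)"
proof -
  have "((\<lambda>s. x + s *\<^sub>R axis j 1) has_derivative (\<lambda>h. h *\<^sub>R axis j 1)) (at s)"
    by (auto intro!: derivative_eq_intros)
  from has_derivative_compose[OF this eta_deriv]
  have "((\<lambda>s. \<eta> (x + s *\<^sub>R axis j 1)) has_derivative
      (\<lambda>h. \<Sum>i\<in>UNIV. (h *\<^sub>R axis j 1) $ i * K i (x + s *\<^sub>R axis j 1))) (at s)" .
  moreover have "(\<Sum>i\<in>UNIV. (h *\<^sub>R axis j 1) $ i * K i z) = K j z * h" for h z
    by (simp add: axis_def if_distrib[of "\<lambda>c. c * _"] if_distrib[of "\<lambda>c. _ * c"] cong: if_cong)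
  ultimately show ?thesis by (simp add: has_field_derivative_def)
qed

lemma K_integral: "(\<integral>x. K j x \<partial>torus) = 0"
  by (rule torus_integral_derivative_continuous[of \<eta> _ "axis j 1"])
    (use kernel_eta kernel_K in \<open>auto simp: kernel_fun_def intro: eta_line_deriv\<close>)

lemma conv_eta_integral: "integrable torus f \<Longrightarrow> (\<integral>x. conv \<eta> f x \<partial>torus) = (\<integral>y. f y \<partial>torus)"
  by (simp add: conv_integral[OF kernel_eta] eta_integral)

lemma conv_K_integral: "integrable torus f \<Longrightarrow> (\<integral>x. conv (K j) f x \<partial>torus) = 0"
  by (simp add: conv_integral[OF kernel_K] K_integral)

lemma conv_eta_deriv:
  "integrable torus f \<Longrightarrow> ((\<lambda>s. conv \<eta> f (x + s *\<^sub>R axis j 1)) has_real_derivative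
     conv (K j) f (x + s *\<^sub>R axis j 1)) (at s)"
  by (rule conv_has_derivative[OF kernel_eta kernel_K _ eta_line_deriv])

lemma conv_eta_const: "conv \<eta> (\<lambda>_. a) x = a"
proof -
  have "(\<integral>y. \<eta> (x - y) \<partial>torus) = (\<integral>y. \<eta> (y + (- x)) \<partial>torus)"
    by (metis (no_types, opaque_lifting) add.commute eta_minus minus_diff_eq uminus_add_conv_diff)
  also have "\<dots> = 1"
    using kernel_eta by (subst torus_integral_shift) (auto simp: kernel_fun_def eta_integral torus_integrable_continuous)
  finally show ?thesis by (simp add: conv_def)
qed

end

section \<open>The energy flux at a fixed time\<close>

lemma borel_measurable_component [measurable (raw)]:
  fixes f :: "'a \<Rightarrow> real^'n"
  assumes "f \<in> borel_measurable M"
  shows "(\<lambda>x. f x $ i) \<in> borel_measurable M"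
  by (rule borel_measurable_continuous_on[OF _ assms]) (intro continuous_intros)

text \<open>The centre \<open>a\<close> does not depend on \<open>y\<close>, so it may be chosen
  afterwards as a function of \<open>x\<close>. In this way moments about the Favre velocity become
  combinations of plain convolutions, which are continuous in \<open>x\<close>.\<close>

lemma conv_square_expand:
  fixes u :: "real^'n \<Rightarrow> real^'n"
  assumes k: "kernel_fun k" and "integrable torus \<rho>" "\<And>i. integrable torus (\<lambda>y. \<rho> y * u y $ i)"
    "integrable torus (\<lambda>y. \<rho> y * (norm (u y))\<^sup>2)"
  shows "conv k (\<lambda>y. \<rho> y * (norm (u y - a))\<^sup>2) x =
    conv k (\<lambda>y. \<rho> y * (norm (u y))\<^sup>2) x - 2 * (\<Sum>i\<in>UNIV. a $ i * conv k (\<lambda>y. \<rho> y * u y $ i) x)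
      + (norm a)\<^sup>2 * conv k \<rho> x"
proof -
  have "\<rho> y * (norm (u y - a))\<^sup>2 = (\<rho> y * (norm (u y))\<^sup>2 - (\<Sum>i\<in>UNIV. (2 * a $ i) * (\<rho> y * u y $ i)))
      + (norm a)\<^sup>2 * \<rho> y" for y
  proof -
    have "(norm (u y - a))\<^sup>2 = (norm (u y))\<^sup>2 - 2 * (\<Sum>i\<in>UNIV. a $ i * u y $ i) + (norm a)\<^sup>2"
      by (simp add: power2_norm_eq_inner inner_diff inner_commute[of "u y" a])
        (simp add: inner_vec_def)
    then show ?thesis by (simp only:) (simp add: algebra_simps sum_distrib_left)
  qed
  then have "conv k (\<lambda>y. \<rho> y * (norm (u y - a))\<^sup>2) x =
      conv k (\<lambda>y. (\<rho> y * (norm (u y))\<^sup>2 - (\<Sum>i\<in>UNIV. (2 * a $ i) * (\<rho> y * u y $ i)))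
      + (norm a)\<^sup>2 * \<rho> y) x" by simp
  also have "\<dots> = conv k (\<lambda>y. \<rho> y * (norm (u y))\<^sup>2) x - (\<Sum>i\<in>UNIV. (2 * a $ i) * conv k (\<lambda>y. \<rho> y * u y $ i) x)
      + (norm a)\<^sup>2 * conv k \<rho> x"
    using assms by (subst conv_add conv_diff conv_sum conv_cmult;
        (intro Bochner_Integration.integrable_diff Bochner_Integration.integrable_sum integrable_mult_right assms | simp add: conv_cmult))+
  finally show ?thesis by (simp add: sum_distrib_left mult.assoc)
qed

text \<open>This is \<open>conv_square_expand\<close> with the signed weight
  \<open>\<rho> y * u y $ j\<close>. The part multiplied by \<open>a $ j\<close> is left as an
  unexpanded second moment, since that moment is later recognised as a derivative.\<close>

lemma conv_cubic_expand:
  fixes u :: "real^'n \<Rightarrow> real^'n"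
  assumes k: "kernel_fun k" and int: "integrable torus \<rho>" "\<And>i. integrable torus (\<lambda>y. \<rho> y * u y $ i)"
    "integrable torus (\<lambda>y. \<rho> y * (norm (u y))\<^sup>2)" "\<And>i. integrable torus (\<lambda>y. \<rho> y * u y $ i * u y $ j)"
    "integrable torus (\<lambda>y. \<rho> y * u y $ j * (norm (u y))\<^sup>2)"
  shows "conv k (\<lambda>y. \<rho> y * (u y $ j - a $ j) * (norm (u y - a))\<^sup>2) x =
    conv k (\<lambda>y. \<rho> y * u y $ j * (norm (u y))\<^sup>2) x
      - 2 * (\<Sum>i\<in>UNIV. a $ i * conv k (\<lambda>y. \<rho> y * u y $ i * u y $ j) x)
      + (norm a)\<^sup>2 * conv k (\<lambda>y. \<rho> y * u y $ j) x - a $ j * conv k (\<lambda>y. \<rho> y * (norm (u y - a))\<^sup>2) x"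
proof -
  let ?\<sigma> = "\<lambda>y. \<rho> y * u y $ j"
  have eq: "?\<sigma> y * u y $ i = \<rho> y * u y $ i * u y $ j" for y i by simp
  have int': "integrable torus (\<lambda>y. ?\<sigma> y * (norm (u y - a))\<^sup>2)" "integrable torus (\<lambda>y. \<rho> y * (norm (u y - a))\<^sup>2)"
  proof -
    have sq: "(norm (u y - a))\<^sup>2 = (norm (u y))\<^sup>2 - (\<Sum>i\<in>UNIV. 2 * a $ i * u y $ i) + (norm a)\<^sup>2" for y
      by (simp add: power2_norm_eq_inner inner_diff inner_commute[of "u y" a])
        (simp add: inner_vec_def sum_distrib_left mult.assoc)
    have "integrable torus (\<lambda>y. \<sigma> y * (norm (u y - a))\<^sup>2)"
      if "integrable torus \<sigma>" "integrable torus (\<lambda>y. \<sigma> y * (norm (u y))\<^sup>2)" "\<And>i. integrable torus (\<lambda>y. \<sigma> y * u y $ i)" for \<sigma>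
    proof -
      have "\<sigma> y * (norm (u y - a))\<^sup>2 = \<sigma> y * (norm (u y))\<^sup>2 - (\<Sum>i\<in>UNIV. (2 * a $ i) * (\<sigma> y * u y $ i)) + (norm a)\<^sup>2 * \<sigma> y" for y
        by (simp add: sq algebra_simps sum_distrib_left)
      then show ?thesis using that by simp
    qed
    from this[of ?\<sigma>] this[of \<rho>] show "integrable torus (\<lambda>y. ?\<sigma> y * (norm (u y - a))\<^sup>2)" "integrable torus (\<lambda>y. \<rho> y * (norm (u y - a))\<^sup>2)"
      using int by (simp_all add: eq)
  qed
  have "conv k (\<lambda>y. \<rho> y * (u y $ j - a $ j) * (norm (u y - a))\<^sup>2) x
    = conv k (\<lambda>y. ?\<sigma> y * (norm (u y - a))\<^sup>2 - a $ j * (\<rho> y * (norm (u y - a))\<^sup>2)) x"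
    by (simp add: algebra_simps)
  also have "\<dots> = conv k (\<lambda>y. ?\<sigma> y * (norm (u y - a))\<^sup>2) x - a $ j * conv k (\<lambda>y. \<rho> y * (norm (u y - a))\<^sup>2) x"
    using int' by (subst conv_diff[OF k]) (auto simp: conv_cmult)
  also have "conv k (\<lambda>y. ?\<sigma> y * (norm (u y - a))\<^sup>2) x = conv k (\<lambda>y. ?\<sigma> y * (norm (u y))\<^sup>2) x
      - 2 * (\<Sum>i\<in>UNIV. a $ i * conv k (\<lambda>y. ?\<sigma> y * u y $ i) x) + (norm a)\<^sup>2 * conv k ?\<sigma> x"
    by (rule conv_square_expand) (use k int in \<open>simp_all add: eq\<close>)
  finally show ?thesis by (simp add: eq)
qed

definition favre :: "(real^'n \<Rightarrow> real) \<Rightarrow> (real^'n \<Rightarrow> real) \<Rightarrow> (real^'n \<Rightarrow> real^'n) \<Rightarrow> real^'n \<Rightarrow> real^'n" where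
  "favre \<eta> \<rho> u x = (\<chi> i. conv \<eta> (\<lambda>y. \<rho> y * u y $ i) x / conv \<eta> \<rho> x)"

text \<open>The time derivative of \<open>|m|\<^sup>2 / r\<close> for the mollified momentum \<open>m\<close> and density \<open>r\<close>,
  computed from the mollified equations.\<close>

definition energy_flux :: "(real^'n \<Rightarrow> real) \<Rightarrow> ('n \<Rightarrow> real^'n \<Rightarrow> real) \<Rightarrow> (real^'n \<Rightarrow> real) \<Rightarrow>
    (real^'n \<Rightarrow> real^'n) \<Rightarrow> (real^'n \<Rightarrow> real) \<Rightarrow> real^'n \<Rightarrow> real" where
  "energy_flux \<eta> K \<rho> u P x =
     (\<Sum>i\<in>UNIV. 2 * favre \<eta> \<rho> u x $ i *
        (- (\<Sum>j\<in>UNIV. conv (K j) (\<lambda>y. \<rho> y * u y $ i * u y $ j) x) - conv (K i) P x))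
     + (norm (favre \<eta> \<rho> u x))\<^sup>2 * (\<Sum>j\<in>UNIV. conv (K j) (\<lambda>y. \<rho> y * u y $ j) x)"

text \<open>A single time slice. The density bounds are asked at every point, which a truncated
  Borel version of the density satisfies.\<close>

locale torus_state = mollifier \<kappa> C \<eta> K
  for \<kappa> C :: real and \<eta> :: "real^'n \<Rightarrow> real" and K :: "'n \<Rightarrow> real^'n \<Rightarrow> real" +
  fixes \<rho> :: "real^'n \<Rightarrow> real" and u :: "real^'n \<Rightarrow> real^'n" and P :: "real^'n \<Rightarrow> real" and c :: real
  assumes c1: "1 \<le> c"
    and rho_meas [measurable]: "\<rho> \<in> borel_measurable borel"
    and u_meas [measurable]: "u \<in> borel_measurable borel"
    and P_meas [measurable]: "P \<in> borel_measurable borel"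
    and rho_ge: "1 / c \<le> \<rho> y" and rho_le: "\<rho> y \<le> c"
    and u3: "integrable torus (\<lambda>y. norm (u y) ^ 3)"
    and P32: "integrable torus (\<lambda>y. \<bar>P y\<bar> powr (3/2))"
begin

lemma rho_pos: "0 < \<rho> y"
  using rho_ge[of y] c1 by (smt (verit) divide_pos_pos)

text \<open>Every moment that occurs has degree at most three in \<open>u\<close>, hence lies below
  a multiple of 1 + |u|^3, which is integrable on a probability space.\<close>

lemma integrable_le_cube:
  assumes "f \<in> borel_measurable borel" "\<And>y. \<bar>f y\<bar> \<le> A * (1 + norm (u y) ^ 3)"
  shows "integrable torus f"
proof (rule Bochner_Integration.integrable_bound[of _ "\<lambda>y. A * (1 + norm (u y) ^ 3)"])
  show "integrable torus (\<lambda>y. A * (1 + norm (u y) ^ 3))"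
    using u3 by simp
  show "AE y in torus. norm (f y) \<le> norm (A * (1 + norm (u y) ^ 3))"
    using assms(2) by (intro AE_I2) (metis abs_ge_self order_trans real_norm_def)
qed (use assms in simp)

lemma pow_le_cube: "0 \<le> (t::real) \<Longrightarrow> t \<le> 1 + t ^ 3" "0 \<le> t \<Longrightarrow> t\<^sup>2 \<le> 1 + t ^ 3"
proof -
  assume t: "0 \<le> t"
  consider "t \<le> 1" | "1 < t" by linarith
  then have "t \<le> 1 + t ^ 3 \<and> t\<^sup>2 \<le> 1 + t ^ 3"
  proof cases
    case 1
    then show ?thesis using t power_le_one[of t 2] by (smt (verit) zero_le_power)
  next
    case 2
    then have "t \<le> t ^ 3" "t ^ 2 \<le> t ^ 3" by (auto intro!: power_increasing self_le_power)
    then show ?thesis by simp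
  qed
  then show "t \<le> 1 + t ^ 3" "t\<^sup>2 \<le> 1 + t ^ 3" by auto
qed

lemma
  shows int_rho: "integrable torus \<rho>"
    and int_u: "integrable torus (\<lambda>y. u y $ i)"
    and int_rho_u: "integrable torus (\<lambda>y. \<rho> y * u y $ i)"
    and int_rho_uu: "integrable torus (\<lambda>y. \<rho> y * u y $ i * u y $ j)"
    and int_rho_sq: "integrable torus (\<lambda>y. \<rho> y * (norm (u y))\<^sup>2)"
    and int_rho_u_sq: "integrable torus (\<lambda>y. \<rho> y * u y $ j * (norm (u y))\<^sup>2)"
proof -
  have rc: "\<bar>\<rho> y\<bar> \<le> c" for y using rho_pos[of y] rho_le[of y] by simp
  have ui: "\<bar>u y $ i\<bar> \<le> norm (u y)" for y i by (rule component_le_norm_cart)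
  have c0: "0 \<le> c" using c1 by simp
  show "integrable torus \<rho>"
  proof (rule integrable_le_cube[where A=c])
    show "\<bar>\<rho> y\<bar> \<le> c * (1 + norm (u y) ^ 3)" for y
      using rc[of y] mult_left_mono[OF _ c0, of 1 "1 + norm (u y) ^ 3"] by simp
  qed simp
  show "integrable torus (\<lambda>y. u y $ i)"
  proof (rule integrable_le_cube[where A=1])
    show "\<bar>u y $ i\<bar> \<le> 1 * (1 + norm (u y) ^ 3)" for y
      using order_trans[OF ui pow_le_cube(1)[OF norm_ge_zero]] by simp
  qed simp
  show "integrable torus (\<lambda>y. \<rho> y * u y $ i)"
    by (rule integrable_le_cube[where A=c])
      (use rc c0 order_trans[OF ui pow_le_cube(1)[OF norm_ge_zero]] in \<open>auto simp: abs_mult intro!: mult_mono\<close>)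
  show "integrable torus (\<lambda>y. \<rho> y * u y $ i * u y $ j)"
  proof (rule integrable_le_cube[where A=c])
    fix y
    have "\<bar>u y $ i\<bar> * \<bar>u y $ j\<bar> \<le> norm (u y) * norm (u y)" by (intro mult_mono ui) auto
    also have "\<dots> \<le> 1 + norm (u y) ^ 3" using pow_le_cube(2)[OF norm_ge_zero, of "u y"] by (simp add: power2_eq_square)
    finally show "\<bar>\<rho> y * u y $ i * u y $ j\<bar> \<le> c * (1 + norm (u y) ^ 3)"
      unfolding abs_mult mult.assoc using rc c0 by (intro mult_mono) auto
  qed auto
  show "integrable torus (\<lambda>y. \<rho> y * (norm (u y))\<^sup>2)"
    by (rule integrable_le_cube[where A=c])
      (use rc c0 pow_le_cube(2)[OF norm_ge_zero] in \<open>auto simp: abs_mult intro!: mult_mono\<close>)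
  show "integrable torus (\<lambda>y. \<rho> y * u y $ j * (norm (u y))\<^sup>2)"
  proof (rule integrable_le_cube[where A=c])
    fix y
    have "\<bar>u y $ j\<bar> * (norm (u y))\<^sup>2 \<le> norm (u y) * (norm (u y))\<^sup>2" by (intro mult_right_mono ui) auto
    also have "\<dots> \<le> 1 + norm (u y) ^ 3" by (simp add: power2_eq_square power3_eq_cube)
    finally show "\<bar>\<rho> y * u y $ j * (norm (u y))\<^sup>2\<bar> \<le> c * (1 + norm (u y) ^ 3)"
      unfolding abs_mult mult.assoc using rc c0 by (intro mult_mono) auto
  qed auto
qed

lemma int_P: "integrable torus P"
proof (rule Bochner_Integration.integrable_bound[of _ "\<lambda>y. 1 + \<bar>P y\<bar> powr (3/2)"])
  show "integrable torus (\<lambda>y. 1 + \<bar>P y\<bar> powr (3/2))" using P32 by simp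
  have "\<bar>P y\<bar> \<le> 1 + \<bar>P y\<bar> powr (3/2)" for y
  proof (cases "\<bar>P y\<bar> \<le> 1")
    case False
    then have "\<bar>P y\<bar> powr 1 \<le> \<bar>P y\<bar> powr (3/2)" by (intro powr_mono) auto
    then show ?thesis using False by simp
  qed (smt (verit) powr_ge_zero)
  then show "AE y in torus. norm (P y) \<le> norm (1 + \<bar>P y\<bar> powr (3/2))" by simp
qed simp

abbreviation "v \<equiv> favre \<eta> \<rho> u"
abbreviation "re \<equiv> conv \<eta> \<rho>"
abbreviation "ue j \<equiv> conv \<eta> (\<lambda>y. u y $ j)"

lemma re_ge: "1 / c \<le> re x"
  using conv_mono[OF kernel_eta, of "\<lambda>_. 1 / c" \<rho> x] eta_nonneg rho_ge int_rho
  by (simp add: conv_eta_const)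

lemma re_pos: "0 < re x"
  using re_ge[of x] c1 by (smt (verit) divide_pos_pos)

lemma v_re: "v x $ i * re x = conv \<eta> (\<lambda>y. \<rho> y * u y $ i) x"
  using re_pos[of x] by (simp add: favre_def)

lemma v_continuous: "continuous_on UNIV (\<lambda>x. v x $ i)"
  unfolding favre_def using re_pos
  by (simp add: less_imp_neq[symmetric] continuous_on_divide conv_continuous kernel_eta int_rho int_rho_u)

lemma v_periodic: "periodic_x v"
  using conv_periodic[OF kernel_eta] by (simp add: favre_def[abs_def] periodic_x_def)

abbreviation "dens j x \<equiv> conv (K j) (\<lambda>y. \<rho> y * (norm (u y - v x))\<^sup>2) x"

lemma dens_expand: "dens j x = conv (K j) (\<lambda>y. \<rho> y * (norm (u y))\<^sup>2) x
   - 2 * (\<Sum>i\<in>UNIV. v x $ i * conv (K j) (\<lambda>y. \<rho> y * u y $ i) x) + (norm (v x))\<^sup>2 * conv (K j) \<rho> x"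
  by (rule conv_square_expand[OF kernel_K int_rho int_rho_u int_rho_sq])

lemma norm_v_sq: "(norm (v x))\<^sup>2 = (\<Sum>i\<in>UNIV. (v x $ i)\<^sup>2)"
  by (simp add: power2_norm_eq_inner inner_vec_def) (simp add: power2_eq_square)

lemma norm_v_sq_continuous: "continuous_on UNIV (\<lambda>x. (norm (v x))\<^sup>2)"
  unfolding norm_v_sq by (intro continuous_intros v_continuous)

text \<open>Summing the expanded third central moments over \<open>j\<close> reproduces the flux up
  to the terms \<open>v * dens\<close>, the pressure, and the kinetic flux of
  \<open>\<rho> u |u|^2\<close>. Writing \<open>v\<close> as \<open>(v - ue) + ue\<close> then
  isolates a part that has mean zero when \<open>ue\<close> is divergence free.\<close>

lemma energy_flux_eq:
  "energy_flux \<eta> K \<rho> u P x =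
     (\<Sum>j\<in>UNIV. conv (K j) (\<lambda>y. \<rho> y * (u y $ j - v x $ j) * (norm (u y - v x))\<^sup>2) x)
   + (\<Sum>j\<in>UNIV. (v x $ j - ue j x) * (dens j x - 2 * conv (K j) P x))
   + (\<Sum>j\<in>UNIV. ue j x * (dens j x - 2 * conv (K j) P x))
   - (\<Sum>j\<in>UNIV. conv (K j) (\<lambda>y. \<rho> y * u y $ j * (norm (u y))\<^sup>2) x)"
proof -
  let ?m = "\<lambda>i j. conv (K j) (\<lambda>y. \<rho> y * u y $ i * u y $ j) x"
  have "energy_flux \<eta> K \<rho> u P x = (\<Sum>i\<in>UNIV. \<Sum>j\<in>UNIV. - 2 * (v x $ i * ?m i j))
      + (\<Sum>j\<in>UNIV. (norm (v x))\<^sup>2 * conv (K j) (\<lambda>y. \<rho> y * u y $ j) x - 2 * v x $ j * conv (K j) P x)"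
    unfolding energy_flux_def
    by (simp add: right_diff_distrib sum_subtractf sum_negf sum_distrib_left mult.assoc)
  also have "(\<Sum>i\<in>UNIV. \<Sum>j\<in>UNIV. - 2 * (v x $ i * ?m i j)) = (\<Sum>j\<in>UNIV. \<Sum>i\<in>UNIV. - 2 * (v x $ i * ?m i j))"
    by (rule sum.swap)
  also have "\<dots> = (\<Sum>j\<in>UNIV. - 2 * (\<Sum>i\<in>UNIV. v x $ i * ?m i j))"
    by (simp add: sum_distrib_left)
  finally show ?thesis
    unfolding conv_cubic_expand[OF kernel_K int_rho int_rho_u int_rho_sq int_rho_uu int_rho_u_sq]
    by (simp add: sum.distrib[symmetric] sum_subtractf[symmetric])
      (rule sum.cong, simp, simp add: algebra_simps)
qed

text \<open>What survives integration over the torus: the third central moment, and the transport by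
  \<open>v - ue\<close>, which is small through the regularity of the density.\<close>

definition flux_rest :: "real^'n \<Rightarrow> real" where
  "flux_rest x = (\<Sum>j\<in>UNIV. conv (K j) (\<lambda>y. \<rho> y * (u y $ j - v x $ j) * (norm (u y - v x))\<^sup>2) x)
   + (\<Sum>j\<in>UNIV. (v x $ j - ue j x) * (dens j x - 2 * conv (K j) P x))"

lemma dens_kernel_fun: "kernel_fun (dens j)"
  unfolding kernel_fun_def
proof
  show "continuous_on UNIV (dens j)"
    unfolding dens_expand
    by (intro continuous_intros norm_v_sq_continuous v_continuous conv_continuous kernel_K int_rho int_rho_u int_rho_sq)
  show "periodic_x (dens j)"
    unfolding dens_expand using v_periodic conv_periodic[OF kernel_K]
    by (simp add: periodic_x_def)
qed

lemma flux_rest_kernel_fun: "kernel_fun flux_rest"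
  unfolding kernel_fun_def
proof
  show "continuous_on UNIV flux_rest"
    unfolding flux_rest_def conv_cubic_expand[OF kernel_K int_rho int_rho_u int_rho_sq int_rho_uu int_rho_u_sq]
    using dens_kernel_fun
    by (intro continuous_intros norm_v_sq_continuous v_continuous conv_continuous kernel_K kernel_eta int_rho int_u
        int_rho_u int_rho_sq int_rho_uu int_rho_u_sq int_P) (auto simp: kernel_fun_def)
  show "periodic_x flux_rest"
    unfolding flux_rest_def conv_cubic_expand[OF kernel_K int_rho int_rho_u int_rho_sq int_rho_uu int_rho_u_sq]
    using v_periodic conv_periodic[OF kernel_K] conv_periodic[OF kernel_eta] dens_kernel_fun
    by (simp add: periodic_x_def kernel_fun_def)
qed

text \<open>The trace of the subgrid stress: by \<open>trace_energy_eq\<close> it is the second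
  central moment of \<open>u\<close> about \<open>v\<close>. The present form, built from plain
  convolutions, is the one that can be differentiated.\<close>

definition "trace_energy x = conv \<eta> (\<lambda>y. \<rho> y * (norm (u y))\<^sup>2) x - (\<Sum>i\<in>UNIV. (conv \<eta> (\<lambda>y. \<rho> y * u y $ i) x)\<^sup>2 / re x)"

text \<open>\<open>dens\<close> differentiates only the kernel and keeps the centre
  \<open>v x\<close> frozen. It is nevertheless the full derivative: the first moment about
  \<open>v\<close> vanishes, so moving the centre contributes nothing to first order.\<close>

lemma trace_energy_deriv:
  "((\<lambda>s. trace_energy (x + s *\<^sub>R axis j 1)) has_real_derivative dens j (x + s *\<^sub>R axis j 1)) (at s)"
proof -
  let ?z = "x + s *\<^sub>R axis j 1"
  let ?m = "\<lambda>i. conv \<eta> (\<lambda>y. \<rho> y * u y $ i)" and ?m' = "\<lambda>i. conv (K j) (\<lambda>y. \<rho> y * u y $ i)"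
  have q: "((\<lambda>s. (?m i (x + s *\<^sub>R axis j 1))\<^sup>2 / re (x + s *\<^sub>R axis j 1)) has_real_derivative
     (2 * v ?z $ i * ?m' i ?z - (v ?z $ i)\<^sup>2 * conv (K j) \<rho> ?z)) (at s)" for i
    using conv_eta_deriv[OF int_rho_u[of i], of x j s] conv_eta_deriv[OF int_rho, of x j s] re_pos[of ?z]
    by (auto intro!: derivative_eq_intros simp: favre_def power2_eq_square field_simps)
  have "((\<lambda>s. trace_energy (x + s *\<^sub>R axis j 1)) has_real_derivative
     conv (K j) (\<lambda>y. \<rho> y * (norm (u y))\<^sup>2) ?z - (\<Sum>i\<in>UNIV. 2 * v ?z $ i * ?m' i ?z - (v ?z $ i)\<^sup>2 * conv (K j) \<rho> ?z)) (at s)"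
    unfolding trace_energy_def by (intro DERIV_diff DERIV_sum conv_eta_deriv q int_rho_sq)
  then show ?thesis
    by (rule DERIV_cong)
      (simp add: dens_expand norm_v_sq sum_subtractf sum_distrib_left sum_distrib_right mult.assoc)
qed

lemma trace_energy_kernel_fun: "kernel_fun trace_energy"
  unfolding kernel_fun_def
proof
  show "continuous_on UNIV trace_energy"
    unfolding trace_energy_def using re_pos
    by (intro continuous_intros conv_continuous kernel_eta int_rho int_rho_u int_rho_sq) (auto simp: less_imp_neq[symmetric])
  show "periodic_x trace_energy"
    using conv_periodic[OF kernel_eta] by (simp add: periodic_x_def trace_energy_def)
qed

text \<open>The integrand is the divergence of the field \<open>ue\<close> times
  \<open>trace_energy - 2 * conv \<eta> P\<close>, because the other half of the product rule
  contains the divergence of \<open>ue\<close>.\<close>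

lemma transport_mean_zero:
  assumes div_free: "\<And>x. (\<Sum>j\<in>UNIV. conv (K j) (\<lambda>y. u y $ j) x) = 0"
  shows "(\<integral>x. (\<Sum>j\<in>UNIV. ue j x * (dens j x - 2 * conv (K j) P x)) \<partial>torus) = 0"
proof -
  let ?e = "\<lambda>x. trace_energy x - 2 * conv \<eta> P x"
  define F where "F j x = ue j x * ?e x" for j x
  define F' where "F' j x = conv (K j) (\<lambda>y. u y $ j) x * ?e x + ue j x * (dens j x - 2 * conv (K j) P x)" for j x
  have F: "kernel_fun (F j)" and F': "kernel_fun (F' j)" for j
    using kernel_fun_conv[OF kernel_eta int_u, of j] trace_energy_kernel_fun kernel_fun_conv[OF kernel_eta int_P]
      kernel_fun_conv[OF kernel_K int_u, of j j] dens_kernel_fun[of j] kernel_fun_conv[OF kernel_K int_P, of j]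
    unfolding kernel_fun_def F_def F'_def
    by (auto intro!: continuous_intros simp: periodic_x_def)
  have 0: "(\<integral>x. F' j x \<partial>torus) = 0" for j
  proof (rule torus_integral_derivative_continuous[of "F j" _ "axis j 1"])
    show "((\<lambda>s. F j (x + s *\<^sub>R axis j 1)) has_real_derivative F' j (x + s *\<^sub>R axis j 1)) (at s)" for x s
      unfolding F_def F'_def
      by (rule DERIV_cong[OF DERIV_mult[OF conv_eta_deriv[OF int_u]
              DERIV_diff[OF trace_energy_deriv DERIV_cmult[OF conv_eta_deriv[OF int_P]]]]]) simp
  qed (use F F' in \<open>auto simp: kernel_fun_def\<close>)
  have "(\<Sum>j\<in>UNIV. F' j x) = (\<Sum>j\<in>UNIV. ue j x * (dens j x - 2 * conv (K j) P x))" for x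
  proof -
    have "(\<Sum>j\<in>UNIV. F' j x) = (\<Sum>j\<in>UNIV. conv (K j) (\<lambda>y. u y $ j) x) * ?e x + (\<Sum>j\<in>UNIV. ue j x * (dens j x - 2 * conv (K j) P x))"
      unfolding F'_def by (simp only: sum.distrib sum_distrib_right)
    then show ?thesis by (simp add: div_free)
  qed
  then have "(\<integral>x. (\<Sum>j\<in>UNIV. ue j x * (dens j x - 2 * conv (K j) P x)) \<partial>torus) = (\<integral>x. (\<Sum>j\<in>UNIV. F' j x) \<partial>torus)"
    by simp
  also have "\<dots> = (\<Sum>j\<in>UNIV. \<integral>x. F' j x \<partial>torus)"
    by (rule Bochner_Integration.integral_sum)
      (use F' in \<open>auto simp: kernel_fun_def intro: torus_integrable_continuous\<close>)
  finally show ?thesis by (simp add: 0)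
qed

lemma energy_flux_integral:
  assumes div_free: "\<And>x. (\<Sum>j\<in>UNIV. conv (K j) (\<lambda>y. u y $ j) x) = 0"
  shows "(\<integral>x. energy_flux \<eta> K \<rho> u P x \<partial>torus) = (\<integral>x. flux_rest x \<partial>torus)"
proof -
  let ?T = "\<lambda>x. \<Sum>j\<in>UNIV. ue j x * (dens j x - 2 * conv (K j) P x)"
  let ?Q = "\<lambda>x. \<Sum>j\<in>UNIV. conv (K j) (\<lambda>y. \<rho> y * u y $ j * (norm (u y))\<^sup>2) x"
  have int: "kernel_fun k \<Longrightarrow> integrable torus k" for k :: "real^'n \<Rightarrow> real"
    by (auto simp: kernel_fun_def intro: torus_integrable_continuous)
  have "kernel_fun ?T"
    using kernel_fun_conv[OF kernel_eta int_u] dens_kernel_fun kernel_fun_conv[OF kernel_K int_P]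
    unfolding kernel_fun_def by (auto intro!: continuous_intros simp: periodic_x_def)
  note T = int[OF this]
  have Qj: "integrable torus (conv (K j) (\<lambda>y. \<rho> y * u y $ j * (norm (u y))\<^sup>2))" for j
    by (intro int kernel_fun_conv kernel_K int_rho_u_sq)
  have Q: "integrable torus ?Q" by (intro Bochner_Integration.integrable_sum Qj)
  have Q0: "(\<integral>x. ?Q x \<partial>torus) = 0"
    by (subst Bochner_Integration.integral_sum) (auto intro: Qj simp: conv_K_integral int_rho_u_sq)
  have "energy_flux \<eta> K \<rho> u P x = flux_rest x + ?T x - ?Q x" for x
    unfolding energy_flux_eq flux_rest_def by simp
  then show ?thesis
    using T Q int[OF flux_rest_kernel_fun] by (simp add: transport_mean_zero[OF div_free] Q0)
qed

end

section \<open>Elementary inequalities\<close>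

lemma emeasure_torus_UNIV: "emeasure (torus :: (real^'n) measure) UNIV = 1"
  using torus.emeasure_space_1 by (simp only: space_torus)

lemma ennreal_lincomb:
  "0 \<le> a \<Longrightarrow> 0 \<le> x \<Longrightarrow> 0 \<le> b \<Longrightarrow> 0 \<le> y \<Longrightarrow>
    ennreal a * ennreal x + ennreal b * ennreal y = ennreal (a * x + b * y)"
  by (simp add: ennreal_mult)

lemma power3_add_le: "0 \<le> s \<Longrightarrow> 0 \<le> t \<Longrightarrow> (s + t) ^ 3 \<le> 4 * (s ^ 3 + t ^ 3)" for s t :: real
proof -
  assume "0 \<le> s" "0 \<le> t"
  then have "0 \<le> 3 * (s + t) * (s - t)\<^sup>2" by simp
  also have "3 * (s + t) * (s - t)\<^sup>2 = 4 * (s ^ 3 + t ^ 3) - (s + t) ^ 3"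
    by (simp add: power2_eq_square power3_eq_cube algebra_simps)
  finally show ?thesis by simp
qed

text \<open>The tangent of the cube at \<open>b\<close>; the difference factors as (a - b)^2 (a + 2
  b). Being linear in \<open>a\<close>, the left side can be averaged, which yields Jensen's
  inequality.\<close>

lemma cube_tangent: "0 \<le> a \<Longrightarrow> 0 \<le> b \<Longrightarrow> 3 * b\<^sup>2 * a - 2 * b ^ 3 \<le> a ^ 3" for a b :: real
proof -
  assume "0 \<le> a" "0 \<le> b"
  then have "0 \<le> (a - b)\<^sup>2 * (a + 2 * b)" by simp
  also have "(a - b)\<^sup>2 * (a + 2 * b) = a ^ 3 - (3 * b\<^sup>2 * a - 2 * b ^ 3)"
    by (simp add: power2_eq_square power3_eq_cube algebra_simps)
  finally show ?thesis by simp
qed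

lemma mult_power2_le_cubes: "0 \<le> a \<Longrightarrow> 0 \<le> b \<Longrightarrow> a * b\<^sup>2 \<le> a ^ 3 + b ^ 3" for a b :: real
proof (cases "a \<le> b")
  case True
  assume "0 \<le> a" "0 \<le> b"
  then show ?thesis using mult_right_mono[OF True, of "b\<^sup>2"] by (simp add: power2_eq_square power3_eq_cube add_increasing)
next
  case False
  assume "0 \<le> a" "0 \<le> b"
  then show ?thesis using False mult_left_mono[OF power_mono[of b a 2], of a]
    by (simp add: power2_eq_square power3_eq_cube add_increasing2)
qed

text \<open>The two cases are separated where \<open>b\<close> equals
  \<open>\<theta> * a\<^sup>2\<close>: below, the first term alone suffices, above, the second. The
  weight \<theta> is left free so that it can be adapted to the scale \<kappa>.\<close>

lemma young_3_32:
  fixes a b \<theta> :: real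
  assumes "0 \<le> a" "0 \<le> b" "0 < \<theta>"
  shows "a * b \<le> \<theta> * a ^ 3 + \<theta> powr (- 1/2) * b powr (3/2)"
proof (cases "b \<le> \<theta> * a\<^sup>2")
  case True
  have "a * b \<le> a * (\<theta> * a\<^sup>2)" using True assms by (intro mult_left_mono)
  also have "\<dots> = \<theta> * a ^ 3" by (simp add: power2_eq_square power3_eq_cube)
  finally show ?thesis by (simp add: add_increasing2)
next
  case False
  then have b: "0 < b" using assms by (smt (verit) mult_nonneg_nonneg zero_le_power2)
  have "a\<^sup>2 \<le> b / \<theta>" using False assms by (simp add: field_simps)
  then have "sqrt (a\<^sup>2) \<le> sqrt (b / \<theta>)" by (rule real_sqrt_le_mono)
  then have "a \<le> sqrt (b / \<theta>)" using assms by simp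
  also have "\<dots> = \<theta> powr (- 1/2) * b powr (1/2)"
    using assms b by (simp add: real_sqrt_divide powr_half_sqrt powr_minus field_simps)
  finally have "a * b \<le> \<theta> powr (- 1/2) * b powr (1/2) * b" using b by (intro mult_right_mono) auto
  also have "\<dots> = \<theta> powr (- 1/2) * b powr (3/2)"
    using b powr_add[of b "1/2" 1] by simp
  finally show ?thesis using assms by (simp add: add_increasing)
qed

text \<open>Read off from the recentring estimate \<open>dev3_le\<close>. Like
  \<open>flux_const\<close> it does not contain \<kappa>, so both may multiply quantities that
  vanish with \<kappa>.\<close>

definition dev_const :: "real \<Rightarrow> real \<Rightarrow> real \<Rightarrow> real" where
  "dev_const d C c = 4 * (1 + C * ((d * c\<^sup>2) ^ 3 * C))"

definition flux_const :: "real \<Rightarrow> real \<Rightarrow> real \<Rightarrow> real \<Rightarrow> real" where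
  "flux_const d C c M = d * (C * c) + 2 * d * (c * M * C * C) * (c * C + C)"

section \<open>Estimates of the flux by increments of the velocity\<close>

context torus_state
begin

abbreviation "N \<equiv> box_kernel \<kappa> :: real^'n \<Rightarrow> real"

lemma N_nonneg: "0 \<le> N z"
  using kappa by (simp add: box_kernel_nonneg)

lemma N_bound: "\<bar>N z\<bar> \<le> 1 / \<kappa> ^ CARD('n)"
  using kappa by (simp add: box_kernel_def indicator_def)

lemma N_integrable: "integrable torus f \<Longrightarrow> integrable torus (\<lambda>y. N (x - y) * f y)"
proof -
  assume f: "integrable torus f"
  note [measurable] = borel_measurable_integrable[OF f]
  show ?thesis
  proof (rule Bochner_Integration.integrable_bound[of _ "\<lambda>y. 1 / \<kappa> ^ CARD('n) * f y"])
    show "AE y in torus. norm (N (x - y) * f y) \<le> norm (1 / \<kappa> ^ CARD('n) * f y)"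
      unfolding real_norm_def abs_mult
      by (intro AE_I2 mult_right_mono order_trans[OF N_bound abs_ge_self] abs_ge_zero)
  qed (use f in auto)
qed

lemma N_mono: "integrable torus f \<Longrightarrow> integrable torus g \<Longrightarrow> (\<And>y. f y \<le> g y) \<Longrightarrow> conv N f x \<le> conv N g x"
  unfolding conv_def by (intro integral_mono N_integrable mult_left_mono N_nonneg)

lemma N_conv_nonneg: "(\<And>y. 0 \<le> f y) \<Longrightarrow> 0 \<le> conv N f x"
  unfolding conv_def by (intro Bochner_Integration.integral_nonneg mult_nonneg_nonneg N_nonneg)

lemma N_add: "integrable torus f \<Longrightarrow> integrable torus g \<Longrightarrow> conv N (\<lambda>y. f y + g y) x = conv N f x + conv N g x"
  unfolding conv_def by (simp add: distrib_left N_integrable)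

lemma nn_integral_N: "(\<integral>\<^sup>+y. ennreal (N (x - y)) \<partial>torus) \<le> ennreal C" "(\<integral>\<^sup>+x. ennreal (N (x - y)) \<partial>torus) \<le> ennreal C"
proof -
  have *: "(\<integral>\<^sup>+x. ennreal (N (x + - y)) \<partial>torus) = (\<integral>\<^sup>+x. ennreal (N x) \<partial>torus)" for y
    using box_kernel_periodic[of \<kappa>, where 'a='n] by (intro nn_integral_torus_shift) (auto simp: periodic_x_def)
  show 1: "(\<integral>\<^sup>+x. ennreal (N (x - y)) \<partial>torus) \<le> ennreal C" for y
    using *[of y] box_integral by simp
  have "N (x - y) = N (y - x)" for y using box_kernel_minus[of \<kappa> "y - x"] by simp
  then show "(\<integral>\<^sup>+y. ennreal (N (x - y)) \<partial>torus) \<le> ennreal C" using 1[of x] by simp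
qed

lemma N_one: "conv N (\<lambda>_. 1) x \<le> C"
proof -
  have "integrable torus (\<lambda>y. N (x - y) * 1)" by (rule N_integrable) simp
  then have "ennreal (conv N (\<lambda>_. 1) x) = (\<integral>\<^sup>+y. ennreal (N (x - y)) \<partial>torus)"
    unfolding conv_def by (subst nn_integral_eq_integral) (auto simp: N_nonneg)
  then show ?thesis using nn_integral_N(1)[of x] C1 by (metis ennreal_le_iff order_trans zero_le_one)
qed

lemma N_const: "0 \<le> a \<Longrightarrow> conv N (\<lambda>_. a) x \<le> C * a"
  using conv_cmult[of N a "\<lambda>_. 1" x] mult_left_mono[OF N_one[of x], of a] by (simp add: mult.commute)

text \<open>The comparison is asked only for almost every \<open>y\<close> in the support of the
  kernel, because that is the form in which the Hoelder bound for the density is available.\<close>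

lemma conv_le_N:
  assumes k: "kernel_fun k" and A: "\<And>z. \<bar>k z\<bar> \<le> A * N z" "0 \<le> A" and f: "integrable torus f" and g: "integrable torus g"
    and le: "AE y in torus. N (x - y) \<noteq> 0 \<longrightarrow> \<bar>f y\<bar> \<le> g y"
  shows "\<bar>conv k f x\<bar> \<le> A * conv N g x"
proof -
  have "\<bar>conv k f x\<bar> \<le> (\<integral>y. \<bar>k (x - y) * f y\<bar> \<partial>torus)"
    unfolding conv_def using integral_norm_bound[of torus "\<lambda>y. k (x - y) * f y"] by simp
  also have "\<dots> \<le> (\<integral>y. A * (N (x - y) * g y) \<partial>torus)"
  proof (rule integral_mono_AE)
    show "AE y in torus. \<bar>k (x - y) * f y\<bar> \<le> A * (N (x - y) * g y)"
      using le
    proof (rule eventually_mono)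
      fix y assume y: "N (x - y) \<noteq> 0 \<longrightarrow> \<bar>f y\<bar> \<le> g y"
      show "\<bar>k (x - y) * f y\<bar> \<le> A * (N (x - y) * g y)"
      proof (cases "N (x - y) = 0")
        case True
        then show ?thesis using A(1)[of "x - y"] by simp
      next
        case False
        have "\<bar>k (x - y)\<bar> * \<bar>f y\<bar> \<le> (A * N (x - y)) * g y"
          using y False A(1)[of "x - y"] A(2) N_nonneg[of "x - y"] by (intro mult_mono) auto
        then show ?thesis by (simp add: abs_mult mult.assoc)
      qed
    qed
  qed (use conv_integrable[OF k f] N_integrable[OF g] in auto)
  finally show ?thesis by (simp add: conv_def)
qed

lemma eta_le_N: "\<bar>\<eta> z\<bar> \<le> C * N z"
  using eta_le eta_nonneg by simp

text \<open>Takes the place of Hoelder's inequality for products of averages: a Young inequality is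
  applied under the double average and integrated in one variable at a time. Each idle variable
  costs the mass of \<open>N\<close>, at most \<open>C\<close>.\<close>

lemma N_product:
  assumes int: "integrable torus f" "integrable torus g" "integrable torus F" "integrable torus G"
    and nn: "\<And>y. 0 \<le> f y" "\<And>y. 0 \<le> F y" "\<And>y. 0 \<le> G y"
    and le: "\<And>y z. f y * g z \<le> F y + G z"
  shows "conv N f x * conv N g x \<le> C * (conv N F x + conv N G x)"
proof -
  let ?n = "conv N (\<lambda>_. 1) x"
  have 1: "f y * conv N g x \<le> F y * ?n + conv N G x" for y
  proof -
    have "f y * conv N g x = conv N (\<lambda>z. f y * g z) x" by (simp add: conv_cmult)
    also have "\<dots> \<le> conv N (\<lambda>z. F y * 1 + G z) x"
      using int le by (intro N_mono) auto
    also have "\<dots> = F y * ?n + conv N G x"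
      using int by (subst N_add) (simp_all add: conv_cmult del: mult_1_right)
    finally show ?thesis .
  qed
  have "conv N f x * conv N g x = conv N (\<lambda>y. conv N g x * f y) x" by (subst conv_cmult) (rule mult.commute)
  also have "\<dots> \<le> conv N (\<lambda>y. ?n * F y + conv N G x * 1) x"
    using int 1 by (intro N_mono) (auto simp: mult.commute)
  also have "\<dots> = ?n * conv N F x + conv N G x * ?n"
    using int by (subst N_add) (simp_all add: conv_cmult del: mult_1_right)
  also have "\<dots> = ?n * (conv N F x + conv N G x)" by (simp add: algebra_simps)
  also have "\<dots> \<le> C * (conv N F x + conv N G x)"
    using N_one N_conv_nonneg nn by (intro mult_right_mono) auto
  finally show ?thesis .
qed

lemma int_dev:
  shows int_dev3: "integrable torus (\<lambda>y. norm (u y - a) ^ 3)"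
    and int_dev2: "integrable torus (\<lambda>y. (norm (u y - a))\<^sup>2)"
    and int_dev1: "integrable torus (\<lambda>y. norm (u y - a))"
proof -
  show 3: "integrable torus (\<lambda>y. norm (u y - a) ^ 3)"
  proof (rule integrable_le_cube[where A="4 * (1 + norm a ^ 3)"])
    fix y
    have "norm (u y - a) ^ 3 \<le> (norm (u y) + norm a) ^ 3"
      by (intro power_mono norm_triangle_ineq4) auto
    also have "\<dots> \<le> 4 * (norm (u y) ^ 3 + norm a ^ 3)" by (rule power3_add_le) auto
    also have "\<dots> \<le> 4 * (1 + norm a ^ 3) * (1 + norm (u y) ^ 3)"
      by (simp add: algebra_simps)
    finally show "\<bar>norm (u y - a) ^ 3\<bar> \<le> 4 * (1 + norm a ^ 3) * (1 + norm (u y) ^ 3)" by simp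
  qed simp
  have 4: "integrable torus (\<lambda>y. 1 + norm (u y - a) ^ 3)" using 3 by simp
  show "integrable torus (\<lambda>y. (norm (u y - a))\<^sup>2)" "integrable torus (\<lambda>y. norm (u y - a))"
    by (rule Bochner_Integration.integrable_bound[OF 4]; use pow_le_cube in auto)+
qed

lemma integrable_le_dev:
  fixes f g :: "real^'n \<Rightarrow> real"
  assumes "f \<in> borel_measurable borel" "integrable torus g" "\<And>y. \<bar>f y\<bar> \<le> A * g y"
  shows "integrable torus f"
  by (rule Bochner_Integration.integrable_bound[of _ "\<lambda>y. A * g y"])
    (use assms order_trans[OF assms(3) abs_ge_self] in auto)

text \<open>The tangent inequality at the mean value of \<open>f\<close>, averaged with the
  mollifier, which has mass one.\<close>

lemma eta_jensen_cube:
  assumes "integrable torus f" "integrable torus (\<lambda>y. f y ^ 3)" "\<And>y. 0 \<le> f y"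
  shows "(conv \<eta> f x) ^ 3 \<le> conv \<eta> (\<lambda>y. f y ^ 3) x"
proof -
  let ?b = "conv \<eta> f x"
  have b: "0 \<le> ?b"
    using conv_mono[OF kernel_eta, of "\<lambda>_. 0" f] assms eta_nonneg by (simp add: conv_eta_const)
  have "3 * ?b\<^sup>2 * ?b - 2 * ?b ^ 3 = conv \<eta> (\<lambda>y. 3 * ?b\<^sup>2 * f y - 2 * ?b ^ 3) x"
    using assms by (simp add: conv_diff[OF kernel_eta] conv_cmult conv_eta_const)
  also have "\<dots> \<le> conv \<eta> (\<lambda>y. f y ^ 3) x"
    using assms b eta_nonneg by (intro conv_mono[OF kernel_eta] cube_tangent) auto
  finally show ?thesis by (simp add: power2_eq_square power3_eq_cube)
qed

text \<open>\<open>v x - a\<close> is the average of \<open>\<rho> (u - a)\<close> divided by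
  \<open>re x\<close>. One factor \<open>c\<close> bounds \<rho>, the other bounds the reciprocal of
  \<open>re\<close>; the dimension comes from estimating the norm by the sum of the
  components.\<close>

lemma v_minus_u:
  "norm (v x - a) \<le> CARD('n) * c\<^sup>2 * conv \<eta> (\<lambda>y. norm (u y - a)) x"
proof -
  let ?n = "conv \<eta> (\<lambda>y. norm (u y - a)) x"
  have "\<bar>(v x - a) $ i\<bar> \<le> c\<^sup>2 * ?n" for i
  proof -
    have f: "integrable torus (\<lambda>y. \<rho> y * (u y $ i - a $ i))"
      using int_rho_u[of i] int_rho by (simp add: right_diff_distrib)
    have "(v x - a) $ i * re x = conv \<eta> (\<lambda>y. \<rho> y * u y $ i) x - conv \<eta> (\<lambda>y. a $ i * \<rho> y) x"
      by (simp add: left_diff_distrib v_re conv_cmult)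
    also have "\<dots> = conv \<eta> (\<lambda>y. \<rho> y * (u y $ i - a $ i)) x"
      using int_rho_u[of i] int_rho by (subst conv_diff[OF kernel_eta, symmetric]) (auto simp: algebra_simps)
    finally have eq: "(v x - a) $ i * re x = conv \<eta> (\<lambda>y. \<rho> y * (u y $ i - a $ i)) x" .
    have pt: "\<bar>\<rho> y * (u y $ i - a $ i)\<bar> \<le> c * norm (u y - a)" for y
      unfolding abs_mult using rho_pos[of y] rho_le[of y] component_le_norm_cart[of "u y - a" i]
      by (intro mult_mono) auto
    have "conv \<eta> (\<lambda>y. \<rho> y * (u y $ i - a $ i)) x \<le> conv \<eta> (\<lambda>y. c * norm (u y - a)) x"
      "conv \<eta> (\<lambda>y. - (c * norm (u y - a))) x \<le> conv \<eta> (\<lambda>y. \<rho> y * (u y $ i - a $ i)) x"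
      using pt int_dev1[of a] f by (intro conv_mono[OF kernel_eta] eta_nonneg; simp add: abs_le_iff minus_le_iff)+
    then have "\<bar>conv \<eta> (\<lambda>y. \<rho> y * (u y $ i - a $ i)) x\<bar> \<le> c * ?n"
      using conv_cmult[of \<eta> "-c"] by (simp add: conv_cmult abs_le_iff)
    then have "\<bar>(v x - a) $ i\<bar> * re x \<le> c * ?n"
      unfolding eq[symmetric] abs_mult using re_pos[of x] by simp
    moreover have "\<bar>(v x - a) $ i\<bar> \<le> c * (\<bar>(v x - a) $ i\<bar> * re x)"
      using mult_left_mono[OF re_ge[of x], of "c * \<bar>(v x - a) $ i\<bar>"] c1 by simp
    moreover have "c * (\<bar>(v x - a) $ i\<bar> * re x) \<le> c * (c * ?n)"
      using calculation(1) c1 by (intro mult_left_mono) auto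
    ultimately show ?thesis by (simp add: power2_eq_square mult.assoc)
  qed
  then have "(\<Sum>i\<in>UNIV. \<bar>(v x - a) $ i\<bar>) \<le> (\<Sum>i\<in>(UNIV :: 'n set). c\<^sup>2 * ?n)" by (intro sum_mono)
  then show ?thesis using norm_le_l1_cart[of "v x - a"] by simp
qed

definition "D3 x = conv N (\<lambda>y. norm (u y - u x) ^ 3) x"
abbreviation "dev p x \<equiv> conv N (\<lambda>y. norm (u y - v x) ^ p) x"

lemma dev_const_pos: "0 < dev_const CARD('n) C c"
  using c1 C1 by (simp add: dev_const_def add_pos_nonneg)

lemma D3_nonneg: "0 \<le> D3 x"
  unfolding D3_def by (rule N_conv_nonneg) simp

text \<open>The hypotheses control increments from \<open>u x\<close>, whereas the flux is centred
  at \<open>v x\<close>. The triangle inequality, \<open>v_minus_u\<close> and Jensen's inequality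
  change the centre at the cost of a constant.\<close>

lemma dev3_le: "dev 3 x \<le> dev_const CARD('n) C c * D3 x"
proof -
  let ?w = "norm (v x - u x)"
  have "?w ^ 3 \<le> (CARD('n) * c\<^sup>2 * conv \<eta> (\<lambda>y. norm (u y - u x)) x) ^ 3"
    by (intro power_mono v_minus_u) simp
  also have "\<dots> \<le> (CARD('n) * c\<^sup>2) ^ 3 * conv \<eta> (\<lambda>y. norm (u y - u x) ^ 3) x"
    unfolding power_mult_distrib[of _ "conv _ _ _"]
    by (intro mult_left_mono eta_jensen_cube int_dev1 int_dev3) auto
  also have "\<dots> \<le> (CARD('n) * c\<^sup>2) ^ 3 * (C * D3 x)"
    unfolding D3_def using C1 order_trans[OF abs_ge_self conv_le_N[OF kernel_eta eta_le_N]] int_dev3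
    by (intro mult_left_mono) auto
  finally have w: "?w ^ 3 \<le> (CARD('n) * c\<^sup>2) ^ 3 * (C * D3 x)" .
  have "dev 3 x \<le> conv N (\<lambda>y. 4 * norm (u y - u x) ^ 3 + 4 * ?w ^ 3) x"
  proof (rule N_mono)
    fix y
    have "norm (u y - v x) ^ 3 \<le> (norm (u y - u x) + ?w) ^ 3"
      using norm_triangle_ineq4[of "u y - u x" "v x - u x"] by (intro power_mono) auto
    also have "\<dots> \<le> 4 * (norm (u y - u x) ^ 3 + ?w ^ 3)" by (rule power3_add_le) auto
    finally show "norm (u y - v x) ^ 3 \<le> 4 * norm (u y - u x) ^ 3 + 4 * ?w ^ 3" by simp
  qed (use int_dev3 in auto)
  also have "\<dots> = 4 * D3 x + conv N (\<lambda>_. 4 * ?w ^ 3) x"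
    unfolding D3_def using int_dev3 by (subst N_add) (auto simp: conv_cmult)
  also have "\<dots> \<le> 4 * D3 x + C * (4 * ?w ^ 3)"
    using N_const[of "4 * ?w ^ 3"] by simp
  also have "\<dots> \<le> 4 * D3 x + C * (4 * ((CARD('n) * c\<^sup>2) ^ 3 * (C * D3 x)))"
    using w C1 by simp
  also have "\<dots> = dev_const CARD('n) C c * D3 x" by (simp add: dev_const_def algebra_simps)
  finally show ?thesis .
qed

text \<open>Average the product of \<open>\<rho> x - \<rho> y\<close> and \<open>u y - v x\<close>
  over \<open>y\<close>: the part with \<open>\<rho> y\<close> vanishes by the choice of
  \<open>v\<close>, and the part with \<open>\<rho> x\<close> is \<open>\<rho> x\<close> times
  \<open>ue - v\<close>. This gains one increment of the density.\<close>

lemma v_minus_ue: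
  assumes L: "AE y in torus. N (x - y) \<noteq> 0 \<longrightarrow> \<bar>\<rho> x - \<rho> y\<bar> \<le> L" "0 \<le> L"
  shows "\<bar>v x $ j - ue j x\<bar> \<le> c * L * C * dev 1 x"
proof -
  let ?f = "\<lambda>y. (\<rho> x - \<rho> y) * (u y $ j - v x $ j)"
  have f: "integrable torus ?f" and
    eq: "\<rho> x * (ue j x - v x $ j) = conv \<eta> ?f x"
  proof -
    have *: "?f = (\<lambda>y. (\<rho> x * u y $ j - \<rho> y * u y $ j) - (\<rho> x * v x $ j - v x $ j * \<rho> y))"
      by (simp add: fun_eq_iff algebra_simps)
    show "integrable torus ?f"
      unfolding * using int_u int_rho int_rho_u by simp
    show "\<rho> x * (ue j x - v x $ j) = conv \<eta> ?f x"
      unfolding * using int_u[of j] int_rho int_rho_u[of j]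
      by (simp add: conv_diff[OF kernel_eta] conv_cmult conv_eta_const v_re[symmetric])
        (simp add: algebra_simps)
  qed
  have "\<bar>conv \<eta> ?f x\<bar> \<le> C * conv N (\<lambda>y. L * norm (u y - v x) ^ 1) x"
  proof (rule conv_le_N[OF kernel_eta eta_le_N _ f])
    show "AE y in torus. N (x - y) \<noteq> 0 \<longrightarrow> \<bar>?f y\<bar> \<le> L * norm (u y - v x) ^ 1"
      using L(1)
    proof (rule eventually_mono, safe)
      fix y assume "\<bar>\<rho> x - \<rho> y\<bar> \<le> L"
      then show "\<bar>?f y\<bar> \<le> L * norm (u y - v x) ^ 1"
        unfolding abs_mult using L(2) component_le_norm_cart[of "u y - v x" j] by (intro mult_mono) auto
    qed
  qed (use int_dev1 C1 in auto)
  also have "\<dots> = C * L * dev 1 x" by (simp add: conv_cmult)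
  finally have "\<rho> x * \<bar>ue j x - v x $ j\<bar> \<le> C * L * dev 1 x"
    unfolding eq[symmetric] abs_mult using rho_pos[of x] by simp
  moreover have "\<bar>ue j x - v x $ j\<bar> \<le> c * (\<rho> x * \<bar>ue j x - v x $ j\<bar>)"
    using mult_left_mono[OF rho_ge[of x], of "c * \<bar>ue j x - v x $ j\<bar>"] c1 by (simp add: mult_ac)
  moreover have "c * (\<rho> x * \<bar>ue j x - v x $ j\<bar>) \<le> c * (C * L * dev 1 x)"
    using calculation(1) c1 by (intro mult_left_mono) auto
  ultimately have "\<bar>ue j x - v x $ j\<bar> \<le> c * (C * L * dev 1 x)" by linarith
  then show ?thesis by (simp only: abs_minus_commute mult_ac)
qed

text \<open>The third moment is bounded directly. In the other term \<open>v - ue\<close> meets a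
  second moment, where first times second moment is absorbed into the third, and the pressure, where
  Young's inequality with weight \<theta> applies.\<close>

lemma flux_rest_bound:
  assumes L: "AE y in torus. N (x - y) \<noteq> 0 \<longrightarrow> \<bar>\<rho> x - \<rho> y\<bar> \<le> L" "0 \<le> L" and \<theta>: "0 < \<theta>"
  shows "\<bar>flux_rest x\<bar> \<le> CARD('n) * (C / \<kappa> * c) * dev 3 x + CARD('n) * (c * L * C * (C / \<kappa>) *
     (2 * c * C * dev 3 x + 2 * C * (\<theta> * dev 3 x + \<theta> powr (- 1/2) * conv N (\<lambda>y. \<bar>P y\<bar> powr (3/2)) x)))"
proof -
  let ?p = "conv N (\<lambda>y. \<bar>P y\<bar> powr (3/2)) x"
  have CK: "0 \<le> C / \<kappa>" using C1 kappa by simp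
  have rc: "\<bar>\<rho> y\<bar> \<le> c" for y using rho_pos[of y] rho_le[of y] by simp
  have cub: "\<bar>conv (K j) (\<lambda>y. \<rho> y * (u y $ j - v x $ j) * (norm (u y - v x))\<^sup>2) x\<bar> \<le> C / \<kappa> * c * dev 3 x" for j
  proof -
    have pt: "\<bar>\<rho> y * (u y $ j - v x $ j) * (norm (u y - v x))\<^sup>2\<bar> \<le> c * norm (u y - v x) ^ 3" for y
    proof -
      have "\<bar>\<rho> y\<bar> * \<bar>(u y - v x) $ j\<bar> * (norm (u y - v x))\<^sup>2 \<le> c * norm (u y - v x) * (norm (u y - v x))\<^sup>2"
        using rc component_le_norm_cart[of "u y - v x" j] c1 by (intro mult_mono) auto
      then show ?thesis by (simp add: abs_mult power2_eq_square power3_eq_cube mult_ac)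
    qed
    have "\<bar>conv (K j) (\<lambda>y. \<rho> y * (u y $ j - v x $ j) * (norm (u y - v x))\<^sup>2) x\<bar> \<le> C / \<kappa> * conv N (\<lambda>y. c * norm (u y - v x) ^ 3) x"
      by (rule conv_le_N[OF kernel_K K_le CK integrable_le_dev[OF _ int_dev3 pt]]) (use pt int_dev3 in auto)
    then show ?thesis by (simp add: conv_cmult)
  qed
  have den: "\<bar>dens j x\<bar> \<le> C / \<kappa> * (c * dev 2 x)" for j
  proof -
    have pt: "\<bar>\<rho> y * (norm (u y - v x))\<^sup>2\<bar> \<le> c * (norm (u y - v x))\<^sup>2" for y
      unfolding abs_mult using rc c1 by (intro mult_mono) auto
    have "\<bar>dens j x\<bar> \<le> C / \<kappa> * conv N (\<lambda>y. c * (norm (u y - v x))\<^sup>2) x"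
      by (rule conv_le_N[OF kernel_K K_le CK integrable_le_dev[OF _ int_dev2 pt]]) (use pt int_dev2 in auto)
    then show ?thesis by (simp add: conv_cmult)
  qed
  have pr: "\<bar>conv (K j) P x\<bar> \<le> C / \<kappa> * conv N (\<lambda>y. \<bar>P y\<bar>) x" for j
    by (rule conv_le_N[OF kernel_K K_le CK]) (use int_P in auto)
  have d12: "dev 1 x * dev 2 x \<le> C * (dev 3 x + dev 3 x)"
    by (rule N_product) (use int_dev1 int_dev2 int_dev3 in \<open>auto intro: mult_power2_le_cubes\<close>)
  have d1p: "dev 1 x * conv N (\<lambda>y. \<bar>P y\<bar>) x \<le> C * (\<theta> * dev 3 x + \<theta> powr (- 1/2) * ?p)"
  proof -
    have "dev 1 x * conv N (\<lambda>y. \<bar>P y\<bar>) x \<le> C * (conv N (\<lambda>y. \<theta> * norm (u y - v x) ^ 3) x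
        + conv N (\<lambda>y. \<theta> powr (- 1/2) * \<bar>P y\<bar> powr (3/2)) x)"
      by (rule N_product) (use int_dev1 int_dev3 int_P P32 \<theta> young_3_32[OF _ _ \<theta>] in auto)
    then show ?thesis by (simp add: conv_cmult)
  qed
  have summand: "\<bar>(v x $ j - ue j x) * (dens j x - 2 * conv (K j) P x)\<bar> \<le> c * L * C * (C / \<kappa>) *
     (2 * c * C * dev 3 x + 2 * C * (\<theta> * dev 3 x + \<theta> powr (- 1/2) * ?p))" for j
  proof -
    have "\<bar>(v x $ j - ue j x) * (dens j x - 2 * conv (K j) P x)\<bar> \<le>
      (c * L * C * dev 1 x) * (C / \<kappa> * (c * dev 2 x) + 2 * (C / \<kappa> * conv N (\<lambda>y. \<bar>P y\<bar>) x))"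
      unfolding abs_mult
    proof (rule mult_mono)
      show "\<bar>dens j x - 2 * conv (K j) P x\<bar> \<le> C / \<kappa> * (c * dev 2 x) + 2 * (C / \<kappa> * conv N (\<lambda>y. \<bar>P y\<bar>) x)"
        using den[of j] pr[of j] by linarith
      show "0 \<le> c * L * C * dev 1 x" using c1 L C1 N_conv_nonneg by simp
    qed (use v_minus_ue[OF L] in auto)
    also have "\<dots> = c * L * C * (C / \<kappa>) * (c * (dev 1 x * dev 2 x) + 2 * (dev 1 x * conv N (\<lambda>y. \<bar>P y\<bar>) x))"
      by (simp add: algebra_simps)
    also have "\<dots> \<le> c * L * C * (C / \<kappa>) * (c * (C * (dev 3 x + dev 3 x)) + 2 * (C * (\<theta> * dev 3 x + \<theta> powr (- 1/2) * ?p)))"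
      using d12 d1p c1 L(2) C1 CK by (intro mult_left_mono add_mono mult_nonneg_nonneg) auto
    finally show ?thesis by (simp add: algebra_simps)
  qed
  have "\<bar>flux_rest x\<bar> \<le> (\<Sum>j\<in>(UNIV::'n set). C / \<kappa> * c * dev 3 x) + (\<Sum>j\<in>(UNIV::'n set). c * L * C * (C / \<kappa>) *
     (2 * c * C * dev 3 x + 2 * C * (\<theta> * dev 3 x + \<theta> powr (- 1/2) * ?p)))"
    unfolding flux_rest_def
    by (intro order_trans[OF abs_triangle_ineq] add_mono order_trans[OF sum_abs] sum_mono cub summand)
  then show ?thesis by simp
qed


lemma flux_rest_bound_scaled:
  assumes L: "AE y in torus. N (x - y) \<noteq> 0 \<longrightarrow> \<bar>\<rho> x - \<rho> y\<bar> \<le> M * \<kappa> powr (2/3)" and M: "0 \<le> M" and \<Lambda>: "0 < \<Lambda>"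
  shows "\<bar>flux_rest x\<bar> \<le> flux_const CARD('n) C c M * (1 + \<Lambda>) * dev_const CARD('n) C c / \<kappa> * D3 x + flux_const CARD('n) C c M * \<Lambda> powr (- 1/2) * conv N (\<lambda>y. \<bar>P y\<bar> powr (3/2)) x"
proof -
  let ?p = "conv N (\<lambda>y. \<bar>P y\<bar> powr (3/2)) x"
  \<comment> \<open>The weight balances Young's inequality: the cubes receive \<kappa> powr (2/3)
    \<theta> / \<kappa> = \<Lambda> / \<kappa>, the same order as the other cubic terms, and the
    coefficient of the pressure becomes \<Lambda> powr (-1/2), free of \<kappa>.\<close>
  define \<theta> where "\<theta> = \<Lambda> * \<kappa> powr (- 2/3)"
  have \<theta>: "0 < \<theta>" using \<Lambda> kappa by (simp add: \<theta>_def)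
  have p0: "0 \<le> ?p" "0 \<le> dev 3 x" by (intro N_conv_nonneg; simp)+
  define d where "d = real CARD('n)"
  define e where "e = d * c * M * C * C"
  have e0: "0 \<le> e" using c1 M C1 by (simp add: e_def d_def)
  have k1: "\<kappa> powr (2/3) \<le> 1" using kappa by (simp add: powr_le1)
  have k2: "\<kappa> powr (2/3) * \<theta> = \<Lambda>"
    using kappa by (simp add: \<theta>_def mult.left_commute flip: powr_add)
  have k3: "\<kappa> powr (2/3) / \<kappa> * \<theta> powr (- 1/2) = \<Lambda> powr (- 1/2)"
  proof -
    have "\<theta> powr (- 1/2) = \<Lambda> powr (- 1/2) * \<kappa> powr (1/3)"
      using \<Lambda> kappa by (simp add: \<theta>_def powr_mult powr_powr)
    moreover have "\<kappa> powr (2/3) * \<kappa> powr (1/3) = \<kappa>"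
      using kappa by (simp flip: powr_add)
    ultimately show ?thesis using kappa by (simp add: field_simps)
  qed
  have "\<bar>flux_rest x\<bar> \<le> d * (C / \<kappa> * c) * dev 3 x + d * (c * (M * \<kappa> powr (2/3)) * C * (C / \<kappa>) *
     (2 * c * C * dev 3 x + 2 * C * (\<theta> * dev 3 x + \<theta> powr (- 1/2) * ?p)))"
    using flux_rest_bound[OF L _ \<theta>] M by (simp add: d_def)
  also have "\<dots> = d * C * c / \<kappa> * dev 3 x + 2 * e * (c * C * \<kappa> powr (2/3) / \<kappa> * dev 3 x
     + C * ((\<kappa> powr (2/3) * \<theta>) / \<kappa>) * dev 3 x + C * (\<kappa> powr (2/3) / \<kappa> * \<theta> powr (- 1/2)) * ?p)"
    by (simp add: e_def algebra_simps)
  also have "\<dots> = d * C * c / \<kappa> * dev 3 x + 2 * e * (c * C * \<kappa> powr (2/3) / \<kappa> * dev 3 x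
     + C * (\<Lambda> / \<kappa>) * dev 3 x + C * \<Lambda> powr (- 1/2) * ?p)"
    unfolding k2 k3 ..
  also have "\<dots> \<le> d * C * c / \<kappa> * dev 3 x + 2 * e * (c * C * 1 / \<kappa> * dev 3 x
     + C * (\<Lambda> / \<kappa>) * dev 3 x + C * \<Lambda> powr (- 1/2) * ?p)"
    using k1 e0 p0 c1 C1 kappa
    by (intro add_left_mono mult_left_mono add_right_mono mult_right_mono divide_right_mono) auto
  also have "\<dots> \<le> flux_const CARD('n) C c M * (1 + \<Lambda>) / \<kappa> * dev 3 x + flux_const CARD('n) C c M * \<Lambda> powr (- 1/2) * ?p"
  proof -
    have fc: "flux_const CARD('n) C c M = d * C * c + 2 * e * (c * C + C)" by (simp add: flux_const_def e_def d_def algebra_simps)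
    have "d * C * c + 2 * e * (c * C + C * \<Lambda>) \<le> flux_const CARD('n) C c M * (1 + \<Lambda>)"
      unfolding fc using \<Lambda> e0 c1 C1 by (simp add: algebra_simps d_def)
    then have "(d * C * c + 2 * e * (c * C + C * \<Lambda>)) / \<kappa> * dev 3 x \<le> flux_const CARD('n) C c M * (1 + \<Lambda>) / \<kappa> * dev 3 x"
      using kappa p0 by (intro mult_right_mono divide_right_mono) auto
    moreover have "2 * e * C \<le> flux_const CARD('n) C c M" unfolding fc using e0 c1 C1 by (simp add: algebra_simps d_def)
    then have "2 * e * C * \<Lambda> powr (- 1/2) * ?p \<le> flux_const CARD('n) C c M * \<Lambda> powr (- 1/2) * ?p"
      using p0 by (intro mult_right_mono) auto
    ultimately show ?thesis by (simp add: algebra_simps add_divide_distrib)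
  qed
  also have "flux_const CARD('n) C c M * (1 + \<Lambda>) / \<kappa> * dev 3 x \<le> flux_const CARD('n) C c M * (1 + \<Lambda>) / \<kappa> * (dev_const CARD('n) C c * D3 x)"
    using \<Lambda> kappa c1 C1 M by (intro mult_left_mono dev3_le divide_nonneg_pos mult_nonneg_nonneg) (auto simp: flux_const_def)
  finally show ?thesis by (simp add: algebra_simps)
qed

lemma nn_integral_D3:
  "(\<integral>\<^sup>+x. ennreal (D3 x) \<partial>torus) = (\<integral>\<^sup>+x. \<integral>\<^sup>+y. ennreal (N (x - y) * norm (u y - u x) ^ 3) \<partial>torus \<partial>torus)"
  unfolding D3_def conv_def
  by (intro nn_integral_cong nn_integral_eq_integral[symmetric] N_integrable int_dev3) (auto simp: N_nonneg)

lemma nn_integral_conv_N: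
  assumes f: "integrable torus f" "\<And>y. 0 \<le> f y"
  shows "(\<integral>\<^sup>+x. ennreal (conv N f x) \<partial>torus) \<le> ennreal C * (\<integral>\<^sup>+y. ennreal (f y) \<partial>torus)"
proof -
  note [measurable] = borel_measurable_integrable[OF f(1)]
  interpret pair_sigma_finite "torus :: (real^'n) measure" "torus :: (real^'n) measure" ..
  have "(\<integral>\<^sup>+x. ennreal (conv N f x) \<partial>torus) = (\<integral>\<^sup>+x. \<integral>\<^sup>+y. ennreal (N (x - y) * f y) \<partial>torus \<partial>torus)"
    unfolding conv_def
    by (intro nn_integral_cong nn_integral_eq_integral[symmetric] N_integrable f) (auto simp: N_nonneg f)
  also have "\<dots> = (\<integral>\<^sup>+y. \<integral>\<^sup>+x. ennreal (N (x - y) * f y) \<partial>torus \<partial>torus)"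
    by (rule Fubini') measurable
  also have "\<dots> = (\<integral>\<^sup>+y. (\<integral>\<^sup>+x. ennreal (N (x - y)) \<partial>torus) * ennreal (f y) \<partial>torus)"
    by (simp add: ennreal_mult' N_nonneg nn_integral_multc)
  also have "\<dots> \<le> (\<integral>\<^sup>+y. ennreal C * ennreal (f y) \<partial>torus)"
    by (intro nn_integral_mono mult_right_mono nn_integral_N) auto
  also have "\<dots> = ennreal C * (\<integral>\<^sup>+y. ennreal (f y) \<partial>torus)"
    by (simp add: nn_integral_cmult)
  finally show ?thesis .
qed

text \<open>In the non-integrable case the left side is 0 by the convention for the
  integral.\<close>

lemma ennreal_abs_integral_le: "ennreal \<bar>\<integral>x. f x \<partial>M\<bar> \<le> (\<integral>\<^sup>+x. ennreal \<bar>f x\<bar> \<partial>M)"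
proof (cases "integrable M f")
  case True
  then show ?thesis using integral_norm_bound_ennreal[OF True] by simp
qed (simp add: not_integrable_integral_eq)

theorem energy_flux_bound:
  assumes div_free: "\<And>x. (\<Sum>j\<in>UNIV. conv (K j) (\<lambda>y. u y $ j) x) = 0"
    and L: "AE x in torus. AE y in torus. N (x - y) \<noteq> 0 \<longrightarrow> \<bar>\<rho> x - \<rho> y\<bar> \<le> M * \<kappa> powr (2/3)"
    and M: "0 \<le> M" and \<Lambda>: "0 < \<Lambda>"
  shows "ennreal \<bar>\<integral>x. energy_flux \<eta> K \<rho> u P x \<partial>torus\<bar> \<le>
    ennreal (flux_const CARD('n) C c M * (1 + \<Lambda>) * dev_const CARD('n) C c / \<kappa>) * (\<integral>\<^sup>+x. \<integral>\<^sup>+y. ennreal (N (x - y) * norm (u y - u x) ^ 3) \<partial>torus \<partial>torus)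
    + ennreal (flux_const CARD('n) C c M * \<Lambda> powr (- 1/2)) * (ennreal C * (\<integral>\<^sup>+y. ennreal (\<bar>P y\<bar> powr (3/2)) \<partial>torus))"
proof -
  let ?p = "conv N (\<lambda>y. \<bar>P y\<bar> powr (3/2))"
  have fc: "0 \<le> flux_const CARD('n) C c M" using c1 C1 M by (simp add: flux_const_def)
  have pos: "0 \<le> flux_const CARD('n) C c M * (1 + \<Lambda>) * dev_const CARD('n) C c / \<kappa>" "0 \<le> flux_const CARD('n) C c M * \<Lambda> powr (- 1/2)"
    using fc dev_const_pos \<Lambda> kappa by (auto intro!: divide_nonneg_pos mult_nonneg_nonneg)
  have [measurable]: "D3 \<in> borel_measurable borel" "?p \<in> borel_measurable borel"
    unfolding D3_def[abs_def] conv_def[abs_def] by measurable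
  have "ennreal \<bar>\<integral>x. energy_flux \<eta> K \<rho> u P x \<partial>torus\<bar> \<le> (\<integral>\<^sup>+x. ennreal \<bar>flux_rest x\<bar> \<partial>torus)"
    unfolding energy_flux_integral[OF div_free] by (rule ennreal_abs_integral_le)
  also have "\<dots> \<le> (\<integral>\<^sup>+x. ennreal (flux_const CARD('n) C c M * (1 + \<Lambda>) * dev_const CARD('n) C c / \<kappa>) * ennreal (D3 x) + ennreal (flux_const CARD('n) C c M * \<Lambda> powr (- 1/2)) * ennreal (?p x) \<partial>torus)"
  proof (intro nn_integral_mono_AE, use L in eventually_elim)
    case (elim x)
    have "0 \<le> ?p x" by (intro N_conv_nonneg) simp
    then have "ennreal (flux_const CARD('n) C c M * (1 + \<Lambda>) * dev_const CARD('n) C c / \<kappa>) * ennreal (D3 x) + ennreal (flux_const CARD('n) C c M * \<Lambda> powr (- 1/2)) * ennreal (?p x)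
      = ennreal (flux_const CARD('n) C c M * (1 + \<Lambda>) * dev_const CARD('n) C c / \<kappa> * D3 x + flux_const CARD('n) C c M * \<Lambda> powr (- 1/2) * ?p x)"
      by (intro ennreal_lincomb D3_nonneg pos)
    then show ?case
      using flux_rest_bound_scaled[OF elim M \<Lambda>] by (simp only: ennreal_leI)
  qed
  also have "\<dots> = ennreal (flux_const CARD('n) C c M * (1 + \<Lambda>) * dev_const CARD('n) C c / \<kappa>) * (\<integral>\<^sup>+x. ennreal (D3 x) \<partial>torus)
     + ennreal (flux_const CARD('n) C c M * \<Lambda> powr (- 1/2)) * (\<integral>\<^sup>+x. ennreal (?p x) \<partial>torus)"
    by (simp add: nn_integral_add nn_integral_cmult)
  also have "\<dots> \<le> ennreal (flux_const CARD('n) C c M * (1 + \<Lambda>) * dev_const CARD('n) C c / \<kappa>) * (\<integral>\<^sup>+x. \<integral>\<^sup>+y. ennreal (N (x - y) * norm (u y - u x) ^ 3) \<partial>torus \<partial>torus)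
    + ennreal (flux_const CARD('n) C c M * \<Lambda> powr (- 1/2)) * (ennreal C * (\<integral>\<^sup>+y. ennreal (\<bar>P y\<bar> powr (3/2)) \<partial>torus))"
    unfolding nn_integral_D3 by (intro add_mono mult_left_mono nn_integral_conv_N P32) auto
  finally show ?thesis .
qed

lemma trace_energy_eq: "trace_energy x = conv \<eta> (\<lambda>y. \<rho> y * (norm (u y - v x))\<^sup>2) x"
proof -
  have "(v x $ i) * conv \<eta> (\<lambda>y. \<rho> y * u y $ i) x = (v x $ i)\<^sup>2 * re x" for i
    by (simp add: v_re[symmetric] power2_eq_square mult.assoc)
  moreover have "(conv \<eta> (\<lambda>y. \<rho> y * u y $ i) x)\<^sup>2 / re x = (v x $ i)\<^sup>2 * re x" for i
    using re_pos[of x] by (simp add: v_re[symmetric] power2_eq_square)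
  ultimately show ?thesis
    unfolding trace_energy_def conv_square_expand[OF kernel_eta int_rho int_rho_u int_rho_sq] norm_v_sq
    by (simp add: sum_distrib_right)
qed

lemma mollified_energy_integrable:
  "integrable torus (\<lambda>x. \<Sum>i\<in>UNIV. (conv \<eta> (\<lambda>y. \<rho> y * u y $ i) x)\<^sup>2 / re x)"
proof (rule torus_integrable_continuous)
  show "continuous_on UNIV (\<lambda>x. \<Sum>i\<in>UNIV. (conv \<eta> (\<lambda>y. \<rho> y * u y $ i) x)\<^sup>2 / re x)"
    using re_pos by (intro continuous_intros conv_continuous kernel_eta int_rho int_rho_u) (auto simp: less_imp_neq[symmetric])
  show "periodic_x (\<lambda>x. \<Sum>i\<in>UNIV. (conv \<eta> (\<lambda>y. \<rho> y * u y $ i) x)\<^sup>2 / re x)"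
    using conv_periodic[OF kernel_eta] by (simp add: periodic_x_def)
qed

text \<open>Mollification preserves means, so the difference of the energies is the integral of
  \<open>trace_energy\<close>. This is quadratic while only cubes are controlled; splitting at |u -
  v| = \<Lambda> bounds the square by \<Lambda>^2 + |u - v|^3 / \<Lambda>, to be used with small
  \<Lambda>.\<close>

theorem energy_defect_bound:
  assumes \<Lambda>: "0 < \<Lambda>"
  shows "ennreal \<bar>(\<integral>y. \<rho> y * (norm (u y))\<^sup>2 \<partial>torus) - (\<integral>x. (\<Sum>i\<in>UNIV. (conv \<eta> (\<lambda>y. \<rho> y * u y $ i) x)\<^sup>2 / re x) \<partial>torus)\<bar>
    \<le> ennreal (c * C * (\<Lambda>\<^sup>2 * C)) +
      ennreal (c * C * dev_const CARD('n) C c / \<Lambda>) * (\<integral>\<^sup>+x. \<integral>\<^sup>+y. ennreal (N (x - y) * norm (u y - u x) ^ 3) \<partial>torus \<partial>torus)"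
proof -
  note 1 = mollified_energy_integrable
  have 2: "integrable torus (conv \<eta> (\<lambda>y. \<rho> y * (norm (u y))\<^sup>2))"
    using kernel_fun_conv[OF kernel_eta int_rho_sq] by (auto simp: kernel_fun_def intro: torus_integrable_continuous)
  have [measurable]: "D3 \<in> borel_measurable borel"
    unfolding D3_def[abs_def] conv_def[abs_def] by measurable
  have "(\<integral>y. \<rho> y * (norm (u y))\<^sup>2 \<partial>torus) - (\<integral>x. (\<Sum>i\<in>UNIV. (conv \<eta> (\<lambda>y. \<rho> y * u y $ i) x)\<^sup>2 / re x) \<partial>torus)
     = (\<integral>x. trace_energy x \<partial>torus)"
    unfolding trace_energy_def conv_eta_integral[OF int_rho_sq, symmetric] using 1 2 by simp
  also have "ennreal \<bar>\<dots>\<bar> \<le> (\<integral>\<^sup>+x. ennreal \<bar>trace_energy x\<bar> \<partial>torus)"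
    by (rule ennreal_abs_integral_le)
  also have "\<dots> \<le> (\<integral>\<^sup>+x. ennreal (c * C * (\<Lambda>\<^sup>2 * C)) + ennreal (c * C * dev_const CARD('n) C c / \<Lambda>) * ennreal (D3 x) \<partial>torus)"
  proof (intro nn_integral_mono)
    fix x :: "real^'n"
    have pt: "\<bar>\<rho> y * (norm (u y - v x))\<^sup>2\<bar> \<le> c * (\<Lambda>\<^sup>2 + norm (u y - v x) ^ 3 / \<Lambda>)" for y
    proof -
      let ?a = "norm (u y - v x)"
      have "?a\<^sup>2 \<le> \<Lambda>\<^sup>2 + ?a ^ 3 / \<Lambda>"
      proof (cases "?a \<le> \<Lambda>")
        case True
        then have "?a\<^sup>2 \<le> \<Lambda>\<^sup>2" by (intro power_mono) auto
        then show ?thesis using \<Lambda> by (simp add: add_increasing2)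
      next
        case False
        then have "?a\<^sup>2 * \<Lambda> \<le> ?a\<^sup>2 * ?a" by (intro mult_left_mono) auto
        then have "?a\<^sup>2 \<le> ?a ^ 3 / \<Lambda>" using \<Lambda> by (simp add: field_simps power2_eq_square power3_eq_cube)
        then show ?thesis by (simp add: add_increasing)
      qed
      then show ?thesis unfolding abs_mult using rho_pos[of y] rho_le[of y] c1 by (intro mult_mono) auto
    qed
    have "\<bar>trace_energy x\<bar> \<le> C * conv N (\<lambda>y. c * \<Lambda>\<^sup>2 + c / \<Lambda> * norm (u y - v x) ^ 3) x"
      unfolding trace_energy_eq
    proof (rule conv_le_N[OF kernel_eta eta_le_N])
      show "integrable torus (\<lambda>y. \<rho> y * (norm (u y - v x))\<^sup>2)"
        by (rule integrable_le_dev[OF _ _ pt]) (use int_dev3 in simp_all)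
      show "AE y in torus. N (x - y) \<noteq> 0 \<longrightarrow> \<bar>\<rho> y * (norm (u y - v x))\<^sup>2\<bar> \<le> c * \<Lambda>\<^sup>2 + c / \<Lambda> * norm (u y - v x) ^ 3"
        using pt by (simp add: distrib_left)
    qed (use C1 int_dev3 in simp_all)
    also have "\<dots> = C * (conv N (\<lambda>_. c * \<Lambda>\<^sup>2) x + c / \<Lambda> * dev 3 x)"
    proof -
      have "conv N (\<lambda>y. c * \<Lambda>\<^sup>2 + c / \<Lambda> * norm (u y - v x) ^ 3) x =
          conv N (\<lambda>_. c * \<Lambda>\<^sup>2) x + conv N (\<lambda>y. c / \<Lambda> * norm (u y - v x) ^ 3) x"
        using int_dev3 by (intro N_add) auto
      then show ?thesis by (simp only: conv_cmult)
    qed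
    also have "\<dots> \<le> C * (C * (c * \<Lambda>\<^sup>2) + c / \<Lambda> * (dev_const CARD('n) C c * D3 x))"
      using C1 c1 \<Lambda> by (intro mult_left_mono add_mono N_const dev3_le) auto
    also have "\<dots> = c * C * (\<Lambda>\<^sup>2 * C) + c * C * dev_const CARD('n) C c / \<Lambda> * D3 x" by (simp add: algebra_simps)
    finally show "ennreal \<bar>trace_energy x\<bar> \<le> ennreal (c * C * (\<Lambda>\<^sup>2 * C)) + ennreal (c * C * dev_const CARD('n) C c / \<Lambda>) * ennreal (D3 x)"
      using C1 c1 \<Lambda> dev_const_pos D3_nonneg[of x] by (simp flip: ennreal_mult ennreal_plus add: ennreal_leI)
  qed
  also have "\<dots> = ennreal (c * C * (\<Lambda>\<^sup>2 * C)) + ennreal (c * C * dev_const CARD('n) C c / \<Lambda>) * (\<integral>\<^sup>+x. ennreal (D3 x) \<partial>torus)"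
    by (subst nn_integral_add, simp, simp, subst nn_integral_cmult, simp)
      (simp only: nn_integral_const space_torus emeasure_torus_UNIV mult_1_right)
  finally show ?thesis unfolding nn_integral_D3 .
qed

end

section \<open>Weak time derivatives\<close>

definition time_test :: "real \<Rightarrow> (real \<Rightarrow> real) \<Rightarrow> bool" where
  "time_test T \<theta> \<longleftrightarrow> smooth \<theta> \<and> (\<exists>a b. 0 < a \<and> a \<le> b \<and> b < T \<and> (\<forall>t. t \<notin> {a..b} \<longrightarrow> \<theta> t = 0))"

text \<open>Integrating against the measure of the open interval makes this a function on the whole
  line, constant before 0 and after \<open>T\<close>. Continuity then involves no one-sided cases at
  the ends.\<close>

definition time_prim :: "real \<Rightarrow> (real \<Rightarrow> real) \<Rightarrow> real \<Rightarrow> real" where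
  "time_prim T f t = (\<integral>s. (if s < t then f s else 0) \<partial>time_measure T)"

lemma AE_time_measure: "(AE t in time_measure T. P t) \<longleftrightarrow> (AE t in lborel. t \<in> {0<..<T} \<longrightarrow> P t)"
  unfolding time_measure_def by (subst AE_density) (auto simp: indicator_def)

lemma AE_time_measure_in: "AE t in time_measure T. t \<in> {0<..<T}"
  by (simp add: AE_time_measure)

lemma integral_time_measure:
  fixes f :: "real \<Rightarrow> real"
  assumes "f \<in> borel_measurable borel"
  shows "(\<integral>t. f t \<partial>time_measure T) = (\<integral>t. indicator {0<..<T} t * f t \<partial>lborel)"
proof -
  have "time_measure T = density lborel (\<lambda>t. ennreal (indicator {0<..<T} t))"
    unfolding time_measure_def by (intro density_cong) (auto simp: indicator_def)
  then show ?thesis using assms by (simp add: integral_density)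
qed

lemma time_integrable_borel: "integrable (time_measure T) f \<Longrightarrow> f \<in> borel_measurable borel"
  using borel_measurable_integrable[of "time_measure T" f] by simp

lemma time_test_continuous: "time_test T \<theta> \<Longrightarrow> continuous_on A \<theta>"
  by (auto simp: time_test_def smooth_continuous_on)

lemma time_test_borel: "time_test T \<theta> \<Longrightarrow> \<theta> \<in> borel_measurable borel"
  by (intro borel_measurable_continuous_onI time_test_continuous)

lemma time_test_bounded:
  assumes "time_test T \<theta>"
  obtains B where "0 \<le> B" "\<And>t. \<bar>\<theta> t\<bar> \<le> B"
proof -
  from assms obtain a b where ab: "\<And>t. t \<notin> {a..b} \<Longrightarrow> \<theta> t = 0"
    by (auto simp: time_test_def)
  have "bounded (\<theta> ` {a..b})"
    using time_test_continuous[OF assms] by (intro compact_imp_bounded compact_continuous_image) auto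
  then obtain B where "\<forall>x\<in>\<theta> ` {a..b}. norm x \<le> B"
    unfolding bounded_iff by blast
  then have B: "\<And>t. t \<in> {a..b} \<Longrightarrow> \<bar>\<theta> t\<bar> \<le> B" by auto
  have "\<bar>\<theta> t\<bar> \<le> max 0 B" for t
    by (cases "t \<in> {a..b}") (use B[of t] ab[of t] in auto)
  then show thesis using that[of "max 0 B"] by auto
qed

lemma time_integrable_bounded_mult:
  fixes f g :: "real \<Rightarrow> real"
  assumes f: "integrable (time_measure T) f" and [measurable]: "g \<in> borel_measurable borel"
    and B: "\<And>t. \<bar>g t\<bar> \<le> B"
  shows "integrable (time_measure T) (\<lambda>t. g t * f t)"
proof -
  note [measurable] = time_integrable_borel[OF f]
  show ?thesis
    by (rule Bochner_Integration.integrable_bound[of _ "\<lambda>t. B * f t"])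
      (use f in \<open>auto simp: abs_mult intro!: mult_right_mono order_trans[OF B abs_ge_self]\<close>)
qed

lemma time_test_integrable:
  assumes "time_test T \<theta>" shows "integrable (time_measure T) \<theta>"
proof -
  note [measurable] = time_test_borel[OF assms]
  obtain B where "\<And>t. \<bar>\<theta> t\<bar> \<le> B" using time_test_bounded[OF assms] by blast
  then show ?thesis by (intro time.integrable_const_bound[of _ B]) auto
qed

lemma flat_exp_filterlim:
  "filterlim f at_top F \<Longrightarrow> ((\<lambda>n. flat_exp 0 (f n)) \<longlongrightarrow> 1) F"
proof -
  assume f: "filterlim f at_top F"
  have "((\<lambda>n. exp (- inverse (f n))) \<longlongrightarrow> exp (- 0)) F"
    by (intro tendsto_exp tendsto_minus filterlim_compose[OF tendsto_inverse_0_at_top f] filterlim_ident)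
  moreover have "\<forall>\<^sub>F n in F. exp (- inverse (f n)) = flat_exp 0 (f n)"
    using f[unfolded filterlim_at_top_dense, rule_format, of 0]
    by eventually_elim (simp add: flat_exp_def divide_inverse)
  ultimately show ?thesis by (simp add: tendsto_cong)
qed

text \<open>On (0, T) the indicator of a half-line is a pointwise limit of test functions with
  values in [0, 1], so the vanishing passes to it by dominated convergence.\<close>

lemma integral_zero_greaterThan:
  fixes f :: "real \<Rightarrow> real"
  assumes f: "integrable (time_measure T) f"
    and 0: "\<And>\<theta>. time_test T \<theta> \<Longrightarrow> (\<integral>t. \<theta> t * f t \<partial>time_measure T) = 0"
  shows "(\<integral>t. indicator {x<..} t * f t \<partial>time_measure T) = 0"
proof (cases "x < T \<and> 0 < T")
  case False
  have "AE t in time_measure T. indicator {x<..} t * f t = 0"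
    using AE_time_measure_in[of T] by eventually_elim (use False in auto)
  then show ?thesis by (simp add: integral_eq_zero_AE)
next
  case True
  note [measurable] = time_integrable_borel[OF f]
  \<comment> \<open>The factors vanish within distance 1/n of the ends, and to the left of
    \<open>x\<close>. Inside, multiplication by \<open>n\<close> drives the arguments of
    \<open>flat_exp 0\<close> to infinity and hence the product to 1.\<close>
  define \<theta> where "\<theta> n t = flat_exp 0 (real n * (t - max x (1 / real n))) * flat_exp 0 (real n * (T - 1 / real n - t))" for n t
  have sm: "smooth (\<theta> n)" for n
    unfolding \<theta>_def
    by (intro smooth_mult smooth_compose[OF smooth_flat_exp] smooth_const smooth_diff smooth_bounded_linear bounded_linear_ident)
  have ab: "\<forall>\<^sub>F n in sequentially. max x (1 / real n) \<le> T - 1 / real n"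
  proof -
    have "(\<lambda>n. max x (1 / real n)) \<longlonglongrightarrow> max x 0"
      by (intro tendsto_max tendsto_const lim_1_over_n)
    moreover have "(\<lambda>n. T - 1 / real n) \<longlonglongrightarrow> T - 0"
      by (intro tendsto_diff tendsto_const lim_1_over_n)
    ultimately have "(\<lambda>n. (T - 1 / real n) - max x (1 / real n)) \<longlonglongrightarrow> (T - 0) - max x 0"
      by (rule tendsto_diff[rotated])
    then have "\<forall>\<^sub>F n in sequentially. 0 < (T - 1 / real n) - max x (1 / real n)"
      by (rule order_tendstoD) (use True in auto)
    then show ?thesis by eventually_elim simp
  qed
  have test: "\<forall>\<^sub>F n in sequentially. time_test T (\<theta> n)"
    using ab eventually_gt_at_top[of 0]
  proof eventually_elim
    case (elim n)
    show ?case
      unfolding time_test_def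
    proof (intro conjI sm exI)
      show "\<forall>t. t \<notin> {max x (1 / real n)..T - 1 / real n} \<longrightarrow> \<theta> n t = 0"
        using elim(2) by (auto simp: \<theta>_def flat_exp_def mult_le_0_iff not_le)
    qed (use elim in \<open>auto simp: less_max_iff_disj\<close>)
  qed
  have [measurable]: "\<theta> n \<in> borel_measurable borel" for n
    using sm by (intro borel_measurable_continuous_onI smooth_continuous_on)
  have "(\<lambda>n. \<integral>t. \<theta> n t * f t \<partial>time_measure T) \<longlonglongrightarrow> (\<integral>t. indicator {x<..} t * f t \<partial>time_measure T)"
  proof (rule integral_dominated_convergence[where w="\<lambda>t. \<bar>f t\<bar>"])
    show "AE t in time_measure T. (\<lambda>n. \<theta> n t * f t) \<longlonglongrightarrow> indicator {x<..} t * f t"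
      using AE_time_measure_in[of T]
    proof eventually_elim
      case (elim t)
      have "(\<lambda>n. \<theta> n t) \<longlonglongrightarrow> indicator {x<..} t"
      proof (cases "x < t")
        case False
        then have "\<theta> n t = 0" for n by (auto simp: \<theta>_def flat_exp_def mult_le_0_iff)
        then show ?thesis using False by simp
      next
        case x: True
        have "filterlim (\<lambda>n. real n * (t - max x (1 / real n))) at_top sequentially"
        proof (rule filterlim_at_top_mult_tendsto_pos[OF _ _ filterlim_real_sequentially, THEN filterlim_cong[THEN iffD1, rotated -1]])
          show "(\<lambda>n. t - max x (1 / real n)) \<longlonglongrightarrow> t - max x 0"
            by (intro tendsto_diff tendsto_max tendsto_const lim_1_over_n)
        qed (use x elim in \<open>auto simp: mult.commute\<close>)
        moreover have "filterlim (\<lambda>n. real n * (T - 1 / real n - t)) at_top sequentially"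
        proof (rule filterlim_at_top_mult_tendsto_pos[OF _ _ filterlim_real_sequentially, THEN filterlim_cong[THEN iffD1, rotated -1]])
          show "(\<lambda>n. T - 1 / real n - t) \<longlonglongrightarrow> T - 0 - t"
            by (intro tendsto_diff tendsto_const lim_1_over_n)
        qed (use elim in \<open>auto simp: mult.commute\<close>)
        ultimately have "(\<lambda>n. \<theta> n t) \<longlonglongrightarrow> 1 * 1"
          unfolding \<theta>_def by (intro tendsto_mult flat_exp_filterlim)
        then show ?thesis using x by simp
      qed
      then show ?case by (intro tendsto_mult tendsto_const)
    qed
    show "AE t in time_measure T. norm (\<theta> n t * f t) \<le> \<bar>f t\<bar>" for n
    proof (rule AE_I2)
      fix t
      have "\<bar>\<theta> n t\<bar> \<le> 1 * 1"
        unfolding \<theta>_def abs_mult using flat_exp_nonneg flat_exp_le_1 by (intro mult_mono) auto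
      then show "norm (\<theta> n t * f t) \<le> \<bar>f t\<bar>"
        using mult_right_mono[of "\<bar>\<theta> n t\<bar>" 1 "\<bar>f t\<bar>"] by (simp add: abs_mult)
    qed
  qed (use f in auto)
  moreover have "\<forall>\<^sub>F n in sequentially. (\<integral>t. \<theta> n t * f t \<partial>time_measure T) = 0"
    using test by eventually_elim (rule 0)
  then have "(\<lambda>n. \<integral>t. \<theta> n t * f t \<partial>time_measure T) \<longlonglongrightarrow> 0" by (rule tendsto_eventually)
  ultimately show ?thesis by (rule LIMSEQ_unique)
qed

text \<open>Taken as densities, the positive and the negative part of \<open>f\<close> give the same
  finite mass to every half-line. So they define the same measure and agree almost
  everywhere.\<close>

lemma time_fundamental_lemma:
  fixes f :: "real \<Rightarrow> real"
  assumes f: "integrable (time_measure T) f"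
    and 0: "\<And>\<theta>. time_test T \<theta> \<Longrightarrow> (\<integral>t. \<theta> t * f t \<partial>time_measure T) = 0"
  shows "AE t in time_measure T. f t = 0"
proof -
  note [measurable] = time_integrable_borel[OF f]
  let ?p = "\<lambda>t. ennreal (max 0 (f t))" and ?m = "\<lambda>t. ennreal (max 0 (- f t))"
  have int: "integrable (time_measure T) (\<lambda>t. indicator {x<..} t * max 0 (f t))"
    "integrable (time_measure T) (\<lambda>t. indicator {x<..} t * max 0 (- f t))" for x :: real
    using f by (auto intro!: time_integrable_bounded_mult[where B=1] simp: indicator_def)
  have em: "emeasure (density (time_measure T) ?p) {x<..} = ennreal (\<integral>t. indicator {x<..} t * max 0 (f t) \<partial>time_measure T)"
    "emeasure (density (time_measure T) ?m) {x<..} = ennreal (\<integral>t. indicator {x<..} t * max 0 (- f t) \<partial>time_measure T)" for x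
    by (subst emeasure_density, simp, simp, subst nn_integral_eq_integral[OF int(1)[of x], symmetric] nn_integral_eq_integral[OF int(2)[of x], symmetric],
        simp, rule nn_integral_cong, simp add: indicator_def)+
  have "density (time_measure T) ?p = density (time_measure T) ?m"
  proof (rule measure_eqI_lessThan)
    fix x :: real
    have "(\<integral>t. indicator {x<..} t * max 0 (f t) \<partial>time_measure T) - (\<integral>t. indicator {x<..} t * max 0 (- f t) \<partial>time_measure T)
      = (\<integral>t. indicator {x<..} t * f t \<partial>time_measure T)"
    proof (subst Bochner_Integration.integral_diff[OF int, symmetric], rule Bochner_Integration.integral_cong)
      show "indicator {x<..} t * max 0 (f t) - indicator {x<..} t * max 0 (- f t) = indicator {x<..} t * f t" for t
        by (simp add: indicator_def max_def)
    qed simp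
    then show "emeasure (density (time_measure T) ?p) {x<..} = emeasure (density (time_measure T) ?m) {x<..}"
      unfolding em using integral_zero_greaterThan[OF f 0, of x] by simp
    show "emeasure (density (time_measure T) ?p) {x<..} < \<infinity>" unfolding em by simp
  qed auto
  then have "AE t in time_measure T. ?p t = ?m t"
    by (intro time.density_unique) auto
  then show ?thesis by eventually_elim (simp add: max_def split: if_splits)
qed

lemma time_prim_continuous:
  assumes f: "integrable (time_measure T) f"
  shows "continuous_on UNIV (time_prim T f)"
proof -
  note [measurable] = time_integrable_borel[OF f]
  have "(\<lambda>n. time_prim T f (X n)) \<longlonglongrightarrow> time_prim T f t" if X: "X \<longlonglongrightarrow> t" for X t
    unfolding time_prim_def
  proof (rule integral_dominated_convergence[where w="\<lambda>t. \<bar>f t\<bar>"])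
    have "AE s in lborel. s \<noteq> t" by (rule AE_lborel_singleton)
    then have "AE s in time_measure T. s \<noteq> t" by (simp add: AE_time_measure eventually_mono)
    then show "AE s in time_measure T. (\<lambda>n. if s < X n then f s else 0) \<longlonglongrightarrow> (if s < t then f s else 0)"
    proof eventually_elim
      case (elim s)
      have "\<forall>\<^sub>F n in sequentially. (if s < X n then f s else 0) = (if s < t then f s else 0)"
      proof (cases "s < t")
        case True
        show ?thesis using order_tendstoD(1)[OF X True] by eventually_elim (use True in auto)
      next
        case False
        then have "t < s" using elim by simp
        show ?thesis using order_tendstoD(2)[OF X \<open>t < s\<close>] by eventually_elim (use False in auto)
      qed
      then show ?case by (rule tendsto_eventually)
    qed
  qed (use f in \<open>auto simp: indicator_def\<close>)
  then show ?thesis by (auto simp: continuous_on_sequentially o_def)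
qed

lemma time_prim_0: "time_prim T f 0 = 0"
proof -
  have "AE s in time_measure T. (if s < 0 then f s else 0) = 0"
    using AE_time_measure_in[of T] by eventually_elim auto
  then show ?thesis unfolding time_prim_def by (rule integral_eq_zero_AE)
qed

lemma time_test_deriv_integral:
  assumes \<theta>: "time_test T \<theta>" and deriv: "\<And>t. (\<theta> has_real_derivative \<theta>' t) (at t)" and s: "0 \<le> s" "s < T"
  shows "(\<integral>t. (if s < t then \<theta>' t else 0) \<partial>time_measure T) = - \<theta> s"
proof -
  have c: "continuous_on UNIV \<theta>'"
    using \<theta> smooth_real_derivative[OF deriv] by (auto simp: time_test_def smooth_continuous_on)
  note [measurable] = borel_measurable_continuous_onI[OF c]
  have "(\<integral>t. (if s < t then \<theta>' t else 0) \<partial>time_measure T) = (\<integral>t. indicator {0<..<T} t * (indicator {s<..} t * \<theta>' t) \<partial>lborel)"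
    by (subst integral_time_measure[symmetric], measurable)
      (auto intro!: Bochner_Integration.integral_cong simp: indicator_def)
  also have "\<dots> = (\<integral>t. \<theta>' t * indicator {s..T} t \<partial>lborel)"
  proof (rule integral_cong_AE)
    have "AE t in lborel. t \<noteq> s" "AE t in lborel. t \<noteq> T" by (rule AE_lborel_singleton)+
    then show "AE t in lborel. indicator {0<..<T} t * (indicator {s<..} t * \<theta>' t) = \<theta>' t * indicator {s..T} t"
      by eventually_elim (use s in \<open>auto simp: indicator_def\<close>)
  qed measurable
  also have "\<dots> = \<theta> T - \<theta> s"
    using s c by (intro integral_FTC_Icc_real) (auto intro: deriv simp: continuous_on_eq_continuous_at)
  also have "\<theta> T = 0" using \<theta> by (auto simp: time_test_def)
  finally show ?thesis by simp
qed

text \<open>Fubini on the triangle s < t: the inner integral of \<open>\<theta>'\<close> over t > s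
  is \<open>- \<theta> s\<close>.\<close>

lemma time_prim_weak_derivative:
  assumes G: "integrable (time_measure T) G"
    and \<theta>: "time_test T \<theta>" and deriv: "\<And>t. (\<theta> has_real_derivative \<theta>' t) (at t)"
    and B: "\<And>t. \<bar>\<theta>' t\<bar> \<le> B"
  shows "(\<integral>t. \<theta>' t * time_prim T G t \<partial>time_measure T) = - (\<integral>t. \<theta> t * G t \<partial>time_measure T)"
proof -
  have c: "continuous_on UNIV \<theta>'"
    using \<theta> smooth_real_derivative[OF deriv] by (auto simp: time_test_def smooth_continuous_on)
  note [measurable] = borel_measurable_continuous_onI[OF c] time_integrable_borel[OF G]
  interpret pair_sigma_finite "time_measure T" "time_measure T" ..
  have int: "integrable (time_measure T \<Otimes>\<^sub>M time_measure T) (\<lambda>(t, s). \<theta>' t * (if s < t then G s else 0))"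
  proof (rule Bochner_Integration.integrable_bound)
    show "integrable (time_measure T \<Otimes>\<^sub>M time_measure T) (\<lambda>(t, s). B * G s)"
      by (rule Fubini_integrable) (use G in \<open>auto simp: abs_mult\<close>)
    show "AE x in time_measure T \<Otimes>\<^sub>M time_measure T. norm (case x of (t, s) \<Rightarrow> \<theta>' t * (if s < t then G s else 0)) \<le> norm (case x of (t, s) \<Rightarrow> B * G s)"
      by (intro AE_I2) (auto simp: abs_mult indicator_def split: prod.split intro!: mult_right_mono order_trans[OF B abs_ge_self])
  qed measurable
  have "(\<integral>t. \<theta>' t * time_prim T G t \<partial>time_measure T) = (\<integral>t. \<integral>s. \<theta>' t * (if s < t then G s else 0) \<partial>time_measure T \<partial>time_measure T)"
    unfolding time_prim_def by simp
  also have "\<dots> = (\<integral>s. \<integral>t. \<theta>' t * (if s < t then G s else 0) \<partial>time_measure T \<partial>time_measure T)"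
    by (rule Fubini_integral[OF int, symmetric])
  also have "\<dots> = (\<integral>s. (\<integral>t. (if s < t then \<theta>' t else 0) \<partial>time_measure T) * G s \<partial>time_measure T)"
    by (subst integral_mult_left_zero[symmetric])
      (intro Bochner_Integration.integral_cong; simp)
  also have "\<dots> = (\<integral>s. - (\<theta> s * G s) \<partial>time_measure T)"
  proof (rule integral_cong_AE)
    show "AE s in time_measure T. (\<integral>t. (if s < t then \<theta>' t else 0) \<partial>time_measure T) * G s = - (\<theta> s * G s)"
      using AE_time_measure_in[of T]
      by eventually_elim (subst time_test_deriv_integral[OF \<theta> deriv], auto)
    show "(\<lambda>s. - (\<theta> s * G s)) \<in> borel_measurable (time_measure T)"
      using time_test_borel[OF \<theta>] by measurable
    show "(\<lambda>s. (\<integral>t. (if s < t then \<theta>' t else 0) \<partial>time_measure T) * G s) \<in> borel_measurable (time_measure T)"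
      by measurable
  qed
  finally show ?thesis by simp
qed

text \<open>The primitive normalised to vanish at 0 is zero before the support of \<open>g\<close>;
  zero mean makes it vanish beyond the support as well.\<close>

lemma time_test_primitive:
  assumes g: "time_test T g" and 0: "(\<integral>t. g t \<partial>time_measure T) = 0"
  shows "\<exists>\<theta>. time_test T \<theta> \<and> (\<forall>t. (\<theta> has_real_derivative g t) (at t))"
proof -
  from g obtain a b where ab: "0 < a" "a \<le> b" "b < T" "\<And>t. t \<notin> {a..b} \<Longrightarrow> g t = 0" and sm: "smooth g"
    by (auto simp: time_test_def)
  have cont: "continuous_on UNIV g" by (rule smooth_continuous_on[OF sm])
  note [measurable] = borel_measurable_continuous_onI[OF cont]
  obtain F where F: "\<And>t. (F has_real_derivative g t) (at t)"
  proof -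
    have "\<exists>F. \<forall>x::real. -\<infinity> < ereal x \<longrightarrow> ereal x < \<infinity> \<longrightarrow> (F has_vector_derivative g x) (at x)"
      by (rule einterval_antiderivative) (use cont in \<open>auto simp: continuous_on_eq_continuous_at\<close>)
    then show thesis using that by (auto simp: has_real_derivative_iff_has_vector_derivative)
  qed
  have left: "F t = F 0" if "t < a" for t
    using has_field_derivative_zero_constant[of "{..<a}" F] F ab that
    by (metis (no_types, lifting) ab(4) atLeastAtMost_iff convex_real_interval(4) has_field_derivative_at_within lessThan_iff not_le)
  have T: "F T = F 0"
  proof -
    have "(\<integral>t. g t \<partial>time_measure T) = (\<integral>t. g t * indicator {0..T} t \<partial>lborel)"
    proof (subst integral_time_measure, measurable, rule integral_cong_AE)
      have "AE t in lborel. t \<noteq> 0" "AE t in lborel. t \<noteq> T" by (rule AE_lborel_singleton)+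
      then show "AE t in lborel. indicator {0<..<T} t * g t = g t * indicator {0..T} t"
        by eventually_elim (auto simp: indicator_def)
    qed measurable
    also have "\<dots> = F T - F 0"
      using ab cont by (intro integral_FTC_Icc_real) (auto intro: F simp: continuous_on_eq_continuous_at)
    finally show ?thesis using 0 by simp
  qed
  have right: "F t = F T" if "b < t" for t
    using has_field_derivative_zero_constant[of "{b<..}" F] F ab that
    by (metis (no_types, lifting) ab(4) atLeastAtMost_iff convex_real_interval(3) has_field_derivative_at_within greaterThan_iff not_le)
  show ?thesis
  proof (intro exI conjI allI)
    show der: "((\<lambda>t. F t - F 0) has_real_derivative g t) (at t)" for t
      using F[of t] by (auto intro!: derivative_eq_intros)
    show "time_test T (\<lambda>t. F t - F 0)"
      unfolding time_test_def
    proof (intro conjI exI)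
      show "smooth (\<lambda>t. F t - F 0)" using smooth_real_derivative[OF der] sm by simp
      show "\<forall>t. t \<notin> {a..b} \<longrightarrow> F t - F 0 = 0"
        using left right T by (auto simp: not_le)
    qed (use ab in auto)
  qed
qed

text \<open>A probe for the first instants: it tests a function only on (0, \<delta>), where an
  initial condition controls it.\<close>

lemma time_test_bump:
  assumes "0 < \<delta>" "0 < T"
  obtains k where "time_test T k" "\<And>t. 0 \<le> k t" "\<And>t. \<delta> \<le> t \<Longrightarrow> k t = 0" "0 < (\<integral>t. k t \<partial>time_measure T)"
proof -
  define r where "r = min \<delta> T / 4"
  have r: "0 < r" "2 * r < \<delta>" "2 * r < T" using assms by (auto simp: r_def)
  define k where "k t = flat_exp 0 (t - r) * flat_exp 0 (2 * r - t)" for t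
  have test: "time_test T k"
    unfolding time_test_def
  proof (intro conjI exI)
    show "smooth k"
      unfolding k_def
      by (intro smooth_mult smooth_compose[OF smooth_flat_exp] smooth_const smooth_diff smooth_bounded_linear bounded_linear_ident)
    show "0 < r" "r \<le> 2 * r" "2 * r < T" using r by auto
    show "\<forall>t. t \<notin> {r..2 * r} \<longrightarrow> k t = 0" by (auto simp: k_def flat_exp_def)
  qed
  have nn: "0 \<le> k t" for t by (simp add: k_def flat_exp_nonneg)
  have "(\<integral>t. k t \<partial>time_measure T) \<noteq> 0"
  proof
    assume "(\<integral>t. k t \<partial>time_measure T) = 0"
    then have "AE t in time_measure T. k t = 0"
      using integral_nonneg_eq_0_iff_AE[OF time_test_integrable[OF test]] nn by simp
    then have "AE t in lborel. t \<notin> {r<..<2 * r}"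
      unfolding AE_time_measure by eventually_elim (use r in \<open>auto simp: k_def flat_exp_def\<close>)
    then have "{r<..<2 * r} \<in> null_sets lborel"
      by (subst AE_iff_null_sets) auto
    then show False using r by (auto simp: null_sets_def)
  qed
  moreover have "0 \<le> (\<integral>t. k t \<partial>time_measure T)" by (simp add: nn)
  ultimately have "0 < (\<integral>t. k t \<partial>time_measure T)" by linarith
  moreover have "k t = 0" if "\<delta> \<le> t" for t
    using that r by (simp add: k_def flat_exp_def)
  ultimately show thesis using that[OF test nn] by blast
qed

text \<open>Du Bois-Reymond: \<open>R\<close> minus the primitive of \<open>G\<close> is almost
  everywhere constant. The initial condition, known only for almost every small \<open>t\<close>,
  identifies the constant by means of test functions concentrated near 0.\<close>

theorem weak_time_derivative:
  assumes T: "0 < T" and R: "integrable (time_measure T) R" and G: "integrable (time_measure T) G"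
    and weak: "\<And>\<theta> \<theta>'. time_test T \<theta> \<Longrightarrow> (\<And>t. (\<theta> has_real_derivative \<theta>' t) (at t)) \<Longrightarrow>
      (\<integral>t. R t * \<theta>' t + G t * \<theta> t \<partial>time_measure T) = 0"
    and init: "\<And>e. 0 < e \<Longrightarrow> \<exists>\<delta>>0. AE t in time_measure T. t < \<delta> \<longrightarrow> \<bar>R t - R0\<bar> < e"
  shows "AE t in time_measure T. R t = R0 + time_prim T G t"
proof -
  note [measurable] = time_integrable_borel[OF R] time_integrable_borel[OF G]
  have pc: "continuous_on UNIV (time_prim T G)" by (rule time_prim_continuous[OF G])
  note [measurable] = borel_measurable_continuous_onI[OF pc]
  have pb: "\<bar>time_prim T G t\<bar> \<le> (\<integral>s. \<bar>G s\<bar> \<partial>time_measure T)" for t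
  proof -
    have "\<bar>time_prim T G t\<bar> \<le> (\<integral>s. \<bar>if s < t then G s else 0\<bar> \<partial>time_measure T)"
      unfolding time_prim_def using integral_norm_bound[of "time_measure T" "\<lambda>s. if s < t then G s else 0"] by simp
    also have "\<dots> \<le> (\<integral>s. \<bar>G s\<bar> \<partial>time_measure T)"
      by (intro integral_mono) (use G in \<open>auto intro!: Bochner_Integration.integrable_bound[OF G]\<close>)
    finally show ?thesis .
  qed
  have pint: "integrable (time_measure T) (time_prim T G)"
    by (rule time.integrable_const_bound[of _ "\<integral>s. \<bar>G s\<bar> \<partial>time_measure T"]) (use pb in auto)
  define W where "W t = R t - R0 - time_prim T G t" for t
  have W: "integrable (time_measure T) W" unfolding W_def using R pint by simp
  note [measurable] = time_integrable_borel[OF W]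
  have small: "\<exists>\<delta>>0. AE t in time_measure T. t < \<delta> \<longrightarrow> \<bar>W t\<bar> \<le> e" if "0 < e" for e
  proof -
    obtain \<delta> where \<delta>: "0 < \<delta>" "AE t in time_measure T. t < \<delta> \<longrightarrow> \<bar>R t - R0\<bar> < e / 2"
      using init[of "e / 2"] \<open>0 < e\<close> by auto
    have "isCont (time_prim T G) 0" using pc by (simp add: continuous_on_eq_continuous_at)
    then obtain d where d: "0 < d" "\<And>t. \<bar>t\<bar> < d \<Longrightarrow> \<bar>time_prim T G t\<bar> < e / 2"
      using \<open>0 < e\<close> unfolding continuous_at_eps_delta
      by (metis (no_types, lifting) diff_zero half_gt_zero real_norm_def dist_real_def time_prim_0)
    have "AE t in time_measure T. t < min \<delta> d \<longrightarrow> \<bar>W t\<bar> \<le> e"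
      using \<delta>(2) AE_time_measure_in[of T]
    proof eventually_elim
      case (elim t)
      show ?case
      proof
        assume "t < min \<delta> d"
        then have "\<bar>time_prim T G t\<bar> < e / 2" "\<bar>R t - R0\<bar> < e / 2" using d(2)[of t] elim by auto
        then show "\<bar>W t\<bar> \<le> e" unfolding W_def by linarith
      qed
    qed
    then show ?thesis using \<delta>(1) d(1) by (intro exI[of _ "min \<delta> d"]) auto
  qed
  have deriv0: "(\<integral>t. W t * \<theta>' t \<partial>time_measure T) = 0"
    if \<theta>: "time_test T \<theta>" "\<And>t. (\<theta> has_real_derivative \<theta>' t) (at t)" "time_test T \<theta>'" for \<theta> \<theta>'
  proof -
    obtain B where B: "\<And>t. \<bar>\<theta>' t\<bar> \<le> B" using time_test_bounded[OF \<theta>(3)] by blast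
    obtain B' where B': "\<And>t. \<bar>\<theta> t\<bar> \<le> B'" using time_test_bounded[OF \<theta>(1)] by blast
    have i: "integrable (time_measure T) (\<lambda>t. \<theta>' t * R t)" "integrable (time_measure T) (\<lambda>t. \<theta>' t * time_prim T G t)"
       "integrable (time_measure T) (\<lambda>t. \<theta> t * G t)"
      using R pint G B B' time_test_borel[OF \<theta>(1)] time_test_borel[OF \<theta>(3)]
      by (auto intro: time_integrable_bounded_mult)
    have z: "(\<integral>t. \<theta>' t \<partial>time_measure T) = 0"
    proof -
      have "(\<integral>t. \<theta>' t \<partial>time_measure T) = (\<integral>t. (if 0 < t then \<theta>' t else 0) \<partial>time_measure T)"
      proof (rule integral_cong_AE)
        show "AE t in time_measure T. \<theta>' t = (if 0 < t then \<theta>' t else 0)"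
          using AE_time_measure_in[of T] by eventually_elim auto
      qed (use time_test_borel[OF \<theta>(3)] in measurable)
      also have "\<dots> = - \<theta> 0" using T by (intro time_test_deriv_integral[OF \<theta>(1,2)]) auto
      also have "\<theta> 0 = 0" using \<theta>(1) by (auto simp: time_test_def)
      finally show ?thesis by simp
    qed
    have "(\<integral>t. W t * \<theta>' t \<partial>time_measure T) = (\<integral>t. \<theta>' t * R t - R0 * \<theta>' t - \<theta>' t * time_prim T G t \<partial>time_measure T)"
      by (intro Bochner_Integration.integral_cong) (auto simp: W_def algebra_simps)
    also have "\<dots> = (\<integral>t. \<theta>' t * R t \<partial>time_measure T) + (\<integral>t. \<theta> t * G t \<partial>time_measure T)"
      using i time_test_integrable[OF \<theta>(3)] time_prim_weak_derivative[OF G \<theta>(1,2) B] z by simp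
    also have "\<dots> = (\<integral>t. R t * \<theta>' t + G t * \<theta> t \<partial>time_measure T)"
      using i by (simp add: mult.commute)
    also have "\<dots> = 0" by (rule weak[OF \<theta>(1,2)])
    finally show ?thesis .
  qed
  have "AE t in time_measure T. W t = 0"
  proof (rule time_fundamental_lemma[OF W])
    fix \<psi> assume \<psi>: "time_test T \<psi>"
    define c where "c = (\<integral>t. \<psi> t \<partial>time_measure T)"
    have "\<bar>\<integral>t. \<psi> t * W t \<partial>time_measure T\<bar> \<le> \<bar>c\<bar> * e" if e: "0 < e" for e
    proof -
      obtain \<delta> where \<delta>: "0 < \<delta>" "AE t in time_measure T. t < \<delta> \<longrightarrow> \<bar>W t\<bar> \<le> e"
        using small[OF e] by blast
      obtain k where k: "time_test T k" "\<And>t. 0 \<le> k t" "\<And>t. \<delta> \<le> t \<Longrightarrow> k t = 0" "0 < (\<integral>t. k t \<partial>time_measure T)"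
        using time_test_bump[OF \<delta>(1) T] by blast
      define m where "m = (\<integral>t. k t \<partial>time_measure T)"
      \<comment> \<open>\<open>g\<close> has mean zero, hence is the derivative of a test function,
        and \<open>W\<close> is orthogonal to it. The integral of \<open>\<psi> * W\<close> thus
        equals \<open>c / m\<close> times that of \<open>k * W\<close>, and \<open>k\<close> sees
        only times at which |W| \<le> e.\<close>
      define g where "g t = \<psi> t - c / m * k t" for t
      have ki: "integrable (time_measure T) k" "integrable (time_measure T) \<psi>"
        using k(1) \<psi> by (auto intro: time_test_integrable)
      obtain Bk where Bk: "\<And>t. \<bar>k t\<bar> \<le> Bk" using time_test_bounded[OF k(1)] by blast
      obtain Bp where Bp: "\<And>t. \<bar>\<psi> t\<bar> \<le> Bp" using time_test_bounded[OF \<psi>] by blast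
      have Wi: "integrable (time_measure T) (\<lambda>t. k t * W t)" "integrable (time_measure T) (\<lambda>t. \<psi> t * W t)"
        using W Bk Bp time_test_borel[OF k(1)] time_test_borel[OF \<psi>] by (auto intro: time_integrable_bounded_mult)
      have tg: "time_test T g"
      proof -
        from \<psi> obtain a b where ab: "0 < a" "a \<le> b" "b < T" "\<forall>t. t \<notin> {a..b} \<longrightarrow> \<psi> t = 0" by (auto simp: time_test_def)
        from k(1) obtain a' b' where ab': "0 < a'" "a' \<le> b'" "b' < T" "\<forall>t. t \<notin> {a'..b'} \<longrightarrow> k t = 0" by (auto simp: time_test_def)
        show ?thesis
          unfolding time_test_def g_def
        proof (intro conjI exI)
          show "smooth (\<lambda>t. \<psi> t - c / m * k t)"
            using \<psi> k(1) by (intro smooth_diff smooth_mult smooth_const) (auto simp: time_test_def)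
          show "0 < min a a'" "min a a' \<le> max b b'" "max b b' < T" using ab ab' by auto
          show "\<forall>t. t \<notin> {min a a'..max b b'} \<longrightarrow> \<psi> t - c / m * k t = 0"
          proof (intro allI impI)
            fix t assume "t \<notin> {min a a'..max b b'}"
            then have "t \<notin> {a..b}" "t \<notin> {a'..b'}" by auto
            then show "\<psi> t - c / m * k t = 0" using ab(4) ab'(4) by simp
          qed
        qed
      qed
      have "(\<integral>t. g t \<partial>time_measure T) = 0"
        unfolding g_def using ki k(4) by (simp add: c_def m_def)
      from time_test_primitive[OF tg this]
      obtain \<theta> where \<theta>: "time_test T \<theta>" "(\<theta> has_real_derivative g t) (at t)" for t by auto
      have "(\<integral>t. W t * g t \<partial>time_measure T) = 0"
        by (rule deriv0[OF \<theta> tg])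
      moreover have "(\<integral>t. W t * g t \<partial>time_measure T) = (\<integral>t. \<psi> t * W t - c / m * (k t * W t) \<partial>time_measure T)"
        by (intro Bochner_Integration.integral_cong) (auto simp: g_def algebra_simps)
      ultimately have eq: "(\<integral>t. \<psi> t * W t \<partial>time_measure T) = c / m * (\<integral>t. k t * W t \<partial>time_measure T)"
        using Wi by simp
      have "\<bar>\<integral>t. k t * W t \<partial>time_measure T\<bar> \<le> (\<integral>t. \<bar>k t * W t\<bar> \<partial>time_measure T)"
        using integral_norm_bound[of "time_measure T" "\<lambda>t. k t * W t"] by simp
      also have "\<dots> \<le> (\<integral>t. e * k t \<partial>time_measure T)"
      proof (rule integral_mono_AE)
        show "AE t in time_measure T. \<bar>k t * W t\<bar> \<le> e * k t"
          using \<delta>(2)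
        proof eventually_elim
          case (elim t)
          show ?case
          proof (cases "t < \<delta>")
            case True
            then show ?thesis using elim k(2)[of t] mult_left_mono[of "\<bar>W t\<bar>" e "k t"] by (simp add: abs_mult mult.commute)
          qed (use k(3)[of t] in simp)
        qed
      qed (use Wi ki in auto)
      also have "\<dots> = e * m" by (simp add: m_def)
      finally have "\<bar>\<integral>t. k t * W t \<partial>time_measure T\<bar> \<le> e * m" .
      then have "\<bar>c / m\<bar> * \<bar>\<integral>t. k t * W t \<partial>time_measure T\<bar> \<le> \<bar>c / m\<bar> * (e * m)" by (intro mult_left_mono) auto
      also have "\<dots> = \<bar>c\<bar> * e" using k(4) by (simp add: m_def)
      finally show ?thesis unfolding eq abs_mult .
    qed
    note bound = this
    show "(\<integral>t. \<psi> t * W t \<partial>time_measure T) = 0"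
    proof (rule ccontr)
      let ?I = "\<integral>t. \<psi> t * W t \<partial>time_measure T"
      assume "?I \<noteq> 0"
      then have "\<bar>?I\<bar> \<le> \<bar>c\<bar> * (\<bar>?I\<bar> / (\<bar>c\<bar> + 1))" by (intro bound) auto
      also have "\<dots> < \<bar>?I\<bar>" using \<open>?I \<noteq> 0\<close> by (simp add: field_simps)
      finally show False by simp
    qed
  qed
  then show ?thesis by eventually_elim (simp add: W_def)
qed

section \<open>Absolutely continuous functions of time\<close>

lemma time_prim_diff:
  assumes f: "integrable (time_measure T) f" and "t \<le> t'"
  shows "time_prim T f t' - time_prim T f t = (\<integral>s. (if t \<le> s \<and> s < t' then f s else 0) \<partial>time_measure T)"
proof -
  note [measurable] = time_integrable_borel[OF f]
  have i: "integrable (time_measure T) (\<lambda>s. if s < t then f s else 0)" for t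
    by (rule Bochner_Integration.integrable_bound[OF f]) auto
  show ?thesis
    unfolding time_prim_def using \<open>t \<le> t'\<close>
    by (subst Bochner_Integration.integral_diff[OF i i, symmetric])
      (auto intro!: Bochner_Integration.integral_cong)
qed

text \<open>The set where the bound fails is open and null in the open interval, hence empty; the
  end points follow by closure.\<close>

lemma continuous_ge_if_AE:
  fixes f :: "real \<Rightarrow> real"
  assumes f: "continuous_on UNIV f" and ae: "AE t in time_measure T. r \<le> f t" and t: "t \<in> {0..T}" and T: "0 < T"
  shows "r \<le> f t"
proof -
  let ?A = "{t\<in>{0<..<T}. f t < r}"
  have "open ({0<..<T} \<inter> {t. f t < r})"
    by (intro open_Int open_greaterThanLessThan open_Collect_less f continuous_on_const)
  moreover have "{0<..<T} \<inter> {t. f t < r} = ?A" by auto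
  ultimately have "open ?A" by simp
  have "AE t in lborel. t \<notin> ?A"
    using ae unfolding AE_time_measure by eventually_elim auto
  then have "?A \<in> null_sets lborel"
    using \<open>open ?A\<close> by (subst AE_iff_null_sets) auto
  then have "negligible ?A"
    by (simp add: negligible_iff_null_sets null_sets_completionI)
  then have "?A = {}" using open_not_negligible[OF \<open>open ?A\<close>] by blast
  then have ge: "r \<le> f t" if "t \<in> {0<..<T}" for t using that by force
  have "closed {t. r \<le> f t}"
    using closed_Collect_le[OF continuous_on_const f] .
  moreover have "{0<..<T} \<subseteq> {t. r \<le> f t}" using ge by auto
  ultimately have "closure {0<..<T} \<subseteq> {t. r \<le> f t}" by (metis closure_minimal)
  then show ?thesis using t T by auto
qed

text \<open>Chain rule for \<open>M\<^sup>2 / R\<close> with absolutely continuous \<open>M\<close> and \<open>R\<close>: the second-order remainder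
  of \<open>M\<^sup>2 / R\<close> is \<open>(v' - v) (\<Delta>M - v \<Delta>R)\<close> with \<open>v = M / R\<close>, which sums to zero over fine partitions
  because \<open>v\<close> is uniformly continuous and \<open>M\<close>, \<open>R\<close> have bounded variation.\<close>

theorem square_quotient_chain_rule:
  fixes H G :: "real \<Rightarrow> real"
  assumes T: "0 < T" and H: "integrable (time_measure T) H" and G: "integrable (time_measure T) G"
    and M_def: "\<And>t. M t = M0 + time_prim T H t" and R_def: "\<And>t. R t = R0 + time_prim T G t"
    and r: "0 < r" "\<And>t. t \<in> {0..T} \<Longrightarrow> r \<le> R t"
    and t: "t \<in> {0..T}"
  shows "(M t)\<^sup>2 / R t - M0\<^sup>2 / R0 = time_prim T (\<lambda>s. 2 * (M s / R s) * H s - (M s / R s)\<^sup>2 * G s) t"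
proof -
  define v where "v s = M s / R s" for s
  note [measurable] = time_integrable_borel[OF G] time_integrable_borel[OF H]
  have Mc: "continuous_on A M" and Rc: "continuous_on A R" for A
    unfolding M_def R_def
    by (intro continuous_on_add continuous_on_const continuous_on_subset[OF time_prim_continuous[OF H]]
      continuous_on_subset[OF time_prim_continuous[OF G]]; simp)+
  note [measurable] = borel_measurable_continuous_onI[OF Mc] borel_measurable_continuous_onI[OF Rc]
  have [measurable]: "v \<in> borel_measurable borel" unfolding v_def by measurable
  have vc: "continuous_on {0..T} v"
    unfolding v_def using r by (intro continuous_on_divide Mc Rc) force
  obtain V where V: "0 \<le> V" "\<And>s. s \<in> {0..T} \<Longrightarrow> \<bar>v s\<bar> \<le> V"
  proof -
    have "bounded (v ` {0..T})" by (intro compact_imp_bounded compact_continuous_image vc) simp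
    then obtain B where "\<forall>x\<in>v ` {0..T}. norm x \<le> B" unfolding bounded_iff by blast
    then show thesis using that[of "max 0 B"] by (auto simp: le_max_iff_disj)
  qed
  have uc: "uniformly_continuous_on {0..T} v"
    by (intro compact_uniformly_continuous vc) simp
  define j where "j s = 2 * v s * H s - (v s)\<^sup>2 * G s" for s
  have j: "integrable (time_measure T) j"
  proof (rule Bochner_Integration.integrable_bound)
    show "integrable (time_measure T) (\<lambda>s. 2 * V * \<bar>H s\<bar> + V\<^sup>2 * \<bar>G s\<bar>)" using H G by simp
    show "AE s in time_measure T. norm (j s) \<le> norm (2 * V * \<bar>H s\<bar> + V\<^sup>2 * \<bar>G s\<bar>)"
      using AE_time_measure_in[of T]
    proof eventually_elim
      case (elim s)
      have v: "\<bar>v s\<bar> \<le> V" using V elim by auto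
      have "\<bar>j s\<bar> \<le> \<bar>2 * v s * H s\<bar> + \<bar>(v s)\<^sup>2 * G s\<bar>" unfolding j_def by (rule abs_triangle_ineq4)
      also have "\<dots> \<le> 2 * V * \<bar>H s\<bar> + V\<^sup>2 * \<bar>G s\<bar>"
        unfolding abs_mult using v power_mono[OF v, of 2] by (intro add_mono mult_right_mono) auto
      finally show ?case by simp
    qed
  qed (simp add: j_def[abs_def])
  \<comment> \<open>\<open>q\<close> majorises the variation of both \<open>M\<close> and
    \<open>R\<close>. The errors on subintervals are proportional to its increments and therefore
    telescope.\<close>
  define q where "q = time_prim T (\<lambda>s. \<bar>H s\<bar> + \<bar>G s\<bar>)"
  have qi: "integrable (time_measure T) (\<lambda>s. \<bar>H s\<bar> + \<bar>G s\<bar>)" using H G by simp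
  define \<Phi> where "\<Phi> t = (M t)\<^sup>2 / R t - time_prim T j t" for t
  have cut: "integrable (time_measure T) (\<lambda>s. if a \<le> s \<and> s < b then f s else 0)" if "integrable (time_measure T) f" for f :: "real \<Rightarrow> real" and a b
    using time_integrable_borel[OF that] by (intro Bochner_Integration.integrable_bound[OF that]) auto
  \<comment> \<open>Of the factor 3, two units come from freezing \<open>v\<close> at the left end
    inside the integrand, and one from the second-order remainder.\<close>
  have step: "\<bar>\<Phi> t' - \<Phi> t\<bar> \<le> 3 * (1 + V) * e * (q t' - q t)"
    if tt: "0 \<le> t" "t \<le> t'" "t' \<le> T" and e: "0 < e" and osc: "\<And>s. t \<le> s \<Longrightarrow> s \<le> t' \<Longrightarrow> \<bar>v s - v t\<bar> \<le> e" for t t' e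
  proof -
    let ?I = "\<lambda>f. \<integral>s. (if t \<le> s \<and> s < t' then f s else 0) \<partial>time_measure T"
    define a b where "a = M t' - M t" and "b = R t' - R t"
    have a: "a = ?I H" and b: "b = ?I G" and qq: "q t' - q t = ?I (\<lambda>s. \<bar>H s\<bar> + \<bar>G s\<bar>)"
      and jj: "time_prim T j t' - time_prim T j t = ?I j"
      unfolding a_def b_def M_def R_def q_def
      using time_prim_diff[OF H tt(2)] time_prim_diff[OF G tt(2)] time_prim_diff[OF qi tt(2)] time_prim_diff[OF j tt(2)] by auto
    have Rp: "0 < R t" "0 < R t'" using r tt by (force intro: less_le_trans)+
    have Mv: "M t = v t * R t" "M t' = v t' * R t'" using Rp by (auto simp: v_def)
    have F: "(M t')\<^sup>2 / R t' - (M t)\<^sup>2 / R t = 2 * v t * a - (v t)\<^sup>2 * b + (v t' - v t) * (a - v t * b)"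
      using Rp unfolding a_def b_def Mv by (simp add: power2_eq_square algebra_simps)
    have absI: "\<bar>?I f\<bar> \<le> K * (q t' - q t)"
      if f: "integrable (time_measure T) f" and le: "\<And>s. t \<le> s \<Longrightarrow> s \<le> t' \<Longrightarrow> \<bar>f s\<bar> \<le> K * (\<bar>H s\<bar> + \<bar>G s\<bar>)" for f K
    proof -
      have "\<bar>?I f\<bar> \<le> (\<integral>s. \<bar>if t \<le> s \<and> s < t' then f s else 0\<bar> \<partial>time_measure T)"
        using integral_norm_bound[of "time_measure T" "\<lambda>s. if t \<le> s \<and> s < t' then f s else 0"] by simp
      also have "\<dots> \<le> (\<integral>s. K * (if t \<le> s \<and> s < t' then \<bar>H s\<bar> + \<bar>G s\<bar> else 0) \<partial>time_measure T)"
        by (intro integral_mono integrable_abs cut f integrable_mult_right qi) (use le in auto)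
      also have "\<dots> = K * (q t' - q t)" unfolding qq by (rule integral_mult_right_zero)
      finally show ?thesis .
    qed
    have vt: "\<bar>v s\<bar> \<le> V" if "t \<le> s" "s \<le> t'" for s using V that tt by auto
    have 1: "\<bar>2 * v t * a - (v t)\<^sup>2 * b - ?I j\<bar> \<le> 2 * (1 + V) * e * (q t' - q t)"
    proof -
      let ?f = "\<lambda>s. 2 * v t * H s - (v t)\<^sup>2 * G s - j s"
      have "2 * v t * a - (v t)\<^sup>2 * b - ?I j = (\<integral>s. 2 * v t * (if t \<le> s \<and> s < t' then H s else 0)
          - (v t)\<^sup>2 * (if t \<le> s \<and> s < t' then G s else 0) - (if t \<le> s \<and> s < t' then j s else 0) \<partial>time_measure T)"
        unfolding a b using cut[OF H] cut[OF G] cut[OF j] by simp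
      also have "\<dots> = ?I ?f" by (intro Bochner_Integration.integral_cong) auto
      finally have eq: "2 * v t * a - (v t)\<^sup>2 * b - ?I j = ?I ?f" .
      show ?thesis
        unfolding eq
      proof (rule absI)
        show "integrable (time_measure T) ?f" using H G j by simp
        fix s assume s: "t \<le> s" "s \<le> t'"
        have "?f s = 2 * (v t - v s) * H s - (v t - v s) * (v t + v s) * G s"
          by (simp add: j_def power2_eq_square algebra_simps)
        also have "\<bar>\<dots>\<bar> \<le> \<bar>2 * (v t - v s) * H s\<bar> + \<bar>(v t - v s) * (v t + v s) * G s\<bar>" by (rule abs_triangle_ineq4)
        also have "\<dots> \<le> 2 * e * \<bar>H s\<bar> + e * (2 * V) * \<bar>G s\<bar>"
        proof -
          have "\<bar>v t - v s\<bar> \<le> e" using osc[OF s] by (simp add: abs_minus_commute)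
          moreover have "\<bar>v t + v s\<bar> \<le> 2 * V" using vt[OF s] vt[of t] tt by (auto intro: order_trans[OF abs_triangle_ineq])
          ultimately show ?thesis unfolding abs_mult using e V by (intro add_mono mult_right_mono mult_mono) auto
        qed
        also have "\<dots> \<le> 2 * (1 + V) * e * (\<bar>H s\<bar> + \<bar>G s\<bar>)"
          using e V by (simp add: algebra_simps)
        finally show "\<bar>?f s\<bar> \<le> 2 * (1 + V) * e * (\<bar>H s\<bar> + \<bar>G s\<bar>)" .
      qed
    qed
    have 2: "\<bar>(v t' - v t) * (a - v t * b)\<bar> \<le> (1 + V) * e * (q t' - q t)"
    proof -
      have "\<bar>a - v t * b\<bar> \<le> (1 + V) * (q t' - q t)"
      proof -
        have "\<bar>a\<bar> \<le> 1 * (q t' - q t)" "\<bar>b\<bar> \<le> 1 * (q t' - q t)"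
          unfolding a b by (rule absI; use H G in simp)+
        moreover from this have "\<bar>v t\<bar> * \<bar>b\<bar> \<le> V * (1 * (q t' - q t))"
          using vt[of t] tt V by (intro mult_mono) auto
        moreover have "\<bar>a - v t * b\<bar> \<le> \<bar>a\<bar> + \<bar>v t\<bar> * \<bar>b\<bar>"
          using abs_triangle_ineq4[of a "v t * b"] by (simp add: abs_mult)
        ultimately have "\<bar>a - v t * b\<bar> \<le> 1 * (q t' - q t) + V * (1 * (q t' - q t))" by linarith
        then show ?thesis by (simp add: distrib_right)
      qed
      then have "\<bar>v t' - v t\<bar> * \<bar>a - v t * b\<bar> \<le> e * ((1 + V) * (q t' - q t))"
        using osc[of t'] tt e by (intro mult_mono) auto
      then show ?thesis by (simp add: abs_mult mult_ac)
    qed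
    have "\<Phi> t' - \<Phi> t = (2 * v t * a - (v t)\<^sup>2 * b - ?I j) + (v t' - v t) * (a - v t * b)"
      unfolding \<Phi>_def using F jj by simp
    then have "\<bar>\<Phi> t' - \<Phi> t\<bar> \<le> 2 * (1 + V) * e * (q t' - q t) + (1 + V) * e * (q t' - q t)"
      using 1 2 by linarith
    then show ?thesis by (simp add: algebra_simps)
  qed
  have small: "\<bar>\<Phi> t - \<Phi> 0\<bar> \<le> 3 * (1 + V) * e * q t" if e: "0 < e" for e
  proof -
    obtain d where d: "0 < d" "\<And>s s'. s \<in> {0..T} \<Longrightarrow> s' \<in> {0..T} \<Longrightarrow> \<bar>s - s'\<bar> < d \<Longrightarrow> \<bar>v s - v s'\<bar> < e"
      using uc[unfolded uniformly_continuous_on_def, rule_format, OF e] by (auto simp: dist_real_def)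
    obtain n where n: "t / d < real n" using reals_Archimedean2 by blast
    have "0 \<le> t / d" using t d by simp
    then have n0: "0 < real n" using n by linarith
    then have n1: "t / real n < d" using n d by (simp add: field_simps)
    define p where "p k = t * (real k / real n)" for k
    have "k \<le> n \<Longrightarrow> \<bar>\<Phi> (p k) - \<Phi> 0\<bar> \<le> 3 * (1 + V) * e * q (p k)" for k
    proof (induction k)
      case 0
      show ?case by (simp add: p_def q_def time_prim_0)
    next
      case (Suc k)
      have pk: "0 \<le> p k" "p k \<le> p (Suc k)" "p (Suc k) \<le> T" "p (Suc k) - p k < d"
      proof -
        show "0 \<le> p k" "p k \<le> p (Suc k)" using t n0 by (auto simp: p_def intro!: mult_left_mono divide_right_mono)
        have "p (Suc k) \<le> t * 1" unfolding p_def using t n0 Suc.prems by (intro mult_left_mono) auto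
        then show "p (Suc k) \<le> T" using t by simp
        show "p (Suc k) - p k < d" using n0 n1 by (simp add: p_def field_simps)
      qed
      have "\<bar>\<Phi> (p (Suc k)) - \<Phi> (p k)\<bar> \<le> 3 * (1 + V) * e * (q (p (Suc k)) - q (p k))"
        by (rule step[OF pk(1-3) e], rule less_imp_le, rule d(2)) (use pk in auto)
      moreover have "\<bar>\<Phi> (p k) - \<Phi> 0\<bar> \<le> 3 * (1 + V) * e * q (p k)" using Suc by simp
      ultimately have "\<bar>\<Phi> (p (Suc k)) - \<Phi> 0\<bar> \<le> 3 * (1 + V) * e * (q (p (Suc k)) - q (p k)) + 3 * (1 + V) * e * q (p k)"
        by linarith
      then show ?case by (simp add: algebra_simps)
    qed
    from this[of n] show ?thesis using n0 by (simp add: p_def)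
  qed
  have "\<Phi> t = \<Phi> 0"
  proof (rule ccontr)
    assume ne: "\<Phi> t \<noteq> \<Phi> 0"
    define A where "A = \<bar>3 * (1 + V) * q t\<bar> + 1"
    have A: "0 < A" by (simp add: A_def)
    define x where "x = \<bar>\<Phi> t - \<Phi> 0\<bar>"
    have x: "0 < x" using ne by (simp add: x_def)
    have "x \<le> 3 * (1 + V) * (x / A) * q t" unfolding x_def[symmetric] using small[of "x / A"] x A by (simp add: x_def)
    also have "\<dots> = (3 * (1 + V) * q t) * (x / A)" by simp
    also have "\<dots> \<le> (A - 1) * (x / A)" using x A by (intro mult_right_mono) (auto simp: A_def)
    also have "\<dots> < x" using x A by (simp add: field_simps)
    finally show False by simp
  qed
  then show ?thesis
    unfolding \<Phi>_def j_def v_def by (simp add: time_prim_0 M_def[of 0] R_def[of 0])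
qed

section \<open>The mollified energy balance\<close>

lemma sets_torus_time [measurable_cong]:
  "sets ((torus :: (real^'n) measure) \<Otimes>\<^sub>M time_measure T) = sets (borel \<Otimes>\<^sub>M borel)"
  by (intro sets_pair_measure_cong) simp_all

lemma time_test_deriv:
  assumes "time_test T \<theta>" "\<And>t. (\<theta> has_real_derivative \<theta>' t) (at t)"
  shows "time_test T \<theta>'"
proof -
  from assms(1) obtain a b where ab: "0 < a" "a \<le> b" "b < T" "\<And>t. t \<notin> {a..b} \<Longrightarrow> \<theta> t = 0" and sm: "smooth \<theta>"
    by (auto simp: time_test_def)
  have "\<theta>' t = 0" if "t \<notin> {a..b}" for t
  proof -
    have "((\<lambda>_. 0) has_real_derivative \<theta>' t) (at t)"
      by (rule has_field_derivative_transform_within_open[OF assms(2), where S="- {a..b}"])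
        (use that ab(4) in auto)
    then show ?thesis using DERIV_const DERIV_unique by blast
  qed
  then show ?thesis using ab smooth_real_derivative[OF assms(2)] sm unfolding time_test_def by blast
qed

text \<open>The weak equations are tested with a translated mollifier times a function of time; the
  minus signs stem from differentiating \<open>\<eta> (x - y)\<close> in \<open>y\<close>. The
  initial values are abstract functions, which keeps questions about the integrability of the
  initial data out of this locale.\<close>

locale flow = mollifier \<kappa> C \<eta> K
  for \<kappa> C :: real and \<eta> :: "real^'n \<Rightarrow> real" and K :: "'n \<Rightarrow> real^'n \<Rightarrow> real" +
  fixes T c :: real and \<rho> :: "real^'n \<Rightarrow> real \<Rightarrow> real" and u :: "real^'n \<Rightarrow> real \<Rightarrow> real^'n"
    and P :: "real^'n \<Rightarrow> real \<Rightarrow> real" and R0 :: "real^'n \<Rightarrow> real" and M0 :: "'n \<Rightarrow> real^'n \<Rightarrow> real"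
  assumes T: "0 < T" and c1: "1 \<le> c"
    and rho_meas [measurable]: "(\<lambda>(x, t). \<rho> x t) \<in> borel_measurable (borel \<Otimes>\<^sub>M borel)"
    and u_meas [measurable]: "(\<lambda>(x, t). u x t) \<in> borel_measurable (borel \<Otimes>\<^sub>M borel)"
    and P_meas [measurable]: "(\<lambda>(x, t). P x t) \<in> borel_measurable (borel \<Otimes>\<^sub>M borel)"
    and R0_meas [measurable]: "R0 \<in> borel_measurable borel"
    and M0_meas [measurable]: "M0 i \<in> borel_measurable borel"
    and rho_ge: "1 / c \<le> \<rho> y t" and rho_le: "\<rho> y t \<le> c"
    and u3: "integrable (torus \<Otimes>\<^sub>M time_measure T) (\<lambda>(y, t). norm (u y t) ^ 3)"
    and P32: "integrable (torus \<Otimes>\<^sub>M time_measure T) (\<lambda>(y, t). \<bar>P y t\<bar> powr (3/2))"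
    and weak_mass: "\<And>\<theta> \<theta>' x. time_test T \<theta> \<Longrightarrow> (\<And>t. (\<theta> has_real_derivative \<theta>' t) (at t)) \<Longrightarrow>
      (\<integral>(y, t). \<rho> y t * (\<eta> (x - y) * \<theta>' t) - (\<Sum>j\<in>UNIV. \<rho> y t * u y t $ j * (K j (x - y) * \<theta> t))
        \<partial>(torus \<Otimes>\<^sub>M time_measure T)) = 0"
    and weak_momentum: "\<And>\<theta> \<theta>' x i. time_test T \<theta> \<Longrightarrow> (\<And>t. (\<theta> has_real_derivative \<theta>' t) (at t)) \<Longrightarrow>
      (\<integral>(y, t). \<rho> y t * u y t $ i * (\<eta> (x - y) * \<theta>' t)
         - (\<Sum>j\<in>UNIV. \<rho> y t * u y t $ i * u y t $ j * (K j (x - y) * \<theta> t)) - P y t * (K i (x - y) * \<theta> t)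
        \<partial>(torus \<Otimes>\<^sub>M time_measure T)) = 0"
    and weak_div: "\<And>\<theta> x. time_test T \<theta> \<Longrightarrow>
      (\<integral>(y, t). (\<Sum>j\<in>UNIV. u y t $ j * (K j (x - y) * \<theta> t)) \<partial>(torus \<Otimes>\<^sub>M time_measure T)) = 0"
    and init_mass: "\<And>x e. 0 < e \<Longrightarrow> \<exists>\<delta>>0. AE t in time_measure T. t < \<delta> \<longrightarrow>
        \<bar>conv \<eta> (\<lambda>y. \<rho> y t) x - R0 x\<bar> < e"
    and init_momentum: "\<And>x e i. 0 < e \<Longrightarrow> \<exists>\<delta>>0. AE t in time_measure T. t < \<delta> \<longrightarrow>
        \<bar>conv \<eta> (\<lambda>y. \<rho> y t * u y t $ i) x - M0 i x\<bar> < e"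
begin

sublocale pair_sigma_finite "torus :: (real^'n) measure" "time_measure T" ..

abbreviation "space_time \<equiv> (torus :: (real^'n) measure) \<Otimes>\<^sub>M time_measure T"

lemma finite_space_time: "finite_measure space_time"
proof (rule finite_measureI)
  have "emeasure space_time (UNIV \<times> UNIV) = emeasure (torus :: (real^'n) measure) UNIV * emeasure (time_measure T) UNIV"
    by (rule time.emeasure_pair_measure_Times) auto
  then show "emeasure space_time (space space_time) \<noteq> \<infinity>"
    using time.emeasure_finite[of T UNIV] by (simp add: space_pair_measure emeasure_torus_UNIV)
qed

lemma rho_pos: "0 < \<rho> y t"
  using rho_ge[of y t] c1 by (smt (verit) divide_pos_pos)

lemma AE_state: "AE t in time_measure T. torus_state \<kappa> C \<eta> K (\<lambda>y. \<rho> y t) (\<lambda>y. u y t) (\<lambda>y. P y t) c"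
proof -
  have "AE t in time_measure T. integrable torus (\<lambda>y. norm (u y t) ^ 3)"
    using AE_integrable_snd[of "\<lambda>y t. norm (u y t) ^ 3"] u3 by simp
  moreover have "AE t in time_measure T. integrable torus (\<lambda>y. \<bar>P y t\<bar> powr (3/2))"
    using AE_integrable_snd[of "\<lambda>y t. \<bar>P y t\<bar> powr (3/2)"] P32 by simp
  ultimately show ?thesis
  proof eventually_elim
    case (elim t)
    show ?case
      by unfold_locales (use elim c1 rho_ge rho_le in \<open>simp_all, measurable\<close>)
  qed
qed

lemma integrable_le_pair_cube:
  assumes [measurable]: "(\<lambda>(y, t). f y t) \<in> borel_measurable (borel \<Otimes>\<^sub>M borel)"
    and le: "\<And>y t. \<bar>f y t\<bar> \<le> A * (1 + norm (u y t) ^ 3)"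
  shows "integrable space_time (\<lambda>(y, t). f y t)"
proof (rule Bochner_Integration.integrable_bound)
  interpret finite_measure space_time by (rule finite_space_time)
  have "integrable space_time (\<lambda>z. A * (1 + (case z of (y, t) \<Rightarrow> norm (u y t) ^ 3)))"
    using u3 by (intro integrable_mult_right Bochner_Integration.integrable_add) auto
  moreover have "(\<lambda>(y, t). A * (1 + norm (u y t) ^ 3)) = (\<lambda>z. A * (1 + (case z of (y, t) \<Rightarrow> norm (u y t) ^ 3)))"
    by auto
  ultimately show "integrable space_time (\<lambda>(y, t). A * (1 + norm (u y t) ^ 3))"
    by (simp only:)
  show "AE z in space_time. norm (case z of (y, t) \<Rightarrow> f y t) \<le> norm (case z of (y, t) \<Rightarrow> A * (1 + norm (u y t) ^ 3))"
    by (intro AE_I2) (use le in \<open>auto split: prod.split intro: order_trans[OF _ abs_ge_self]\<close>)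
qed measurable

lemma cube_ge: "norm (u y t) \<le> 1 + norm (u y t) ^ 3" "(norm (u y t))\<^sup>2 \<le> 1 + norm (u y t) ^ 3"
proof -
  have "0 \<le> s \<Longrightarrow> s \<le> 1 + s ^ 3 \<and> s\<^sup>2 \<le> 1 + s ^ 3" for s :: real
  proof (cases "s \<le> 1")
    case False
    then have "s \<le> s ^ 3" "s ^ 2 \<le> s ^ 3" by (auto intro!: power_increasing self_le_power)
    then show ?thesis by simp
  next
    case True
    then show "0 \<le> s \<Longrightarrow> ?thesis" using power_le_one[of s 2] by (smt (verit) zero_le_power)
  qed
  then show "norm (u y t) \<le> 1 + norm (u y t) ^ 3" "(norm (u y t))\<^sup>2 \<le> 1 + norm (u y t) ^ 3" by auto
qed

lemma
  shows pair_int_rho: "integrable space_time (\<lambda>(y, t). \<rho> y t)"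
    and pair_int_u: "integrable space_time (\<lambda>(y, t). u y t $ i)"
    and pair_int_rho_u: "integrable space_time (\<lambda>(y, t). \<rho> y t * u y t $ i)"
    and pair_int_rho_uu: "integrable space_time (\<lambda>(y, t). \<rho> y t * u y t $ i * u y t $ j)"
    and pair_int_P: "integrable space_time (\<lambda>(y, t). P y t)"
proof -
  have rc: "\<bar>\<rho> y t\<bar> \<le> c" for y t using rho_pos[of y t] rho_le[of y t] by simp
  have ui: "\<bar>u y t $ i\<bar> \<le> norm (u y t)" for y t i by (rule component_le_norm_cart)
  have c0: "0 \<le> c" using c1 by simp
  show "integrable space_time (\<lambda>(y, t). \<rho> y t)"
  proof (rule integrable_le_pair_cube[where A=c])
    show "\<bar>\<rho> y t\<bar> \<le> c * (1 + norm (u y t) ^ 3)" for y t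
      using rc[of y t] mult_left_mono[OF _ c0, of 1 "1 + norm (u y t) ^ 3"] by simp
  qed measurable
  show "integrable space_time (\<lambda>(y, t). u y t $ i)"
  proof (rule integrable_le_pair_cube[where A=1])
    show "\<bar>u y t $ i\<bar> \<le> 1 * (1 + norm (u y t) ^ 3)" for y t
      using order_trans[OF ui cube_ge(1)] by simp
  qed measurable
  show "integrable space_time (\<lambda>(y, t). \<rho> y t * u y t $ i)"
  proof (rule integrable_le_pair_cube[where A=c])
    show "\<bar>\<rho> y t * u y t $ i\<bar> \<le> c * (1 + norm (u y t) ^ 3)" for y t
      unfolding abs_mult using rc c0 order_trans[OF ui cube_ge(1)] by (intro mult_mono) auto
  qed measurable
  show "integrable space_time (\<lambda>(y, t). \<rho> y t * u y t $ i * u y t $ j)"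
  proof (rule integrable_le_pair_cube[where A=c])
    fix y t
    have "\<bar>u y t $ i\<bar> * \<bar>u y t $ j\<bar> \<le> norm (u y t) * norm (u y t)" by (intro mult_mono ui) auto
    also have "\<dots> \<le> 1 + norm (u y t) ^ 3" using cube_ge(2)[of y t] by (simp add: power2_eq_square)
    finally show "\<bar>\<rho> y t * u y t $ i * u y t $ j\<bar> \<le> c * (1 + norm (u y t) ^ 3)"
      unfolding abs_mult mult.assoc using rc c0 by (intro mult_mono) auto
  qed measurable
  show "integrable space_time (\<lambda>(y, t). P y t)"
  proof (rule Bochner_Integration.integrable_bound)
    interpret finite_measure space_time by (rule finite_space_time)
    have "integrable space_time (\<lambda>z. 1 + (case z of (y, t) \<Rightarrow> \<bar>P y t\<bar> powr (3/2)))"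
      using P32 by (intro Bochner_Integration.integrable_add) auto
    then show "integrable space_time (\<lambda>(y, t). 1 + \<bar>P y t\<bar> powr (3/2))" by (simp add: case_prod_beta')
    have "\<bar>P y t\<bar> \<le> 1 + \<bar>P y t\<bar> powr (3/2)" for y t
    proof (cases "\<bar>P y t\<bar> \<le> 1")
      case False
      then have "\<bar>P y t\<bar> powr 1 \<le> \<bar>P y t\<bar> powr (3/2)" by (intro powr_mono) auto
      then show ?thesis using False by simp
    qed (smt (verit) powr_ge_zero)
    then show "AE z in space_time. norm (case z of (y, t) \<Rightarrow> P y t) \<le> norm (case z of (y, t) \<Rightarrow> 1 + \<bar>P y t\<bar> powr (3/2))"
      by (intro AE_I2) (auto split: prod.split)
  qed measurable
qed

lemma pair_kernel_integrable:
  assumes k: "kernel_fun k" and f: "integrable space_time (\<lambda>(y, t). f y t)"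
  shows "integrable space_time (\<lambda>(y, t). k (x - y) * f y t)"
proof -
  obtain B where B: "0 \<le> B" "\<And>x. \<bar>k x\<bar> \<le> B" using kernel_fun_bounded[OF k] by blast
  note [measurable] = kernel_fun_borel[OF k] borel_measurable_integrable[OF f]
  show ?thesis
  proof (rule Bochner_Integration.integrable_bound[of _ "\<lambda>z. B * (case z of (y, t) \<Rightarrow> f y t)"])
    show "integrable space_time (\<lambda>z. B * (case z of (y, t) \<Rightarrow> f y t))" using f by simp
    show "AE z in space_time. norm (case z of (y, t) \<Rightarrow> k (x - y) * f y t) \<le> norm (B * (case z of (y, t) \<Rightarrow> f y t))"
      using B by (intro AE_I2) (auto simp: abs_mult split: prod.split intro!: mult_right_mono)
  qed measurable
qed

lemma conv_time_integrable:
  assumes "kernel_fun k" "integrable space_time (\<lambda>(y, t). f y t)"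
  shows "integrable (time_measure T) (\<lambda>t. conv k (\<lambda>y. f y t) x)"
  unfolding conv_def
  using integrable_snd[of "\<lambda>y t. k (x - y) * f y t"] pair_kernel_integrable[OF assms, of x] by simp

lemma pair_kernel_test_integrable:
  assumes k: "kernel_fun k" and f: "integrable space_time (\<lambda>(y, t). f y t)" and \<theta>: "time_test T \<theta>"
  shows "integrable space_time (\<lambda>(y, t). f y t * (k (x - y) * \<theta> t))"
proof -
  obtain B where B: "0 \<le> B" "\<And>t. \<bar>\<theta> t\<bar> \<le> B" using time_test_bounded[OF \<theta>] by blast
  note i = pair_kernel_integrable[OF k f, of x]
  note [measurable] = time_test_borel[OF \<theta>] kernel_fun_borel[OF k] borel_measurable_integrable[OF f]
  show ?thesis
  proof (rule Bochner_Integration.integrable_bound[of _ "\<lambda>z. B * (case z of (y, t) \<Rightarrow> k (x - y) * f y t)"])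
    show "integrable space_time (\<lambda>z. B * (case z of (y, t) \<Rightarrow> k (x - y) * f y t))" using i by simp
    show "AE z in space_time. norm (case z of (y, t) \<Rightarrow> f y t * (k (x - y) * \<theta> t)) \<le> norm (B * (case z of (y, t) \<Rightarrow> k (x - y) * f y t))"
    proof (intro AE_I2, clarsimp split: prod.split)
      fix y t
      have "\<bar>\<theta> t\<bar> * \<bar>k (x - y) * f y t\<bar> \<le> \<bar>B\<bar> * \<bar>k (x - y) * f y t\<bar>" using B by (intro mult_right_mono) auto
      then show "\<bar>f y t * (k (x - y) * \<theta> t)\<bar> \<le> \<bar>B * (k (x - y) * f y t)\<bar>" by (simp add: abs_mult mult_ac)
    qed
  qed measurable
qed

lemma pair_kernel_test_integral:
  assumes k: "kernel_fun k" and f: "integrable space_time (\<lambda>(y, t). f y t)" and \<theta>: "time_test T \<theta>"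
  shows "(\<integral>(y, t). f y t * (k (x - y) * \<theta> t) \<partial>space_time) = (\<integral>t. conv k (\<lambda>y. f y t) x * \<theta> t \<partial>time_measure T)"
proof -
  have "(\<integral>(y, t). f y t * (k (x - y) * \<theta> t) \<partial>space_time) = (\<integral>t. \<integral>y. f y t * (k (x - y) * \<theta> t) \<partial>torus \<partial>time_measure T)"
    by (rule integral_snd[symmetric, OF pair_kernel_test_integrable[OF assms]])
  also have "\<dots> = (\<integral>t. conv k (\<lambda>y. f y t) x * \<theta> t \<partial>time_measure T)"
    unfolding conv_def by (subst integral_mult_left_zero[symmetric]) (simp add: mult_ac)
  finally show ?thesis .
qed

lemma conv_test_integrable:
  assumes k: "kernel_fun k" and f: "integrable space_time (\<lambda>(y, t). f y t)" and \<theta>: "time_test T \<theta>"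
  shows "integrable (time_measure T) (\<lambda>t. conv k (\<lambda>y. f y t) x * \<theta> t)"
proof -
  obtain B where B: "\<And>t. \<bar>\<theta> t\<bar> \<le> B" using time_test_bounded[OF \<theta>] by blast
  show ?thesis
    using time_integrable_bounded_mult[OF conv_time_integrable[OF k f] time_test_borel[OF \<theta>] B]
    by (simp add: mult.commute)
qed

abbreviation "vt t \<equiv> favre \<eta> (\<lambda>y. \<rho> y t) (\<lambda>y. u y t)"
definition "rt x t = conv \<eta> (\<lambda>y. \<rho> y t) x"
definition "mt i x t = conv \<eta> (\<lambda>y. \<rho> y t * u y t $ i) x"
definition "drt x t = - (\<Sum>j\<in>UNIV. conv (K j) (\<lambda>y. \<rho> y t * u y t $ j) x)"
definition "dmt i x t = - (\<Sum>j\<in>UNIV. conv (K j) (\<lambda>y. \<rho> y t * u y t $ i * u y t $ j) x) - conv (K i) (\<lambda>y. P y t) x"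
abbreviation "flux t \<equiv> energy_flux \<eta> K (\<lambda>y. \<rho> y t) (\<lambda>y. u y t) (\<lambda>y. P y t)"

lemma drt_integrable: "integrable (time_measure T) (drt x)"
  unfolding drt_def[abs_def]
  by (intro Bochner_Integration.integrable_minus Bochner_Integration.integrable_sum conv_time_integrable kernel_K pair_int_rho_u)

lemma dmt_integrable: "integrable (time_measure T) (dmt i x)"
  unfolding dmt_def[abs_def]
  by (intro Bochner_Integration.integrable_diff Bochner_Integration.integrable_minus Bochner_Integration.integrable_sum
      conv_time_integrable kernel_K pair_int_rho_uu pair_int_P)

lemma rt_integrable: "integrable (time_measure T) (rt x)"
  and mt_integrable: "integrable (time_measure T) (mt i x)"
  unfolding rt_def[abs_def] mt_def[abs_def]
  by (intro conv_time_integrable kernel_eta pair_int_rho pair_int_rho_u)+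

text \<open>For each fixed \<open>x\<close>, Fubini turns the weak continuity equation into a weak
  ordinary differential equation for \<open>rt x\<close>, to which
  \<open>weak_time_derivative\<close> applies.\<close>

lemma rt_prim: "AE t in time_measure T. rt x t = R0 x + time_prim T (drt x) t"
proof (rule weak_time_derivative[OF T rt_integrable drt_integrable])
  fix \<theta> \<theta>' assume \<theta>: "time_test T \<theta>" "\<And>t. (\<theta> has_real_derivative \<theta>' t) (at t)"
  note \<theta>' = time_test_deriv[OF \<theta>]
  have i1: "integrable space_time (\<lambda>(y, t). \<rho> y t * (\<eta> (x - y) * \<theta>' t))"
    by (rule pair_kernel_test_integrable[OF kernel_eta pair_int_rho \<theta>'])
  have i2: "integrable space_time (\<lambda>(y, t). \<rho> y t * u y t $ j * (K j (x - y) * \<theta> t))" for j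
    by (rule pair_kernel_test_integrable[OF kernel_K pair_int_rho_u \<theta>(1)])
  have "0 = (\<integral>z. (case z of (y, t) \<Rightarrow> \<rho> y t * (\<eta> (x - y) * \<theta>' t)) - (\<Sum>j\<in>UNIV. (case z of (y, t) \<Rightarrow> \<rho> y t * u y t $ j * (K j (x - y) * \<theta> t))) \<partial>space_time)"
    using weak_mass[OF \<theta>, of x] by (simp add: case_prod_beta')
  also have "\<dots> = (\<integral>z. (case z of (y, t) \<Rightarrow> \<rho> y t * (\<eta> (x - y) * \<theta>' t)) \<partial>space_time)
     - (\<Sum>j\<in>UNIV. \<integral>z. (case z of (y, t) \<Rightarrow> \<rho> y t * u y t $ j * (K j (x - y) * \<theta> t)) \<partial>space_time)"
    using i1 i2 by (subst Bochner_Integration.integral_diff) (auto intro!: Bochner_Integration.integrable_sum Bochner_Integration.integral_sum)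
  also have "\<dots> = (\<integral>t. rt x t * \<theta>' t \<partial>time_measure T) - (\<Sum>j\<in>UNIV. \<integral>t. conv (K j) (\<lambda>y. \<rho> y t * u y t $ j) x * \<theta> t \<partial>time_measure T)"
    by (simp add: pair_kernel_test_integral[OF kernel_eta pair_int_rho \<theta>'] pair_kernel_test_integral[OF kernel_K pair_int_rho_u \<theta>(1)] rt_def)
  also have "\<dots> = (\<integral>t. rt x t * \<theta>' t \<partial>time_measure T) - (\<integral>t. (\<Sum>j\<in>UNIV. conv (K j) (\<lambda>y. \<rho> y t * u y t $ j) x * \<theta> t) \<partial>time_measure T)"
    by (subst Bochner_Integration.integral_sum) (auto intro: conv_test_integrable kernel_K pair_int_rho_u \<theta>)
  also have "\<dots> = (\<integral>t. rt x t * \<theta>' t - (\<Sum>j\<in>UNIV. conv (K j) (\<lambda>y. \<rho> y t * u y t $ j) x * \<theta> t) \<partial>time_measure T)"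
    unfolding rt_def
    by (rule Bochner_Integration.integral_diff[symmetric])
      (intro conv_test_integrable Bochner_Integration.integrable_sum kernel_eta kernel_K pair_int_rho pair_int_rho_u \<theta> \<theta>')+
  also have "\<dots> = (\<integral>t. rt x t * \<theta>' t + drt x t * \<theta> t \<partial>time_measure T)"
    by (simp add: drt_def sum_distrib_right)
  finally show "(\<integral>t. rt x t * \<theta>' t + drt x t * \<theta> t \<partial>time_measure T) = 0" by simp
qed (use init_mass in \<open>simp add: rt_def\<close>)

lemma mt_prim: "AE t in time_measure T. mt i x t = M0 i x + time_prim T (dmt i x) t"
proof (rule weak_time_derivative[OF T mt_integrable dmt_integrable])
  fix \<theta> \<theta>' assume \<theta>: "time_test T \<theta>" "\<And>t. (\<theta> has_real_derivative \<theta>' t) (at t)"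
  note \<theta>' = time_test_deriv[OF \<theta>]
  have i1: "integrable space_time (\<lambda>(y, t). \<rho> y t * u y t $ i * (\<eta> (x - y) * \<theta>' t))"
    by (rule pair_kernel_test_integrable[OF kernel_eta pair_int_rho_u \<theta>'])
  have i2: "integrable space_time (\<lambda>(y, t). \<rho> y t * u y t $ i * u y t $ j * (K j (x - y) * \<theta> t))" for j
    by (rule pair_kernel_test_integrable[OF kernel_K pair_int_rho_uu \<theta>(1)])
  have i3: "integrable space_time (\<lambda>(y, t). P y t * (K i (x - y) * \<theta> t))"
    by (rule pair_kernel_test_integrable[OF kernel_K pair_int_P \<theta>(1)])
  have "0 = (\<integral>z. (case z of (y, t) \<Rightarrow> \<rho> y t * u y t $ i * (\<eta> (x - y) * \<theta>' t))
     - (\<Sum>j\<in>UNIV. (case z of (y, t) \<Rightarrow> \<rho> y t * u y t $ i * u y t $ j * (K j (x - y) * \<theta> t)))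
     - (case z of (y, t) \<Rightarrow> P y t * (K i (x - y) * \<theta> t)) \<partial>space_time)"
    using weak_momentum[OF \<theta>, of i x] by (simp add: case_prod_beta')
  also have "\<dots> = (\<integral>z. (case z of (y, t) \<Rightarrow> \<rho> y t * u y t $ i * (\<eta> (x - y) * \<theta>' t)) \<partial>space_time)
     - (\<Sum>j\<in>UNIV. \<integral>z. (case z of (y, t) \<Rightarrow> \<rho> y t * u y t $ i * u y t $ j * (K j (x - y) * \<theta> t)) \<partial>space_time)
     - (\<integral>z. (case z of (y, t) \<Rightarrow> P y t * (K i (x - y) * \<theta> t)) \<partial>space_time)"
    using i1 i2 i3 by (simp add: Bochner_Integration.integral_sum[OF i2])
  also have "\<dots> = (\<integral>t. mt i x t * \<theta>' t \<partial>time_measure T)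
     - (\<Sum>j\<in>UNIV. \<integral>t. conv (K j) (\<lambda>y. \<rho> y t * u y t $ i * u y t $ j) x * \<theta> t \<partial>time_measure T)
     - (\<integral>t. conv (K i) (\<lambda>y. P y t) x * \<theta> t \<partial>time_measure T)"
    by (simp add: pair_kernel_test_integral[OF kernel_eta pair_int_rho_u \<theta>'] pair_kernel_test_integral[OF kernel_K pair_int_rho_uu \<theta>(1)]
        pair_kernel_test_integral[OF kernel_K pair_int_P \<theta>(1)] mt_def)
  also have "\<dots> = (\<integral>t. mt i x t * \<theta>' t - (\<Sum>j\<in>UNIV. conv (K j) (\<lambda>y. \<rho> y t * u y t $ i * u y t $ j) x * \<theta> t)
      - conv (K i) (\<lambda>y. P y t) x * \<theta> t \<partial>time_measure T)"
  proof -
    have a: "integrable (time_measure T) (\<lambda>t. mt i x t * \<theta>' t)"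
      unfolding mt_def by (intro conv_test_integrable kernel_eta pair_int_rho_u \<theta>')
    have b: "integrable (time_measure T) (\<lambda>t. conv (K j) (\<lambda>y. \<rho> y t * u y t $ i * u y t $ j) x * \<theta> t)" for j
      by (intro conv_test_integrable kernel_K pair_int_rho_uu \<theta>)
    have c: "integrable (time_measure T) (\<lambda>t. conv (K i) (\<lambda>y. P y t) x * \<theta> t)"
      by (intro conv_test_integrable kernel_K pair_int_P \<theta>)
    show ?thesis
      using a b c by (simp add: Bochner_Integration.integral_sum[OF b])
  qed
  also have "\<dots> = (\<integral>t. mt i x t * \<theta>' t + dmt i x t * \<theta> t \<partial>time_measure T)"
    by (intro Bochner_Integration.integral_cong refl) (simp add: dmt_def left_diff_distrib sum_distrib_right)
  finally show "(\<integral>t. mt i x t * \<theta>' t + dmt i x t * \<theta> t \<partial>time_measure T) = 0" by simp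
qed (use init_momentum in \<open>simp add: mt_def\<close>)

text \<open>Testing gives a null set of times for each \<open>x\<close>. A countable dense set of
  points and the continuity of the convolutions in \<open>x\<close> yield one null set for all
  \<open>x\<close>, as the product rule in \<open>transport_mean_zero\<close> requires.\<close>

lemma AE_div_free: "AE t in time_measure T. \<forall>x. (\<Sum>j\<in>UNIV. conv (K j) (\<lambda>y. u y t $ j) x) = 0"
proof -
  define dv where "dv x t = (\<Sum>j\<in>UNIV. conv (K j) (\<lambda>y. u y t $ j) x)" for x t
  have each: "AE t in time_measure T. dv x t = 0" for x
  proof (rule time_fundamental_lemma)
    show "integrable (time_measure T) (dv x)"
      unfolding dv_def[abs_def] by (intro Bochner_Integration.integrable_sum conv_time_integrable kernel_K pair_int_u)
    fix \<theta> assume \<theta>: "time_test T \<theta>"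
    have i: "integrable space_time (\<lambda>(y, t). u y t $ j * (K j (x - y) * \<theta> t))" for j
      by (rule pair_kernel_test_integrable[OF kernel_K pair_int_u \<theta>])
    have "0 = (\<integral>z. (\<Sum>j\<in>UNIV. (case z of (y, t) \<Rightarrow> u y t $ j * (K j (x - y) * \<theta> t))) \<partial>space_time)"
      using weak_div[OF \<theta>, of x] by (simp add: case_prod_beta')
    also have "\<dots> = (\<Sum>j\<in>UNIV. \<integral>t. conv (K j) (\<lambda>y. u y t $ j) x * \<theta> t \<partial>time_measure T)"
      by (simp add: Bochner_Integration.integral_sum[OF i] pair_kernel_test_integral[OF kernel_K pair_int_u \<theta>])
    also have "\<dots> = (\<integral>t. (\<Sum>j\<in>UNIV. conv (K j) (\<lambda>y. u y t $ j) x * \<theta> t) \<partial>time_measure T)"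
      by (rule Bochner_Integration.integral_sum[symmetric]) (intro conv_test_integrable kernel_K pair_int_u \<theta>)
    finally show "(\<integral>t. \<theta> t * dv x t \<partial>time_measure T) = 0"
      by (simp add: dv_def sum_distrib_left mult.commute)
  qed
  obtain D :: "(real^'n) set" where D: "countable D" "\<And>X. open X \<Longrightarrow> X \<noteq> {} \<Longrightarrow> \<exists>d\<in>D. d \<in> X"
    using countable_dense_setE by blast
  have "AE t in time_measure T. \<forall>x\<in>D. dv x t = 0"
    using each D(1) by (simp add: AE_ball_countable)
  then show ?thesis
    using AE_state
  proof eventually_elim
    case (elim t)
    interpret torus_state \<kappa> C \<eta> K "\<lambda>y. \<rho> y t" "\<lambda>y. u y t" "\<lambda>y. P y t" c by (rule elim)
    have "continuous_on UNIV (\<lambda>x. dv x t)"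
      unfolding dv_def by (intro continuous_intros conv_continuous kernel_K int_u)
    then have "open {x. dv x t \<noteq> 0}"
      by (intro open_Collect_neq continuous_on_const)
    then have "{x. dv x t \<noteq> 0} = {}" using D(2) elim(1) by blast
    then show ?case by (auto simp: dv_def)
  qed
qed

lemma rt_ge: "AE t in time_measure T. 1 / c \<le> rt x t"
  using AE_state
proof eventually_elim
  case (elim t)
  interpret torus_state \<kappa> C \<eta> K "\<lambda>y. \<rho> y t" "\<lambda>y. u y t" "\<lambda>y. P y t" c by (rule elim)
  show ?case unfolding rt_def by (rule re_ge)
qed

lemma conv_meas [measurable]:
  assumes [measurable]: "kernel_fun k" "(\<lambda>(y, t). f y t) \<in> borel_measurable (borel \<Otimes>\<^sub>M borel)"
  shows "(\<lambda>(x, t). conv k (\<lambda>y. f y t) x) \<in> borel_measurable (borel \<Otimes>\<^sub>M borel)"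
proof -
  note [measurable] = kernel_fun_borel[OF assms(1)]
  show ?thesis unfolding conv_def by measurable
qed

lemma flux_meas [measurable]: "(\<lambda>(x, t). flux t x) \<in> borel_measurable (borel \<Otimes>\<^sub>M borel)"
proof -
  note [measurable] = kernel_fun_borel[OF kernel_eta] kernel_fun_borel[OF kernel_K]
  have "(norm (vt t x))\<^sup>2 = (\<Sum>i\<in>UNIV. (vt t x $ i)\<^sup>2)" for t x
    by (simp add: power2_norm_eq_inner inner_vec_def) (simp add: power2_eq_square)
  then show ?thesis
    unfolding energy_flux_def
    by (simp only: favre_def vec_lambda_beta) (unfold conv_def, measurable)
qed

text \<open>The chain rule is applied to the continuous representatives \<open>M\<close> and
  \<open>R\<close>, which are exchanged for \<open>mt\<close> and \<open>rt\<close> almost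
  everywhere. Continuity extends the lower bound for \<open>R\<close> to all of [0, T], so the
  division is safe at the ends too.\<close>

lemma energy_density_prim:
  "AE t in time_measure T. (\<Sum>i\<in>UNIV. (mt i x t)\<^sup>2 / rt x t) = (\<Sum>i\<in>UNIV. (M0 i x)\<^sup>2 / R0 x) + time_prim T (\<lambda>s. flux s x) t"
proof -
  define R where "R t = R0 x + time_prim T (drt x) t" for t
  define M where "M i t = M0 i x + time_prim T (dmt i x) t" for i t
  have aeR: "AE t in time_measure T. rt x t = R t" unfolding R_def by (rule rt_prim)
  have aeM: "AE t in time_measure T. \<forall>i. mt i x t = M i t" unfolding M_def by (simp add: AE_all_countable mt_prim)
  have Rc: "continuous_on UNIV R"
    unfolding R_def by (intro continuous_intros time_prim_continuous drt_integrable)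
  have Rge: "1 / c \<le> R t" if "t \<in> {0..T}" for t
  proof (rule continuous_ge_if_AE[OF Rc _ that T])
    show "AE t in time_measure T. 1 / c \<le> R t"
      using rt_ge[of x] aeR by eventually_elim simp
  qed
  have c0: "0 < 1 / c" using c1 by simp
  let ?j = "\<lambda>i s. 2 * (M i s / R s) * dmt i x s - (M i s / R s)\<^sup>2 * drt x s"
  have chain: "(M i t)\<^sup>2 / R t - (M0 i x)\<^sup>2 / R0 x = time_prim T (?j i) t" if "t \<in> {0..T}" for i t
    by (rule square_quotient_chain_rule[OF T dmt_integrable drt_integrable M_def R_def c0 Rge that])
  have Mc: "continuous_on UNIV (M i)" for i
    unfolding M_def by (intro continuous_intros time_prim_continuous dmt_integrable)
  note [measurable] = borel_measurable_continuous_onI[OF Rc] borel_measurable_continuous_onI[OF Mc]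
    time_integrable_borel[OF drt_integrable] time_integrable_borel[OF dmt_integrable]
  have jint: "integrable (time_measure T) (?j i)" for i
  proof -
    have "continuous_on {0..T} (\<lambda>s. M i s / R s)"
      using Rge c0 by (intro continuous_on_divide continuous_on_subset[OF Mc] continuous_on_subset[OF Rc]) force+
    then have "bounded ((\<lambda>s. M i s / R s) ` {0..T})" by (intro compact_imp_bounded compact_continuous_image) auto
    then obtain V where V: "\<And>s. s \<in> {0..T} \<Longrightarrow> \<bar>M i s / R s\<bar> \<le> V"
      unfolding bounded_iff by (metis image_eqI real_norm_def)
    show ?thesis
    proof (rule Bochner_Integration.integrable_bound)
      show "integrable (time_measure T) (\<lambda>s. 2 * V * \<bar>dmt i x s\<bar> + V\<^sup>2 * \<bar>drt x s\<bar>)"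
        using drt_integrable dmt_integrable by auto
      show "AE s in time_measure T. norm (?j i s) \<le> norm (2 * V * \<bar>dmt i x s\<bar> + V\<^sup>2 * \<bar>drt x s\<bar>)"
        using AE_time_measure_in[of T]
      proof eventually_elim
        case (elim s)
        have v: "\<bar>M i s / R s\<bar> \<le> V" using V elim by auto
        have "\<bar>?j i s\<bar> \<le> \<bar>2 * (M i s / R s) * dmt i x s\<bar> + \<bar>(M i s / R s)\<^sup>2 * drt x s\<bar>" by (rule abs_triangle_ineq4)
        also have "\<dots> \<le> 2 * V * \<bar>dmt i x s\<bar> + V\<^sup>2 * \<bar>drt x s\<bar>"
          unfolding abs_mult using v power_mono[OF v abs_ge_zero, of 2, unfolded power2_abs]
          by (intro add_mono mult_right_mono) (simp_all only: abs_power2 abs_ge_zero abs_numeral mult_left_mono zero_le_numeral)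
        finally show ?case by simp
      qed
    qed measurable
  qed
  have flux: "AE s in time_measure T. (\<Sum>i\<in>UNIV. ?j i s) = flux s x"
    using aeR aeM
  proof eventually_elim
    case (elim s)
    have v: "M i s / R s = vt s x $ i" for i
      using elim by (simp add: favre_def rt_def mt_def)
    have "(norm (vt s x))\<^sup>2 = (\<Sum>i\<in>UNIV. (vt s x $ i)\<^sup>2)"
      by (simp add: power2_norm_eq_inner inner_vec_def) (simp add: power2_eq_square)
    then show ?case
      unfolding v energy_flux_def by (simp add: sum.distrib sum_subtractf drt_def dmt_def sum_negf sum_distrib_right)
  qed
  have sumprim: "(\<Sum>i\<in>UNIV. time_prim T (?j i) t) = time_prim T (\<lambda>s. flux s x) t" for t
  proof -
    have "(\<Sum>i\<in>UNIV. time_prim T (?j i) t) = (\<integral>s. (\<Sum>i\<in>UNIV. if s < t then ?j i s else 0) \<partial>time_measure T)"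
      unfolding time_prim_def
      by (rule Bochner_Integration.integral_sum[symmetric])
        (rule Bochner_Integration.integrable_bound[OF jint], auto)
    also have "\<dots> = time_prim T (\<lambda>s. flux s x) t"
      unfolding time_prim_def
    proof (rule integral_cong_AE)
      show "AE s in time_measure T. (\<Sum>i\<in>UNIV. if s < t then ?j i s else 0) = (if s < t then flux s x else 0)"
        using flux by eventually_elim auto
    qed measurable
    finally show ?thesis .
  qed
  show ?thesis
    using aeR aeM AE_time_measure_in[of T]
  proof eventually_elim
    case (elim t)
    have "(\<Sum>i\<in>UNIV. (mt i x t)\<^sup>2 / rt x t) - (\<Sum>i\<in>UNIV. (M0 i x)\<^sup>2 / R0 x) = (\<Sum>i\<in>UNIV. time_prim T (?j i) t)"
    proof (subst sum_subtractf[symmetric], rule sum.cong[OF refl])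
      fix i
      have "(M i t)\<^sup>2 / R t - (M0 i x)\<^sup>2 / R0 x = time_prim T (?j i) t"
        by (rule chain) (use elim(3) in auto)
      then show "(mt i x t)\<^sup>2 / rt x t - (M0 i x)\<^sup>2 / R0 x = time_prim T (?j i) t"
        using elim(1,2) by (simp only:)
    qed
    then show ?case unfolding sumprim by simp
  qed
qed

end

text \<open>The same device as \<open>N_product\<close>, for averages over the whole torus: a
  pointwise inequality in two variables is integrated in one after the other.\<close>

lemma torus_product_le:
  fixes f g F G :: "real^'n \<Rightarrow> real"
  assumes int: "integrable torus f" "integrable torus g" "integrable torus F" "integrable torus G"
    and le: "\<And>y z. f y * g z \<le> F y + G z"
  shows "(\<integral>y. f y \<partial>torus) * (\<integral>z. g z \<partial>torus) \<le> (\<integral>y. F y \<partial>torus) + (\<integral>z. G z \<partial>torus)"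
proof -
  have one: "measure torus (UNIV :: (real^'n) set) = 1"
    using torus.prob_space by (simp only: space_torus)
  have "f y * (\<integral>z. g z \<partial>torus) \<le> F y + (\<integral>z. G z \<partial>torus)" for y
  proof -
    have "f y * (\<integral>z. g z \<partial>torus) = (\<integral>z. f y * g z \<partial>torus)" by simp
    also have "\<dots> \<le> (\<integral>z. F y + G z \<partial>torus)"
      using int le by (intro integral_mono) auto
    also have "\<dots> = F y + (\<integral>z. G z \<partial>torus)" using int by (simp add: one)
    finally show ?thesis .
  qed
  then have "(\<integral>y. f y * (\<integral>z. g z \<partial>torus) \<partial>torus) \<le> (\<integral>y. F y + (\<integral>z. G z \<partial>torus) \<partial>torus)"
    using int by (intro integral_mono) auto
  then show ?thesis using int by (simp add: one)
qed

text \<open>It blows up as \<kappa> tends to 0 and serves at fixed \<kappa> only, to make the flux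
  jointly integrable in space and time so that Fubini applies. The products of means of
  \<open>u\<close> and \<open>P\<close> are reduced to the two norms that are integrable in
  time.\<close>

lemma (in torus_state) energy_flux_crude_bound:
  defines "b \<equiv> C / \<kappa> / \<kappa> ^ CARD('n)"
  shows "\<bar>energy_flux \<eta> K \<rho> u P x\<bar> \<le>
    (CARD('n) * (2 * c\<^sup>2 * b) * (CARD('n) * (b * c) * 2 + b) + CARD('n) * (c\<^sup>2 * b)\<^sup>2 * (CARD('n) * (b * c)) * 4)
      * ((\<integral>y. norm (u y) ^ 3 \<partial>torus) + (\<integral>y. \<bar>P y\<bar> powr (3/2) \<partial>torus))"
proof -
  define a1 a2 p1 U Q where "a1 = (\<integral>y. norm (u y) \<partial>torus)" and "a2 = (\<integral>y. (norm (u y))\<^sup>2 \<partial>torus)"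
    and "p1 = (\<integral>y. \<bar>P y\<bar> \<partial>torus)" and "U = (\<integral>y. norm (u y) ^ 3 \<partial>torus)" and "Q = (\<integral>y. \<bar>P y\<bar> powr (3/2) \<partial>torus)"
  note defs = a1_def a2_def p1_def U_def Q_def
  have nn: "0 \<le> a1" "0 \<le> a2" "0 \<le> p1" "0 \<le> U" "0 \<le> Q" by (simp_all add: defs)
  have b: "0 \<le> b" using kappa C1 by (simp add: b_def)
  have Kb: "\<bar>K j z\<bar> \<le> b" for j z
  proof -
    have "\<bar>K j z\<bar> \<le> C / \<kappa> * \<bar>N z\<bar>" using K_le[of j z] N_nonneg[of z] by simp
    also have "\<dots> \<le> C / \<kappa> * (1 / \<kappa> ^ CARD('n))" using C1 kappa by (intro mult_left_mono N_bound) auto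
    finally show ?thesis by (simp add: b_def)
  qed
  have eb: "\<bar>\<eta> z\<bar> \<le> b" for z
  proof -
    have "\<bar>\<eta> z\<bar> \<le> C * \<bar>N z\<bar>" using eta_le_N[of z] N_nonneg[of z] by simp
    also have "\<dots> \<le> C / \<kappa> * (1 / \<kappa> ^ CARD('n))" using C1 kappa by (intro mult_mono N_bound) (auto simp: field_simps)
    finally show ?thesis by (simp add: b_def)
  qed
  note int1 = int_dev1[of 0, simplified] and int2 = int_dev2[of 0, simplified] and int3 = int_dev3[of 0, simplified]
  have rc: "\<bar>\<rho> y\<bar> \<le> c" for y using rho_pos[of y] rho_le[of y] by simp
  have rho_u_le: "(\<integral>y. \<bar>\<rho> y * u y $ i\<bar> \<partial>torus) \<le> c * a1" for i
  proof -
    have "(\<integral>y. \<bar>\<rho> y * u y $ i\<bar> \<partial>torus) \<le> (\<integral>y. c * norm (u y) \<partial>torus)"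
      unfolding abs_mult using rc component_le_norm_cart[of "u _" i] int_rho_u[of i] int1 c1
      by (intro integral_mono mult_mono) (auto simp: abs_mult[symmetric])
    then show ?thesis by (simp add: a1_def)
  qed
  have rho_uu_le: "(\<integral>y. \<bar>\<rho> y * u y $ i * u y $ j\<bar> \<partial>torus) \<le> c * a2" for i j
  proof -
    have pt: "\<bar>\<rho> y * u y $ i * u y $ j\<bar> \<le> c * (norm (u y))\<^sup>2" for y
      unfolding abs_mult power2_eq_square mult.assoc using rc component_le_norm_cart[of "u y"] c1 by (intro mult_mono) auto
    have "(\<integral>y. \<bar>\<rho> y * u y $ i * u y $ j\<bar> \<partial>torus) \<le> (\<integral>y. c * (norm (u y))\<^sup>2 \<partial>torus)"
      by (intro integral_mono pt integrable_abs int_rho_uu integrable_mult_right int2)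
    then show ?thesis by (simp add: a2_def)
  qed
  have vb: "\<bar>v x $ i\<bar> \<le> c\<^sup>2 * b * a1" for i
  proof -
    have "\<bar>v x $ i\<bar> \<le> c * (\<bar>v x $ i\<bar> * re x)"
      using mult_left_mono[OF re_ge[of x], of "c * \<bar>v x $ i\<bar>"] c1 by simp
    also have "\<bar>v x $ i\<bar> * re x = \<bar>conv \<eta> (\<lambda>y. \<rho> y * u y $ i) x\<bar>"
      using re_pos[of x] by (simp flip: v_re add: abs_mult)
    also have "\<dots> \<le> b * (c * a1)"
      by (rule order_trans[OF conv_bound[OF kernel_eta eb int_rho_u] mult_left_mono[OF rho_u_le b]])
    finally show ?thesis using c1 by (simp add: power2_eq_square mult_ac)
  qed
  have uu: "\<bar>conv (K j) (\<lambda>y. \<rho> y * u y $ i * u y $ j) x\<bar> \<le> b * (c * a2)" for i j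
    by (rule order_trans[OF conv_bound[OF kernel_K Kb int_rho_uu] mult_left_mono[OF rho_uu_le b]])
  have pp: "\<bar>conv (K j) P x\<bar> \<le> b * p1" for j
    unfolding p1_def by (rule conv_bound[OF kernel_K Kb int_P])
  have ru: "\<bar>conv (K j) (\<lambda>y. \<rho> y * u y $ j) x\<bar> \<le> b * (c * a1)" for j
    by (rule order_trans[OF conv_bound[OF kernel_K Kb int_rho_u] mult_left_mono[OF rho_u_le b]])
  have a12: "a1 * a2 \<le> 2 * U"
    using torus_product_le[OF int1 int2 int3 int3 mult_power2_le_cubes[OF norm_ge_zero norm_ge_zero]] by (simp add: defs)
  have a11: "a1 * a1 \<le> 2 * a2"
  proof -
    have "norm (u y) * norm (u z) \<le> (norm (u y))\<^sup>2 + (norm (u z))\<^sup>2" for y z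
    proof -
      have "0 \<le> norm (u y) * norm (u z)" by simp
      moreover have "2 * (norm (u y) * norm (u z)) \<le> (norm (u y))\<^sup>2 + (norm (u z))\<^sup>2"
        using sum_squares_bound[of "norm (u y)" "norm (u z)"] by (simp add: mult.assoc)
      ultimately show ?thesis by linarith
    qed
    from torus_product_le[OF int1 int1 int2 int2 this] show ?thesis by (simp add: defs)
  qed
  have a1p: "a1 * p1 \<le> U + Q"
  proof -
    have "norm (u y) * \<bar>P z\<bar> \<le> norm (u y) ^ 3 + \<bar>P z\<bar> powr (3/2)" for y z
      using young_3_32[of "norm (u y)" "\<bar>P z\<bar>" 1] by simp
    from torus_product_le[OF int1 _ int3 P32 this] int_P show ?thesis by (simp add: defs)
  qed
  have a111: "a1\<^sup>2 * a1 \<le> 4 * (U + Q)"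
  proof -
    have "a1 * a1 * a1 \<le> 2 * a2 * a1" using nn by (intro mult_right_mono a11)
    also have "\<dots> \<le> 4 * U" using a12 by (simp add: mult.commute)
    finally show ?thesis using nn by (simp add: power2_eq_square)
  qed
  define d where "d = real CARD('n)"
  have 1: "\<bar>2 * v x $ i * (- (\<Sum>j\<in>UNIV. conv (K j) (\<lambda>y. \<rho> y * u y $ i * u y $ j) x) - conv (K i) P x)\<bar>
      \<le> 2 * c\<^sup>2 * b * (d * (b * c) * 2 + b) * (U + Q)" for i
  proof -
    have "\<bar>\<Sum>j\<in>UNIV. conv (K j) (\<lambda>y. \<rho> y * u y $ i * u y $ j) x\<bar> \<le> (\<Sum>j\<in>(UNIV::'n set). b * (c * a2))"
      by (intro order_trans[OF sum_abs] sum_mono uu)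
    then have "\<bar>- (\<Sum>j\<in>UNIV. conv (K j) (\<lambda>y. \<rho> y * u y $ i * u y $ j) x) - conv (K i) P x\<bar> \<le> d * (b * (c * a2)) + b * p1"
      using pp[of i] by (simp add: d_def)
    then have "\<bar>v x $ i\<bar> * \<bar>- (\<Sum>j\<in>UNIV. conv (K j) (\<lambda>y. \<rho> y * u y $ i * u y $ j) x) - conv (K i) P x\<bar> \<le> (c\<^sup>2 * b * a1) * (d * (b * (c * a2)) + b * p1)"
      using nn b c1 by (intro mult_mono vb) (auto simp: d_def)
    also have "\<dots> = c\<^sup>2 * b * (d * (b * c) * (a1 * a2) + b * (a1 * p1))" by (simp add: algebra_simps)
    also have "\<dots> \<le> c\<^sup>2 * b * (d * (b * c) * (2 * (U + Q)) + b * (U + Q))"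
      using a12 a1p nn b c1 by (intro mult_left_mono add_mono) (auto simp: d_def)
    finally have "2 * (\<bar>v x $ i\<bar> * \<bar>- (\<Sum>j\<in>UNIV. conv (K j) (\<lambda>y. \<rho> y * u y $ i * u y $ j) x) - conv (K i) P x\<bar>)
        \<le> 2 * (c\<^sup>2 * b * (d * (b * c) * (2 * (U + Q)) + b * (U + Q)))" by linarith
    then show ?thesis by (simp only: abs_mult abs_numeral mult.assoc) (simp add: algebra_simps)
  qed
  have 2: "\<bar>(norm (v x))\<^sup>2 * (\<Sum>j\<in>UNIV. conv (K j) (\<lambda>y. \<rho> y * u y $ j) x)\<bar> \<le> d * (c\<^sup>2 * b)\<^sup>2 * (d * (b * c)) * 4 * (U + Q)"
  proof -
    have "(norm (v x))\<^sup>2 \<le> (\<Sum>i\<in>(UNIV :: 'n set). (c\<^sup>2 * b * a1)\<^sup>2)"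
      unfolding norm_v_sq by (intro sum_mono abs_le_square_iff[THEN iffD1]) (use vb nn b in auto)
    moreover have "\<bar>\<Sum>j\<in>UNIV. conv (K j) (\<lambda>y. \<rho> y * u y $ j) x\<bar> \<le> (\<Sum>j\<in>(UNIV::'n set). b * (c * a1))"
      by (intro order_trans[OF sum_abs] sum_mono ru)
    ultimately have "(norm (v x))\<^sup>2 * \<bar>\<Sum>j\<in>UNIV. conv (K j) (\<lambda>y. \<rho> y * u y $ j) x\<bar> \<le> (d * (c\<^sup>2 * b * a1)\<^sup>2) * (d * (b * (c * a1)))"
      by (intro mult_mono) (auto simp: d_def)
    also have "\<dots> = d * (c\<^sup>2 * b)\<^sup>2 * (d * (b * c)) * (a1\<^sup>2 * a1)" by (simp add: power_mult_distrib algebra_simps)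
    also have "\<dots> \<le> d * (c\<^sup>2 * b)\<^sup>2 * (d * (b * c)) * (4 * (U + Q))"
      using a111 b c1 by (intro mult_left_mono) (auto simp: d_def)
    finally show ?thesis by (simp add: abs_mult mult.assoc)
  qed
  have "\<bar>energy_flux \<eta> K \<rho> u P x\<bar> \<le> (\<Sum>i\<in>(UNIV::'n set). 2 * c\<^sup>2 * b * (d * (b * c) * 2 + b) * (U + Q)) + d * (c\<^sup>2 * b)\<^sup>2 * (d * (b * c)) * 4 * (U + Q)"
    unfolding energy_flux_def
    by (intro order_trans[OF abs_triangle_ineq] add_mono order_trans[OF sum_abs] sum_mono 1 2)
  then show ?thesis by (simp add: d_def U_def Q_def algebra_simps)
qed

section \<open>Integration of the energy balance over the torus\<close>

context flow
begin

definition "mollified_energy t = (\<integral>x. (\<Sum>i\<in>UNIV. (mt i x t)\<^sup>2 / rt x t) \<partial>torus)"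
definition "initial_energy = (\<integral>x. (\<Sum>i\<in>UNIV. (M0 i x)\<^sup>2 / R0 x) \<partial>torus)"
definition "total_flux t = (\<integral>x. flux t x \<partial>torus)"

lemma rt_meas [measurable]: "(\<lambda>(x, t). rt x t) \<in> borel_measurable (borel \<Otimes>\<^sub>M borel)"
  and mt_meas [measurable]: "(\<lambda>(x, t). mt i x t) \<in> borel_measurable (borel \<Otimes>\<^sub>M borel)"
  unfolding rt_def mt_def by (intro conv_meas kernel_eta; measurable)+

lemma flux_integrable: "integrable space_time (\<lambda>(x, t). flux t x)"
proof -
  define b where "b = C / \<kappa> / \<kappa> ^ CARD('n)"
  define A where "A = CARD('n) * (2 * c\<^sup>2 * b) * (CARD('n) * (b * c) * 2 + b) + CARD('n) * (c\<^sup>2 * b)\<^sup>2 * (CARD('n) * (b * c)) * 4"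
  define V where "V t = A * ((\<integral>y. norm (u y t) ^ 3 \<partial>torus) + (\<integral>y. \<bar>P y t\<bar> powr (3/2) \<partial>torus))" for t
  have V: "integrable (time_measure T) V"
    unfolding V_def using integrable_snd[of "\<lambda>y t. norm (u y t) ^ 3"] integrable_snd[of "\<lambda>y t. \<bar>P y t\<bar> powr (3/2)"] u3 P32 by simp
  note [measurable] = time_integrable_borel[OF V]
  have Vpair: "integrable space_time (\<lambda>(x, t). V t)"
  proof (rule Fubini_integrable)
    show "integrable torus (\<lambda>x. \<integral>t. norm (case (x, t) of (x, t) \<Rightarrow> V t) \<partial>time_measure T)" by simp
    show "AE x in torus. integrable (time_measure T) (\<lambda>t. case (x, t) of (x, t) \<Rightarrow> V t)" using V by simp
  qed measurable
  show ?thesis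
  proof (rule Bochner_Integration.integrable_bound[OF Vpair])
    have "AE t in time_measure T. \<bar>flux t x\<bar> \<le> V t" for x
      using AE_state
    proof eventually_elim
      case (elim t)
      interpret torus_state \<kappa> C \<eta> K "\<lambda>y. \<rho> y t" "\<lambda>y. u y t" "\<lambda>y. P y t" c by (rule elim)
      show ?case unfolding V_def A_def b_def by (rule energy_flux_crude_bound)
    qed
    then have "AE z in space_time. \<bar>flux (snd z) (fst z)\<bar> \<le> V (snd z)"
    proof (intro AE_pair_measure)
      show "{z \<in> space space_time. \<bar>flux (snd z) (fst z)\<bar> \<le> V (snd z)} \<in> sets space_time"
        by measurable
    qed simp
    then show "AE z in space_time. norm (case z of (x, t) \<Rightarrow> flux t x) \<le> norm (case z of (x, t) \<Rightarrow> V t)"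
      by eventually_elim (auto split: prod.split)
  qed measurable
qed

lemma flux_prim_integral:
  shows "integrable torus (\<lambda>x. time_prim T (\<lambda>s. flux s x) t)"
    and "(\<integral>x. time_prim T (\<lambda>s. flux s x) t \<partial>torus) = time_prim T total_flux t"
proof -
  have i: "integrable space_time (\<lambda>(x, s). if s < t then flux s x else 0)"
    by (rule Bochner_Integration.integrable_bound[OF flux_integrable]) (measurable, auto)
  show "integrable torus (\<lambda>x. time_prim T (\<lambda>s. flux s x) t)"
    unfolding time_prim_def using integrable_fst[OF i] .
  have "(\<integral>x. time_prim T (\<lambda>s. flux s x) t \<partial>torus) = (\<integral>s. \<integral>x. (if s < t then flux s x else 0) \<partial>torus \<partial>time_measure T)"
    unfolding time_prim_def using Fubini_integral[OF i] by simp
  also have "\<dots> = time_prim T total_flux t"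
    unfolding time_prim_def total_flux_def by (intro Bochner_Integration.integral_cong) auto
  finally show "(\<integral>x. time_prim T (\<lambda>s. flux s x) t \<partial>torus) = time_prim T total_flux t" .
qed

lemma mollified_energy_balance:
  "AE t in time_measure T. mollified_energy t = initial_energy + time_prim T total_flux t"
proof -
  define F where "F x t = (\<Sum>i\<in>UNIV. (mt i x t)\<^sup>2 / rt x t)" for x t
  define F0 where "F0 x = (\<Sum>i\<in>UNIV. (M0 i x)\<^sup>2 / R0 x)" for x
  have [measurable]: "(\<lambda>(x, t). F x t) \<in> borel_measurable (borel \<Otimes>\<^sub>M borel)" "F0 \<in> borel_measurable borel"
    unfolding F_def F0_def by measurable
  have "AE x in torus. AE t in time_measure T. F x t = F0 x + time_prim T (\<lambda>s. flux s x) t"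
    unfolding F_def F0_def using energy_density_prim by simp
  \<comment> \<open>The exceptional times depend on \<open>x\<close>. Both sides are jointly
    measurable, so the two quantifiers may be exchanged.\<close>
  then have "AE t in time_measure T. AE x in torus. F x t = F0 x + time_prim T (\<lambda>s. flux s x) t"
  proof (subst AE_commute[symmetric])
    show "{z \<in> space space_time. F (fst z) (snd z) = F0 (fst z) + time_prim T (\<lambda>s. flux s (fst z)) (snd z)} \<in> sets space_time"
      unfolding time_prim_def by measurable
  qed
  then show ?thesis
    using AE_state
  proof eventually_elim
    case (elim t)
    interpret torus_state \<kappa> C \<eta> K "\<lambda>y. \<rho> y t" "\<lambda>y. u y t" "\<lambda>y. P y t" c by (rule elim)
    have Fi: "integrable torus (\<lambda>x. F x t)"
      unfolding F_def rt_def mt_def by (rule mollified_energy_integrable)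
    have [measurable]: "(\<lambda>x. time_prim T (\<lambda>s. flux s x) t) \<in> borel_measurable borel"
      using borel_measurable_integrable[OF flux_prim_integral(1)] by simp
    \<comment> \<open>The integral of \<open>F0\<close> is obtained at one good time, where
      \<open>F0\<close> agrees almost everywhere with a difference of two integrable
      functions.\<close>
    have "(\<integral>x. F0 x \<partial>torus) = (\<integral>x. F x t - time_prim T (\<lambda>s. flux s x) t \<partial>torus)"
      by (rule integral_cong_AE) (measurable, use elim(1) in eventually_elim, simp)
    also have "\<dots> = (\<integral>x. F x t \<partial>torus) - time_prim T total_flux t"
      using Fi flux_prim_integral by simp
    finally show ?case by (simp add: mollified_energy_def initial_energy_def F_def F0_def)
  qed
qed

definition "energy t = (\<integral>y. \<rho> y t * (norm (u y t))\<^sup>2 \<partial>torus)"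
definition "cube_defect t = (\<integral>\<^sup>+x. \<integral>\<^sup>+y. ennreal (box_kernel \<kappa> (x - y) * norm (u y t - u x t) ^ 3) \<partial>torus \<partial>torus)"

text \<open>The bound is in mean over time, since cubes and pressure are controlled only in that
  sense. The parameter \<Lambda>' belongs to the gap between energy and mollified energy, \<Lambda>
  to the pressure; the factor \<open>T\<close> in the last term comes from bounding the primitive of
  the flux uniformly in \<open>t\<close>.\<close>

theorem energy_deviation:
  assumes osc: "AE t in time_measure T. AE x in torus. AE y in torus.
      box_kernel \<kappa> (x - y) \<noteq> 0 \<longrightarrow> \<bar>\<rho> x t - \<rho> y t\<bar> \<le> M * \<kappa> powr (2/3)"
    and M: "0 \<le> M" and \<Lambda>: "0 < \<Lambda>" and \<Lambda>': "0 < \<Lambda>'"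
  shows "(\<integral>\<^sup>+t. ennreal \<bar>energy t - initial_energy\<bar> \<partial>time_measure T) \<le>
     ennreal (c * C * (\<Lambda>'\<^sup>2 * C)) * ennreal T
     + ennreal (c * C * dev_const CARD('n) C c / \<Lambda>') * (\<integral>\<^sup>+t. cube_defect t \<partial>time_measure T)
     + ennreal T * (ennreal (flux_const CARD('n) C c M * (1 + \<Lambda>) * dev_const CARD('n) C c / \<kappa>) * (\<integral>\<^sup>+t. cube_defect t \<partial>time_measure T)
        + ennreal (flux_const CARD('n) C c M * \<Lambda> powr (- 1/2)) * (ennreal C *
            (\<integral>\<^sup>+t. \<integral>\<^sup>+y. ennreal (\<bar>P y t\<bar> powr (3/2)) \<partial>torus \<partial>time_measure T)))"
    (is "_ \<le> ?a * _ + ?b * _ + _ * (?e * _ + ?f * (_ * ?PP))")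
proof -
  have [measurable]: "cube_defect \<in> borel_measurable borel" "(\<lambda>t. \<integral>\<^sup>+y. ennreal (\<bar>P y t\<bar> powr (3/2)) \<partial>torus) \<in> borel_measurable borel"
    unfolding cube_defect_def[abs_def] by measurable
  have tot: "emeasure (time_measure T) UNIV = ennreal T"
    using T by (simp add: time_measure_def emeasure_density)
  define X where "X = (\<integral>\<^sup>+s. ennreal \<bar>total_flux s\<bar> \<partial>time_measure T)"
  have X: "X \<le> ?e * (\<integral>\<^sup>+t. cube_defect t \<partial>time_measure T) + ?f * (ennreal C * ?PP)"
  proof -
    have "X \<le> (\<integral>\<^sup>+t. ?e * cube_defect t + ?f * (ennreal C * (\<integral>\<^sup>+y. ennreal (\<bar>P y t\<bar> powr (3/2)) \<partial>torus)) \<partial>time_measure T)"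
      unfolding X_def
    proof (intro nn_integral_mono_AE, use AE_state AE_div_free osc in eventually_elim)
      case (elim t)
      interpret torus_state \<kappa> C \<eta> K "\<lambda>y. \<rho> y t" "\<lambda>y. u y t" "\<lambda>y. P y t" c by (rule elim)
      show ?case
        unfolding total_flux_def cube_defect_def by (rule energy_flux_bound[OF _ elim(3) M \<Lambda>]) (use elim(2) in simp)
    qed
    then show ?thesis by (simp add: nn_integral_add nn_integral_cmult)
  qed
  have prim: "ennreal \<bar>time_prim T total_flux t\<bar> \<le> X" for t
  proof -
    have "ennreal \<bar>time_prim T total_flux t\<bar> \<le> (\<integral>\<^sup>+s. ennreal \<bar>if s < t then total_flux s else 0\<bar> \<partial>time_measure T)"
      unfolding time_prim_def
    proof (cases "integrable (time_measure T) (\<lambda>s. if s < t then total_flux s else 0)")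
      case True
      from integral_norm_bound_ennreal[OF True]
      show "ennreal \<bar>\<integral>s. (if s < t then total_flux s else 0) \<partial>time_measure T\<bar> \<le> (\<integral>\<^sup>+s. ennreal \<bar>if s < t then total_flux s else 0\<bar> \<partial>time_measure T)"
        by simp
    qed (simp add: not_integrable_integral_eq)
    also have "\<dots> \<le> X" unfolding X_def by (intro nn_integral_mono) auto
    finally show ?thesis .
  qed
  have "(\<integral>\<^sup>+t. ennreal \<bar>energy t - initial_energy\<bar> \<partial>time_measure T) \<le> (\<integral>\<^sup>+t. ?a + ?b * cube_defect t + X \<partial>time_measure T)"
  proof (intro nn_integral_mono_AE, use AE_state mollified_energy_balance in eventually_elim)
    case (elim t)
    interpret torus_state \<kappa> C \<eta> K "\<lambda>y. \<rho> y t" "\<lambda>y. u y t" "\<lambda>y. P y t" c by (rule elim)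
    have "\<bar>energy t - initial_energy\<bar> \<le> \<bar>energy t - mollified_energy t\<bar> + \<bar>time_prim T total_flux t\<bar>"
      using elim(2) by linarith
    then have "ennreal \<bar>energy t - initial_energy\<bar> \<le> ennreal \<bar>energy t - mollified_energy t\<bar> + ennreal \<bar>time_prim T total_flux t\<bar>"
      by (metis abs_ge_zero ennreal_leI ennreal_plus)
    also have "\<dots> \<le> (?a + ?b * cube_defect t) + X"
      unfolding energy_def mollified_energy_def cube_defect_def rt_def mt_def
      by (intro add_mono prim energy_defect_bound \<Lambda>')
    finally show ?case .
  qed
  also have "\<dots> = ?a * ennreal T + ?b * (\<integral>\<^sup>+t. cube_defect t \<partial>time_measure T) + X * ennreal T"
    by (subst nn_integral_add, simp, simp, subst nn_integral_add, simp, simp, subst nn_integral_cmult, simp)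
      (simp only: nn_integral_const space_time_measure tot)
  also have "\<dots> \<le> ?a * ennreal T + ?b * (\<integral>\<^sup>+t. cube_defect t \<partial>time_measure T) +
     ennreal T * (?e * (\<integral>\<^sup>+t. cube_defect t \<partial>time_measure T) + ?f * (ennreal C * ?PP))"
    unfolding mult.commute[of X] by (intro add_left_mono mult_left_mono X) auto
  finally show ?thesis .
qed

end

section \<open>Averages over small shifts\<close>

text \<open>Substituting y = x + h turns the double integral into an average over shifts
  \<open>h\<close> with weight \<open>k\<close>. On the support of \<open>k\<close>, periodicity
  allows \<open>h\<close> to be replaced by a vector of length at most
  \<open>CARD('n) * \<kappa>\<close>.\<close>

lemma nn_integral_kernel_difference:
  fixes f :: "real^'n \<Rightarrow> 'b::{real_normed_vector, second_countable_topology}" and k :: "real^'n \<Rightarrow> real" and \<phi> :: "'b \<Rightarrow> ennreal" and \<kappa> :: real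
  assumes [measurable]: "f \<in> borel_measurable borel" "k \<in> borel_measurable borel" "\<phi> \<in> borel_measurable borel"
    and per: "periodic_x f" "periodic_x k"
    and supp: "\<And>z. k z \<noteq> 0 \<Longrightarrow> z \<in> near_lattice \<kappa>" and even: "\<And>z. k (- z) = k z"
    and A: "\<And>h. norm h \<le> CARD('n) * \<kappa> \<Longrightarrow> (\<integral>\<^sup>+x. \<phi> (f (x + h) - f x) \<partial>torus) \<le> A"
  shows "(\<integral>\<^sup>+x. \<integral>\<^sup>+y. ennreal (k (x - y)) * \<phi> (f y - f x) \<partial>torus \<partial>torus) \<le> (\<integral>\<^sup>+h. ennreal (k h) \<partial>torus) * A"
proof -
  interpret pair_sigma_finite "torus :: (real^'n) measure" "torus :: (real^'n) measure" ..
  have "(\<integral>\<^sup>+x. \<integral>\<^sup>+y. ennreal (k (x - y)) * \<phi> (f y - f x) \<partial>torus \<partial>torus)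
    = (\<integral>\<^sup>+x. \<integral>\<^sup>+h. ennreal (k h) * \<phi> (f (x + h) - f x) \<partial>torus \<partial>torus)"
  proof (rule nn_integral_cong)
    fix x :: "real^'n"
    have "(\<integral>\<^sup>+y. ennreal (k (x - y)) * \<phi> (f y - f x) \<partial>torus) = (\<integral>\<^sup>+y. ennreal (k (y - x)) * \<phi> (f y - f x) \<partial>torus)"
      using even[of "y - x" for y] by simp
    also have "\<dots> = (\<integral>\<^sup>+y. ennreal (k (y + x - x)) * \<phi> (f (y + x) - f x) \<partial>torus)"
    proof (rule nn_integral_torus_shift[symmetric])
      have "k (y + l - x) = k (y - x)" if "\<forall>i. l $ i \<in> \<int>" for y l
        using per(2) that unfolding periodic_x_def by (metis add.commute add_diff_eq)
      then show "periodic_x (\<lambda>y. ennreal (k (y - x)) * \<phi> (f y - f x))"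
        using per(1) by (simp add: periodic_x_def)
    qed measurable
    finally show "(\<integral>\<^sup>+y. ennreal (k (x - y)) * \<phi> (f y - f x) \<partial>torus) = (\<integral>\<^sup>+h. ennreal (k h) * \<phi> (f (x + h) - f x) \<partial>torus)"
      by (simp add: add.commute)
  qed
  also have "\<dots> = (\<integral>\<^sup>+h. \<integral>\<^sup>+x. ennreal (k h) * \<phi> (f (x + h) - f x) \<partial>torus \<partial>torus)"
    by (rule Fubini') measurable
  also have "\<dots> = (\<integral>\<^sup>+h. ennreal (k h) * (\<integral>\<^sup>+x. \<phi> (f (x + h) - f x) \<partial>torus) \<partial>torus)"
    by (intro nn_integral_cong nn_integral_cmult) measurable
  also have "\<dots> \<le> (\<integral>\<^sup>+h. ennreal (k h) * A \<partial>torus)"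
  proof (intro nn_integral_mono)
    fix h :: "real^'n"
    show "ennreal (k h) * (\<integral>\<^sup>+x. \<phi> (f (x + h) - f x) \<partial>torus) \<le> ennreal (k h) * A"
    proof (cases "k h = 0")
      case False
      obtain l where l: "l \<in> int_lattice" "norm (h - l) \<le> CARD('n) * \<kappa>"
        using near_lattice_cell[OF supp[OF False]] by blast
      have "f (x + h) = f (x + (h - l))" for x
        using periodic_x_diff[OF per(1) l(1), of "x + h"] by (simp add: add_diff_eq)
      then show ?thesis using A[OF l(2)] by (simp add: mult_left_mono)
    qed simp
  qed
  also have "\<dots> = (\<integral>\<^sup>+h. ennreal (k h) \<partial>torus) * A"
    by (simp add: nn_integral_multc)
  finally show ?thesis .
qed

lemma box_kernel_supp: "box_kernel \<kappa> z \<noteq> 0 \<Longrightarrow> z \<in> near_lattice \<kappa>"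
  by (auto simp: box_kernel_def indicator_def split: if_splits)

text \<open>\<open>W\<close> stands for the cube of the seminorm. Cubing the exponent 1/3 leaves one
  power of |h|, hence the one power of \<kappa> that cancels the factor 1/\<kappa> of the
  flux.\<close>

lemma (in mollifier) cube_difference_le:
  fixes u :: "real^'n \<Rightarrow> real^'n"
  assumes [measurable]: "u \<in> borel_measurable borel" and per: "periodic_x u"
    and W: "\<And>h. h \<noteq> 0 \<Longrightarrow> norm h \<le> CARD('n) * \<kappa> \<Longrightarrow> (\<integral>\<^sup>+x. ennreal (norm (u (x + h) - u x) ^ 3) \<partial>torus) \<le> ennreal (norm h) * W"
  shows "(\<integral>\<^sup>+x. \<integral>\<^sup>+y. ennreal (box_kernel \<kappa> (x - y) * norm (u y - u x) ^ 3) \<partial>torus \<partial>torus) \<le> ennreal (C * CARD('n) * \<kappa>) * W"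
proof -
  have "(\<integral>\<^sup>+x. \<integral>\<^sup>+y. ennreal (box_kernel \<kappa> (x - y) * norm (u y - u x) ^ 3) \<partial>torus \<partial>torus)
    = (\<integral>\<^sup>+x. \<integral>\<^sup>+y. ennreal (box_kernel \<kappa> (x - y)) * ennreal (norm (u y - u x) ^ 3) \<partial>torus \<partial>torus)"
    using kappa by (simp add: ennreal_mult' box_kernel_nonneg)
  also have "\<dots> \<le> (\<integral>\<^sup>+h. ennreal (box_kernel \<kappa> h) \<partial>(torus :: (real^'n) measure)) * (ennreal (CARD('n) * \<kappa>) * W)"
  proof (rule nn_integral_kernel_difference[where \<kappa>=\<kappa> and \<phi>="\<lambda>z. ennreal (norm z ^ 3)"])
    fix h :: "real^'n" assume h: "norm h \<le> CARD('n) * \<kappa>"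
    show "(\<integral>\<^sup>+x. ennreal (norm (u (x + h) - u x) ^ 3) \<partial>torus) \<le> ennreal (CARD('n) * \<kappa>) * W"
    proof (cases "h = 0")
      case False
      then show ?thesis using order_trans[OF W[OF False h] mult_right_mono[OF ennreal_leI[OF h]]] by simp
    qed simp
  qed (use per box_kernel_periodic box_kernel_supp box_kernel_minus in auto)
  also have "\<dots> \<le> ennreal C * (ennreal (CARD('n) * \<kappa>) * W)"
    by (intro mult_right_mono box_integral) simp
  also have "\<dots> = ennreal (C * CARD('n) * \<kappa>) * W"
    using C1 kappa by (simp add: ennreal_mult' mult.assoc)
  finally show ?thesis .
qed

text \<open>A bounded function is approximated in \<open>L\<^sup>1\<close> of a box slightly larger than the cell by a continuous
  function, which need not be periodic; the box absorbs the shift.\<close>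

lemma torus_shift_continuous_bounded:
  fixes f :: "real^'n \<Rightarrow> real"
  assumes f_meas [measurable]: "f \<in> borel_measurable borel" and B: "\<And>x. \<bar>f x\<bar> \<le> B" and e: "0 < e"
  shows "\<exists>d>0. \<forall>h. norm h \<le> d \<longrightarrow> (\<integral>\<^sup>+x. ennreal \<bar>f (x + h) - f x\<bar> \<partial>torus) \<le> ennreal e"
proof -
  define Q :: "(real^'n) set" where "Q = cbox (- 1) (\<chi> i. 2)"
  have Qfin: "emeasure lborel Q < \<infinity>" unfolding Q_def by (rule emeasure_lborel_cbox_finite)
  have [measurable]: "Q \<in> sets borel" by (simp add: Q_def)
  have cell: "x + h \<in> Q" if "x \<in> torus_cell" "norm h \<le> 1" for x h
  proof -
    have "\<bar>h $ i\<bar> \<le> 1" for i using component_le_norm_cart[of h i] that(2) by linarith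
    then have "- 1 \<le> h $ i \<and> h $ i \<le> 1" for i by (simp add: abs_le_iff minus_le_iff)
    moreover have "0 \<le> x $ i \<and> x $ i \<le> 1" for i using that(1) by (auto simp: torus_cell_def mem_box_cart)
    ultimately show ?thesis unfolding Q_def mem_box_cart by (simp add: add_mono) (smt (verit))
  qed
  have "f measurable_on UNIV"
    using f_meas by (intro lebesgue_measurable_imp_measurable_on) (auto intro: measurable_completion)
  then obtain Z g where Z: "negligible Z" "\<And>n. continuous_on UNIV (g n)" "\<And>x. x \<notin> Z \<Longrightarrow> (\<lambda>n. g n x) \<longlonglongrightarrow> f x"
    unfolding measurable_on_def by auto
  \<comment> \<open>Clipping at the bound of \<open>f\<close> does not change the limit and supplies
    the majorant for dominated convergence.\<close>
  define k where "k n x = max (- B) (min B (g n x))" for n :: nat and x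
  have kc: "continuous_on UNIV (k n)" for n unfolding k_def by (intro continuous_intros Z)
  note [measurable] = borel_measurable_continuous_onI[OF kc]
  have B0: "0 \<le> B" using B[of 0] by linarith
  have kB: "\<bar>k n x\<bar> \<le> B" for n x using B0 by (auto simp: k_def)
  have "Z \<in> null_sets (completion lborel)" using Z(1) by (simp add: negligible_iff_null_sets)
  then have "AE x in completion lborel. x \<notin> Z" by (rule AE_not_in)
  then have Zae: "AE x in lborel. x \<notin> Z" by (simp add: AE_completion_iff)
  have "(\<lambda>n. \<integral>x. indicator Q x * \<bar>k n x - f x\<bar> \<partial>lborel) \<longlonglongrightarrow> (\<integral>x. (0::real) \<partial>(lborel :: (real^'n) measure))"
  proof (rule integral_dominated_convergence[where w="\<lambda>x. indicator Q x * (2 * B)"])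
    show "integrable lborel (\<lambda>x. indicator Q x * (2 * B))"
      using Qfin by (intro integrable_mult_left integrable_real_indicator) auto
    show "AE x in lborel. (\<lambda>n. indicator Q x * \<bar>k n x - f x\<bar>) \<longlonglongrightarrow> 0"
      using Zae
    proof eventually_elim
      case (elim x)
      have "(\<lambda>n. k n x) \<longlonglongrightarrow> max (- B) (min B (f x))"
        unfolding k_def by (intro tendsto_intros tendsto_max tendsto_min Z(3) elim)
      also have "max (- B) (min B (f x)) = f x" using B[of x] by (auto simp: abs_le_iff)
      finally have "(\<lambda>n. indicator Q x * \<bar>k n x - f x\<bar>) \<longlonglongrightarrow> indicator Q x * \<bar>f x - f x\<bar>"
        by (intro tendsto_intros)
      then show ?case by simp
    qed
    show "AE x in lborel. norm (indicator Q x * \<bar>k n x - f x\<bar>) \<le> indicator Q x * (2 * B)" for n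
    proof (rule AE_I2)
      fix x
      have "\<bar>k n x - f x\<bar> \<le> 2 * B" using kB[of n x] B[of x] by linarith
      then show "norm (indicator Q x * \<bar>k n x - f x\<bar>) \<le> indicator Q x * (2 * B)" by (simp add: indicator_def)
    qed
  qed measurable
  then have "\<forall>\<^sub>F n in sequentially. (\<integral>x. indicator Q x * \<bar>k n x - f x\<bar> \<partial>lborel) < e / 3"
    using e by (intro order_tendstoD(2)) auto
  then obtain n where n: "(\<integral>x. indicator Q x * \<bar>k n x - f x\<bar> \<partial>lborel) < e / 3"
    by (auto simp: eventually_sequentially)
  have ki: "integrable lborel (\<lambda>x. indicator Q x * \<bar>k n x - f x\<bar>)"
  proof (rule Bochner_Integration.integrable_bound[where f="\<lambda>x. indicator Q x * (2 * B)"])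
    show "integrable lborel (\<lambda>x. indicator Q x * (2 * B))"
      using Qfin by (intro integrable_mult_left integrable_real_indicator) auto
    show "AE x in lborel. norm (indicator Q x * \<bar>k n x - f x\<bar>) \<le> norm (indicator Q x * (2 * B))"
    proof (rule AE_I2)
      fix x
      have "\<bar>k n x - f x\<bar> \<le> 2 * B" using kB[of n x] B[of x] by linarith
      then show "norm (indicator Q x * \<bar>k n x - f x\<bar>) \<le> norm (indicator Q x * (2 * B))" by (simp add: indicator_def)
    qed
  qed measurable
  have n': "(\<integral>\<^sup>+x. ennreal (indicator Q x * \<bar>k n x - f x\<bar>) \<partial>lborel) \<le> ennreal (e / 3)"
    using n by (subst nn_integral_eq_integral[OF ki]) (auto intro: ennreal_leI)
  have shift: "(\<integral>\<^sup>+x. ennreal \<bar>k n (x + h) - f (x + h)\<bar> \<partial>torus) \<le> ennreal (e / 3)" if h: "norm h \<le> 1" for h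
  proof -
    have "(\<integral>\<^sup>+x. ennreal \<bar>k n (x + h) - f (x + h)\<bar> \<partial>torus) = (\<integral>\<^sup>+x. indicator torus_cell x * ennreal \<bar>k n (x + h) - f (x + h)\<bar> \<partial>lborel)"
      unfolding torus_def by (subst nn_integral_density) auto
    also have "\<dots> \<le> (\<integral>\<^sup>+x. ennreal (indicator Q (x + h) * \<bar>k n (x + h) - f (x + h)\<bar>) \<partial>lborel)"
      using cell[OF _ h] by (intro nn_integral_mono) (auto simp: indicator_def)
    also have "\<dots> = (\<integral>\<^sup>+x. ennreal (indicator Q x * \<bar>k n x - f x\<bar>) \<partial>lborel)"
      by (rule nn_integral_lborel_shift) measurable
    finally show ?thesis using n' by (rule order_trans)
  qed
  have "uniformly_continuous_on Q (k n)"
    by (intro compact_uniformly_continuous continuous_on_subset[OF kc]) (auto simp: Q_def)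
  then obtain d where d: "0 < d" "\<And>x y. x \<in> Q \<Longrightarrow> y \<in> Q \<Longrightarrow> dist y x < d \<Longrightarrow> dist (k n y) (k n x) < e / 3"
    unfolding uniformly_continuous_on_def using e by (metis divide_pos_pos zero_less_numeral)
  show ?thesis
  proof (intro exI[of _ "min 1 (d / 2)"] conjI allI impI)
    fix h :: "real^'n" assume h: "norm h \<le> min 1 (d / 2)"
    have mid: "(\<integral>\<^sup>+x. ennreal \<bar>k n (x + h) - k n x\<bar> \<partial>torus) \<le> ennreal (e / 3)"
    proof -
      have "AE x in torus. ennreal \<bar>k n (x + h) - k n x\<bar> \<le> ennreal (e / 3)"
        using AE_torus_half_open
      proof eventually_elim
        case (elim x)
        then have x: "x \<in> torus_cell" using half_open_cell_subset by blast
        have "dist (k n (x + h)) (k n x) < e / 3"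
          using cell[OF x, of h] cell[OF x, of 0] h d(1) by (intro d(2)) (auto simp: dist_norm)
        then show ?case by (intro ennreal_leI) (simp add: dist_real_def)
      qed
      then have "(\<integral>\<^sup>+x. ennreal \<bar>k n (x + h) - k n x\<bar> \<partial>torus) \<le> (\<integral>\<^sup>+x. ennreal (e / 3) \<partial>(torus :: (real^'n) measure))"
        by (rule nn_integral_mono_AE)
      also have "\<dots> = ennreal (e / 3)" by (simp add: emeasure_torus_UNIV)
      finally show ?thesis .
    qed
    have "(\<integral>\<^sup>+x. ennreal \<bar>f (x + h) - f x\<bar> \<partial>torus) \<le>
      (\<integral>\<^sup>+x. ennreal \<bar>k n (x + h) - f (x + h)\<bar> + ennreal \<bar>k n (x + h) - k n x\<bar> + ennreal \<bar>k n (x + 0) - f (x + 0)\<bar> \<partial>torus)"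
      by (intro nn_integral_mono) (auto simp flip: ennreal_plus intro!: ennreal_leI)
    also have "\<dots> = (\<integral>\<^sup>+x. ennreal \<bar>k n (x + h) - f (x + h)\<bar> \<partial>torus) + (\<integral>\<^sup>+x. ennreal \<bar>k n (x + h) - k n x\<bar> \<partial>torus)
       + (\<integral>\<^sup>+x. ennreal \<bar>k n (x + 0) - f (x + 0)\<bar> \<partial>torus)"
      by (subst nn_integral_add, measurable, subst nn_integral_add) auto
    also have "\<dots> \<le> ennreal (e / 3) + ennreal (e / 3) + ennreal (e / 3)"
      using h by (intro add_mono shift mid) auto
    also have "\<dots> = ennreal e" using e by (simp flip: ennreal_plus)
    finally show "(\<integral>\<^sup>+x. ennreal \<bar>f (x + h) - f x\<bar> \<partial>torus) \<le> ennreal e" .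
  qed (use d in auto)
qed

text \<open>Truncating the values preserves periodicity, so the truncation error has the same
  integral after a shift; the bounded case handles the rest.\<close>

lemma torus_shift_continuous:
  fixes f :: "real^'n \<Rightarrow> real"
  assumes f: "integrable torus f" and per: "periodic_x f" and e: "0 < e"
  shows "\<exists>d>0. \<forall>h. norm h \<le> d \<longrightarrow> (\<integral>\<^sup>+x. ennreal \<bar>f (x + h) - f x\<bar> \<partial>torus) \<le> ennreal e"
proof -
  have [measurable]: "f \<in> borel_measurable borel" using borel_measurable_integrable[OF f] by simp
  define g where "g n x = max (- real n) (min (real n) (f x))" for n x
  have [measurable]: "g n \<in> borel_measurable borel" for n unfolding g_def by measurable
  have "(\<lambda>n. \<integral>x. \<bar>g n x - f x\<bar> \<partial>torus) \<longlonglongrightarrow> (\<integral>x. (0::real) \<partial>(torus :: (real^'n) measure))"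
  proof (rule integral_dominated_convergence[where w="\<lambda>x. \<bar>f x\<bar>"])
    show "AE x in torus. (\<lambda>n. \<bar>g n x - f x\<bar>) \<longlonglongrightarrow> 0"
    proof (rule AE_I2)
      fix x
      have "\<forall>\<^sub>F n in sequentially. \<bar>f x\<bar> \<le> real n"
        by (meson eventually_sequentiallyI nat_ceiling_le_eq)
      then have "\<forall>\<^sub>F n in sequentially. \<bar>g n x - f x\<bar> = 0" by eventually_elim (auto simp: g_def)
      then show "(\<lambda>n. \<bar>g n x - f x\<bar>) \<longlonglongrightarrow> 0" by (rule tendsto_eventually)
    qed
    show "integrable torus (\<lambda>x. \<bar>f x\<bar>)" using f by simp
    show "AE x in torus. norm \<bar>g n x - f x\<bar> \<le> \<bar>f x\<bar>" for n
      by (intro AE_I2) (auto simp: g_def)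
  qed measurable
  then have "\<forall>\<^sub>F n in sequentially. (\<integral>x. \<bar>g n x - f x\<bar> \<partial>torus) < e / 3"
    using e by (intro order_tendstoD(2)) auto
  then obtain n where n: "(\<integral>x. \<bar>g n x - f x\<bar> \<partial>torus) < e / 3"
    by (auto simp: eventually_sequentially)
  have "integrable torus (\<lambda>x. \<bar>g n x - f x\<bar>)"
    by (rule Bochner_Integration.integrable_bound[OF f]) (auto simp: g_def)
  then have n': "(\<integral>\<^sup>+x. ennreal \<bar>g n x - f x\<bar> \<partial>torus) \<le> ennreal (e / 3)"
    using n by (subst nn_integral_eq_integral) (auto intro: ennreal_leI)
  have n'': "(\<integral>\<^sup>+x. ennreal \<bar>g n (x + h) - f (x + h)\<bar> \<partial>torus) \<le> ennreal (e / 3)" for h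
    using n' by (subst nn_integral_torus_shift) (use per in \<open>auto simp: periodic_x_def g_def\<close>)
  have gb: "\<bar>g n x\<bar> \<le> real n" for x by (auto simp: g_def)
  obtain d where d: "0 < d" "\<And>h. norm h \<le> d \<Longrightarrow> (\<integral>\<^sup>+x. ennreal \<bar>g n (x + h) - g n x\<bar> \<partial>torus) \<le> ennreal (e / 3)"
    using torus_shift_continuous_bounded[of "g n" "real n" "e / 3"] gb e by auto
  show ?thesis
  proof (intro exI[of _ d] conjI allI impI)
    fix h :: "real^'n" assume h: "norm h \<le> d"
    have "(\<integral>\<^sup>+x. ennreal \<bar>f (x + h) - f x\<bar> \<partial>torus) \<le>
      (\<integral>\<^sup>+x. ennreal \<bar>g n (x + h) - f (x + h)\<bar> + ennreal \<bar>g n (x + h) - g n x\<bar> + ennreal \<bar>g n x - f x\<bar> \<partial>torus)"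
      by (intro nn_integral_mono) (auto simp flip: ennreal_plus intro!: ennreal_leI)
    also have "\<dots> = (\<integral>\<^sup>+x. ennreal \<bar>g n (x + h) - f (x + h)\<bar> \<partial>torus) + (\<integral>\<^sup>+x. ennreal \<bar>g n (x + h) - g n x\<bar> \<partial>torus)
       + (\<integral>\<^sup>+x. ennreal \<bar>g n x - f x\<bar> \<partial>torus)"
      by (subst nn_integral_add, measurable, subst nn_integral_add) auto
    also have "\<dots> \<le> ennreal (e / 3) + ennreal (e / 3) + ennreal (e / 3)"
      using h by (intro add_mono n'' d n')
    also have "\<dots> = ennreal e" using e by (simp flip: ennreal_plus)
    finally show "(\<integral>\<^sup>+x. ennreal \<bar>f (x + h) - f x\<bar> \<partial>torus) \<le> ennreal e" .
  qed (rule d)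
qed

text \<open>The deviation is an average of increments over short shifts, with weight of total mass
  one; continuity of translations makes it small.\<close>

lemma (in mollifier) conv_eta_deviation:
  assumes f: "integrable torus f" and per: "periodic_x f"
    and A: "\<And>h. norm h \<le> CARD('n) * \<kappa> \<Longrightarrow> (\<integral>\<^sup>+x. ennreal \<bar>f (x + h) - f x\<bar> \<partial>torus) \<le> ennreal e"
  shows "(\<integral>\<^sup>+x. ennreal \<bar>conv \<eta> f x - f x\<bar> \<partial>torus) \<le> ennreal e"
proof -
  have [measurable]: "f \<in> borel_measurable borel" using borel_measurable_integrable[OF f] by simp
  note [measurable] = kernel_fun_borel[OF kernel_eta]
  have "(\<integral>\<^sup>+x. ennreal \<bar>conv \<eta> f x - f x\<bar> \<partial>torus) \<le> (\<integral>\<^sup>+x. \<integral>\<^sup>+y. ennreal (\<eta> (x - y)) * ennreal \<bar>f y - f x\<bar> \<partial>torus \<partial>torus)"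
  proof (intro nn_integral_mono)
    fix x :: "real^'n"
    have i: "integrable torus (\<lambda>y. f y - f x)" using f by simp
    have "conv \<eta> f x - f x = conv \<eta> (\<lambda>y. f y - f x) x"
      using f by (simp add: conv_diff[OF kernel_eta] conv_eta_const)
    also have "ennreal \<bar>\<dots>\<bar> \<le> (\<integral>\<^sup>+y. ennreal \<bar>\<eta> (x - y) * (f y - f x)\<bar> \<partial>torus)"
      unfolding conv_def using integral_norm_bound_ennreal[OF conv_integrable[OF kernel_eta i]] by simp
    also have "\<dots> = (\<integral>\<^sup>+y. ennreal (\<eta> (x - y)) * ennreal \<bar>f y - f x\<bar> \<partial>torus)"
      by (simp add: abs_mult eta_nonneg ennreal_mult')
    finally show "ennreal \<bar>conv \<eta> f x - f x\<bar> \<le> (\<integral>\<^sup>+y. ennreal (\<eta> (x - y)) * ennreal \<bar>f y - f x\<bar> \<partial>torus)" .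
  qed
  also have "\<dots> \<le> (\<integral>\<^sup>+h. ennreal (\<eta> h) \<partial>torus) * ennreal e"
  proof (rule nn_integral_kernel_difference[where \<kappa>=\<kappa> and \<phi>="\<lambda>z. ennreal \<bar>z\<bar>"])
    fix z assume "\<eta> z \<noteq> 0"
    then have "box_kernel \<kappa> z \<noteq> 0" using eta_le[of z] eta_nonneg[of z] by auto
    then show "z \<in> near_lattice \<kappa>" by (rule box_kernel_supp)
  qed (use per eta_periodic eta_minus A in auto)
  also have "(\<integral>\<^sup>+h. ennreal (\<eta> h) \<partial>torus) = 1"
    using kernel_eta eta_nonneg eta_integral
    by (subst nn_integral_eq_integral) (auto simp: kernel_fun_def torus_integrable_continuous)
  finally show ?thesis by simp
qed

text \<open>Two constants that are both close to \<open>E\<close> in mean over an interval of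
  positive length are close to each other, so \<open>a\<close> is Cauchy, and \<open>E\<close>
  equals its limit almost everywhere. Conservation is thereby obtained without comparing the energy
  at two times.\<close>

lemma L1_limit_constant:
  fixes E :: "real \<Rightarrow> real" and a :: "nat \<Rightarrow> real"
  assumes T: "0 < T" and [measurable]: "E \<in> borel_measurable borel"
    and lim: "\<And>e. 0 < e \<Longrightarrow> \<forall>\<^sub>F n in sequentially. (\<integral>\<^sup>+t. ennreal \<bar>E t - a n\<bar> \<partial>time_measure T) \<le> ennreal e"
  obtains L where "a \<longlonglongrightarrow> L" "AE t in time_measure T. E t = L"
proof -
  have tot: "emeasure (time_measure T) UNIV = ennreal T"
    using T by (simp add: time_measure_def emeasure_density)
  have const: "(\<integral>\<^sup>+t. ennreal b \<partial>time_measure T) = ennreal (b * T)" if "0 \<le> b" for b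
    using T that by (simp add: tot ennreal_mult)
  have "Cauchy a"
  proof (rule CauchyI)
    fix e :: real assume e: "0 < e"
    then have "0 < e * T / 3" using T by simp
    then obtain N where N: "\<And>n. N \<le> n \<Longrightarrow> (\<integral>\<^sup>+t. ennreal \<bar>E t - a n\<bar> \<partial>time_measure T) \<le> ennreal (e * T / 3)"
      using lim unfolding eventually_sequentially by metis
    show "\<exists>M. \<forall>m\<ge>M. \<forall>n\<ge>M. norm (a m - a n) < e"
    proof (intro exI[of _ N] allI impI)
      fix m n assume mn: "N \<le> m" "N \<le> n"
      have "ennreal (\<bar>a m - a n\<bar> * T) = (\<integral>\<^sup>+t. ennreal \<bar>a m - a n\<bar> \<partial>time_measure T)" by (rule const[symmetric]) simp
      also have "\<dots> \<le> (\<integral>\<^sup>+t. ennreal \<bar>E t - a m\<bar> + ennreal \<bar>E t - a n\<bar> \<partial>time_measure T)"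
        by (intro nn_integral_mono) (auto simp flip: ennreal_plus intro!: ennreal_leI)
      also have "\<dots> \<le> ennreal (e * T / 3) + ennreal (e * T / 3)"
        by (subst nn_integral_add) (auto intro!: add_mono N mn)
      also have "\<dots> = ennreal (2 * e * T / 3)" using e T by (simp flip: ennreal_plus)
      finally have "\<bar>a m - a n\<bar> * T \<le> (2 * e / 3) * T" using e T by (subst (asm) ennreal_le_iff) auto
      then have "\<bar>a m - a n\<bar> \<le> 2 * e / 3" using T by simp
      then show "norm (a m - a n) < e" using e by simp
    qed
  qed
  then obtain L where L: "a \<longlonglongrightarrow> L" by (auto simp: Cauchy_convergent_iff convergent_def)
  have "(\<integral>\<^sup>+t. ennreal \<bar>E t - L\<bar> \<partial>time_measure T) \<le> ennreal e" if e: "0 < e" for e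
  proof -
    have "\<forall>\<^sub>F n in sequentially. \<bar>a n - L\<bar> < e / (2 * T)"
      using L e T by (simp add: tendsto_iff dist_real_def)
    then have "\<forall>\<^sub>F n in sequentially. \<bar>a n - L\<bar> < e / (2 * T) \<and> (\<integral>\<^sup>+t. ennreal \<bar>E t - a n\<bar> \<partial>time_measure T) \<le> ennreal (e / 2)"
      using lim[of "e / 2"] e by (auto elim: eventually_elim2)
    then obtain n where n: "\<bar>a n - L\<bar> < e / (2 * T)" "(\<integral>\<^sup>+t. ennreal \<bar>E t - a n\<bar> \<partial>time_measure T) \<le> ennreal (e / 2)"
      by (auto simp: eventually_sequentially)
    have "(\<integral>\<^sup>+t. ennreal \<bar>E t - L\<bar> \<partial>time_measure T) \<le> (\<integral>\<^sup>+t. ennreal \<bar>E t - a n\<bar> + ennreal \<bar>a n - L\<bar> \<partial>time_measure T)"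
      by (intro nn_integral_mono) (auto simp flip: ennreal_plus intro!: ennreal_leI)
    also have "\<dots> = (\<integral>\<^sup>+t. ennreal \<bar>E t - a n\<bar> \<partial>time_measure T) + ennreal (\<bar>a n - L\<bar> * T)"
      by (subst nn_integral_add, simp, simp, subst const) auto
    also have "\<dots> \<le> ennreal (e / 2) + ennreal (e / 2)"
      using n T by (intro add_mono ennreal_leI) (auto simp: field_simps)
    also have "\<dots> = ennreal e" using e by (simp flip: ennreal_plus)
    finally show ?thesis .
  qed
  then have "(\<integral>\<^sup>+t. ennreal \<bar>E t - L\<bar> \<partial>time_measure T) = 0"
    by (metis (no_types, lifting) ennreal_le_epsilon add_0 le_zero_eq)
  then have "AE t in time_measure T. ennreal \<bar>E t - L\<bar> = 0"
    by (subst (asm) nn_integral_0_iff_AE) auto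
  then have "AE t in time_measure T. E t = L" by eventually_elim simp
  with L show thesis by (rule that)
qed

section \<open>Energy conservation for Borel data\<close>

lemma C_k_sum:
  assumes "finite A" "\<And>i. i \<in> A \<Longrightarrow> C_k k (f i)"
  shows "C_k k (\<lambda>x. \<Sum>i\<in>A. f i x)"
  using assms by (induction A rule: finite_induct) (auto intro: C_k_const C_k_add)

lemma C_k_affine:
  fixes f :: "'b::euclidean_space \<Rightarrow> real" and L :: "'a::euclidean_space \<Rightarrow> 'b"
  assumes L: "bounded_linear L" and f: "C_k k f"
  shows "C_k k (\<lambda>z. f (L z + b))"
  using f
proof (induction k arbitrary: f)
  case 0
  then have f: "continuous_on UNIV f" by simp
  have "continuous_on UNIV (\<lambda>z. L z + b)"
    by (intro continuous_on_add linear_continuous_on L continuous_on_const)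
  then show ?case using continuous_on_compose2[OF f] by simp
next
  case (Suc k)
  let ?D = "\<lambda>y. frechet_derivative f (at y)"
  have "((\<lambda>z. L z + b) has_derivative L) (at z)" for z
    using bounded_linear_imp_has_derivative[OF L, of "at z"] by (auto intro!: derivative_eq_intros)
  from has_derivative_compose[OF this C_k_Suc_derivative[OF Suc.prems]]
  have d: "((\<lambda>z. f (L z + b)) has_derivative (\<lambda>h. ?D (L z + b) (L h))) (at z)" for z .
  have lin: "linear (?D y)" for y
    using has_derivative_linear[OF C_k_Suc_derivative[OF Suc.prems]] .
  \<comment> \<open>\<open>C_k\<close> speaks about derivatives in basis directions only, so the
    derivative in the direction \<open>L h\<close> has to be expanded in the basis.\<close>
  have ex: "?D y w = (\<Sum>e\<in>Basis. (w \<bullet> e) * ?D y e)" for y w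
  proof -
    have "?D y w = ?D y (\<Sum>e\<in>Basis. (w \<bullet> e) *\<^sub>R e)" by (simp add: euclidean_representation)
    also have "\<dots> = (\<Sum>e\<in>Basis. (w \<bullet> e) * ?D y e)"
      by (simp add: linear_sum[OF lin] linear_cmul[OF lin])
    finally show ?thesis .
  qed
  show ?case
  proof (rule C_k_SucI[OF d])
    fix h :: 'a
    have "C_k k (\<lambda>z. \<Sum>e\<in>Basis. (L h \<bullet> e) * ?D (L z + b) e)"
      using Suc by (intro C_k_sum C_k_mult C_k_const) auto
    then show "C_k k (\<lambda>z. ?D (L z + b) (L h))" by (subst ex)
  qed
qed

lemma smooth_affine:
  fixes f :: "'b::euclidean_space \<Rightarrow> real" and L :: "'a::euclidean_space \<Rightarrow> 'b"
  shows "bounded_linear L \<Longrightarrow> smooth f \<Longrightarrow> smooth (\<lambda>z. f (L z + b))"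
  by (auto simp: smooth_def C_k_affine)

lemma smooth_reflect_shift: "smooth f \<Longrightarrow> smooth (\<lambda>y. f (x - y))"
  using smooth_affine[of uminus f x] bounded_linear_minus[OF bounded_linear_ident] by simp

lemma periodic_reflect_shift:
  assumes "periodic_x f" shows "periodic_x (\<lambda>y. f (x - y))"
  unfolding periodic_x_def
proof (intro allI impI)
  fix y k :: "real^'a" assume k: "\<forall>i. k $ i \<in> \<int>"
  have "f (x - (y + k) + k) = f (x - (y + k))"
    using assms k unfolding periodic_x_def by blast
  then show "f (x - (y + k)) = f (x - y)" by simp
qed

lemma time_AE_ex:
  assumes "AE t in time_measure T. Q t" "0 < \<delta>" "0 < T"
  obtains t where "0 < t" "t < \<delta>" "t < T" "Q t"
proof -
  have "\<exists>t. 0 < t \<and> t < \<delta> \<and> t < T \<and> Q t"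
  proof (rule ccontr)
    assume no: "\<not> ?thesis"
    have "AE t in lborel. t \<notin> {0<..<min \<delta> T}"
      using assms(1) unfolding AE_time_measure by eventually_elim (use no in auto)
    then have "{0<..<min \<delta> T} \<in> null_sets lborel" by (subst AE_iff_null_sets) auto
    then show False using assms by (auto simp: null_sets_def)
  qed
  then show thesis using that by blast
qed

text \<open>Borel data with pointwise density bounds. The regularity hypotheses appear only as
  \<open>osc\<close> and \<open>vanish\<close>, phrased through \<open>box_kernel\<close>; in this
  form all integrands are measurable, which is not evident for the seminorms as functions of
  time.\<close>

locale periodic_flow =
  fixes T c M \<kappa>0 :: real and \<rho> :: "real^'n \<Rightarrow> real \<Rightarrow> real" and u :: "real^'n \<Rightarrow> real \<Rightarrow> real^'n"
    and P :: "real^'n \<Rightarrow> real \<Rightarrow> real" and \<rho>0 :: "real^'n \<Rightarrow> real" and u0 :: "real^'n \<Rightarrow> real^'n"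
  assumes T: "0 < T" and c1: "1 \<le> c"
    and rho_meas [measurable]: "(\<lambda>(x, t). \<rho> x t) \<in> borel_measurable (borel \<Otimes>\<^sub>M borel)"
    and u_meas [measurable]: "(\<lambda>(x, t). u x t) \<in> borel_measurable (borel \<Otimes>\<^sub>M borel)"
    and P_meas [measurable]: "(\<lambda>(x, t). P x t) \<in> borel_measurable (borel \<Otimes>\<^sub>M borel)"
    and rho0_meas [measurable]: "\<rho>0 \<in> borel_measurable borel"
    and u0_meas [measurable]: "u0 \<in> borel_measurable borel"
    and per_init: "periodic_x \<rho>0" "periodic_x u0"
    and rho_ge: "1 / c \<le> \<rho> y t" and rho_le: "\<rho> y t \<le> c"
    and u3: "integrable (torus \<Otimes>\<^sub>M time_measure T) (\<lambda>(y, t). norm (u y t) ^ 3)"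
    and P32: "integrable (torus \<Otimes>\<^sub>M time_measure T) (\<lambda>(y, t). \<bar>P y t\<bar> powr (3/2))"
    and weak_mass: "\<And>\<kappa> C \<eta> K \<theta> \<theta>' x. mollifier \<kappa> C \<eta> K \<Longrightarrow> time_test T \<theta> \<Longrightarrow>
      (\<And>t. (\<theta> has_real_derivative \<theta>' t) (at t)) \<Longrightarrow>
      (\<integral>(y, t). \<rho> y t * (\<eta> (x - y) * \<theta>' t) - (\<Sum>j\<in>UNIV. \<rho> y t * u y t $ j * (K j (x - y) * \<theta> t))
        \<partial>(torus \<Otimes>\<^sub>M time_measure T)) = 0"
    and weak_momentum: "\<And>\<kappa> C \<eta> K \<theta> \<theta>' x i. mollifier \<kappa> C \<eta> K \<Longrightarrow> time_test T \<theta> \<Longrightarrow>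
      (\<And>t. (\<theta> has_real_derivative \<theta>' t) (at t)) \<Longrightarrow>
      (\<integral>(y, t). \<rho> y t * u y t $ i * (\<eta> (x - y) * \<theta>' t)
         - (\<Sum>j\<in>UNIV. \<rho> y t * u y t $ i * u y t $ j * (K j (x - y) * \<theta> t)) - P y t * (K i (x - y) * \<theta> t)
        \<partial>(torus \<Otimes>\<^sub>M time_measure T)) = 0"
    and weak_div: "\<And>\<kappa> C \<eta> K \<theta> x. mollifier \<kappa> C \<eta> K \<Longrightarrow> time_test T \<theta> \<Longrightarrow>
      (\<integral>(y, t). (\<Sum>j\<in>UNIV. u y t $ j * (K j (x - y) * \<theta> t)) \<partial>(torus \<Otimes>\<^sub>M time_measure T)) = 0"
    and init_mass: "\<And>\<psi> e. smooth \<psi> \<Longrightarrow> periodic_x \<psi> \<Longrightarrow> 0 < e \<Longrightarrow>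
      \<exists>\<delta>>0. AE t in time_measure T. t < \<delta> \<longrightarrow> \<bar>(\<integral>y. \<rho> y t * \<psi> y \<partial>torus) - (\<integral>y. \<rho>0 y * \<psi> y \<partial>torus)\<bar> < e"
    and init_momentum: "\<And>\<psi> e. (\<And>i. smooth (\<lambda>x. \<psi> x $ i)) \<Longrightarrow> periodic_x \<psi> \<Longrightarrow> 0 < e \<Longrightarrow>
      \<exists>\<delta>>0. AE t in time_measure T. t < \<delta> \<longrightarrow>
        \<bar>(\<integral>y. (\<rho> y t *\<^sub>R u y t) \<bullet> \<psi> y \<partial>torus) - (\<integral>y. (\<rho>0 y *\<^sub>R u0 y) \<bullet> \<psi> y \<partial>torus)\<bar> < e"
    and M: "0 \<le> M" and kappa0: "0 < \<kappa>0"
    and osc: "\<And>\<kappa>. 0 < \<kappa> \<Longrightarrow> \<kappa> < \<kappa>0 \<Longrightarrow> AE t in time_measure T. AE x in torus. AE y in torus.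
      box_kernel \<kappa> (x - y) \<noteq> 0 \<longrightarrow> \<bar>\<rho> x t - \<rho> y t\<bar> \<le> M * \<kappa> powr (2/3)"
    and vanish: "\<And>e. 0 < e \<Longrightarrow> \<exists>\<kappa>1>0. \<forall>\<kappa>. 0 < \<kappa> \<longrightarrow> \<kappa> < \<kappa>1 \<longrightarrow>
      (\<integral>\<^sup>+t. \<integral>\<^sup>+x. \<integral>\<^sup>+y. ennreal (box_kernel \<kappa> (x - y) * norm (u y t - u x t) ^ 3) \<partial>torus \<partial>torus \<partial>time_measure T)
        \<le> ennreal (\<kappa> * e)"
begin

abbreviation "m0 i \<equiv> \<lambda>y. \<rho>0 y * u0 y $ i"
abbreviation "kinetic t \<equiv> \<integral>y. \<rho> y t * (norm (u y t))\<^sup>2 \<partial>torus"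

lemma inner_axis_scale: "(r *\<^sub>R w) \<bullet> (a *\<^sub>R axis i 1) = a * (r * w $ i)" for w :: "real^'n"
  by (simp add: inner_axis)

lemma smooth_axis: "smooth f \<Longrightarrow> smooth (\<lambda>y. (f y *\<^sub>R axis i 1 :: real^'n) $ j)"
  by (cases "i = j") (auto simp: axis_def smooth_const)

lemma flow_mollifier:
  assumes "mollifier \<kappa> C \<eta> K"
  shows "flow \<kappa> C \<eta> K T c \<rho> u P (conv \<eta> \<rho>0) (\<lambda>i. conv \<eta> (m0 i))"
proof -
  interpret mollifier \<kappa> C \<eta> K by fact
  note [measurable] = kernel_fun_borel[OF kernel_eta]
  note per = periodic_reflect_shift[OF eta_periodic]
  show ?thesis
  proof (unfold_locales)
    show "\<exists>\<delta>>0. AE t in time_measure T. t < \<delta> \<longrightarrow> \<bar>conv \<eta> (\<lambda>y. \<rho> y t) x - conv \<eta> \<rho>0 x\<bar> < e" if "0 < e" for x e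
      using init_mass[OF smooth_reflect_shift[OF smooth_eta] per that, of x] by (simp add: conv_def mult.commute)
    show "\<exists>\<delta>>0. AE t in time_measure T. t < \<delta> \<longrightarrow> \<bar>conv \<eta> (\<lambda>y. \<rho> y t * u y t $ i) x - conv \<eta> (m0 i) x\<bar> < e" if "0 < e" for x e i
    proof -
      have "periodic_x (\<lambda>y. \<eta> (x - y) *\<^sub>R axis i 1 :: real^'n)" using per[of x] by (simp add: periodic_x_def)
      from init_momentum[OF smooth_axis[OF smooth_reflect_shift[OF smooth_eta]] this that]
      show ?thesis unfolding inner_axis_scale conv_def .
    qed
    show "conv \<eta> \<rho>0 \<in> borel_measurable borel" "conv \<eta> (m0 i) \<in> borel_measurable borel" for i
      unfolding conv_def[abs_def] by measurable
  qed (use T c1 rho_ge rho_le u3 P32 weak_mass[OF assms] weak_momentum[OF assms] weak_div[OF assms] in \<open>simp_all\<close>)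
qed

text \<open>The lower bound at positive times survives mollification and passes through the initial
  limit. This is the source of all positivity of \<open>\<rho>0\<close>.\<close>

lemma mollified_initial_density_ge:
  assumes "mollifier \<kappa> C \<eta> K"
  shows "1 / c \<le> conv \<eta> \<rho>0 x"
proof (rule field_le_epsilon)
  interpret flow \<kappa> C \<eta> K T c \<rho> u P "conv \<eta> \<rho>0" "\<lambda>i. conv \<eta> (m0 i)" by (rule flow_mollifier[OF assms])
  fix e :: real assume "0 < e"
  then obtain \<delta> where \<delta>: "0 < \<delta>" "AE t in time_measure T. t < \<delta> \<longrightarrow> \<bar>conv \<eta> (\<lambda>y. \<rho> y t) x - conv \<eta> \<rho>0 x\<bar> < e"
    using flow.init_mass[OF flow_mollifier[OF assms]] by blast
  have "AE t in time_measure T. (t < \<delta> \<longrightarrow> \<bar>rt x t - conv \<eta> \<rho>0 x\<bar> < e) \<and> 1 / c \<le> rt x t"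
    using \<delta>(2) rt_ge[of x] by eventually_elim (simp add: rt_def)
  then obtain t where t: "t < \<delta>" "t < \<delta> \<longrightarrow> \<bar>rt x t - conv \<eta> \<rho>0 x\<bar> < e" "1 / c \<le> rt x t"
    by (rule time_AE_ex[OF _ \<delta>(1) T]) auto
  then have "\<bar>rt x t - conv \<eta> \<rho>0 x\<bar> < e" by simp
  then show "1 / c \<le> conv \<eta> \<rho>0 x + e" using t(3) by linarith
qed

text \<open>Otherwise the initial mass would have the default value 0, contradicting the initial
  limit for the test function 1, because the mass at positive times is at least
  \<open>1 / c\<close>.\<close>

lemma initial_density_integrable: "integrable torus \<rho>0"
proof (rule ccontr)
  assume "\<not> integrable torus \<rho>0"
  then have 0: "(\<integral>y. \<rho>0 y * 1 \<partial>torus) = 0" by (simp add: not_integrable_integral_eq)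
  have p: "0 < 1 / c" using c1 by simp
  obtain \<delta> where \<delta>: "0 < \<delta>" "AE t in time_measure T. t < \<delta> \<longrightarrow> \<bar>(\<integral>y. \<rho> y t * 1 \<partial>torus) - (\<integral>y. \<rho>0 y * 1 \<partial>torus)\<bar> < 1 / c"
    using init_mass[OF smooth_const[of 1] _ p] by (auto simp: periodic_x_def)
  obtain t where t: "t < \<delta>" "t < \<delta> \<longrightarrow> \<bar>(\<integral>y. \<rho> y t * 1 \<partial>torus) - (\<integral>y. \<rho>0 y * 1 \<partial>torus)\<bar> < 1 / c"
    by (rule time_AE_ex[OF \<delta>(2) \<delta>(1) T]) blast
  have "integrable torus (\<lambda>y. \<rho> y t)"
  proof (rule torus.integrable_const_bound[of _ c])
    have "\<bar>\<rho> y t\<bar> \<le> c" for y using rho_ge[of y t] rho_le[of y t] p by linarith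
    then show "AE y in torus. norm (\<rho> y t) \<le> c" by simp
  qed measurable
  then have "(\<integral>y. 1 / c \<partial>(torus :: (real^'n) measure)) \<le> (\<integral>y. \<rho> y t \<partial>torus)"
    by (intro integral_mono) (auto simp: rho_ge)
  moreover have "measure torus (UNIV :: (real^'n) set) = 1"
    using torus.prob_space by (simp only: space_torus)
  ultimately have "1 / c \<le> (\<integral>y. \<rho> y t \<partial>torus)" by simp
  then show False using t 0 by simp
qed

text \<open>A momentum for which some pairing is not integrable pairs to zero with every test function: the
  pairing has the junk value 0 off a proper subspace, and it is additive because it is a limit.\<close>

lemma mollified_momentum_junk:
  assumes mol: "mollifier \<kappa> C \<eta> K" and ni: "\<not> integrable torus (m0 i)"
  shows "conv \<eta> (m0 j) x = 0"
proof (rule ccontr)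
  interpret mollifier \<kappa> C \<eta> K by fact
  interpret F: flow \<kappa> C \<eta> K T c \<rho> u P "conv \<eta> \<rho>0" "\<lambda>i. conv \<eta> (m0 i)" by (rule flow_mollifier[OF mol])
  assume ne: "conv \<eta> (m0 j) x \<noteq> 0"
  define \<psi> \<psi>' :: "real^'n \<Rightarrow> real^'n" where "\<psi> y = \<eta> (x - y) *\<^sub>R axis j 1" and "\<psi>' y = 1 *\<^sub>R axis i 1" for y
  let ?f = "\<lambda>y. (\<rho>0 y *\<^sub>R u0 y) \<bullet> \<psi> y" and ?f' = "\<lambda>y. (\<rho>0 y *\<^sub>R u0 y) \<bullet> \<psi>' y"
  have f: "?f = (\<lambda>y. \<eta> (x - y) * m0 j y)" and f': "?f' = m0 i"
    unfolding \<psi>_def \<psi>'_def inner_axis_scale by auto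
  have "integrable torus ?f"
    using ne not_integrable_integral_eq unfolding f conv_def by blast
  have "\<not> integrable torus (\<lambda>y. (\<rho>0 y *\<^sub>R u0 y) \<bullet> (\<psi> y + \<psi>' y))"
  proof
    assume "integrable torus (\<lambda>y. (\<rho>0 y *\<^sub>R u0 y) \<bullet> (\<psi> y + \<psi>' y))"
    then have "integrable torus (\<lambda>y. (\<rho>0 y *\<^sub>R u0 y) \<bullet> (\<psi> y + \<psi>' y) - ?f y)"
      using \<open>integrable torus ?f\<close> by (rule Bochner_Integration.integrable_diff)
    then have "integrable torus ?f'" by (simp add: inner_add_right)
    then show False using ni f' by simp
  qed
  then have z: "(\<integral>y. (\<rho>0 y *\<^sub>R u0 y) \<bullet> (\<psi> y + \<psi>' y) \<partial>torus) = 0" "(\<integral>y. ?f' y \<partial>torus) = 0"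
    using ni f' by (simp_all add: not_integrable_integral_eq)
  \<comment> \<open>A third is enough: at a common small time the pairing with \<open>\<psi>\<close>
    is within \<open>e\<close> of its initial value, while the pairings with \<open>\<psi>'\<close>
    and with the sum are within \<open>e\<close> of 0. Together they force the initial value below
    \<open>3 * e\<close>.\<close>
  define e where "e = \<bar>\<integral>y. ?f y \<partial>torus\<bar> / 3"
  have e: "0 < e" using ne unfolding e_def f conv_def by simp
  note per = periodic_reflect_shift[OF eta_periodic, of x]
  have sm: "smooth (\<lambda>y. \<psi> y $ k)" "smooth (\<lambda>y. \<psi>' y $ k)" for k
    unfolding \<psi>_def \<psi>'_def
    by (rule smooth_axis[OF smooth_reflect_shift[OF smooth_eta]], rule smooth_axis[OF smooth_const])
  have pp: "periodic_x \<psi>" "periodic_x \<psi>'" "periodic_x (\<lambda>y. \<psi> y + \<psi>' y)"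
    using per unfolding periodic_x_def \<psi>_def \<psi>'_def by simp_all
  have sm': "smooth (\<lambda>y. (\<psi> y + \<psi>' y) $ k)" for k using sm by (simp add: smooth_add)
  let ?A = "\<lambda>t \<psi>. \<integral>y. (\<rho> y t *\<^sub>R u y t) \<bullet> \<psi> y \<partial>torus"
  obtain \<delta>1 where \<delta>1: "0 < \<delta>1" "AE t in time_measure T. t < \<delta>1 \<longrightarrow> \<bar>?A t \<psi> - (\<integral>y. ?f y \<partial>torus)\<bar> < e"
    using init_momentum[OF sm(1) pp(1) e] by blast
  obtain \<delta>2 where \<delta>2: "0 < \<delta>2" "AE t in time_measure T. t < \<delta>2 \<longrightarrow> \<bar>?A t \<psi>' - (\<integral>y. ?f' y \<partial>torus)\<bar> < e"
    using init_momentum[OF sm(2) pp(2) e] by blast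
  obtain \<delta>3 where \<delta>3: "0 < \<delta>3" "AE t in time_measure T. t < \<delta>3 \<longrightarrow> \<bar>?A t (\<lambda>y. \<psi> y + \<psi>' y) - (\<integral>y. (\<rho>0 y *\<^sub>R u0 y) \<bullet> (\<psi> y + \<psi>' y) \<partial>torus)\<bar> < e"
    using init_momentum[OF sm' pp(3) e] by blast
  have "AE t in time_measure T. t < min \<delta>1 (min \<delta>2 \<delta>3) \<longrightarrow> False"
    using \<delta>1(2) \<delta>2(2) \<delta>3(2) F.AE_state
  proof eventually_elim
    case (elim t)
    interpret S: torus_state \<kappa> C \<eta> K "\<lambda>y. \<rho> y t" "\<lambda>y. u y t" "\<lambda>y. P y t" c by (rule elim)
    have "integrable torus (\<lambda>y. (\<rho> y t *\<^sub>R u y t) \<bullet> \<psi> y)"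
      unfolding \<psi>_def inner_axis_scale by (rule conv_integrable[OF kernel_eta S.int_rho_u])
    moreover have "integrable torus (\<lambda>y. (\<rho> y t *\<^sub>R u y t) \<bullet> \<psi>' y)"
      unfolding \<psi>'_def inner_axis_scale using S.int_rho_u by simp
    ultimately have "?A t (\<lambda>y. \<psi> y + \<psi>' y) = ?A t \<psi> + ?A t \<psi>'"
      by (simp add: inner_add_right)
    note add = this
    show ?case
    proof
      assume "t < min \<delta>1 (min \<delta>2 \<delta>3)"
      then have "\<bar>?A t \<psi> - (\<integral>y. ?f y \<partial>torus)\<bar> < e" "\<bar>?A t \<psi>'\<bar> < e" "\<bar>?A t \<psi> + ?A t \<psi>'\<bar> < e"
        using elim(1-3) z unfolding add by auto
      moreover have "\<bar>\<integral>y. ?f y \<partial>torus\<bar> = 3 * e" by (simp add: e_def)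
      ultimately show False by linarith
    qed
  qed
  then show False
    by (rule time_AE_ex[where \<delta>="min \<delta>1 (min \<delta>2 \<delta>3)"]) (use \<delta>1 \<delta>2 \<delta>3 T in auto)
qed

text \<open>The Jensen gap is an explicit quantity: the second central moment of \<open>u0\<close>
  about its Favre average, nonnegative because the initial density is.\<close>

lemma mollified_initial_energy_le:
  assumes mol: "mollifier \<kappa> C \<eta> K" and m: "\<And>i. integrable torus (m0 i)"
    and e: "integrable torus (\<lambda>y. \<rho>0 y * (norm (u0 y))\<^sup>2)" and nn: "AE y in torus. 0 \<le> \<rho>0 y"
  shows "(\<integral>x. (\<Sum>i\<in>UNIV. (conv \<eta> (m0 i) x)\<^sup>2 / conv \<eta> \<rho>0 x) \<partial>torus) \<le> (\<integral>y. \<rho>0 y * (norm (u0 y))\<^sup>2 \<partial>torus)"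
proof -
  interpret mollifier \<kappa> C \<eta> K by fact
  have pos: "0 < conv \<eta> \<rho>0 x" for x
    using mollified_initial_density_ge[OF mol, of x] c1 by (smt (verit) divide_pos_pos)
  have le: "(\<Sum>i\<in>UNIV. (conv \<eta> (m0 i) x)\<^sup>2 / conv \<eta> \<rho>0 x) \<le> conv \<eta> (\<lambda>y. \<rho>0 y * (norm (u0 y))\<^sup>2) x" for x
  proof -
    let ?v = "favre \<eta> \<rho>0 u0 x"
    have "0 \<le> conv \<eta> (\<lambda>y. \<rho>0 y * (norm (u0 y - ?v))\<^sup>2) x"
      unfolding conv_def by (rule integral_nonneg_AE, use nn in eventually_elim) (simp add: eta_nonneg)
    also have "\<dots> = conv \<eta> (\<lambda>y. \<rho>0 y * (norm (u0 y))\<^sup>2) x - 2 * (\<Sum>i\<in>UNIV. ?v $ i * conv \<eta> (m0 i) x) + (norm ?v)\<^sup>2 * conv \<eta> \<rho>0 x"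
      by (rule conv_square_expand[OF kernel_eta initial_density_integrable m e])
    also have "(norm ?v)\<^sup>2 * conv \<eta> \<rho>0 x = (\<Sum>i\<in>UNIV. (conv \<eta> (m0 i) x)\<^sup>2 / conv \<eta> \<rho>0 x)"
    proof -
      have "(norm ?v)\<^sup>2 = (\<Sum>i\<in>UNIV. (?v $ i)\<^sup>2)"
        by (simp add: power2_norm_eq_inner inner_vec_def) (simp add: power2_eq_square)
      then show ?thesis using pos[of x] by (simp add: sum_distrib_right favre_def power2_eq_square)
    qed
    also have "(\<Sum>i\<in>UNIV. ?v $ i * conv \<eta> (m0 i) x) = (\<Sum>i\<in>UNIV. (conv \<eta> (m0 i) x)\<^sup>2 / conv \<eta> \<rho>0 x)"
      by (simp add: favre_def power2_eq_square)
    finally show ?thesis by simp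
  qed
  have "(\<integral>x. (\<Sum>i\<in>UNIV. (conv \<eta> (m0 i) x)\<^sup>2 / conv \<eta> \<rho>0 x) \<partial>torus) \<le> (\<integral>x. conv \<eta> (\<lambda>y. \<rho>0 y * (norm (u0 y))\<^sup>2) x \<partial>torus)"
  proof (rule integral_mono[OF _ _ le])
    show "integrable torus (\<lambda>x. \<Sum>i\<in>UNIV. (conv \<eta> (m0 i) x)\<^sup>2 / conv \<eta> \<rho>0 x)"
    proof (rule torus_integrable_continuous)
      show "continuous_on UNIV (\<lambda>x. \<Sum>i\<in>UNIV. (conv \<eta> (m0 i) x)\<^sup>2 / conv \<eta> \<rho>0 x)"
        using pos by (intro continuous_intros conv_continuous kernel_eta m initial_density_integrable) (auto simp: less_imp_neq[symmetric])
      show "periodic_x (\<lambda>x. \<Sum>i\<in>UNIV. (conv \<eta> (m0 i) x)\<^sup>2 / conv \<eta> \<rho>0 x)"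
        using conv_periodic[OF kernel_eta] by (simp add: periodic_x_def)
    qed
    show "integrable torus (conv \<eta> (\<lambda>y. \<rho>0 y * (norm (u0 y))\<^sup>2))"
      using kernel_fun_conv[OF kernel_eta e] by (auto simp: kernel_fun_def intro: torus_integrable_continuous)
  qed
  then show ?thesis by (simp add: conv_eta_integral[OF e])
qed

lemma mollified_L1_tendsto:
  fixes \<kappa> :: "nat \<Rightarrow> real" and f :: "real^'n \<Rightarrow> real"
  assumes mol: "\<And>n. mollifier (\<kappa> n) C (\<eta> n) (K n)" and \<kappa>: "\<kappa> \<longlonglongrightarrow> 0"
    and f: "integrable torus f" "periodic_x f"
  shows "(\<lambda>n. \<integral>x. \<bar>conv (\<eta> n) f x - f x\<bar> \<partial>torus) \<longlonglongrightarrow> 0"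
proof (rule tendstoI)
  fix e :: real assume e: "0 < e"
  then have e2: "0 < e / 2" by simp
  obtain d where d: "0 < d" "\<And>h. norm h \<le> d \<Longrightarrow> (\<integral>\<^sup>+x. ennreal \<bar>f (x + h) - f x\<bar> \<partial>torus) \<le> ennreal (e / 2)"
    using torus_shift_continuous[OF f e2] by blast
  have "(\<lambda>n. real CARD('n) * \<kappa> n) \<longlonglongrightarrow> real CARD('n) * 0" by (intro tendsto_intros \<kappa>)
  then have "\<forall>\<^sub>F n in sequentially. CARD('n) * \<kappa> n < d" using d(1) by (intro order_tendstoD(2)) auto
  then show "\<forall>\<^sub>F n in sequentially. dist (\<integral>x. \<bar>conv (\<eta> n) f x - f x\<bar> \<partial>torus) 0 < e"
  proof eventually_elim
    case (elim n)
    interpret mollifier "\<kappa> n" C "\<eta> n" "K n" by (rule mol)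
    have "integrable torus (conv (\<eta> n) f)"
      using kernel_fun_conv[OF kernel_eta f(1)] by (auto simp: kernel_fun_def intro: torus_integrable_continuous)
    then have i: "integrable torus (\<lambda>x. \<bar>conv (\<eta> n) f x - f x\<bar>)" using f by simp
    have "(\<integral>\<^sup>+x. ennreal \<bar>conv (\<eta> n) f x - f x\<bar> \<partial>torus) \<le> ennreal (e / 2)"
      using d(2) elim by (intro conv_eta_deviation f) auto
    then have "(\<integral>x. \<bar>conv (\<eta> n) f x - f x\<bar> \<partial>torus) \<le> e / 2"
      using e by (subst (asm) nn_integral_eq_integral[OF i]) auto
    then show ?case using e by (simp add: dist_real_def)
  qed
qed

text \<open>If some momentum component is not integrable, all mollified momenta vanish and
  \<open>L = 0\<close>. The energy density is then not integrable either, since it together with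
  \<open>\<rho>0\<close> dominates the momentum, so its integral is 0 by convention. Otherwise the
  Fatou and Jensen bounds meet at \<open>L\<close>.\<close>

lemma initial_energy_limit:
  fixes \<kappa> :: "nat \<Rightarrow> real"
  assumes mol: "\<And>n. mollifier (\<kappa> n) C (\<eta> n) (K n)" and \<kappa>: "\<kappa> \<longlonglongrightarrow> 0"
    and lim: "(\<lambda>n. \<integral>x. (\<Sum>i\<in>UNIV. (conv (\<eta> n) (m0 i) x)\<^sup>2 / conv (\<eta> n) \<rho>0 x) \<partial>torus) \<longlonglongrightarrow> L"
  shows "(\<integral>y. \<rho>0 y * (norm (u0 y))\<^sup>2 \<partial>torus) = L"
proof (cases "\<forall>i. integrable torus (m0 i)")
  case False
  then obtain i where i: "\<not> integrable torus (m0 i)" by blast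
  have "(\<lambda>n::nat. 0::real) \<longlonglongrightarrow> L"
    using lim by (simp add: mollified_momentum_junk[OF mol i])
  then have "L = 0" by (simp add: LIMSEQ_const_iff)
  moreover have "\<not> integrable torus (\<lambda>y. \<rho>0 y * (norm (u0 y))\<^sup>2)"
  proof
    assume e: "integrable torus (\<lambda>y. \<rho>0 y * (norm (u0 y))\<^sup>2)"
    have "integrable torus (\<lambda>y. \<bar>\<rho>0 y\<bar> + \<bar>\<rho>0 y * (norm (u0 y))\<^sup>2\<bar>)"
      using e initial_density_integrable by simp
    then have "integrable torus (m0 i)"
    proof (rule Bochner_Integration.integrable_bound)
      show "AE y in torus. norm (m0 i y) \<le> norm (\<bar>\<rho>0 y\<bar> + \<bar>\<rho>0 y * (norm (u0 y))\<^sup>2\<bar>)"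
      proof (rule AE_I2)
        fix y
        have "\<bar>u0 y $ i\<bar> \<le> norm (u0 y)" by (rule component_le_norm_cart)
        also have "norm (u0 y) \<le> 1 + (norm (u0 y))\<^sup>2"
        proof -
          have "2 * norm (u0 y) \<le> 1 + (norm (u0 y))\<^sup>2" using sum_squares_bound[of 1 "norm (u0 y)"] by simp
          then show ?thesis using norm_ge_zero[of "u0 y"] by linarith
        qed
        finally have "\<bar>\<rho>0 y\<bar> * \<bar>u0 y $ i\<bar> \<le> \<bar>\<rho>0 y\<bar> * (1 + (norm (u0 y))\<^sup>2)" by (rule mult_left_mono) simp
        then show "norm (m0 i y) \<le> norm (\<bar>\<rho>0 y\<bar> + \<bar>\<rho>0 y * (norm (u0 y))\<^sup>2\<bar>)"
          by (simp add: abs_mult distrib_left)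
      qed
    qed measurable
    then show False using i by simp
  qed
  ultimately show ?thesis by (simp add: not_integrable_integral_eq)
next
  case True
  then have m: "integrable torus (m0 i)" for i by blast
  have per: "periodic_x (m0 i)" for i using per_init by (simp add: periodic_x_def)
  have kc: "integrable torus (conv (\<eta> n) f)" if "integrable torus f" for n f
    using kernel_fun_conv[OF mollifier.kernel_eta[OF mol] that] by (auto simp: kernel_fun_def intro: torus_integrable_continuous)
  \<comment> \<open>The errors of the density and of all momentum components are added, so that a
    single subsequence converges almost everywhere for all of them.\<close>
  define h where "h n x = \<bar>conv (\<eta> n) \<rho>0 x - \<rho>0 x\<bar> + (\<Sum>i\<in>UNIV. \<bar>conv (\<eta> n) (m0 i) x - m0 i x\<bar>)" for n x
  have hi: "integrable torus (h n)" for n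
    unfolding h_def using kc[OF initial_density_integrable] kc[OF m] initial_density_integrable m by simp
  have hn: "norm (h n x) = h n x" for n x by (simp add: h_def sum_nonneg)
  have "(\<lambda>n. (\<integral>x. \<bar>conv (\<eta> n) \<rho>0 x - \<rho>0 x\<bar> \<partial>torus) + (\<Sum>i\<in>UNIV. \<integral>x. \<bar>conv (\<eta> n) (m0 i) x - m0 i x\<bar> \<partial>torus)) \<longlonglongrightarrow> 0 + (\<Sum>i\<in>(UNIV::'n set). 0)"
    by (intro tendsto_add tendsto_sum mollified_L1_tendsto[OF mol \<kappa>] initial_density_integrable m per per_init)
  moreover have "(\<integral>x. norm (h n x) \<partial>torus) = (\<integral>x. \<bar>conv (\<eta> n) \<rho>0 x - \<rho>0 x\<bar> \<partial>torus) + (\<Sum>i\<in>UNIV. \<integral>x. \<bar>conv (\<eta> n) (m0 i) x - m0 i x\<bar> \<partial>torus)" for n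
    unfolding hn unfolding h_def using kc[OF initial_density_integrable] kc[OF m] initial_density_integrable m by simp
  ultimately have "(\<lambda>n. \<integral>x. norm (h n x) \<partial>torus) \<longlonglongrightarrow> 0" by simp
  from tendsto_L1_AE_subseq[OF hi this] obtain r :: "nat \<Rightarrow> nat" where r: "strict_mono r" "AE x in torus. (\<lambda>n. h (r n) x) \<longlonglongrightarrow> 0"
    by blast
  define F where "F n x = (\<Sum>i\<in>UNIV. (conv (\<eta> n) (m0 i) x)\<^sup>2 / conv (\<eta> n) \<rho>0 x)" for n x
  have pos: "0 < conv (\<eta> n) \<rho>0 x" for n x
    using mollified_initial_density_ge[OF mol, of n x] c1 by (smt (verit) divide_pos_pos)
  have Fnn: "0 \<le> F n x" for n x unfolding F_def using pos[of n x] by (intro sum_nonneg) simp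
  have Fi: "integrable torus (F n)" for n
  proof (rule torus_integrable_continuous)
    show "continuous_on UNIV (F n)"
      unfolding F_def using pos by (intro continuous_intros conv_continuous mollifier.kernel_eta[OF mol] m initial_density_integrable) (auto simp: less_imp_neq[symmetric])
    show "periodic_x (F n)"
      using conv_periodic[OF mollifier.kernel_eta[OF mol]] by (simp add: periodic_x_def F_def)
  qed
  note [measurable] = borel_measurable_integrable[OF Fi]
  have conv: "AE x in torus. 1 / c \<le> \<rho>0 x \<and> (\<lambda>n. F (r n) x) \<longlonglongrightarrow> \<rho>0 x * (norm (u0 x))\<^sup>2"
    using r(2)
  proof eventually_elim
    case (elim x)
    have sub: "(\<lambda>n. a n) \<longlonglongrightarrow> b" if "\<And>n. \<bar>a n - b\<bar> \<le> h (r n) x" for a :: "nat \<Rightarrow> real" and b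
      by (rule Lim_transform[OF tendsto_const[of b]], rule Lim_null_comparison[OF _ elim]) (use that in \<open>auto simp: abs_minus_commute\<close>)
    have R: "(\<lambda>n. conv (\<eta> (r n)) \<rho>0 x) \<longlonglongrightarrow> \<rho>0 x"
      by (rule sub) (simp add: h_def sum_nonneg)
    have Mi: "(\<lambda>n. conv (\<eta> (r n)) (m0 i) x) \<longlonglongrightarrow> m0 i x" for i
    proof (rule sub)
      fix n
      have "\<bar>conv (\<eta> (r n)) (m0 i) x - m0 i x\<bar> \<le> (\<Sum>i\<in>UNIV. \<bar>conv (\<eta> (r n)) (m0 i) x - m0 i x\<bar>)"
        by (rule member_le_sum) auto
      then show "\<bar>conv (\<eta> (r n)) (m0 i) x - m0 i x\<bar> \<le> h (r n) x" by (simp add: h_def)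
    qed
    have ge: "1 / c \<le> \<rho>0 x"
      by (rule LIMSEQ_le_const[OF R]) (use mollified_initial_density_ge[OF mol] in auto)
    then have p: "0 < \<rho>0 x" using c1 by (smt (verit) divide_pos_pos)
    have "(\<lambda>n. F (r n) x) \<longlonglongrightarrow> (\<Sum>i\<in>UNIV. (m0 i x)\<^sup>2 / \<rho>0 x)"
      unfolding F_def using p by (intro tendsto_intros R Mi) auto
    also have "(\<Sum>i\<in>UNIV. (m0 i x)\<^sup>2 / \<rho>0 x) = \<rho>0 x * (norm (u0 x))\<^sup>2"
    proof -
      have "(norm (u0 x))\<^sup>2 = (\<Sum>i\<in>UNIV. (u0 x $ i)\<^sup>2)"
        by (simp add: power2_norm_eq_inner inner_vec_def) (simp add: power2_eq_square)
      then show ?thesis using p by (simp add: sum_distrib_left power2_eq_square mult_ac)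
    qed
    finally show ?case using ge by simp
  qed
  have nn: "AE y in torus. 0 \<le> \<rho>0 y"
    using conv by eventually_elim (use c1 in \<open>auto intro: order_trans[of _ "1 / c"]\<close>)
  have limr: "(\<lambda>n. \<integral>x. F (r n) x \<partial>torus) \<longlonglongrightarrow> L"
    using LIMSEQ_subseq_LIMSEQ[OF lim r(1)] by (simp add: F_def o_def)
  have L0: "0 \<le> L"
    by (rule LIMSEQ_le_const[OF limr]) (intro exI allI impI Bochner_Integration.integral_nonneg Fnn)
  have fatou: "(\<integral>\<^sup>+x. ennreal (\<rho>0 x * (norm (u0 x))\<^sup>2) \<partial>torus) \<le> ennreal L"
  proof -
    have "(\<integral>\<^sup>+x. ennreal (\<rho>0 x * (norm (u0 x))\<^sup>2) \<partial>torus) = (\<integral>\<^sup>+x. liminf (\<lambda>n. ennreal (F (r n) x)) \<partial>torus)"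
    proof (rule nn_integral_cong_AE, use conv in eventually_elim)
      case (elim x)
      then have "(\<lambda>n. ennreal (F (r n) x)) \<longlonglongrightarrow> ennreal (\<rho>0 x * (norm (u0 x))\<^sup>2)" by (intro tendsto_ennrealI) simp
      then show ?case using lim_imp_Liminf[of sequentially] by (metis sequentially_bot)
    qed
    also have "\<dots> \<le> liminf (\<lambda>n. \<integral>\<^sup>+x. ennreal (F (r n) x) \<partial>torus)"
      by (rule nn_integral_liminf) measurable
    also have "(\<lambda>n. \<integral>\<^sup>+x. ennreal (F (r n) x) \<partial>torus) = (\<lambda>n. ennreal (\<integral>x. F (r n) x \<partial>torus))"
      using Fnn by (simp add: nn_integral_eq_integral[OF Fi])
    also have "liminf (\<lambda>n. ennreal (\<integral>x. F (r n) x \<partial>torus)) = ennreal L"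
      by (rule lim_imp_Liminf) (auto intro: tendsto_ennrealI limr)
    finally show ?thesis .
  qed
  have e: "integrable torus (\<lambda>y. \<rho>0 y * (norm (u0 y))\<^sup>2)"
  proof (rule integrableI_nonneg)
    show "AE y in torus. 0 \<le> \<rho>0 y * (norm (u0 y))\<^sup>2" using nn by eventually_elim simp
    show "(\<integral>\<^sup>+x. ennreal (\<rho>0 x * (norm (u0 x))\<^sup>2) \<partial>torus) < \<infinity>"
      using fatou by (rule order.strict_trans1) simp
  qed measurable
  have "AE y in torus. 0 \<le> \<rho>0 y * (norm (u0 y))\<^sup>2" using nn by eventually_elim simp
  then have "ennreal (\<integral>y. \<rho>0 y * (norm (u0 y))\<^sup>2 \<partial>torus) \<le> ennreal L"
    using fatou by (subst (asm) nn_integral_eq_integral[OF e]) auto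
  then have "(\<integral>y. \<rho>0 y * (norm (u0 y))\<^sup>2 \<partial>torus) \<le> L" using L0 by (simp add: ennreal_le_iff)
  moreover have "L \<le> (\<integral>y. \<rho>0 y * (norm (u0 y))\<^sup>2 \<partial>torus)"
    by (rule LIMSEQ_le_const2[OF lim]) (use mollified_initial_energy_le[OF mol m e nn] in auto)
  ultimately show ?thesis by simp
qed

text \<open>The order of choices matters: \<Lambda>' small for the energy defect, \<Lambda> large
  for the pressure, and only then \<kappa> small for the cubes, whose coefficients depend on both.
  Each of the three contributions receives a share \<open>e / 4\<close>.\<close>

theorem energy_conserved:
  "AE t in time_measure T. kinetic t = (\<integral>y. \<rho>0 y * (norm (u0 y))\<^sup>2 \<partial>torus)"
proof -
  obtain C :: real where C: "\<And>\<kappa>. 0 < \<kappa> \<Longrightarrow> \<kappa> < 1 \<Longrightarrow> \<exists>\<eta> K. mollifier \<kappa> C (\<eta> :: real^'n \<Rightarrow> real) K"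
    using mollifier_exists by blast
  define \<kappa> where "\<kappa> n = 1 / real (n + 2)" for n
  have \<kappa>: "0 < \<kappa> n" "\<kappa> n < 1" for n by (auto simp: \<kappa>_def)
  have k0: "\<kappa> \<longlonglongrightarrow> 0"
    unfolding \<kappa>_def using LIMSEQ_ignore_initial_segment[OF lim_1_over_n, of 2] by simp
  from C[OF \<kappa>] obtain \<eta> :: "nat \<Rightarrow> real^'n \<Rightarrow> real" and K where mol: "\<And>n. mollifier (\<kappa> n) C (\<eta> n) (K n)"
    by metis
  have C1: "1 \<le> C" using mollifier.C1[OF mol] .
  define a where "a n = (\<integral>x. (\<Sum>i\<in>UNIV. (conv (\<eta> n) (m0 i) x)\<^sup>2 / conv (\<eta> n) \<rho>0 x) \<partial>torus)" for n
  define D where "D \<kappa> = (\<integral>\<^sup>+t. \<integral>\<^sup>+x. \<integral>\<^sup>+y. ennreal (box_kernel \<kappa> (x - y) * norm (u y t - u x t) ^ 3) \<partial>torus \<partial>torus \<partial>time_measure T)" for \<kappa>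
  define p where "p = (\<integral>(y, t). \<bar>P y t\<bar> powr (3/2) \<partial>(torus \<Otimes>\<^sub>M time_measure T))"
  have p0: "0 \<le> p" unfolding p_def by (intro Bochner_Integration.integral_nonneg) (auto split: prod.split)
  have pp: "(\<integral>\<^sup>+t. \<integral>\<^sup>+y. ennreal (\<bar>P y t\<bar> powr (3/2)) \<partial>torus \<partial>time_measure T) = ennreal p"
  proof -
    interpret pair_sigma_finite "torus :: (real^'n) measure" "time_measure T" ..
    have "(\<integral>\<^sup>+t. \<integral>\<^sup>+y. ennreal (\<bar>P y t\<bar> powr (3/2)) \<partial>torus \<partial>time_measure T)
      = (\<integral>\<^sup>+z. (case z of (y, t) \<Rightarrow> ennreal (\<bar>P y t\<bar> powr (3/2))) \<partial>(torus \<Otimes>\<^sub>M time_measure T))"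
      using nn_integral_snd[of "\<lambda>z. case z of (y, t) \<Rightarrow> ennreal (\<bar>P y t\<bar> powr (3/2))"] by simp
    also have "\<dots> = (\<integral>\<^sup>+z. ennreal (case z of (y, t) \<Rightarrow> \<bar>P y t\<bar> powr (3/2)) \<partial>(torus \<Otimes>\<^sub>M time_measure T))"
      by (intro nn_integral_cong) (auto split: prod.split)
    also have "\<dots> = ennreal p" unfolding p_def
      by (rule nn_integral_eq_integral[OF P32]) (auto split: prod.split)
    finally show ?thesis .
  qed
  let ?d = "real CARD('n)"
  define b1 where "b1 = dev_const ?d C c"
  define f1 where "f1 = flux_const ?d C c M"
  have b1: "0 \<le> b1" using c1 C1 by (simp add: b1_def dev_const_def)
  have f1: "0 \<le> f1" using c1 C1 M by (simp add: f1_def flux_const_def)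
  have dev: "\<forall>\<^sub>F n in sequentially. (\<integral>\<^sup>+t. ennreal \<bar>kinetic t - a n\<bar> \<partial>time_measure T) \<le> ennreal e" if e: "0 < e" for e
  proof -
    \<comment> \<open>The coefficient of \<Lambda>'^2. The added 1 here, and in \<open>Bp\<close>
      and \<open>G\<close> below, keeps the denominators positive.\<close>
    define A where "A = c * C * C * T + 1"
    have A: "0 < A" using c1 C1 T by (simp add: A_def add_nonneg_pos)
    define \<Lambda>' where "\<Lambda>' = min 1 (e / (4 * A))"
    have \<Lambda>': "0 < \<Lambda>'" using e A by (simp add: \<Lambda>'_def)
    have t1: "c * C * (\<Lambda>'\<^sup>2 * C) * T \<le> e / 4"
    proof -
      have "\<Lambda>'\<^sup>2 \<le> \<Lambda>' * 1" unfolding power2_eq_square using \<Lambda>' by (intro mult_left_mono) (auto simp: \<Lambda>'_def)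
      also have "\<dots> \<le> e / (4 * A)" by (simp add: \<Lambda>'_def)
      finally have "(c * C * C * T) * \<Lambda>'\<^sup>2 \<le> A * (e / (4 * A))"
        using c1 C1 T e A by (intro mult_mono) (auto simp: A_def)
      then show ?thesis using A by (simp add: mult_ac)
    qed
    define Bp where "Bp = T * f1 * C * p + 1"
    have Bp: "0 < Bp" using T f1 C1 p0 by (simp add: Bp_def add_nonneg_pos)
    \<comment> \<open>Chosen so that \<Lambda> powr (-1/2) equals
      \<open>e / (4 * Bp)\<close>.\<close>
    define \<Lambda> where "\<Lambda> = (4 * Bp / e)\<^sup>2"
    have \<Lambda>: "0 < \<Lambda>" using Bp e by (simp add: \<Lambda>_def)
    have t4: "T * (f1 * \<Lambda> powr (- 1/2) * (C * p)) \<le> e / 4"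
    proof -
      define x where "x = 4 * Bp / e"
      have x: "0 < x" using Bp e by (simp add: x_def)
      have "\<Lambda> = x powr 2" using x by (simp add: \<Lambda>_def x_def powr_numeral)
      then have "\<Lambda> powr (- 1/2) = x powr (- 1)" by (simp only: powr_powr) simp
      also have "\<dots> = 1 / x" using x by (simp add: powr_minus_divide)
      also have "\<dots> = e / (4 * Bp)" by (simp add: x_def)
      finally have "T * (f1 * \<Lambda> powr (- 1/2) * (C * p)) = (T * f1 * C * p) * (e / (4 * Bp))" by simp
      also have "\<dots> \<le> Bp * (e / (4 * Bp))" using Bp e by (intro mult_right_mono) (auto simp: Bp_def)
      finally show ?thesis using Bp by simp
    qed
    \<comment> \<open>Total coefficient of \<open>w\<close> once the cube defect is bounded by
      \<open>\<kappa> n * w\<close>: in the flux the factor \<kappa> cancels 1/\<kappa>, and in the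
      energy defect it is estimated by 1.\<close>
    define G where "G = c * C * b1 / \<Lambda>' + T * (f1 * (1 + \<Lambda>) * b1) + 1"
    have G: "0 < G" using c1 C1 b1 f1 \<Lambda> \<Lambda>' T by (simp add: G_def add_nonneg_pos)
    obtain \<kappa>1 where \<kappa>1: "0 < \<kappa>1" "\<And>\<kappa>. 0 < \<kappa> \<Longrightarrow> \<kappa> < \<kappa>1 \<Longrightarrow> D \<kappa> \<le> ennreal (\<kappa> * (e / (4 * G)))"
      using vanish[of "e / (4 * G)"] e G unfolding D_def by auto
    have "\<forall>\<^sub>F n in sequentially. \<kappa> n < min \<kappa>0 \<kappa>1"
      using k0 kappa0 \<kappa>1(1) by (intro order_tendstoD(2)) auto
    then show ?thesis
    proof eventually_elim
      case (elim n)
      interpret F: flow "\<kappa> n" C "\<eta> n" "K n" T c \<rho> u P "conv (\<eta> n) \<rho>0" "\<lambda>i. conv (\<eta> n) (m0 i)"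
        by (rule flow_mollifier[OF mol])
      define w where "w = e / (4 * G)"
      have w: "0 \<le> w" using e G by (simp add: w_def)
      have Dn: "(\<integral>\<^sup>+t. F.cube_defect t \<partial>time_measure T) \<le> ennreal (\<kappa> n * w)"
        using \<kappa>1(2)[OF \<kappa>(1)[of n]] elim unfolding F.cube_defect_def D_def w_def by simp
      have "(\<integral>\<^sup>+t. ennreal \<bar>kinetic t - a n\<bar> \<partial>time_measure T) \<le>
         ennreal (c * C * (\<Lambda>'\<^sup>2 * C)) * ennreal T
         + ennreal (c * C * b1 / \<Lambda>') * (\<integral>\<^sup>+t. F.cube_defect t \<partial>time_measure T)
         + ennreal T * (ennreal (f1 * (1 + \<Lambda>) * b1 / \<kappa> n) * (\<integral>\<^sup>+t. F.cube_defect t \<partial>time_measure T)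
            + ennreal (f1 * \<Lambda> powr (- 1/2)) * (ennreal C * ennreal p))"
        using F.energy_deviation[OF osc[OF \<kappa>(1)] M \<Lambda> \<Lambda>'] elim
        unfolding F.energy_def F.initial_energy_def a_def b1_def f1_def pp by simp
      also have "\<dots> \<le> ennreal (c * C * (\<Lambda>'\<^sup>2 * C)) * ennreal T
         + ennreal (c * C * b1 / \<Lambda>') * ennreal (\<kappa> n * w)
         + ennreal T * (ennreal (f1 * (1 + \<Lambda>) * b1 / \<kappa> n) * ennreal (\<kappa> n * w)
            + ennreal (f1 * \<Lambda> powr (- 1/2)) * (ennreal C * ennreal p))"
        by (intro add_mono mult_left_mono Dn order_refl) auto
      also have "\<dots> = ennreal (c * C * (\<Lambda>'\<^sup>2 * C) * T + c * C * b1 / \<Lambda>' * (\<kappa> n * w)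
         + T * (f1 * (1 + \<Lambda>) * b1 / \<kappa> n * (\<kappa> n * w) + f1 * \<Lambda> powr (- 1/2) * (C * p)))"
      proof -
        have nn: "0 \<le> c * C * (\<Lambda>'\<^sup>2 * C)" "0 \<le> T" "0 \<le> c * C * b1 / \<Lambda>'" "0 \<le> \<kappa> n * w"
          "0 \<le> f1 * (1 + \<Lambda>) * b1 / \<kappa> n" "0 \<le> f1 * \<Lambda> powr (- 1/2)" "0 \<le> C" "0 \<le> p"
          using c1 C1 T b1 f1 \<Lambda> \<Lambda>' \<kappa>(1)[of n] w p0 by auto
        show ?thesis
          using nn by (simp only: ennreal_mult[symmetric] ennreal_plus[symmetric] mult_nonneg_nonneg add_nonneg_nonneg)
      qed
      also have "\<dots> \<le> ennreal e"
      proof (rule ennreal_leI)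
        have r1: "c * C * b1 / \<Lambda>' * (\<kappa> n * w) \<le> c * C * b1 / \<Lambda>' * (1 * w)"
          using c1 C1 b1 \<Lambda>' \<kappa>[of n] w by (intro mult_left_mono mult_right_mono) auto
        have r2: "f1 * (1 + \<Lambda>) * b1 / \<kappa> n * (\<kappa> n * w) = f1 * (1 + \<Lambda>) * b1 * w"
          using \<kappa>(1)[of n] by simp
        have r3: "c * C * b1 / \<Lambda>' * w + T * (f1 * (1 + \<Lambda>) * b1 * w) \<le> e / 4"
        proof -
          have "c * C * b1 / \<Lambda>' * w + T * (f1 * (1 + \<Lambda>) * b1 * w) = (G - 1) * w"
            by (simp add: G_def distrib_right mult.assoc)
          also have "\<dots> \<le> G * w" using w by (intro mult_right_mono) auto
          also have "\<dots> = e / 4" using G by (simp add: w_def)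
          finally show ?thesis .
        qed
        show "c * C * (\<Lambda>'\<^sup>2 * C) * T + c * C * b1 / \<Lambda>' * (\<kappa> n * w)
         + T * (f1 * (1 + \<Lambda>) * b1 / \<kappa> n * (\<kappa> n * w) + f1 * \<Lambda> powr (- 1/2) * (C * p)) \<le> e"
          unfolding r2 distrib_left[of T] using r1 r3 t1 t4 e by linarith
      qed
      finally show ?case .
    qed
  qed
  have [measurable]: "(\<lambda>t. kinetic t) \<in> borel_measurable borel" by measurable
  obtain L where L: "a \<longlonglongrightarrow> L" "AE t in time_measure T. kinetic t = L"
    by (rule L1_limit_constant[OF T _ dev]) auto
  have "(\<integral>y. \<rho>0 y * (norm (u0 y))\<^sup>2 \<partial>torus) = L"
    by (rule initial_energy_limit[OF mol k0]) (use L(1) in \<open>simp add: a_def[abs_def]\<close>)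
  then show ?thesis using L(2) by simp
qed

end

section \<open>Borel versions of Lebesgue measurable periodic data\<close>

lemma AE_density_indicator:
  assumes "A \<in> sets M"
  shows "(AE z in density M (indicator A). Q z) \<longleftrightarrow> (AE z in M. z \<in> A \<longrightarrow> Q z)"
  using assms by (subst AE_density) (auto simp: indicator_def)

lemma AE_torus: "(AE x in torus. Q x) \<longleftrightarrow> (AE x in lebesgue. x \<in> torus_cell \<longrightarrow> Q x)"
  unfolding torus_def AE_completion_iff by (rule AE_density_indicator) simp

lemma AE_time: "(AE t in time_measure T. Q t) \<longleftrightarrow> (AE t in lebesgue. t \<in> {0<..<T} \<longrightarrow> Q t)"
  by (simp add: AE_time_measure AE_completion_iff)

lemma spacetime_borel [measurable]: "spacetime T \<in> sets (borel :: ((real^'n) \<times> real) measure)"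
  unfolding spacetime_def by (intro borel_Times) simp_all

lemma torus_time_density:
  "(torus :: (real^'n) measure) \<Otimes>\<^sub>M time_measure T = density lborel (indicator (spacetime T))"
proof -
  have "(torus :: (real^'n) measure) \<Otimes>\<^sub>M time_measure T =
      density (lborel \<Otimes>\<^sub>M lborel) (\<lambda>(x, t). indicator torus_cell x * indicator {0<..<T} t)"
    unfolding torus_def time_measure_def
    by (rule pair_measure_density) (auto simp: sigma_finite_lborel time.sigma_finite_measure_axioms[unfolded time_measure_def])
  also have "\<dots> = density lborel (indicator (spacetime T))"
    by (intro arg_cong2[where f=density] lborel_prod) (auto simp: spacetime_def indicator_def fun_eq_iff)
  finally show ?thesis .
qed

lemma AE_torus_time: "(AE z in (torus :: (real^'n) measure) \<Otimes>\<^sub>M time_measure T. Q z) \<longleftrightarrow> (AE z in lebesgue. z \<in> spacetime T \<longrightarrow> Q z)"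
  unfolding torus_time_density AE_completion_iff by (rule AE_density_indicator) simp

lemma density_indicator_real:
  "A \<in> sets M \<Longrightarrow> density M (indicator A) = density M (\<lambda>z. ennreal (indicator A z))"
  by (intro density_cong) (auto simp: indicator_def)

text \<open>The equality covers the non-integrable case, in which both sides take the default value
  0. Hence the weak equations and initial limits, which speak of bare integrals, carry over to Borel
  versions as they stand.\<close>

lemma set_integral_lebesgue_eq:
  fixes f g :: "'a::euclidean_space \<Rightarrow> real"
  assumes A [measurable]: "A \<in> sets borel" and g [measurable]: "g \<in> borel_measurable borel"
    and ae: "AE z in lebesgue. z \<in> A \<longrightarrow> f z = g z"
  shows "(LINT z : A | lebesgue. f z) = (\<integral>z. g z \<partial>density lborel (indicator A))"
    and "set_integrable lebesgue A f \<Longrightarrow> integrable (density lborel (indicator A)) g"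
proof -
  have k: "(\<lambda>z. indicator A z *\<^sub>R g z) \<in> borel_measurable lborel" by simp
  then have kl: "(\<lambda>z. indicator A z *\<^sub>R g z) \<in> borel_measurable lebesgue" by (rule measurable_completion)
  have ae': "AE z in lebesgue. indicator A z *\<^sub>R g z = indicator A z *\<^sub>R f z"
    using ae by eventually_elim (auto simp: indicator_def)
  note fl = borel_measurable_AE[OF kl ae']
  have "(LINT z : A | lebesgue. f z) = (\<integral>z. indicator A z *\<^sub>R g z \<partial>lebesgue)"
    unfolding set_lebesgue_integral_def using ae' by (intro integral_cong_AE fl kl) auto
  also have "\<dots> = (\<integral>z. indicator A z *\<^sub>R g z \<partial>lborel)" by (rule integral_completion[OF k])
  also have "\<dots> = (\<integral>z. g z \<partial>density lborel (indicator A))"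
    by (subst density_indicator_real, simp, subst integral_density) auto
  finally show "(LINT z : A | lebesgue. f z) = (\<integral>z. g z \<partial>density lborel (indicator A))" .
  assume "set_integrable lebesgue A f"
  then have "integrable lebesgue (\<lambda>z. indicator A z *\<^sub>R g z)"
    unfolding set_integrable_def using integrable_cong_AE[OF kl fl ae'] by simp
  then have "integrable lborel (\<lambda>z. indicator A z *\<^sub>R g z)"
    using integrable_completion[OF k] by simp
  then show "integrable (density lborel (indicator A)) g"
    by (subst density_indicator_real, simp, subst integrable_density) auto
qed

lemma torus_integral_eq:
  fixes f g :: "real^'n \<Rightarrow> real"
  assumes "g \<in> borel_measurable borel" "AE x in torus. f x = g x"
  shows "(LINT x : torus_cell | lebesgue. f x) = (\<integral>x. g x \<partial>torus)"
  unfolding torus_def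
  by (rule set_integral_lebesgue_eq(1)[OF torus_cell_borel assms(1) assms(2)[unfolded AE_torus]])

lemma spacetime_integral_eq:
  fixes f g :: "(real^'n) \<times> real \<Rightarrow> real"
  assumes "g \<in> borel_measurable borel" "AE z in torus \<Otimes>\<^sub>M time_measure T. f z = g z"
  shows "(LINT z : spacetime T | lebesgue. f z) = (\<integral>z. g z \<partial>(torus \<Otimes>\<^sub>M time_measure T))"
    and "set_integrable lebesgue (spacetime T) f \<Longrightarrow> integrable (torus \<Otimes>\<^sub>M time_measure T) g"
proof -
  note ae = assms(2)[unfolded AE_torus_time]
  show "(LINT z : spacetime T | lebesgue. f z) = (\<integral>z. g z \<partial>(torus \<Otimes>\<^sub>M time_measure T))"
    unfolding torus_time_density by (rule set_integral_lebesgue_eq(1)[OF spacetime_borel assms(1) ae])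
  show "set_integrable lebesgue (spacetime T) f \<Longrightarrow> integrable (torus \<Otimes>\<^sub>M time_measure T) g"
    unfolding torus_time_density by (rule set_integral_lebesgue_eq(2)[OF spacetime_borel assms(1) ae])
qed

text \<open>\<open>Q\<close> may be non-measurable, so the exchange of quantifiers is carried out
  for the complement of a measurable null set that covers the exceptions.\<close>

lemma AE_pair_swap:
  assumes "AE z in (torus :: (real^'n) measure) \<Otimes>\<^sub>M time_measure T. Q z"
  shows "AE t in time_measure T. AE x in torus. Q (x, t)"
proof -
  interpret pair_sigma_finite "torus :: (real^'n) measure" "time_measure T" ..
  from assms obtain Z where Z: "Z \<in> null_sets ((torus :: (real^'n) measure) \<Otimes>\<^sub>M time_measure T)"
      "{z. \<not> Q z} \<subseteq> Z"
    by (auto simp: eventually_ae_filter space_pair_measure)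
  have [measurable]: "Z \<in> sets ((torus :: (real^'n) measure) \<Otimes>\<^sub>M time_measure T)" using Z(1) by auto
  have "AE z in (torus :: (real^'n) measure) \<Otimes>\<^sub>M time_measure T. z \<notin> Z" using Z(1) by (rule AE_not_in)
  then have "AE x in (torus :: (real^'n) measure). AE t in time_measure T. (x, t) \<notin> Z" by (rule AE_pair)
  then have "AE t in time_measure T. AE x in torus. (x, t) \<notin> Z"
  proof (subst AE_commute[symmetric])
    show "{z \<in> space ((torus :: (real^'n) measure) \<Otimes>\<^sub>M time_measure T). (fst z, snd z) \<notin> Z} \<in> sets (torus \<Otimes>\<^sub>M time_measure T)"
      by measurable
  qed
  then show ?thesis
    by eventually_elim (use Z(2) in \<open>auto elim!: eventually_mono\<close>)
qed

lemma measurable_vec_lambda [measurable (raw)]: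
  assumes "\<And>i. (\<lambda>x. f x i) \<in> borel_measurable M"
  shows "(\<lambda>x. (\<chi> i. f x i) :: real^'n) \<in> borel_measurable M"
proof -
  have "(\<chi> i. f x i) = (\<Sum>i\<in>UNIV. f x i *\<^sub>R (axis i 1 :: real^'n))" for x
    by (simp add: vec_eq_iff axis_def if_distrib[of "\<lambda>c. _ * c"] cong: if_cong)
  then show ?thesis using assms by simp
qed

text \<open>Composition with this map makes any function periodic and leaves it unchanged on the
  half-open cell.\<close>

definition cell_part :: "real^'n \<Rightarrow> real^'n" where
  "cell_part x = x - lattice_floor x"

lemma cell_part_borel [measurable]: "cell_part \<in> borel_measurable borel"
  unfolding cell_part_def[abs_def] lattice_floor_def[abs_def] by measurable

lemma cell_part_periodic: "(\<forall>i. k $ i \<in> \<int>) \<Longrightarrow> cell_part (x + k) = cell_part x"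
  by (auto simp: cell_part_def lattice_floor_def vec_eq_iff elim!: Ints_cases dest!: spec)

lemma cell_part_half_open: "x \<in> half_open_cell \<Longrightarrow> cell_part x = x"
  using lattice_floor_unique[of 0 x] by (simp add: cell_part_def int_lattice_def)

text \<open>A Borel version supplied by the completion need not be periodic; composing it with
  \<open>cell_part\<close> restores periodicity without changing it on the fundamental
  domain.\<close>

lemma borel_version_torus:
  fixes f :: "real^'n \<Rightarrow> real"
  assumes "f \<in> borel_measurable lebesgue"
  obtains g where "g \<in> borel_measurable borel" "periodic_x g" "AE x in torus. f x = g x"
proof -
  obtain g' where [measurable]: "g' \<in> borel_measurable borel" and g': "AE x in lborel. f x = g' x"
    using completion_ex_borel_measurable_real[OF assms] by auto
  have "AE x in torus. f x = g' x"
    using g' unfolding AE_torus AE_completion_iff by eventually_elim simp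
  then have "AE x in torus. f x = g' (cell_part x)"
    using AE_torus_half_open by eventually_elim (simp add: cell_part_half_open)
  then show thesis
    by (intro that[of "\<lambda>x. g' (cell_part x)"]) (simp_all add: periodic_x_def cell_part_periodic)
qed

lemma borel_version_spacetime:
  fixes f :: "real^'n \<Rightarrow> real \<Rightarrow> real"
  assumes "(\<lambda>z. f (fst z) (snd z)) \<in> borel_measurable (lebesgue_on (UNIV \<times> {0<..<T}))"
  obtains g where "(\<lambda>(x, t). g x t) \<in> borel_measurable (borel \<Otimes>\<^sub>M borel)" "\<And>t. periodic_x (\<lambda>x. g x t)"
    "AE z in torus \<Otimes>\<^sub>M time_measure T. f (fst z) (snd z) = g (fst z) (snd z)"
proof -
  interpret pair_sigma_finite "torus :: (real^'n) measure" "time_measure T" ..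
  let ?S = "UNIV \<times> {0<..<T} :: ((real^'n) \<times> real) set"
  have S: "?S \<in> sets borel" by (intro borel_Times) simp_all
  have "(\<lambda>z. if z \<in> ?S then f (fst z) (snd z) else 0) \<in> borel_measurable lebesgue"
    by (rule borel_measurable_if_I[OF assms]) (use S in auto)
  then obtain g' where g'm: "g' \<in> borel_measurable lborel"
    and g': "AE z in lborel. (if z \<in> ?S then f (fst z) (snd z) else 0) = g' z"
    using completion_ex_borel_measurable_real by blast
  have [measurable]: "g' \<in> borel_measurable (borel \<Otimes>\<^sub>M borel)"
    using g'm by (simp add: borel_prod)
  have 1: "AE z in (torus :: (real^'n) measure) \<Otimes>\<^sub>M time_measure T. f (fst z) (snd z) = g' z"
    using g' unfolding AE_torus_time AE_completion_iff by eventually_elim (auto simp: spacetime_def)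
  have "AE z in (torus :: (real^'n) measure) \<Otimes>\<^sub>M time_measure T. fst z \<in> half_open_cell"
  proof (rule AE_pair_measure)
    show "AE x in torus. AE t in time_measure T. fst (x :: real^'n, t) \<in> half_open_cell"
      using AE_torus_half_open by eventually_elim simp
    show "{z \<in> space (torus \<Otimes>\<^sub>M time_measure T). fst z \<in> half_open_cell} \<in> sets ((torus :: (real^'n) measure) \<Otimes>\<^sub>M time_measure T)"
      by measurable
  qed
  then have 2: "AE z in torus \<Otimes>\<^sub>M time_measure T. f (fst z) (snd z) = g' (cell_part (fst z), snd z)"
    using 1 by eventually_elim (simp add: cell_part_half_open)
  show thesis
    by (rule that[of "\<lambda>x t. g' (cell_part x, t)"]) (use 2 in \<open>simp_all add: periodic_x_def cell_part_periodic\<close>)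
qed

text \<open>The exceptional set is covered by a Borel null set, and pulling this back along
  \<open>cell_part\<close> makes its indicator periodic. The integral of the indicator is then
  invariant under the shift.\<close>

lemma AE_torus_shift:
  assumes Q: "\<And>x k. k \<in> int_lattice \<Longrightarrow> Q (x + k) \<longleftrightarrow> Q x" and ae: "AE x in torus. Q (x :: real^'n)"
  shows "AE x in torus. Q (x + h)"
proof -
  from ae obtain Z where Z: "Z \<in> null_sets torus" "{x. \<not> Q x} \<subseteq> Z"
    by (auto simp: eventually_ae_filter)
  have [measurable]: "Z \<in> sets borel" using Z(1) by (auto simp: null_sets_def)
  have nz: "AE x in torus. x \<notin> Z" using Z(1) by (rule AE_not_in)
  have sub: "cell_part x \<in> Z" if "\<not> Q x" for x
  proof -
    have "Q (cell_part x) \<longleftrightarrow> Q x"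
      using Q[of "lattice_floor x" "cell_part x"] lattice_floor(1)[of x] by (simp add: cell_part_def)
    then show ?thesis using that Z(2) by blast
  qed
  have "(\<integral>\<^sup>+x. indicator Z (cell_part (x + h)) \<partial>torus) = (\<integral>\<^sup>+x. indicator Z (cell_part x) \<partial>(torus :: (real^'n) measure))"
    by (rule nn_integral_torus_shift) (auto simp: periodic_x_def cell_part_periodic)
  also have "\<dots> = (\<integral>\<^sup>+x. 0 \<partial>(torus :: (real^'n) measure))"
    by (rule nn_integral_cong_AE, use nz AE_torus_half_open in eventually_elim) (simp add: cell_part_half_open)
  also have "\<dots> = 0" by simp
  finally have "(\<integral>\<^sup>+x. indicator Z (cell_part (x + h)) \<partial>(torus :: (real^'n) measure)) = 0" .
  then have "AE x in (torus :: (real^'n) measure). (indicator Z (cell_part (x + h)) :: ennreal) = 0"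
    by (subst (asm) nn_integral_0_iff_AE) auto
  then show ?thesis
    by eventually_elim (use sub in \<open>auto simp: indicator_def split: if_splits\<close>)
qed

text \<open>The seminorm yields a null set of \<open>x\<close> for each shift. Fubini turns this
  into almost every \<open>x\<close> and almost every \<open>h\<close>, and translation invariance
  then replaces \<open>h\<close> by \<open>y - x\<close>.\<close>

lemma osc_from_shifts:
  fixes r :: "real^'n \<Rightarrow> real" and \<kappa> :: real
  assumes [measurable]: "r \<in> borel_measurable borel" and per: "periodic_x r"
    and A0: "0 \<le> A" and A: "\<And>h. h \<noteq> 0 \<Longrightarrow> norm h \<le> CARD('n) * \<kappa> \<Longrightarrow> AE x in torus. \<bar>r (x + h) - r x\<bar> \<le> A"
  shows "AE x in torus. AE y in torus. box_kernel \<kappa> (x - y) \<noteq> 0 \<longrightarrow> \<bar>r x - r y\<bar> \<le> A"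
proof -
  interpret pair_sigma_finite "torus :: (real^'n) measure" "torus :: (real^'n) measure" ..
  let ?Q = "\<lambda>h x. box_kernel \<kappa> h \<noteq> 0 \<longrightarrow> \<bar>r (x + h) - r x\<bar> \<le> A"
  have "AE x in torus. ?Q h x" for h
  proof (cases "box_kernel \<kappa> h = 0")
    case False
    obtain l where l: "l \<in> int_lattice" "norm (h - l) \<le> CARD('n) * \<kappa>"
      using near_lattice_cell[OF box_kernel_supp[OF False]] by blast
    have eq: "r (x + (h - l)) = r (x + h)" for x
      using periodic_x_diff[OF per l(1), of "x + h"] by (simp add: add_diff_eq)
    show ?thesis
    proof (cases "h - l = 0")
      case True
      then have "r (x + h) = r x" for x using eq[of x] by simp
      then show ?thesis using A0 by simp
    next
      case False
      show ?thesis using A[OF False l(2)] unfolding eq by eventually_elim simp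
    qed
  qed simp
  then have "AE h in torus. AE x in torus. ?Q h x" by simp
  then have "AE x in torus. AE h in torus. ?Q h x"
  proof (subst AE_commute[symmetric])
    show "{z \<in> space (torus \<Otimes>\<^sub>M torus). ?Q (fst z) (snd z)} \<in> sets ((torus :: (real^'n) measure) \<Otimes>\<^sub>M torus)"
      by measurable
  qed
  then show ?thesis
  proof eventually_elim
    case (elim x)
    have "AE y in torus. ?Q (y + - x) x"
    proof (rule AE_torus_shift[OF _ elim])
      fix h k :: "real^'n" assume k: "k \<in> int_lattice"
      have "r (x + (h + k)) = r (x + h)" using periodic_x_add[OF per k, of "x + h"] by (simp add: add.assoc)
      then show "?Q (h + k) x \<longleftrightarrow> ?Q h x" using periodic_x_add[OF box_kernel_periodic k, of \<kappa> h] by simp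
    qed
    then show ?case
    proof eventually_elim
      case (elim y)
      have "box_kernel \<kappa> (y - x) = box_kernel \<kappa> (x - y)" using box_kernel_minus[of \<kappa> "x - y"] by simp
      then show ?case using elim by (simp add: abs_minus_commute)
    qed
  qed
qed

section \<open>The seminorms\<close>

lemma V_norm_ge:
  assumes "h \<noteq> 0" "norm h < \<delta>"
  shows "ennreal (norm h powr (- \<beta>)) * Lnorm_torus p (\<lambda>x. f (x + h) - f x) \<le> V_norm \<beta> p \<delta> f"
  unfolding V_norm_def by (rule SUP_upper) (use assms in simp)

lemma V_norm_infinity_AE:
  fixes f :: "real^'n \<Rightarrow> real"
  assumes V: "V_norm \<beta> \<infinity> \<delta> f \<le> ennreal m" and m: "0 \<le> m" and h: "h \<noteq> 0" "norm h < \<delta>"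
  shows "AE x in torus. \<bar>f (x + h) - f x\<bar> \<le> m * norm h powr \<beta>"
proof -
  let ?g = "\<lambda>x. ennreal (norm (f (x + h) - f x))"
  let ?E = "esssup (lebesgue_on torus_cell) ?g"
  have np: "0 < norm h" using h by simp
  have "ennreal (norm h powr (- \<beta>)) * ?E \<le> ennreal m"
    using V_norm_ge[OF h, of \<beta> \<infinity> f] V unfolding Lnorm_torus_def by (simp add: order_trans)
  then have "ennreal (norm h powr \<beta>) * (ennreal (norm h powr (- \<beta>)) * ?E) \<le> ennreal (norm h powr \<beta>) * ennreal m"
    by (intro mult_left_mono) auto
  moreover have "ennreal (norm h powr \<beta>) * ennreal (norm h powr (- \<beta>)) = 1"
    using np by (simp flip: ennreal_mult powr_add)
  ultimately have E: "?E \<le> ennreal (m * norm h powr \<beta>)"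
    using m by (simp add: mult.assoc[symmetric] mult.commute ennreal_mult)
  have "AE x in lebesgue_on torus_cell. ?g x \<le> ?E" by (rule esssup_AE)
  then have "AE x in lebesgue. x \<in> torus_cell \<longrightarrow> ?g x \<le> ?E"
    by (subst (asm) AE_restrict_space_iff) auto
  then show ?thesis
    unfolding AE_torus
  proof eventually_elim
    case (elim x)
    show ?case
    proof
      assume "x \<in> torus_cell"
      then have "?g x \<le> ennreal (m * norm h powr \<beta>)" using elim E by (blast intro: order_trans)
      then show "\<bar>f (x + h) - f x\<bar> \<le> m * norm h powr \<beta>"
        using m by (subst (asm) ennreal_le_iff) auto
    qed
  qed
qed

lemma enn_powr_root:
  assumes "enn_powr X (1/3) \<le> y" shows "X \<le> enn_powr y 3"
proof (cases "y = \<infinity>")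
  case False
  then have X: "X \<noteq> \<infinity>" using assms by (auto simp: enn_powr_def top_unique split: if_splits)
  have y: "ennreal (enn2real y) = y" using False by (simp add: ennreal_enn2real less_top)
  have "ennreal (enn2real X powr (1/3)) \<le> ennreal (enn2real y)"
    unfolding y using assms X by (simp add: enn_powr_def)
  then have "enn2real X powr (1/3) \<le> enn2real y" by (simp add: ennreal_le_iff)
  then have "(enn2real X powr (1/3)) powr 3 \<le> enn2real y powr 3" by (intro powr_mono2) auto
  then have "enn2real X \<le> enn2real y powr 3" by (simp add: powr_powr)
  then have "ennreal (enn2real X) \<le> ennreal (enn2real y powr 3)" by (rule ennreal_leI)
  moreover have "ennreal (enn2real X) = X" using X by (simp add: ennreal_enn2real less_top)
  moreover have "enn_powr y 3 = ennreal (enn2real y powr 3)" using False by (simp only: enn_powr_def if_False)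
  ultimately show ?thesis by (simp only:)
qed (simp add: enn_powr_def)

text \<open>The seminorm is that of the given \<open>f\<close>, the integral that of its Borel
  version \<open>g\<close>; agreement of the increments for the one shift \<open>h\<close> suffices.
  Multiplying by \<open>norm h powr (1/3)\<close> and cubing leaves the linear factor
  \<open>norm h\<close>.\<close>

lemma V_norm_cube:
  fixes f g :: "real^'n \<Rightarrow> real^'n"
  assumes h: "h \<noteq> 0" "norm h < \<delta>" and ae: "AE x in torus. f (x + h) - f x = g (x + h) - g x"
    and [measurable]: "g \<in> borel_measurable borel"
  shows "(\<integral>\<^sup>+x. ennreal (norm (g (x + h) - g x) ^ 3) \<partial>torus) \<le> ennreal (norm h) * enn_powr (V_norm (1/3) 3 \<delta> f) 3"
proof -
  let ?V = "V_norm (1/3) 3 \<delta> f"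
  have np: "0 < norm h" using h by simp
  define X where "X = (\<integral>\<^sup>+ x \<in> torus_cell. ennreal (norm (f (x + h) - f x) powr 3) \<partial>lebesgue)"
  have e3: "enn2real 3 = 3" by (metis enn2real_numeral)
  have "ennreal (norm h powr (- (1/3))) * enn_powr X (1/3) \<le> ?V"
    using V_norm_ge[OF h, of "1/3" 3 f] unfolding Lnorm_torus_def enn_root_def e3 X_def by simp
  then have "ennreal (norm h powr (1/3)) * (ennreal (norm h powr (- (1/3))) * enn_powr X (1/3)) \<le> ennreal (norm h powr (1/3)) * ?V"
    by (intro mult_left_mono) auto
  moreover have "ennreal (norm h powr (1/3)) * ennreal (norm h powr (- (1/3))) = 1"
    using np by (simp flip: ennreal_mult powr_add)
  ultimately have "enn_powr X (1/3) \<le> ennreal (norm h powr (1/3)) * ?V"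
    by (simp add: mult.assoc[symmetric])
  then have "X \<le> enn_powr (ennreal (norm h powr (1/3)) * ?V) 3" by (rule enn_powr_root)
  also have "\<dots> = ennreal (norm h) * enn_powr ?V 3"
  proof (cases "?V = \<infinity>")
    case True
    then show ?thesis using np by (simp add: enn_powr_def ennreal_mult_top)
  next
    case False
    then have "ennreal (norm h powr (1/3)) * ?V \<noteq> \<infinity>" by (simp add: ennreal_mult_eq_top_iff)
    then show ?thesis
      using False np by (simp add: enn_powr_def enn2real_mult powr_mult powr_powr ennreal_mult)
  qed
  finally have X: "X \<le> ennreal (norm h) * enn_powr ?V 3" .
  have "(\<integral>\<^sup>+x. ennreal (norm (g (x + h) - g x) ^ 3) \<partial>torus) = (\<integral>\<^sup>+x. ennreal (norm (g (x + h) - g x) ^ 3) * indicator torus_cell x \<partial>lborel)"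
    unfolding torus_def by (subst nn_integral_density) (auto simp: mult.commute)
  also have "\<dots> = (\<integral>\<^sup>+x. ennreal (norm (g (x + h) - g x) ^ 3) * indicator torus_cell x \<partial>lebesgue)"
    by (simp add: nn_integral_completion)
  also have "\<dots> = X"
    unfolding X_def
  proof (rule nn_integral_cong_AE)
    show "AE x in lebesgue. ennreal (norm (g (x + h) - g x) ^ 3) * indicator torus_cell x =
       ennreal (norm (f (x + h) - f x) powr 3) * indicator torus_cell x"
      using ae unfolding AE_torus
    proof eventually_elim
      case (elim x)
      have "s powr 3 = s ^ 3" if "0 \<le> s" for s :: real
        using that by (cases "s = 0") (auto simp: powr_numeral)
      then show ?case using elim by (auto simp: indicator_def)
    qed
  qed
  finally show ?thesis using X by simp
qed

text \<open>The shifts reach length \<open>CARD('n) * \<kappa>\<close>, which explains the factor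
  \<open>CARD('n) powr (2/3)\<close>. Shift invariance of null sets makes \<open>f\<close> and
  \<open>g\<close> agree at \<open>x + h\<close> as well.\<close>

lemma osc_from_seminorm:
  fixes f g :: "real^'n \<Rightarrow> real" and \<kappa> \<delta> m :: real
  assumes V: "V_norm (2/3) \<infinity> \<delta> f \<le> ennreal m" and m: "0 \<le> m"
    and per: "periodic_x f" "periodic_x g" and g: "g \<in> borel_measurable borel"
    and ae: "AE x in torus. f x = g x"
    and \<kappa>: "0 < \<kappa>" "CARD('n) * \<kappa> < \<delta>"
  shows "AE x in torus. AE y in torus. box_kernel \<kappa> (x - y) \<noteq> 0 \<longrightarrow> \<bar>g x - g y\<bar> \<le> (m * CARD('n) powr (2/3)) * \<kappa> powr (2/3)"
proof (rule osc_from_shifts[OF g per(2)])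
  fix h :: "real^'n" assume h: "h \<noteq> 0" "norm h \<le> CARD('n) * \<kappa>"
  have "AE x in torus. f (x + h) = g (x + h)"
    by (rule AE_torus_shift[OF _ ae]) (simp add: periodic_x_add[OF per(1)] periodic_x_add[OF per(2)])
  moreover have "AE x in torus. \<bar>f (x + h) - f x\<bar> \<le> m * norm h powr (2/3)"
    by (rule V_norm_infinity_AE[OF V m h(1)]) (use h \<kappa> in simp)
  ultimately show "AE x in torus. \<bar>g (x + h) - g x\<bar> \<le> (m * CARD('n) powr (2/3)) * \<kappa> powr (2/3)"
    using ae
  proof eventually_elim
    case (elim x)
    have "norm h powr (2/3) \<le> (CARD('n) * \<kappa>) powr (2/3)" using h by (intro powr_mono2) auto
    then have "m * norm h powr (2/3) \<le> m * (CARD('n) powr (2/3) * \<kappa> powr (2/3))"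
      using m \<kappa> by (simp add: powr_mult mult_left_mono)
    then show ?case using elim by (simp add: mult.assoc)
  qed
qed (use m in simp)

text \<open>The cube of the time norm is an integral of cubed seminorms, and
  \<open>cube_difference_le\<close> converts it, slice by slice, into cubes of increments with one
  factor \<kappa>.\<close>

lemma vanish_from_limsup:
  fixes u w :: "real^'n \<Rightarrow> real \<Rightarrow> real^'n"
  assumes lim: "Limsup (at_right 0) (\<lambda>\<delta>. Lnorm_time T 3 (\<lambda>t. V_norm (1/3) 3 \<delta> (\<lambda>x. u x t))) = 0"
    and per: "\<And>t. periodic_x (\<lambda>x. u x t)" "\<And>t. periodic_x (\<lambda>x. w x t)"
    and w [measurable]: "(\<lambda>(x, t). w x t) \<in> borel_measurable (borel \<Otimes>\<^sub>M borel)"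
    and ae: "AE t in time_measure T. AE x in torus. u x t = w x t" and e: "0 < e"
  shows "\<exists>\<kappa>1>0. \<forall>\<kappa>. 0 < \<kappa> \<longrightarrow> \<kappa> < \<kappa>1 \<longrightarrow>
      (\<integral>\<^sup>+t. \<integral>\<^sup>+x. \<integral>\<^sup>+y. ennreal (box_kernel \<kappa> (x - y) * norm (w y t - w x t) ^ 3) \<partial>torus \<partial>torus \<partial>time_measure T)
        \<le> ennreal (\<kappa> * e)"
proof -
  obtain C :: real where C: "\<And>\<kappa>. 0 < \<kappa> \<Longrightarrow> \<kappa> < 1 \<Longrightarrow> \<exists>\<eta> K. mollifier \<kappa> C (\<eta> :: real^'n \<Rightarrow> real) K"
    using mollifier_exists by blast
  define d where "d = real CARD('n)"
  have d: "1 \<le> d" by (simp add: d_def Suc_leI)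
  have C1: "1 \<le> C" using C[of "1/2"] mollifier.C1 by fastforce
  have A: "0 < C * d" using C1 d by simp
  \<comment> \<open>The cube root is chosen so that the cubed time norm times the constant
    \<open>C * d * \<kappa>\<close> is at most \<open>\<kappa> * e\<close>.\<close>
  define e' where "e' = (e / (C * d)) powr (1/3)"
  have e': "0 < e'" using divide_pos_pos[OF e A] unfolding e'_def powr_gt_zero by (rule less_imp_neq[symmetric])
  have e3: "enn2real 3 = 3" by (metis enn2real_numeral)
  have "Limsup (at_right 0) (\<lambda>\<delta>. Lnorm_time T 3 (\<lambda>t. V_norm (1/3) 3 \<delta> (\<lambda>x. u x t))) < ennreal e'"
    unfolding lim using e' by simp
  from Limsup_lessD[OF this] obtain \<delta>1 where \<delta>1: "0 < \<delta>1"
    "\<And>\<delta>. 0 < \<delta> \<Longrightarrow> \<delta> < \<delta>1 \<Longrightarrow> Lnorm_time T 3 (\<lambda>t. V_norm (1/3) 3 \<delta> (\<lambda>x. u x t)) < ennreal e'"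
    unfolding eventually_at_right_field by auto
  show ?thesis
  proof (intro exI[of _ "min 1 (\<delta>1 / (2 * d))"] conjI allI impI)
    show "0 < min 1 (\<delta>1 / (2 * d))" using \<delta>1(1) d by simp
    fix \<kappa> assume \<kappa>: "0 < \<kappa>" "\<kappa> < min 1 (\<delta>1 / (2 * d))"
    \<comment> \<open>The kernel uses shifts up to \<open>d * \<kappa>\<close> inclusive, whereas
      the seminorm takes only shifts strictly shorter than \<delta>; the factor 2 leaves
      room.\<close>
    define \<delta> where "\<delta> = 2 * d * \<kappa>"
    have \<delta>: "0 < \<delta>" "\<delta> < \<delta>1" using \<kappa> d by (auto simp: \<delta>_def field_simps)
    obtain \<eta> :: "real^'n \<Rightarrow> real" and K where mol: "mollifier \<kappa> C \<eta> K" using C[of \<kappa>] \<kappa> by auto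
    let ?W = "\<lambda>t. enn_powr (V_norm (1/3) 3 \<delta> (\<lambda>x. u x t)) 3"
    let ?D = "\<lambda>t. \<integral>\<^sup>+x. \<integral>\<^sup>+y. ennreal (box_kernel \<kappa> (x - y) * norm (w y t - w x t) ^ 3) \<partial>torus \<partial>torus"
    define X where "X = (\<integral>\<^sup>+ t \<in> {0<..<T}. ?W t \<partial>lebesgue)"
    have "enn_powr X (1/3) \<le> ennreal e'"
      using less_imp_le[OF \<delta>1(2)[OF \<delta>]] unfolding Lnorm_time_def enn_root_def e3 X_def by simp
    then have "X \<le> enn_powr (ennreal e') 3" by (rule enn_powr_root)
    also have "\<dots> = ennreal (e / (C * d))"
      using e A by (simp add: enn_powr_def e'_def powr_powr)
    finally have X: "X \<le> ennreal (e / (C * d))" .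
    define a where "a = C * d * \<kappa>"
    have a: "0 < a" using A \<kappa> by (simp add: a_def)
    have wt: "(\<lambda>x. w x t) \<in> borel_measurable borel" for t by measurable
    have Dle: "AE t in time_measure T. ennreal (1 / a) * ?D t \<le> ?W t"
      using ae
    proof eventually_elim
      case (elim t)
      have "?D t \<le> ennreal (C * CARD('n) * \<kappa>) * ?W t"
      proof (rule mollifier.cube_difference_le[OF mol wt per(2)])
        fix h :: "real^'n" assume h: "h \<noteq> 0" "norm h \<le> CARD('n) * \<kappa>"
        have "CARD('n) * \<kappa> < \<delta>" using \<kappa> d by (simp add: \<delta>_def d_def)
        then have h': "norm h < \<delta>" using h by linarith
        have "AE x in torus. u (x + h) t = w (x + h) t"
          by (rule AE_torus_shift[OF _ elim]) (simp add: periodic_x_add[OF per(1)] periodic_x_add[OF per(2)])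
        then have "AE x in torus. u (x + h) t - u x t = w (x + h) t - w x t"
          using elim by eventually_elim simp
        from V_norm_cube[OF h(1) h' this wt]
        show "(\<integral>\<^sup>+x. ennreal (norm (w (x + h) t - w x t) ^ 3) \<partial>torus) \<le> ennreal (norm h) * ?W t" .
      qed
      then have "ennreal (1 / a) * ?D t \<le> ennreal (1 / a) * (ennreal a * ?W t)"
        by (intro mult_left_mono) (simp_all add: a_def d_def)
      also have "\<dots> = ?W t" using a by (simp add: mult.assoc[symmetric] ennreal_mult[symmetric])
      finally show ?case .
    qed
    have [measurable]: "?D \<in> borel_measurable borel" by measurable
    have "(\<integral>\<^sup>+t. ?D t \<partial>time_measure T) = (\<integral>\<^sup>+t. ennreal a * (ennreal (1 / a) * ?D t) \<partial>time_measure T)"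
      using a by (simp add: mult.assoc[symmetric] ennreal_mult[symmetric])
    also have "\<dots> = ennreal a * (\<integral>\<^sup>+t. ennreal (1 / a) * ?D t \<partial>time_measure T)"
      by (rule nn_integral_cmult) measurable
    also have "(\<integral>\<^sup>+t. ennreal (1 / a) * ?D t \<partial>time_measure T) = (\<integral>\<^sup>+t. indicator {0<..<T} t * (ennreal (1 / a) * ?D t) \<partial>lborel)"
      unfolding time_measure_def by (rule nn_integral_density) measurable
    also have "\<dots> = (\<integral>\<^sup>+t. indicator {0<..<T} t * (ennreal (1 / a) * ?D t) \<partial>lebesgue)"
      by (simp add: nn_integral_completion)
    also have "\<dots> \<le> X"
      unfolding X_def
    proof (rule nn_integral_mono_AE)
      show "AE t in lebesgue. indicator {0<..<T} t * (ennreal (1 / a) * ?D t) \<le> ?W t * indicator {0<..<T} t"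
        using Dle unfolding AE_time by eventually_elim (auto simp: indicator_def)
    qed
    finally have "(\<integral>\<^sup>+t. ?D t \<partial>time_measure T) \<le> ennreal a * X" by (simp add: mult_left_mono)
    also have "\<dots> \<le> ennreal a * ennreal (e / (C * d))" by (intro mult_left_mono X) simp
    also have "\<dots> = ennreal (\<kappa> * e)" using a e A C1 d \<kappa> by (auto simp: ennreal_mult[symmetric] a_def)
    finally show "(\<integral>\<^sup>+t. ?D t \<partial>time_measure T) \<le> ennreal (\<kappa> * e)" .
  qed
qed

section \<open>Translated mollifiers as test functions\<close>

context mollifier
begin

lemma test_product_derivative:
  assumes "(\<theta> has_real_derivative \<theta>') (at t)"
  shows "((\<lambda>z. \<eta> (x - fst z) * \<theta> (snd z)) has_derivative
    (\<lambda>h. \<eta> (x - y) * (\<theta>' * snd h) + (\<Sum>j\<in>UNIV. (- fst h) $ j * K j (x - y)) * \<theta> t)) (at (y, t))"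
proof -
  have "((\<lambda>z::(real^'n) \<times> real. x - fst z) has_derivative (\<lambda>h. - fst h)) (at (y, t))"
    by (auto intro!: derivative_eq_intros)
  moreover have "(\<eta> has_derivative (\<lambda>h. \<Sum>j\<in>UNIV. h $ j * K j (x - y))) (at (x - fst (y, t)))"
    using eta_deriv[of "x - y"] by simp
  ultimately have 1: "((\<lambda>z. \<eta> (x - fst z)) has_derivative (\<lambda>h. \<Sum>j\<in>UNIV. (- fst h) $ j * K j (x - y))) (at (y, t))"
    by (rule has_derivative_compose)
  have "((\<lambda>z::(real^'n) \<times> real. snd z) has_derivative snd) (at (y, t))"
    by (auto intro!: derivative_eq_intros)
  moreover have "(\<theta> has_derivative (*) \<theta>') (at (snd (y, t)))"
    using assms by (simp add: has_field_derivative_def)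
  ultimately have 2: "((\<lambda>z. \<theta> (snd z)) has_derivative (\<lambda>h. \<theta>' * snd h)) (at (y, t))"
    by (rule has_derivative_compose)
  from has_derivative_mult[OF 1 2] show ?thesis by simp
qed

lemma
  assumes "(\<theta> has_real_derivative \<theta>') (at t)"
  shows test_product_d_t: "d_t (\<lambda>y t. \<eta> (x - y) * \<theta> t) y t = \<eta> (x - y) * \<theta>'"
    and test_product_d_x: "d_x (\<lambda>y t. \<eta> (x - y) * \<theta> t) i y t = - (K i (x - y) * \<theta> t)"
proof -
  note fr = frechet_derivative_at[OF test_product_derivative[OF assms, of x y], symmetric]
  show "d_t (\<lambda>y t. \<eta> (x - y) * \<theta> t) y t = \<eta> (x - y) * \<theta>'"
    unfolding d_t_def fr by simp
  have "(\<Sum>j\<in>UNIV. (- axis i 1 :: real^'n) $ j * K j (x - y)) = - K i (x - y)"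
  proof -
    have "(- axis i 1 :: real^'n) $ j * K j (x - y) = (if j = i then - K j (x - y) else 0)" for j
      by (simp add: axis_def)
    then show ?thesis by simp
  qed
  then show "d_x (\<lambda>y t. \<eta> (x - y) * \<theta> t) i y t = - (K i (x - y) * \<theta> t)"
    unfolding d_x_def fr by simp
qed

lemma test_product:
  assumes "time_test T \<theta>"
  shows "test_fun T (\<lambda>y t. \<eta> (x - y) * \<theta> t)"
  unfolding test_fun_def
proof (intro conjI allI)
  have "smooth (\<lambda>z::(real^'n) \<times> real. \<eta> (- fst z + x))"
    by (rule smooth_affine[OF _ smooth_eta]) (intro bounded_linear_minus bounded_linear_fst)
  moreover have "smooth (\<lambda>z::(real^'n) \<times> real. \<theta> (snd z))"
    by (rule smooth_compose[OF _ smooth_bounded_linear[OF bounded_linear_snd]]) (use assms in \<open>simp add: time_test_def\<close>)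
  ultimately show "smooth (\<lambda>z::(real^'n) \<times> real. \<eta> (x - fst z) * \<theta> (snd z))"
    using smooth_mult[of "\<lambda>z::(real^'n) \<times> real. \<eta> (- fst z + x)" "\<lambda>z. \<theta> (snd z)"] by simp
  show "periodic_x (\<lambda>y. \<eta> (x - y) * \<theta> t)" for t
    using periodic_reflect_shift[OF eta_periodic, of x] by (simp add: periodic_x_def)
  show "\<exists>a b. 0 < a \<and> a \<le> b \<and> b < T \<and> (\<forall>y t. t \<notin> {a..b} \<longrightarrow> \<eta> (x - y) * \<theta> t = 0)"
  proof -
    from assms obtain a b where "0 < a" "a \<le> b" "b < T" "\<forall>t. t \<notin> {a..b} \<longrightarrow> \<theta> t = 0"
      by (auto simp: time_test_def)
    then show ?thesis by (intro exI[of _ a] exI[of _ b]) auto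
  qed
qed

end

lemma smooth_zero: "smooth (\<lambda>_. 0)"
  by (rule smooth_const)

lemma test_fun_zero: "0 < T \<Longrightarrow> test_fun T (\<lambda>_ _. 0)"
  unfolding test_fun_def periodic_x_def
  by (intro conjI smooth_zero exI[of _ "T / 2"]) auto

lemma d_zero: "d_t (\<lambda>_ _. 0) y t = 0" "d_x (\<lambda>_ _. 0) i y t = 0"
proof -
  have "frechet_derivative (\<lambda>z. 0 :: real) (at z) = (\<lambda>_. 0)" for z :: "(real^'n) \<times> real"
    by (rule frechet_derivative_at[symmetric]) (rule has_derivative_const)
  then show "d_t (\<lambda>_ _. 0) y t = 0" "d_x (\<lambda>_ _. 0) i y t = 0"
    by (simp_all add: d_t_def d_x_def)
qed

theorem theorem1p1:
  fixes T :: real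
    and \<rho> :: "real^'n \<Rightarrow> real \<Rightarrow> real"
    and u :: "real^'n \<Rightarrow> real \<Rightarrow> real^'n"
    and P :: "real^'n \<Rightarrow> real \<Rightarrow> real"
    and \<rho>0 :: "real^'n \<Rightarrow> real"
    and u0 :: "real^'n \<Rightarrow> real^'n"
    and \<delta>0 :: real
  assumes d: "CARD('n) \<ge> 2"
    and T: "T > 0"
    and per_rho: "\<forall>t. periodic_x (\<lambda>x. \<rho> x t)"
    and per_u: "\<forall>t. periodic_x (\<lambda>x. u x t)"
    and per_P: "\<forall>t. periodic_x (\<lambda>x. P x t)"
    and per_init: "periodic_x \<rho>0" "periodic_x u0"
    and meas: "(\<lambda>z. \<rho> (fst z) (snd z)) \<in> borel_measurable (lebesgue_on (UNIV \<times> {0<..<T}))"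
              "(\<lambda>z. u (fst z) (snd z)) \<in> borel_measurable (lebesgue_on (UNIV \<times> {0<..<T}))"
              "(\<lambda>z. P (fst z) (snd z)) \<in> borel_measurable (lebesgue_on (UNIV \<times> {0<..<T}))"
    and meas_init: "\<rho>0 \<in> borel_measurable lebesgue" "u0 \<in> borel_measurable lebesgue"
    and weak: "weak_solution T \<rho> u P \<rho>0 u0"
    and rho_bounds: "\<exists>C. AE z in lebesgue. z \<in> spacetime T \<longrightarrow>
                        0 < \<rho> (fst z) (snd z) \<and> \<rho> (fst z) (snd z) \<le> C
                        \<and> 1 / \<rho> (fst z) (snd z) \<le> C"
    and u_L3: "set_integrable lebesgue (spacetime T) (\<lambda>z. norm (u (fst z) (snd z)) ^ 3)"
    and P_L32: "set_integrable lebesgue (spacetime T) (\<lambda>z. \<bar>P (fst z) (snd z)\<bar> powr (3/2))"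
    and \<delta>0: "\<delta>0 > 0"
    and reg: "Lnorm_time T \<infinity> (\<lambda>t. V_norm (2/3) \<infinity> \<delta>0 (\<lambda>x. \<rho> x t))
              + Lnorm_time T 3 (\<lambda>t. V_norm (1/3) 3 \<delta>0 (\<lambda>x. u x t)) < \<infinity>"
    and vanish: "Limsup (at_right 0) (\<lambda>\<delta>. Lnorm_time T 3 (\<lambda>t. V_norm (1/3) 3 \<delta> (\<lambda>x. u x t))) = 0"
  shows "AE t in lebesgue. t \<in> {0<..<T} \<longrightarrow>
           (LINT x : torus_cell | lebesgue. \<rho> x t * (norm (u x t))\<^sup>2)
         = (LINT x : torus_cell | lebesgue. \<rho>0 x * (norm (u0 x))\<^sup>2)"
proof -
  let ?ST = "(torus :: (real^'n) measure) \<Otimes>\<^sub>M time_measure T"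
  obtain C0 where C0: "AE z in lebesgue. z \<in> spacetime T \<longrightarrow>
      0 < \<rho> (fst z) (snd z) \<and> \<rho> (fst z) (snd z) \<le> C0 \<and> 1 / \<rho> (fst z) (snd z) \<le> C0"
    using rho_bounds by blast
  \<comment> \<open>A single constant at least 1 that bounds both the density and its
    reciprocal.\<close>
  define c where "c = max 1 C0"
  have c1: "1 \<le> c" by (simp add: c_def)
  obtain \<rho>g where \<rho>g: "(\<lambda>(x, t). \<rho>g x t) \<in> borel_measurable (borel \<Otimes>\<^sub>M borel)" "\<And>t. periodic_x (\<lambda>x. \<rho>g x t)"
    "AE z in ?ST. \<rho> (fst z) (snd z) = \<rho>g (fst z) (snd z)"
    by (rule borel_version_spacetime[OF meas(1)], rule that)
  obtain Pb where Pb: "(\<lambda>(x, t). Pb x t) \<in> borel_measurable (borel \<Otimes>\<^sub>M borel)" "\<And>t. periodic_x (\<lambda>x. Pb x t)"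
    "AE z in ?ST. P (fst z) (snd z) = Pb (fst z) (snd z)"
    by (rule borel_version_spacetime[OF meas(3)], rule that)
  have ex: "\<forall>i. \<exists>g. (\<lambda>(x, t). g x t) \<in> borel_measurable (borel \<Otimes>\<^sub>M borel) \<and> (\<forall>t. periodic_x (\<lambda>x. g x t)) \<and>
    (AE z in ?ST. u (fst z) (snd z) $ i = g (fst z) (snd z))"
  proof
    fix i show "\<exists>g. (\<lambda>(x, t). g x t) \<in> borel_measurable (borel \<Otimes>\<^sub>M borel) \<and> (\<forall>t. periodic_x (\<lambda>x. g x t)) \<and>
        (AE z in ?ST. u (fst z) (snd z) $ i = g (fst z) (snd z))"
      by (rule borel_version_spacetime[OF borel_measurable_component[OF meas(2)], of i]) blast
  qed
  obtain ug where ug: "\<And>i. (\<lambda>(x, t). ug i x t) \<in> borel_measurable (borel \<Otimes>\<^sub>M borel)"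
    "\<And>i t. periodic_x (\<lambda>x. ug i x t)" "\<And>i. AE z in ?ST. u (fst z) (snd z) $ i = ug i (fst z) (snd z)"
    using choice[OF ex] by blast
  \<comment> \<open>The truncation changes \<open>\<rho>g\<close> only on a null set, by the assumed
    bounds, but makes the bounds hold at every point.\<close>
  define r where "r x t = max (1 / c) (min c (\<rho>g x t))" for x t
  define w :: "real^'n \<Rightarrow> real \<Rightarrow> real^'n" where "w x t = (\<chi> i. ug i x t)" for x t
  note [measurable] = \<rho>g(1) Pb(1) ug(1)
  have rm [measurable]: "(\<lambda>(x, t). r x t) \<in> borel_measurable (borel \<Otimes>\<^sub>M borel)" unfolding r_def by measurable
  have wm [measurable]: "(\<lambda>(x, t). w x t) \<in> borel_measurable (borel \<Otimes>\<^sub>M borel)" unfolding w_def by measurable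
  have rper: "periodic_x (\<lambda>x. r x t)" for t using \<rho>g(2)[of t] by (simp add: periodic_x_def r_def)
  have wper: "periodic_x (\<lambda>x. w x t)" for t using ug(2)[of _ t] by (simp add: periodic_x_def w_def)
  have r_ge: "1 / c \<le> r x t" and r_le: "r x t \<le> c" for x t
  proof -
    have "1 / c \<le> 1" using c1 by simp
    then have "1 / c \<le> c" using c1 by linarith
    then show "1 / c \<le> r x t" "r x t \<le> c" using c1 by (auto simp: r_def)
  qed
  have aer: "AE z in ?ST. \<rho> (fst z) (snd z) = r (fst z) (snd z)"
  proof -
    have "AE z in ?ST. 0 < \<rho> (fst z) (snd z) \<and> \<rho> (fst z) (snd z) \<le> C0 \<and> 1 / \<rho> (fst z) (snd z) \<le> C0"
      using C0 unfolding AE_torus_time .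
    then show ?thesis
      using \<rho>g(3)
    proof eventually_elim
      case (elim z)
      let ?r = "\<rho> (fst z) (snd z)"
      have "?r \<le> c" "1 / ?r \<le> c" using elim by (auto simp: c_def)
      then have "1 / c \<le> ?r" using elim c1 by (simp add: field_simps)
      then show ?case using \<open>?r \<le> c\<close> elim by (simp add: r_def)
    qed
  qed
  have aew: "AE z in ?ST. u (fst z) (snd z) = w (fst z) (snd z)"
  proof -
    have "AE z in ?ST. \<forall>i. u (fst z) (snd z) $ i = ug i (fst z) (snd z)" using ug(3) by (simp add: AE_all_countable)
    then show ?thesis by eventually_elim (simp add: w_def vec_eq_iff)
  qed
  have aert: "AE t in time_measure T. AE x in torus. \<rho> x t = r x t"
    using AE_pair_swap[OF aer] by simp
  have aewt: "AE t in time_measure T. AE x in torus. u x t = w x t"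
    using AE_pair_swap[OF aew] by simp
  obtain \<rho>b where \<rho>b: "\<rho>b \<in> borel_measurable borel" "periodic_x \<rho>b" "AE x in torus. \<rho>0 x = \<rho>b x"
    by (rule borel_version_torus[OF meas_init(1)], rule that)
  have ex0: "\<forall>i. \<exists>g. g \<in> borel_measurable borel \<and> periodic_x g \<and> (AE x in torus. u0 x $ i = g x)"
  proof
    fix i show "\<exists>g. g \<in> borel_measurable borel \<and> periodic_x g \<and> (AE x in torus. u0 x $ i = g x)"
      by (rule borel_version_torus[OF borel_measurable_component[OF meas_init(2)], of i]) blast
  qed
  obtain u0g where u0g: "\<And>i. u0g i \<in> borel_measurable borel" "\<And>i. periodic_x (u0g i)" "\<And>i. AE x in torus. u0 x $ i = u0g i x"
    using choice[OF ex0] by blast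
  define ub :: "real^'n \<Rightarrow> real^'n" where "ub x = (\<chi> i. u0g i x)" for x
  note [measurable] = \<rho>b(1) u0g(1)
  have ubm [measurable]: "ub \<in> borel_measurable borel" unfolding ub_def by measurable
  have ubper: "periodic_x ub" using u0g(2) by (simp add: periodic_x_def ub_def)
  have aeu0: "AE x in torus. u0 x = ub x"
  proof -
    have "AE x in torus. \<forall>i. u0 x $ i = u0g i x" using u0g(3) by (simp add: AE_all_countable)
    then show ?thesis by eventually_elim (simp add: ub_def vec_eq_iff)
  qed
  have "Lnorm_time T \<infinity> (\<lambda>t. V_norm (2/3) \<infinity> \<delta>0 (\<lambda>x. \<rho> x t)) < \<infinity>"
    using reg by (simp add: less_top[symmetric])
  then obtain m where m: "0 \<le> m" "Lnorm_time T \<infinity> (\<lambda>t. V_norm (2/3) \<infinity> \<delta>0 (\<lambda>x. \<rho> x t)) = ennreal m"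
    by (cases "Lnorm_time T \<infinity> (\<lambda>t. V_norm (2/3) \<infinity> \<delta>0 (\<lambda>x. \<rho> x t))") auto
  have aeV: "AE t in time_measure T. V_norm (2/3) \<infinity> \<delta>0 (\<lambda>x. \<rho> x t) \<le> ennreal m"
  proof -
    have "AE t in lebesgue_on {0<..<T}. V_norm (2/3) \<infinity> \<delta>0 (\<lambda>x. \<rho> x t) \<le> ennreal m"
      unfolding m(2)[symmetric] Lnorm_time_def by simp (rule esssup_AE)
    then show ?thesis unfolding AE_time by (subst (asm) AE_restrict_space_iff) auto
  qed
  obtain weak_rho: "\<And>\<phi>. test_fun T \<phi> \<Longrightarrow> (LINT z : spacetime T | lebesgue.
           (case z of (x, t) \<Rightarrow> \<rho> x t * d_t \<phi> x t + \<rho> x t * (\<Sum>i\<in>UNIV. u x t $ i * d_x \<phi> i x t))) = 0"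
    and weak_mom: "\<And>\<psi>. test_vfun T \<psi> \<Longrightarrow> (LINT z : spacetime T | lebesgue.
           (case z of (x, t) \<Rightarrow>
              (\<Sum>i\<in>UNIV. \<rho> x t * u x t $ i * d_t (\<lambda>y s. \<psi> y s $ i) x t)
            + (\<Sum>i\<in>UNIV. \<Sum>j\<in>UNIV. \<rho> x t * u x t $ i * u x t $ j * d_x (\<lambda>y s. \<psi> y s $ i) j x t)
            + P x t * (\<Sum>i\<in>UNIV. d_x (\<lambda>y s. \<psi> y s $ i) i x t))) = 0"
    and weak_div: "\<And>\<phi>. test_fun T \<phi> \<Longrightarrow> (LINT z : spacetime T | lebesgue.
           (case z of (x, t) \<Rightarrow> (\<Sum>i\<in>UNIV. u x t $ i * d_x \<phi> i x t))) = 0"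
    and init_rho: "\<And>\<phi>::real^'n \<Rightarrow> real. smooth \<phi> \<Longrightarrow> periodic_x \<phi> \<Longrightarrow>
        ((\<lambda>t. LINT x : torus_cell | lebesgue. \<rho> x t * \<phi> x)
           \<longlongrightarrow> (LINT x : torus_cell | lebesgue. \<rho>0 x * \<phi> x)) (at_right 0)"
    and init_mom: "\<And>\<psi>::real^'n \<Rightarrow> real^'n. (\<And>i. smooth (\<lambda>x. \<psi> x $ i)) \<Longrightarrow> periodic_x \<psi> \<Longrightarrow>
        ((\<lambda>t. LINT x : torus_cell | lebesgue. (\<rho> x t *\<^sub>R u x t) \<bullet> \<psi> x)
           \<longlongrightarrow> (LINT x : torus_cell | lebesgue. (\<rho>0 x *\<^sub>R u0 x) \<bullet> \<psi> x)) (at_right 0)"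
    using weak unfolding weak_solution_def by blast
  \<comment> \<open>The Borel versions agree with the given fields only for almost every time, so
    the initial limits survive as bounds for almost every small \<open>t\<close>.\<close>
  have limit_AE: "\<exists>\<delta>>0. AE t in time_measure T. t < \<delta> \<longrightarrow> \<bar>g t - L\<bar> < e"
    if "(f \<longlongrightarrow> L) (at_right 0)" "AE t in time_measure T. f t = g t" "0 < e" for f g :: "real \<Rightarrow> real" and L e
  proof -
    have "\<forall>\<^sub>F t in at_right 0. dist (f t) L < e" by (rule tendstoD[OF that(1,3)])
    then obtain \<delta> where \<delta>: "0 < \<delta>" "\<And>t. 0 < t \<Longrightarrow> t < \<delta> \<Longrightarrow> dist (f t) L < e"
      unfolding eventually_at_right_field by auto
    have "AE t in time_measure T. t < \<delta> \<longrightarrow> \<bar>g t - L\<bar> < e"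
      using that(2) AE_time_measure_in[of T]
      by eventually_elim (use \<delta>(2) in \<open>force simp: dist_real_def\<close>)
    then show ?thesis using \<delta>(1) by blast
  qed
  \<comment> \<open>For \<kappa> below this threshold the shifts of length
    \<open>CARD('n) * \<kappa>\<close> stay below \<open>\<delta>0 / 2\<close>, inside the range of
    the seminorm.\<close>
  let ?M = "m * CARD('n) powr (2/3)" and ?\<kappa> = "\<delta>0 / (2 * CARD('n))"
  interpret periodic_flow T c ?M ?\<kappa> r w Pb \<rho>b ub
  proof
    show "0 < T" "1 \<le> c" "\<And>y t. 1 / c \<le> r y t" "\<And>y t. r y t \<le> c" by (rule T c1 r_ge r_le)+
    show "(\<lambda>(x, t). r x t) \<in> borel_measurable (borel \<Otimes>\<^sub>M borel)" "(\<lambda>(x, t). w x t) \<in> borel_measurable (borel \<Otimes>\<^sub>M borel)"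
      "(\<lambda>(x, t). Pb x t) \<in> borel_measurable (borel \<Otimes>\<^sub>M borel)" "\<rho>b \<in> borel_measurable borel" "ub \<in> borel_measurable borel"
      by measurable
    show "periodic_x \<rho>b" "periodic_x ub" by (rule \<rho>b(2) ubper)+
    show "integrable ?ST (\<lambda>(y, t). norm (w y t) ^ 3)"
    proof (rule spacetime_integral_eq(2)[OF _ _ u_L3])
      show "AE z in ?ST. norm (u (fst z) (snd z)) ^ 3 = (case z of (y, t) \<Rightarrow> norm (w y t) ^ 3)"
        using aew by eventually_elim (auto split: prod.split)
    qed (simp add: borel_prod[symmetric])
    show "integrable ?ST (\<lambda>(y, t). \<bar>Pb y t\<bar> powr (3/2))"
    proof (rule spacetime_integral_eq(2)[OF _ _ P_L32])
      show "AE z in ?ST. \<bar>P (fst z) (snd z)\<bar> powr (3/2) = (case z of (y, t) \<Rightarrow> \<bar>Pb y t\<bar> powr (3/2))"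
        using Pb(3) by eventually_elim (auto split: prod.split)
    qed (simp add: borel_prod[symmetric])
    show "0 \<le> ?M" "0 < ?\<kappa>" using m \<delta>0 by simp_all
    show "AE t in time_measure T. AE x in torus. AE y in torus. box_kernel \<kappa> (x - y) \<noteq> 0 \<longrightarrow> \<bar>r x t - r y t\<bar> \<le> ?M * \<kappa> powr (2/3)"
      if \<kappa>: "0 < \<kappa>" "\<kappa> < ?\<kappa>" for \<kappa>
      using aeV aert
    proof eventually_elim
      case (elim t)
      have rt: "(\<lambda>x. r x t) \<in> borel_measurable borel" by measurable
      have k2: "CARD('n) * \<kappa> < \<delta>0"
      proof -
        have "CARD('n) * \<kappa> < CARD('n) * ?\<kappa>" using \<kappa> by (intro mult_strict_left_mono) auto
        also have "\<dots> = \<delta>0 / 2" by simp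
        finally show ?thesis using \<delta>0 by simp
      qed
      show ?case
        by (rule osc_from_seminorm[OF elim(1) m(1) per_rho[rule_format] rper rt elim(2) \<kappa>(1) k2])
    qed
    show "\<exists>\<kappa>1>0. \<forall>\<kappa>. 0 < \<kappa> \<longrightarrow> \<kappa> < \<kappa>1 \<longrightarrow>
      (\<integral>\<^sup>+t. \<integral>\<^sup>+x. \<integral>\<^sup>+y. ennreal (box_kernel \<kappa> (x - y) * norm (w y t - w x t) ^ 3) \<partial>torus \<partial>torus \<partial>time_measure T) \<le> ennreal (\<kappa> * e)"
      if "0 < e" for e
      by (rule vanish_from_limsup[OF vanish per_u[rule_format] wper wm aewt that])
    show "\<exists>\<delta>>0. AE t in time_measure T. t < \<delta> \<longrightarrow> \<bar>(\<integral>y. r y t * \<psi> y \<partial>torus) - (\<integral>y. \<rho>b y * \<psi> y \<partial>torus)\<bar> < e"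
      if \<psi>: "smooth \<psi>" "periodic_x \<psi>" and e: "0 < e" for \<psi> :: "real^'n \<Rightarrow> real" and e
    proof -
      have [measurable]: "\<psi> \<in> borel_measurable borel"
        using smooth_continuous_on[OF \<psi>(1)] by (rule borel_measurable_continuous_onI)
      have "(LINT x : torus_cell | lebesgue. \<rho>0 x * \<psi> x) = (\<integral>y. \<rho>b y * \<psi> y \<partial>torus)"
        by (rule torus_integral_eq) (measurable, use \<rho>b(3) in \<open>eventually_elim, simp\<close>)
      moreover have "AE t in time_measure T. (LINT x : torus_cell | lebesgue. \<rho> x t * \<psi> x) = (\<integral>y. r y t * \<psi> y \<partial>torus)"
        using aert
      proof eventually_elim
        case (elim t)
        show ?case by (rule torus_integral_eq) (measurable, use elim in \<open>eventually_elim, simp\<close>)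
      qed
      ultimately show ?thesis using limit_AE[OF init_rho[OF \<psi>] _ e] by simp
    qed
    show "\<exists>\<delta>>0. AE t in time_measure T. t < \<delta> \<longrightarrow>
        \<bar>(\<integral>y. (r y t *\<^sub>R w y t) \<bullet> \<psi> y \<partial>torus) - (\<integral>y. (\<rho>b y *\<^sub>R ub y) \<bullet> \<psi> y \<partial>torus)\<bar> < e"
      if \<psi>: "\<And>i. smooth (\<lambda>x. \<psi> x $ i)" "periodic_x \<psi>" and e: "0 < e" for \<psi> :: "real^'n \<Rightarrow> real^'n" and e
    proof -
      have "(\<lambda>x. \<psi> x $ i) \<in> borel_measurable borel" for i
        using smooth_continuous_on[OF \<psi>(1)] by (rule borel_measurable_continuous_onI)
      then have "(\<lambda>x. \<chi> i. \<psi> x $ i) \<in> borel_measurable borel" by (rule measurable_vec_lambda)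
      then have [measurable]: "\<psi> \<in> borel_measurable borel" by simp
      have "(LINT x : torus_cell | lebesgue. (\<rho>0 x *\<^sub>R u0 x) \<bullet> \<psi> x) = (\<integral>y. (\<rho>b y *\<^sub>R ub y) \<bullet> \<psi> y \<partial>torus)"
        by (rule torus_integral_eq) (measurable, use \<rho>b(3) aeu0 in \<open>eventually_elim, simp\<close>)
      moreover have "AE t in time_measure T. (LINT x : torus_cell | lebesgue. (\<rho> x t *\<^sub>R u x t) \<bullet> \<psi> x) = (\<integral>y. (r y t *\<^sub>R w y t) \<bullet> \<psi> y \<partial>torus)"
        using aert aewt
      proof eventually_elim
        case (elim t)
        show ?case by (rule torus_integral_eq) (measurable, use elim in \<open>eventually_elim, simp\<close>)
      qed
      ultimately show ?thesis using limit_AE[OF init_mom[OF \<psi>] _ e] by simp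
    qed
  next
    fix \<kappa> C :: real and \<eta> :: "real^'n \<Rightarrow> real" and K :: "'n \<Rightarrow> real^'n \<Rightarrow> real" and \<theta> \<theta>' :: "real \<Rightarrow> real" and x :: "real^'n"
    assume mol: "mollifier \<kappa> C \<eta> K" and \<theta>: "time_test T \<theta>" and \<theta>': "\<And>t. (\<theta> has_real_derivative \<theta>' t) (at t)"
    interpret mollifier \<kappa> C \<eta> K by (rule mol)
    note [measurable] = kernel_fun_borel[OF kernel_eta] kernel_fun_borel[OF kernel_K] time_test_borel[OF \<theta>] time_test_borel[OF time_test_deriv[OF \<theta> \<theta>']]
    let ?\<phi> = "\<lambda>y t. \<eta> (x - y) * \<theta> t"
    note d = test_product_d_t[OF \<theta>', of x] test_product_d_x[OF \<theta>', of x]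
    show "(\<integral>(y, t). r y t * (\<eta> (x - y) * \<theta>' t) - (\<Sum>j\<in>UNIV. r y t * w y t $ j * (K j (x - y) * \<theta> t)) \<partial>?ST) = 0"
      unfolding weak_rho[OF test_product[OF \<theta>], of x, symmetric]
    proof (rule spacetime_integral_eq(1)[symmetric])
      show "AE z in ?ST. (case z of (y, t) \<Rightarrow> \<rho> y t * d_t ?\<phi> y t + \<rho> y t * (\<Sum>i\<in>UNIV. u y t $ i * d_x ?\<phi> i y t)) =
         (case z of (y, t) \<Rightarrow> r y t * (\<eta> (x - y) * \<theta>' t) - (\<Sum>j\<in>UNIV. r y t * w y t $ j * (K j (x - y) * \<theta> t)))"
        using aer aew by eventually_elim (auto simp: d sum_negf sum_distrib_left mult.assoc split: prod.split)
    qed (unfold borel_prod[symmetric], measurable)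
    show "(\<integral>(y, t). r y t * w y t $ i * (\<eta> (x - y) * \<theta>' t)
         - (\<Sum>j\<in>UNIV. r y t * w y t $ i * w y t $ j * (K j (x - y) * \<theta> t)) - Pb y t * (K i (x - y) * \<theta> t) \<partial>?ST) = 0" for i
    proof -
      \<comment> \<open>A vector field with the \<open>i\<close>-th component as its only nonzero
        one extracts the \<open>i\<close>-th momentum equation; the pressure then meets only
        \<open>K i\<close>.\<close>
      define \<psi> :: "real^'n \<Rightarrow> real \<Rightarrow> real^'n" where "\<psi> y t = (\<chi> k. if k = i then ?\<phi> y t else 0)" for y t
      have \<psi>: "(\<lambda>y t. \<psi> y t $ k) = (if k = i then ?\<phi> else (\<lambda>_ _. 0))" for k
        by (auto simp: \<psi>_def fun_eq_iff)
      have test0: "test_fun T (\<lambda>(_ :: real^'n) _. 0)" by (rule test_fun_zero[OF T])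
      have test: "test_vfun T \<psi>"
        unfolding test_vfun_def \<psi> using test_product[OF \<theta>, of x] test0 by simp
      have dt: "d_t (\<lambda>y s. \<psi> y s $ k) y t = (if k = i then \<eta> (x - y) * \<theta>' t else 0)" for k y t
        unfolding \<psi> by (simp add: d d_zero)
      have dx: "d_x (\<lambda>y s. \<psi> y s $ k) j y t = (if k = i then - (K j (x - y) * \<theta> t) else 0)" for k j y t
        unfolding \<psi> by (simp add: d d_zero)
      have eq: "(\<Sum>k\<in>UNIV. a * b k * d_t (\<lambda>y s. \<psi> y s $ k) y t)
            + (\<Sum>k\<in>UNIV. \<Sum>j\<in>UNIV. a * b k * b j * d_x (\<lambda>y s. \<psi> y s $ k) j y t)
            + p * (\<Sum>k\<in>UNIV. d_x (\<lambda>y s. \<psi> y s $ k) k y t) =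
          a * b i * (\<eta> (x - y) * \<theta>' t) - (\<Sum>j\<in>UNIV. a * b i * b j * (K j (x - y) * \<theta> t)) - p * (K i (x - y) * \<theta> t)"
        for a p :: real and b :: "'n \<Rightarrow> real" and y t
      proof -
        have "(\<Sum>k\<in>UNIV. \<Sum>j\<in>UNIV. a * b k * b j * d_x (\<lambda>y s. \<psi> y s $ k) j y t) =
          (\<Sum>k\<in>UNIV. if k = i then \<Sum>j\<in>UNIV. - (a * b k * b j * (K j (x - y) * \<theta> t)) else 0)"
          unfolding dx by (intro sum.cong) auto
        also have "\<dots> = - (\<Sum>j\<in>UNIV. a * b i * b j * (K j (x - y) * \<theta> t))"
          by (simp add: sum_negf)
        finally show ?thesis
          unfolding dt dx by (simp add: if_distrib[of "\<lambda>c. _ * c"] cong: if_cong)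
      qed
      show ?thesis
        unfolding weak_mom[OF test, symmetric]
      proof (rule spacetime_integral_eq(1)[symmetric])
        show "AE z in ?ST. (case z of (y, t) \<Rightarrow> (\<Sum>k\<in>UNIV. \<rho> y t * u y t $ k * d_t (\<lambda>y s. \<psi> y s $ k) y t)
            + (\<Sum>k\<in>UNIV. \<Sum>j\<in>UNIV. \<rho> y t * u y t $ k * u y t $ j * d_x (\<lambda>y s. \<psi> y s $ k) j y t)
            + P y t * (\<Sum>k\<in>UNIV. d_x (\<lambda>y s. \<psi> y s $ k) k y t)) =
           (case z of (y, t) \<Rightarrow> r y t * w y t $ i * (\<eta> (x - y) * \<theta>' t)
             - (\<Sum>j\<in>UNIV. r y t * w y t $ i * w y t $ j * (K j (x - y) * \<theta> t)) - Pb y t * (K i (x - y) * \<theta> t))"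
          unfolding eq using aer aew Pb(3) by eventually_elim (auto split: prod.split)
      qed (unfold borel_prod[symmetric], measurable)
    qed
  next
    fix \<kappa> C :: real and \<eta> :: "real^'n \<Rightarrow> real" and K :: "'n \<Rightarrow> real^'n \<Rightarrow> real" and \<theta> :: "real \<Rightarrow> real" and x :: "real^'n"
    assume mol: "mollifier \<kappa> C \<eta> K" and \<theta>: "time_test T \<theta>"
    interpret mollifier \<kappa> C \<eta> K by (rule mol)
    note [measurable] = kernel_fun_borel[OF kernel_K] time_test_borel[OF \<theta>]
    \<comment> \<open>The formula for \<open>d_x\<close> of the product is stated with a derivative
      of \<theta>, which the smoothness of the test function supplies.\<close>
    obtain \<theta>' where \<theta>': "\<And>t. (\<theta> has_real_derivative \<theta>' t) (at t)"
    proof -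
      have "\<theta> differentiable (at t)" for t
        using smooth_has_derivative[of \<theta>] \<theta> unfolding time_test_def differentiable_def by blast
      then show thesis using that by (metis real_differentiable_def)
    qed
    show "(\<integral>(y, t). (\<Sum>j\<in>UNIV. w y t $ j * (K j (x - y) * \<theta> t)) \<partial>?ST) = 0"
    proof -
      have "(LINT z : spacetime T | lebesgue. (case z of (y, t) \<Rightarrow> (\<Sum>i\<in>UNIV. u y t $ i * d_x (\<lambda>y t. \<eta> (x - y) * \<theta> t) i y t)))
        = (\<integral>z. - (case z of (y, t) \<Rightarrow> (\<Sum>j\<in>UNIV. w y t $ j * (K j (x - y) * \<theta> t))) \<partial>?ST)"
      proof (rule spacetime_integral_eq(1))
        show "AE z in ?ST. (case z of (y, t) \<Rightarrow> (\<Sum>i\<in>UNIV. u y t $ i * d_x (\<lambda>y t. \<eta> (x - y) * \<theta> t) i y t)) =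
          - (case z of (y, t) \<Rightarrow> (\<Sum>j\<in>UNIV. w y t $ j * (K j (x - y) * \<theta> t)))"
          using aew by eventually_elim (auto simp: test_product_d_x[OF \<theta>'] sum_negf split: prod.split)
      qed (unfold borel_prod[symmetric], measurable)
      then show ?thesis using weak_div[OF test_product[OF \<theta>], of x] by simp
    qed
  qed
  have E0: "(LINT x : torus_cell | lebesgue. \<rho>0 x * (norm (u0 x))\<^sup>2) = (\<integral>y. \<rho>b y * (norm (ub y))\<^sup>2 \<partial>torus)"
    by (rule torus_integral_eq) (measurable, use \<rho>b(3) aeu0 in \<open>eventually_elim, simp\<close>)
  have "AE t in time_measure T. (LINT x : torus_cell | lebesgue. \<rho> x t * (norm (u x t))\<^sup>2)
         = (LINT x : torus_cell | lebesgue. \<rho>0 x * (norm (u0 x))\<^sup>2)"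
    using energy_conserved aert aewt
  proof eventually_elim
    case (elim t)
    have "(LINT x : torus_cell | lebesgue. \<rho> x t * (norm (u x t))\<^sup>2) = (\<integral>y. r y t * (norm (w y t))\<^sup>2 \<partial>torus)"
      by (rule torus_integral_eq) (measurable, use elim(2,3) in \<open>eventually_elim, simp\<close>)
    then show ?case using elim(1) E0 by simp
  qed
  then show ?thesis unfolding AE_time .
qed

end
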